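(* Let $(E,\|\cdot\|)$ be a complete random normed module over $\mathbb{R}$ with base $(\Omega,\mathcal{F},P)$ having full support. An operator $S:\mathscr{C}(E)\to\mathscr{C}_{w^*}(E^* )$ is stable and fully order reversing if and only if there exist $v\in E^*$, $y\in E$, $\rho\in L^0(\mathcal{F})$, $\tau\in L^0_{++}(\mathcal{F})$ and a continuous module automorphism $H$ of $E$ such that $$S(f)(u)=\tau f^*(H^*(u)+v)+u(y)+\rho\qquad\text{for all } f\in\mathscr{C}(E)\text{ and } u\in E^*.$$
   Context: $(\Omega,\mathcal{F},P)$ is a probability space. $L^0(\mathcal{F})$ is the algebra of equivalence classes (under a.s. equality) of real-valued random variables, and $\bar L^0(\mathcal{F})$ is the set of equivalence classes of extended real-valued random variables, ordered by $\xi\le\eta$ iff $\xi\le\eta$ a.s.; it is a complete lattice, and $\vee H,\wedge H$ denote supremum and infimum. "$\xi>\eta$ on $A$" means $\xi(\omega)>\eta(\omega)$ for almost all $\omega\in A$. $L^0_+(\mathcal{F})=\{\xi\in L^0(\mathcal{F}):\xi\ge 0\}$, $L^0_{++}(\mathcal{F})=\{\xi\in L^0(\mathcal{F}):\xi>0\text{ on }\Omega\}$. $\tilde I_A$ is the class of the characteristic function of $A\in\mathcal{F}$, $A^c=\Omega\setminus A$. Convention: $0\cdot(+\infty)=0$. A random normed (RN) module over $\mathbb{R}$ with base $(\Omega,\mathcal{F},P)$ is an $L^0(\mathcal{F})$-module $E$ with a map $\|\cdot\|:E\to L^0_+(\mathcal{F})$ such that $\|\xi x\|=|\xi|\|x\|$,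 $\|x+y\|\le\|x\|+\|y\|$, and $\|x\|=0$ implies $x=\theta$ (the null element), for all $\xi\in L^0(\mathcal{F})$, $x,y\in E$. It carries the $(\varepsilon,\lambda)$-topology, a metrizable linear topology with local base at $\theta$ the sets $\{x:P(\|x\|<\varepsilon)>1-\lambda\}$, $\varepsilon>0$, $0<\lambda<1$ (so $x_n\to x$ iff $\|x_n-x\|\to0$ in probability); completeness, closedness and continuity on $E$ refer to this topology. $L^0(\mathcal{F})$ is an RN module with $|\cdot|$. $E$ has full support if $\vee\{\|x\|:x\in E\}>0$ on $\Omega$. $E^*$ is the $L^0(\mathcal{F})$-module of continuous module homomorphisms $E\to L^0(\mathcal{F})$. For a continuous module homomorphism $H:E\to E$, $H^*:E^*\to E^*$ is $H^*(u)(x)=u(H(x))$. $\mathscr{C}(E)$ is the set of proper lower semicontinuous $L^0$-convex functions, i.e. maps $f:E\to\bar L^0(\mathcal{F})$ such that: (1) $f(x)>-\infty$ on $\Omega$ for all $x\in E$; (2) $dom(f)=\{x\in E:f(x)<+\infty\text{ on }\Omega\}\neq\emptyset$; (3) $f(\xi x+(1-\xi)y)\le\xi f(x)+(1-\xi)f(y)$ for all $x,y\in E$ and $\xi\in L^0_+(\mathcal{F})$ with $0\le\xi\le1$; (4) $epi(f)=\{(x,r)\in E\times L^0(\mathcal{F}):f(x)\le r\}$ is closed in the RN module $E\times L^0(\mathcal{F})$ with $L^0$-norm $\|x\|+|r|$. $\mathscr{C}_{w^*}(E^* )$ is the set of proper random $w^*$-lower semicontinuous $L^0$-convex functions $g:E^*\to\bar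 L^0(\mathcal{F})$, i.e. those satisfying (1), (2), (3) with $E^*$ in place of $E$, and such that $epi(g)=\{(u,r)\in E^*\times L^0(\mathcal{F}):g(u)\le r\}$ is closed in $E^*\times L^0(\mathcal{F})$ for the linear topology in which a net $(u_\alpha,r_\alpha)$ converges to $(u,r)$ iff, for each $x\in E$, $|u_\alpha(x)-u(x)|+|r_\alpha-r|\to0$ in probability. The random conjugate of $f\in\mathscr{C}(E)$ is $f^*:E^*\to\bar L^0(\mathcal{F})$, $f^*(u)=\vee\{u(x)-f(x):x\in E\}$. The order $\le$ on functions and the combinations $\tilde I_Af+\tilde I_{A^c}g$ are pointwise; both $\mathscr{C}(E)$ and $\mathscr{C}_{w^*}(E^* )$ are closed under such combinations. An operator $S:\mathscr{C}(E)\to\mathscr{C}_{w^*}(E^* )$ is fully order reversing if it is onto and, for all $f,g$, $f\le g$ iff $S(f)\ge S(g)$; it is stable if $S(\tilde I_Af+\tilde I_{A^c}g)=\tilde I_AS(f)+\tilde I_{A^c}S(g)$ for all $A\in\mathcal{F}$ and $f,g\in\mathscr{C}(E)$. *)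

theory Defs
  imports "HOL-Probability.Probability" "HOL-Algebra.Module" "HOL-Algebra.Complete_Lattice"
begin

section \<open>Equivalence classes of random variables\<close>

definition ae_eq :: "'w measure \<Rightarrow> (('w \<Rightarrow> 'b::topological_space) \<times> ('w \<Rightarrow> 'b)) set" where
  "ae_eq M = {(f, g). f \<in> borel_measurable M \<and> g \<in> borel_measurable M \<and> (AE w in M. f w = g w)}"

definition ae_classes :: "'w measure \<Rightarrow> ('w \<Rightarrow> 'b::topological_space) set set" where
  "ae_classes M = borel_measurable M // ae_eq M"

definition cls :: "'w measure \<Rightarrow> ('w \<Rightarrow> 'b::topological_space) \<Rightarrow> ('w \<Rightarrow> 'b) set" where
  "cls M f = ae_eq M `` {f}"

definition rep :: "('w \<Rightarrow> 'b) set \<Rightarrow> 'w \<Rightarrow> 'b" where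
  "rep X = (SOME f. f \<in> X)"

lemma cls_eq_iff: assumes "f \<in> borel_measurable M" "g \<in> borel_measurable M"
  shows "cls M f = cls M g \<longleftrightarrow> (AE w in M. f w = g w)"
proof
  assume "cls M f = cls M g"
  moreover have "g \<in> cls M g" using assms by (auto simp: cls_def ae_eq_def)
  ultimately show "AE w in M. f w = g w" by (auto simp: cls_def ae_eq_def)
next
  assume "AE w in M. f w = g w"
  then show "cls M f = cls M g" using assms by (auto simp: cls_def ae_eq_def elim: eventually_elim2)
qed

lemma cls_in: "f \<in> borel_measurable M \<Longrightarrow> cls M f \<in> ae_classes M"
  by (auto simp: cls_def ae_classes_def quotient_def)

lemma rep_props: assumes "X \<in> ae_classes M"
  shows "rep X \<in> borel_measurable M" "cls M (rep X) = X"
proof -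
  obtain f where f: "f \<in> borel_measurable M" "X = cls M f" using assms by (auto simp: cls_def ae_classes_def quotient_def)
  then have "f \<in> X" by (auto simp: cls_def ae_eq_def)
  then have "rep X \<in> X" unfolding rep_def by (rule someI[of "\<lambda>f. f \<in> X"])
  then have r: "rep X \<in> borel_measurable M" "AE w in M. f w = rep X w" using f by (auto simp: cls_def ae_eq_def)
  then show "rep X \<in> borel_measurable M" by simp
  show "cls M (rep X) = X" using r f cls_eq_iff[of "rep X" M f] by (auto elim: eventually_mono)
qed

lemma rep_cls: "f \<in> borel_measurable M \<Longrightarrow> AE w in M. rep (cls M f) w = f w"
  using cls_eq_iff rep_props cls_in by metis

text \<open>Operations on classes are computed on chosen representatives; since all of them are applied
  pointwise, the choice only matters up to a null set.\<close>

definition lift1 ::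
  "'w measure \<Rightarrow> ('a \<Rightarrow> 'b::topological_space) \<Rightarrow> ('w \<Rightarrow> 'a) set \<Rightarrow> ('w \<Rightarrow> 'b) set" where
  "lift1 M h X = cls M (\<lambda>w. h (rep X w))"

definition lift2 ::
  "'w measure \<Rightarrow> ('a \<Rightarrow> 'b \<Rightarrow> 'c::topological_space) \<Rightarrow> ('w \<Rightarrow> 'a) set \<Rightarrow> ('w \<Rightarrow> 'b) set \<Rightarrow> ('w \<Rightarrow> 'c) set"
  where "lift2 M h X Y = cls M (\<lambda>w. h (rep X w) (rep Y w))"

definition ae_le :: "'w measure \<Rightarrow> ('w \<Rightarrow> 'b::ord) set \<Rightarrow> ('w \<Rightarrow> 'b) set \<Rightarrow> bool" where
  "ae_le M X Y \<longleftrightarrow> (AE w in M. rep X w \<le> rep Y w)"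

definition less_on :: "'w measure \<Rightarrow> 'w set \<Rightarrow> ('w \<Rightarrow> 'b::ord) set \<Rightarrow> ('w \<Rightarrow> 'b) set \<Rightarrow> bool" where
  "less_on M A X Y \<longleftrightarrow> (AE w in M. w \<in> A \<longrightarrow> rep X w < rep Y w)"

text \<open>The algebra $L^0$, as a ring and at the same time as a module over itself.\<close>

definition L0 :: "'w measure \<Rightarrow> (('w \<Rightarrow> real) set, ('w \<Rightarrow> real) set) module" where
  "L0 M = \<lparr>carrier = ae_classes M, mult = lift2 M (*), one = cls M (\<lambda>_. 1),
     zero = cls M (\<lambda>_. 0), add = lift2 M (+), smult = lift2 M (*)\<rparr>"

lemma cring_L0: "cring (L0 (M :: 'a measure))"
proof (rule cringI)
  have add: "X \<oplus>\<^bsub>L0 M\<^esub> Y = cls M (\<lambda>w. rep X w + rep Y w)" for X Y by (simp add: L0_def lift2_def)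
  have mul: "X \<otimes>\<^bsub>L0 M\<^esub> Y = cls M (\<lambda>w. rep X w * rep Y w)" for X Y by (simp add: L0_def lift2_def)
  have car[simp]: "carrier (L0 M) = ae_classes M" by (simp add: L0_def)
  note [measurable] = rep_props(1)
  have eqI: "X = Y" if "X \<in> ae_classes M" "Y \<in> ae_classes M" "AE w in M. rep X w = rep Y w" for X Y :: "('a \<Rightarrow> real) set"
    using that cls_eq_iff rep_props by metis
  have ca: "X \<oplus>\<^bsub>L0 M\<^esub> Y \<in> ae_classes M" if "X \<in> ae_classes M" "Y \<in> ae_classes M" for X Y
    unfolding add using that by (intro cls_in) measurable
  have cm: "X \<otimes>\<^bsub>L0 M\<^esub> Y \<in> ae_classes M" if "X \<in> ae_classes M" "Y \<in> ae_classes M" for X Y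
    unfolding mul using that by (intro cls_in) measurable
  have ra: "AE w in M. rep (X \<oplus>\<^bsub>L0 M\<^esub> Y) w = rep X w + rep Y w" if "X \<in> ae_classes M" "Y \<in> ae_classes M" for X Y
    unfolding add using that by (intro rep_cls) measurable
  have rm: "AE w in M. rep (X \<otimes>\<^bsub>L0 M\<^esub> Y) w = rep X w * rep Y w" if "X \<in> ae_classes M" "Y \<in> ae_classes M" for X Y
    unfolding mul using that by (intro rep_cls) measurable
  have cac: "X \<oplus>\<^bsub>L0 M\<^esub> Y = Y \<oplus>\<^bsub>L0 M\<^esub> X" for X Y by (simp add: add ac_simps)
  have cmc: "X \<otimes>\<^bsub>L0 M\<^esub> Y = Y \<otimes>\<^bsub>L0 M\<^esub> X" for X Y by (simp add: mul ac_simps)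
  have z: "\<zero>\<^bsub>L0 M\<^esub> \<in> ae_classes M" "AE w in M. rep \<zero>\<^bsub>L0 M\<^esub> w = 0" by (auto simp: L0_def intro: cls_in rep_cls)
  have o: "\<one>\<^bsub>L0 M\<^esub> \<in> ae_classes M" "AE w in M. rep \<one>\<^bsub>L0 M\<^esub> w = 1" by (auto simp: L0_def intro: cls_in rep_cls)
  show "abelian_group (L0 M)"
  proof (rule abelian_groupI; (unfold car)?)
    fix X Y Z :: "('a \<Rightarrow> real) set" assume X: "X \<in> ae_classes M" and Y: "Y \<in> ae_classes M" and Z: "Z \<in> ae_classes M"
    show "X \<oplus>\<^bsub>L0 M\<^esub> Y \<oplus>\<^bsub>L0 M\<^esub> Z = X \<oplus>\<^bsub>L0 M\<^esub> (Y \<oplus>\<^bsub>L0 M\<^esub> Z)"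
      apply (rule eqI) using X Y Z apply (auto intro: ca)[2]
      using ra[OF X Y] ra[OF Y Z] ra[OF X ca[OF Y Z]] ra[OF ca[OF X Y] Z] by eventually_elim auto
  next
    fix X :: "('a \<Rightarrow> real) set" assume X: "X \<in> ae_classes M"
    show "\<exists>Y\<in>ae_classes M. Y \<oplus>\<^bsub>L0 M\<^esub> X = \<zero>\<^bsub>L0 M\<^esub>"
    proof
      let ?Y = "cls M (\<lambda>w. - rep X w)"
      show Y: "?Y \<in> ae_classes M" using X by (intro cls_in) measurable
      have r: "AE w in M. rep ?Y w = - rep X w" using X by (intro rep_cls) measurable
      show "?Y \<oplus>\<^bsub>L0 M\<^esub> X = \<zero>\<^bsub>L0 M\<^esub>"
        apply (rule eqI) using X Y z apply (auto intro: ca)[2]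
        using r ra[OF Y X] z(2) by eventually_elim auto
    qed
  next
    fix X :: "('a \<Rightarrow> real) set" assume X: "X \<in> ae_classes M"
    show "\<zero>\<^bsub>L0 M\<^esub> \<oplus>\<^bsub>L0 M\<^esub> X = X"
      apply (rule eqI) using X z apply (auto intro: ca)[2]
      using ra[OF z(1) X] z(2) by eventually_elim auto
  qed (use ca z cac in auto)
  show "Group.comm_monoid (L0 M)"
  proof (rule comm_monoidI; (unfold car)?)
    fix X Y Z :: "('a \<Rightarrow> real) set" assume X: "X \<in> ae_classes M" and Y: "Y \<in> ae_classes M" and Z: "Z \<in> ae_classes M"
    show "X \<otimes>\<^bsub>L0 M\<^esub> Y \<otimes>\<^bsub>L0 M\<^esub> Z = X \<otimes>\<^bsub>L0 M\<^esub> (Y \<otimes>\<^bsub>L0 M\<^esub> Z)"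
      apply (rule eqI) using X Y Z apply (auto intro: cm)[2]
      using rm[OF X Y] rm[OF Y Z] rm[OF X cm[OF Y Z]] rm[OF cm[OF X Y] Z] by eventually_elim auto
  next
    fix X :: "('a \<Rightarrow> real) set" assume X: "X \<in> ae_classes M"
    show "\<one>\<^bsub>L0 M\<^esub> \<otimes>\<^bsub>L0 M\<^esub> X = X"
      apply (rule eqI) using X o apply (auto intro: cm)[2]
      using rm[OF o(1) X] o(2) by eventually_elim auto
  qed (use cm o cmc in auto)
  fix X Y Z assume "X \<in> carrier (L0 M)" "Y \<in> carrier (L0 M)" "Z \<in> carrier (L0 M)"
  then have X: "X \<in> ae_classes M" and Y: "Y \<in> ae_classes M" and Z: "Z \<in> ae_classes M" by auto
  show "(X \<oplus>\<^bsub>L0 M\<^esub> Y) \<otimes>\<^bsub>L0 M\<^esub> Z = X \<otimes>\<^bsub>L0 M\<^esub> Z \<oplus>\<^bsub>L0 M\<^esub> Y \<otimes>\<^bsub>L0 M\<^esub> Z"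
    apply (rule eqI) using X Y Z apply (auto intro: cm ca)[2]
    using ra[OF X Y] rm[OF X Z] rm[OF Y Z] rm[OF ca[OF X Y] Z] ra[OF cm[OF X Z] cm[OF Y Z]] by eventually_elim (auto simp: algebra_simps)
qed

definition L0_pos :: "'w measure \<Rightarrow> ('w \<Rightarrow> real) set set" where
  "L0_pos M = {\<xi> \<in> carrier (L0 M). ae_le M \<zero>\<^bsub>L0 M\<^esub> \<xi>}"

definition L0_strict_pos :: "'w measure \<Rightarrow> ('w \<Rightarrow> real) set set" where
  "L0_strict_pos M = {\<xi> \<in> carrier (L0 M). less_on M (space M) \<zero>\<^bsub>L0 M\<^esub> \<xi>}"

abbreviation L0_abs :: "'w measure \<Rightarrow> ('w \<Rightarrow> real) set \<Rightarrow> ('w \<Rightarrow> real) set" where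
  "L0_abs M \<equiv> lift1 M abs"

text \<open>The lattice of classes of extended real-valued random variables. Suprema in it are
  HOL-Algebra's \<open>\<Squnion>\<close>. Its arithmetic is inherited from \<^typ>\<open>ereal\<close>, where \<open>0 * \<infinity> = 0\<close>.\<close>

definition L0bar :: "'w measure \<Rightarrow> ('w \<Rightarrow> ereal) set gorder" where
  "L0bar M = \<lparr>carrier = ae_classes M, eq = (=), le = ae_le M\<rparr>"

abbreviation to_ext :: "'w measure \<Rightarrow> ('w \<Rightarrow> real) set \<Rightarrow> ('w \<Rightarrow> ereal) set" where
  "to_ext M \<equiv> lift1 M ereal"

abbreviation ext_add :: "'w measure \<Rightarrow> ('w \<Rightarrow> ereal) set \<Rightarrow> ('w \<Rightarrow> ereal) set \<Rightarrow> ('w \<Rightarrow> ereal) set" where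
  "ext_add M \<equiv> lift2 M (+)"

abbreviation ext_diff :: "'w measure \<Rightarrow> ('w \<Rightarrow> ereal) set \<Rightarrow> ('w \<Rightarrow> ereal) set \<Rightarrow> ('w \<Rightarrow> ereal) set" where
  "ext_diff M \<equiv> lift2 M (-)"

abbreviation ext_mult :: "'w measure \<Rightarrow> ('w \<Rightarrow> ereal) set \<Rightarrow> ('w \<Rightarrow> ereal) set \<Rightarrow> ('w \<Rightarrow> ereal) set" where
  "ext_mult M \<equiv> lift2 M (*)"

section \<open>Topologies given by families of $L^0$-seminorms\<close>

definition prob_ball ::
  "'w measure \<Rightarrow> (('w \<Rightarrow> real) set, 'e) module \<Rightarrow> ('e \<Rightarrow> ('w \<Rightarrow> real) set) set \<Rightarrow> 'e \<Rightarrow> real \<Rightarrow> real \<Rightarrow> 'e set"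
  where "prob_ball M E Q x \<epsilon> l =
    {y \<in> carrier E. \<forall>p\<in>Q. measure M {w \<in> space M. rep (p (y \<ominus>\<^bsub>E\<^esub> x)) w < \<epsilon>} > 1 - l}"

text \<open>The linear topology whose neighbourhoods of a point are generated by the balls for finite
  subfamilies: a net converges to \<open>x\<close> iff for every seminorm \<open>p\<close> in the family its \<open>p\<close>-distance
  to \<open>x\<close> tends to 0 in probability.\<close>

definition prob_topology ::
  "'w measure \<Rightarrow> (('w \<Rightarrow> real) set, 'e) module \<Rightarrow> ('e \<Rightarrow> ('w \<Rightarrow> real) set) set \<Rightarrow> 'e topology"
  where "prob_topology M E \<P> = topology (\<lambda>U. U \<subseteq> carrier E \<and>
    (\<forall>x\<in>U. \<exists>Q \<epsilon> l. finite Q \<and> Q \<subseteq> \<P> \<and> 0 < \<epsilon> \<and> 0 < l \<and> l < 1 \<and> prob_ball M E Q x \<epsilon> l \<subseteq> U))"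

lemma istopology_prob_topology:
  assumes "finite_measure M"
    and p: "\<And>p x y. p \<in> \<P> \<Longrightarrow> x \<in> carrier E \<Longrightarrow> y \<in> carrier E \<Longrightarrow> p (y \<ominus>\<^bsub>E\<^esub> x) \<in> carrier (L0 M)"
  shows "istopology (\<lambda>U. U \<subseteq> carrier E \<and>
    (\<forall>x\<in>U. \<exists>Q \<epsilon> l. finite Q \<and> Q \<subseteq> \<P> \<and> 0 < \<epsilon> \<and> 0 < l \<and> l < 1 \<and> prob_ball M E Q x \<epsilon> l \<subseteq> U))"
proof -
  interpret finite_measure M by fact
  have mono: "prob_ball M E Q x \<epsilon> l \<subseteq> prob_ball M E Q' x \<epsilon>' l'"
    if "Q' \<subseteq> Q" "Q \<subseteq> \<P>" "\<epsilon> \<le> \<epsilon>'" "l \<le> l'" "x \<in> carrier E" for Q Q' x \<epsilon> \<epsilon>' l l'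
  proof
    fix y assume y: "y \<in> prob_ball M E Q x \<epsilon> l"
    { fix q assume q: "q \<in> Q'"
      then have m: "rep (q (y \<ominus>\<^bsub>E\<^esub> x)) \<in> borel_measurable M"
        using y that p by (intro rep_props) (auto simp: prob_ball_def L0_def subset_iff)
      have "1 - l' \<le> 1 - l" using that by simp
      also have "1 - l < measure M {w \<in> space M. rep (q (y \<ominus>\<^bsub>E\<^esub> x)) w < \<epsilon>}" using y q that by (auto simp: prob_ball_def)
      also have "\<dots> \<le> measure M {w \<in> space M. rep (q (y \<ominus>\<^bsub>E\<^esub> x)) w < \<epsilon>'}"
        using that m by (intro finite_measure_mono) (auto)
      finally have "measure M {w \<in> space M. rep (q (y \<ominus>\<^bsub>E\<^esub> x)) w < \<epsilon>'} > 1 - l'" . }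
    then show "y \<in> prob_ball M E Q' x \<epsilon>' l'" using y by (auto simp: prob_ball_def)
  qed
  show ?thesis unfolding istopology_def
  proof (intro conjI allI impI ballI)
    fix S T x assume S: "S \<subseteq> carrier E \<and> (\<forall>x\<in>S. \<exists>Q \<epsilon> l. finite Q \<and> Q \<subseteq> \<P> \<and> 0 < \<epsilon> \<and> 0 < l \<and> l < 1 \<and> prob_ball M E Q x \<epsilon> l \<subseteq> S)"
     and T: "T \<subseteq> carrier E \<and> (\<forall>x\<in>T. \<exists>Q \<epsilon> l. finite Q \<and> Q \<subseteq> \<P> \<and> 0 < \<epsilon> \<and> 0 < l \<and> l < 1 \<and> prob_ball M E Q x \<epsilon> l \<subseteq> T)"
     and x: "x \<in> S \<inter> T"
    obtain Q e l where 1: "finite Q" "Q \<subseteq> \<P>" "0 < e" "0 < l" "l < 1" "prob_ball M E Q x e l \<subseteq> S" using S x by blast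
    obtain Q' e' l' where 2: "finite Q'" "Q' \<subseteq> \<P>" "0 < e'" "0 < l'" "l' < 1" "prob_ball M E Q' x e' l' \<subseteq> T" using T x by blast
    have "prob_ball M E (Q \<union> Q') x (min e e') (min l l') \<subseteq> prob_ball M E Q x e l \<inter> prob_ball M E Q' x e' l'"
      using 1 2 S x by (intro Int_greatest mono) auto
    then show "\<exists>Q \<epsilon> l. finite Q \<and> Q \<subseteq> \<P> \<and> 0 < \<epsilon> \<and> 0 < l \<and> l < 1 \<and> prob_ball M E Q x \<epsilon> l \<subseteq> S \<inter> T"
      using 1 2 by (intro exI[of _ "Q \<union> Q'"] exI[of _ "min e e'"] exI[of _ "min l l'"]) auto
  next
    fix \<K> x assume K: "\<forall>K\<in>\<K>. K \<subseteq> carrier E \<and> (\<forall>x\<in>K. \<exists>Q \<epsilon> l. finite Q \<and> Q \<subseteq> \<P> \<and> 0 < \<epsilon> \<and> 0 < l \<and> l < 1 \<and> prob_ball M E Q x \<epsilon> l \<subseteq> K)"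
      and "x \<in> \<Union>\<K>"
    then obtain K where "K \<in> \<K>" "x \<in> K" by blast
    with K obtain Q e l where "finite Q" "Q \<subseteq> \<P>" "0 < e" "0 < l" "l < 1" "prob_ball M E Q x e l \<subseteq> K" by metis
    then show "\<exists>Q \<epsilon> l. finite Q \<and> Q \<subseteq> \<P> \<and> 0 < \<epsilon> \<and> 0 < l \<and> l < 1 \<and> prob_ball M E Q x \<epsilon> l \<subseteq> \<Union>\<K>"
      using \<open>K \<in> \<K>\<close> by (intro exI[of _ Q] exI[of _ e] exI[of _ l]) auto
  qed blast+
qed

abbreviation eps_lambda_topology ::
  "'w measure \<Rightarrow> (('w \<Rightarrow> real) set, 'e) module \<Rightarrow> ('e \<Rightarrow> ('w \<Rightarrow> real) set) \<Rightarrow> 'e topology"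
  where "eps_lambda_topology M E nrm \<equiv> prob_topology M E {nrm}"

section \<open>Random normed modules\<close>

locale random_normed_module = prob_space M + module "L0 M" E
  for M :: "'w measure" and E :: "(('w \<Rightarrow> real) set, 'e) module" +
  fixes nrm :: "'e \<Rightarrow> ('w \<Rightarrow> real) set"
  assumes nrm_closed: "x \<in> carrier E \<Longrightarrow> nrm x \<in> L0_pos M"
    and nrm_smult: "\<lbrakk>\<xi> \<in> carrier (L0 M); x \<in> carrier E\<rbrakk> \<Longrightarrow>
          nrm (\<xi> \<odot>\<^bsub>E\<^esub> x) = L0_abs M \<xi> \<otimes>\<^bsub>L0 M\<^esub> nrm x"
    and nrm_triangle: "\<lbrakk>x \<in> carrier E; y \<in> carrier E\<rbrakk> \<Longrightarrow>
          ae_le M (nrm (x \<oplus>\<^bsub>E\<^esub> y)) (nrm x \<oplus>\<^bsub>L0 M\<^esub> nrm y)"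
    and nrm_zeroD: "\<lbrakk>x \<in> carrier E; nrm x = \<zero>\<^bsub>L0 M\<^esub>\<rbrakk> \<Longrightarrow> x = \<zero>\<^bsub>E\<^esub>"

text \<open>The \<open>(\<epsilon>, \<lambda>)\<close>-topology is metrizable and linear, so completeness may be tested on sequences.\<close>

definition rn_complete ::
  "'w measure \<Rightarrow> (('w \<Rightarrow> real) set, 'e) module \<Rightarrow> ('e \<Rightarrow> ('w \<Rightarrow> real) set) \<Rightarrow> bool" where
  "rn_complete M E nrm \<longleftrightarrow> (\<forall>s :: nat \<Rightarrow> 'e. range s \<subseteq> carrier E \<longrightarrow>
     (\<forall>\<epsilon> l. 0 < \<epsilon> \<and> 0 < l \<and> l < 1 \<longrightarrow> (\<exists>N. \<forall>m\<ge>N. \<forall>n\<ge>N. s m \<in> prob_ball M E {nrm} (s n) \<epsilon> l)) \<longrightarrow>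
     (\<exists>x. limitin (eps_lambda_topology M E nrm) s x sequentially))"

definition full_support ::
  "'w measure \<Rightarrow> (('w \<Rightarrow> real) set, 'e) module \<Rightarrow> ('e \<Rightarrow> ('w \<Rightarrow> real) set) \<Rightarrow> bool" where
  "full_support M E nrm \<longleftrightarrow>
     less_on M (space M) (cls M (\<lambda>_. 0)) (\<Squnion>\<^bsub>L0bar M\<^esub> ((\<lambda>x. to_ext M (nrm x)) ` carrier E))"

definition module_homs :: "('r, 'm) ring_scheme \<Rightarrow> ('r, 'a) module \<Rightarrow> ('r, 'b) module \<Rightarrow> ('a \<Rightarrow> 'b) set" where
  "module_homs R E F = {h \<in> carrier E \<rightarrow> carrier F.
     (\<forall>x\<in>carrier E. \<forall>y\<in>carrier E. h (x \<oplus>\<^bsub>E\<^esub> y) = h x \<oplus>\<^bsub>F\<^esub> h y) \<and>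
     (\<forall>\<xi>\<in>carrier R. \<forall>x\<in>carrier E. h (\<xi> \<odot>\<^bsub>E\<^esub> x) = \<xi> \<odot>\<^bsub>F\<^esub> h x)}"

definition continuous_module_automorphisms ::
  "'w measure \<Rightarrow> (('w \<Rightarrow> real) set, 'e) module \<Rightarrow> ('e \<Rightarrow> ('w \<Rightarrow> real) set) \<Rightarrow> ('e \<Rightarrow> 'e) set" where
  "continuous_module_automorphisms M E nrm = {H \<in> module_homs (L0 M) E E.
     bij_betw H (carrier E) (carrier E) \<and>
     continuous_map (eps_lambda_topology M E nrm) (eps_lambda_topology M E nrm) H}"

text \<open>The random conjugate space. Its elements, like all functions on a carrier below, are
  \<^const>\<open>extensional\<close>, so that they are equal iff they agree on the carrier. The ring
  multiplication fields of the record play no role in a module.\<close>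

definition dual ::
  "'w measure \<Rightarrow> (('w \<Rightarrow> real) set, 'e) module \<Rightarrow> ('e \<Rightarrow> ('w \<Rightarrow> real) set) \<Rightarrow>
    (('w \<Rightarrow> real) set, 'e \<Rightarrow> ('w \<Rightarrow> real) set) module" where
  "dual M E nrm = \<lparr>
     carrier = {u \<in> module_homs (L0 M) E (L0 M). u \<in> extensional (carrier E) \<and>
       continuous_map (eps_lambda_topology M E nrm) (eps_lambda_topology M (L0 M) (L0_abs M)) u},
     mult = undefined, one = undefined,
     zero = (\<lambda>x\<in>carrier E. \<zero>\<^bsub>L0 M\<^esub>),
     add = (\<lambda>u v. \<lambda>x\<in>carrier E. u x \<oplus>\<^bsub>L0 M\<^esub> v x),
     smult = (\<lambda>\<xi> u. \<lambda>x\<in>carrier E. \<xi> \<otimes>\<^bsub>L0 M\<^esub> u x)\<rparr>"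

definition rn_adjoint ::
  "(('w \<Rightarrow> real) set, 'e) module \<Rightarrow> ('e \<Rightarrow> 'e) \<Rightarrow> ('e \<Rightarrow> ('w \<Rightarrow> real) set) \<Rightarrow> 'e \<Rightarrow> ('w \<Rightarrow> real) set" where
  "rn_adjoint E H u = (\<lambda>x\<in>carrier E. u (H x))"

definition module_prod :: "('r, 'a) module \<Rightarrow> ('r, 'b) module \<Rightarrow> ('r, 'a \<times> 'b) module" where
  "module_prod E F = \<lparr>carrier = carrier E \<times> carrier F, mult = undefined, one = undefined,
     zero = (\<zero>\<^bsub>E\<^esub>, \<zero>\<^bsub>F\<^esub>),
     add = (\<lambda>(x, r) (y, s). (x \<oplus>\<^bsub>E\<^esub> y, r \<oplus>\<^bsub>F\<^esub> s)),
     smult = (\<lambda>\<xi> (x, r). (\<xi> \<odot>\<^bsub>E\<^esub> x, \<xi> \<odot>\<^bsub>F\<^esub> r))\<rparr>"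

section \<open>Proper lower semicontinuous $L^0$-convex functions\<close>

definition eff_dom ::
  "'w measure \<Rightarrow> (('w \<Rightarrow> real) set, 'e) module \<Rightarrow> ('e \<Rightarrow> ('w \<Rightarrow> ereal) set) \<Rightarrow> 'e set" where
  "eff_dom M E f = {x \<in> carrier E. less_on M (space M) (f x) (cls M (\<lambda>_. \<infinity>))}"

definition proper_convex_functions ::
  "'w measure \<Rightarrow> (('w \<Rightarrow> real) set, 'e) module \<Rightarrow> ('e \<Rightarrow> ('w \<Rightarrow> ereal) set) set" where
  "proper_convex_functions M E = {f \<in> carrier E \<rightarrow>\<^sub>E carrier (L0bar M).
     (\<forall>x\<in>carrier E. less_on M (space M) (cls M (\<lambda>_. -\<infinity>)) (f x)) \<and>
     eff_dom M E f \<noteq> {} \<and>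
     (\<forall>x\<in>carrier E. \<forall>y\<in>carrier E. \<forall>\<xi>\<in>L0_pos M. ae_le M \<xi> \<one>\<^bsub>L0 M\<^esub> \<longrightarrow>
        ae_le M (f (\<xi> \<odot>\<^bsub>E\<^esub> x \<oplus>\<^bsub>E\<^esub> (\<one>\<^bsub>L0 M\<^esub> \<ominus>\<^bsub>L0 M\<^esub> \<xi>) \<odot>\<^bsub>E\<^esub> y))
          (ext_add M (ext_mult M (to_ext M \<xi>) (f x))
                     (ext_mult M (to_ext M (\<one>\<^bsub>L0 M\<^esub> \<ominus>\<^bsub>L0 M\<^esub> \<xi>)) (f y))))}"

definition epi ::
  "'w measure \<Rightarrow> (('w \<Rightarrow> real) set, 'e) module \<Rightarrow> ('e \<Rightarrow> ('w \<Rightarrow> ereal) set) \<Rightarrow> ('e \<times> ('w \<Rightarrow> real) set) set" where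
  "epi M E f = {(x, r). x \<in> carrier E \<and> r \<in> carrier (L0 M) \<and> ae_le M (f x) (to_ext M r)}"

definition lsc_convex_functions ::
  "'w measure \<Rightarrow> (('w \<Rightarrow> real) set, 'e) module \<Rightarrow> ('e \<Rightarrow> ('w \<Rightarrow> real) set) \<Rightarrow>
    ('e \<Rightarrow> ('w \<Rightarrow> ereal) set) set" where
  "lsc_convex_functions M E nrm = {f \<in> proper_convex_functions M E.
     closedin (eps_lambda_topology M (module_prod E (L0 M)) (\<lambda>(x, r). nrm x \<oplus>\<^bsub>L0 M\<^esub> L0_abs M r))
       (epi M E f)}"

definition wstar_lsc_convex_functions ::
  "'w measure \<Rightarrow> (('w \<Rightarrow> real) set, 'e) module \<Rightarrow> ('e \<Rightarrow> ('w \<Rightarrow> real) set) \<Rightarrow>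
    (('e \<Rightarrow> ('w \<Rightarrow> real) set) \<Rightarrow> ('w \<Rightarrow> ereal) set) set" where
  "wstar_lsc_convex_functions M E nrm = {g \<in> proper_convex_functions M (dual M E nrm).
     closedin (prob_topology M (module_prod (dual M E nrm) (L0 M))
         ((\<lambda>x (u, r). L0_abs M (u x) \<oplus>\<^bsub>L0 M\<^esub> L0_abs M r) ` carrier E))
       (epi M (dual M E nrm) g)}"

definition conjugate ::
  "'w measure \<Rightarrow> (('w \<Rightarrow> real) set, 'e) module \<Rightarrow> ('e \<Rightarrow> ('w \<Rightarrow> real) set) \<Rightarrow>
    ('e \<Rightarrow> ('w \<Rightarrow> ereal) set) \<Rightarrow> ('e \<Rightarrow> ('w \<Rightarrow> real) set) \<Rightarrow> ('w \<Rightarrow> ereal) set" where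
  "conjugate M E nrm f = (\<lambda>u\<in>carrier (dual M E nrm).
     \<Squnion>\<^bsub>L0bar M\<^esub> ((\<lambda>x. ext_diff M (to_ext M (u x)) (f x)) ` carrier E))"

section \<open>Stable and fully order reversing operators\<close>

definition fun_le :: "'w measure \<Rightarrow> 'x set \<Rightarrow> ('x \<Rightarrow> ('w \<Rightarrow> ereal) set) \<Rightarrow> ('x \<Rightarrow> ('w \<Rightarrow> ereal) set) \<Rightarrow> bool" where
  "fun_le M X f g \<longleftrightarrow> (\<forall>x\<in>X. ae_le M (f x) (g x))"

text \<open>The combination of \<open>f\<close> and \<open>g\<close> with weights the indicator classes of \<open>A\<close> and its complement.\<close>

definition paste ::
  "'w measure \<Rightarrow> 'x set \<Rightarrow> 'w set \<Rightarrow> ('x \<Rightarrow> ('w \<Rightarrow> ereal) set) \<Rightarrow> ('x \<Rightarrow> ('w \<Rightarrow> ereal) set) \<Rightarrow>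
    'x \<Rightarrow> ('w \<Rightarrow> ereal) set" where
  "paste M X A f g = (\<lambda>x\<in>X. ext_add M (ext_mult M (cls M (indicator A)) (f x))
                                      (ext_mult M (cls M (indicator (space M - A))) (g x)))"

definition fully_order_reversing ::
  "'w measure \<Rightarrow> (('w \<Rightarrow> real) set, 'e) module \<Rightarrow> ('e \<Rightarrow> ('w \<Rightarrow> real) set) \<Rightarrow>
    (('e \<Rightarrow> ('w \<Rightarrow> ereal) set) \<Rightarrow> (('e \<Rightarrow> ('w \<Rightarrow> real) set) \<Rightarrow> ('w \<Rightarrow> ereal) set)) \<Rightarrow> bool" where
  "fully_order_reversing M E nrm S \<longleftrightarrow>
     S ` lsc_convex_functions M E nrm = wstar_lsc_convex_functions M E nrm \<and>
     (\<forall>f\<in>lsc_convex_functions M E nrm. \<forall>g\<in>lsc_convex_functions M E nrm.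
        fun_le M (carrier E) f g \<longleftrightarrow> fun_le M (carrier (dual M E nrm)) (S g) (S f))"

definition stable_operator ::
  "'w measure \<Rightarrow> (('w \<Rightarrow> real) set, 'e) module \<Rightarrow> ('e \<Rightarrow> ('w \<Rightarrow> real) set) \<Rightarrow>
    (('e \<Rightarrow> ('w \<Rightarrow> ereal) set) \<Rightarrow> (('e \<Rightarrow> ('w \<Rightarrow> real) set) \<Rightarrow> ('w \<Rightarrow> ereal) set)) \<Rightarrow> bool" where
  "stable_operator M E nrm S \<longleftrightarrow>
     (\<forall>A\<in>sets M. \<forall>f\<in>lsc_convex_functions M E nrm. \<forall>g\<in>lsc_convex_functions M E nrm.
        S (paste M (carrier E) A f g) = paste M (carrier (dual M E nrm)) A (S f) (S g))"

end

theory Submission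
  imports Defs
begin

text \<open>Both classes of functions consist of the suprema of their affine minorants; this follows from
  a Hahn--Banach separation whose functionals are built from essential infima. In such a class the
  functions with a single point \<open>x\<close> in their domain, with value \<open>c\<close> there, can be recognized from the
  order, and so can the affine ones. An order reversing bijection \<open>S\<close> interchanges the two kinds, so it maps
  the point function \<open>(x, c)\<close> to an affine function with linear part \<open>H x\<close>. As \<open>u(x) + r \<le> c\<close> says
  that the affine function \<open>u + r\<close> lies below the point function \<open>(x, c)\<close>, evaluating the images
  makes \<open>u(x) + r\<close> a sum of a function of \<open>(u, r)\<close> and a pairing of \<open>H x\<close> with a
  function of \<open>u\<close>. Stability makes the dependence on \<open>r\<close> an affine one, with slope \<open>\<tau>\<close>, and the
  pairing forces \<open>H\<close> to be linear with a closed graph, hence continuous. Finally \<open>f\<close> is the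
  infimum of the point functions at the points of its epigraph, so \<open>S f\<close> is the supremum of
  their images, which is the conjugate of \<open>f\<close> up to the affine change of variables.\<close>

section \<open>Convergence in probability and essential suprema\<close>

text \<open>Scalars are random variables: a nonzero scalar may vanish, a value may be infinite and
  two points may coincide on a part of \<Omega> only. Case distinctions are therefore replaced by
  gluing along measurable sets. Each statement holds up to a null set depending on the points
  involved, and only countably many can be combined; hence suprema and infima of arbitrary families
  are reached through countable subfamilies. Additivity and monotonicity do not make a map of random
  variables linear over them: composition with a measure preserving map of \<Omega> has both.
  Locality, which stability provides, excludes this. Full support yields a point and a functional
  whose pairing is 1 on \<Omega>, so that u(x) takes every value and the scalar function induced by
  S is additive on all random variables. Completeness serves to glue countably many points into one,
  and in the closed graph theorem through Baire's theorem. The order argument runs in an abstract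
  pair of modules whose roles can be exchanged, so that it applies to the inverse of S as
  well.\<close>

abbreviation borel_funs :: "'w measure \<Rightarrow> ('w \<Rightarrow> 'b::topological_space) set" ("\<L>") where
  "\<L> \<equiv> borel_measurable"

text \<open>Metrizes convergence in probability.\<close>
definition mu :: "'w measure \<Rightarrow> ('w \<Rightarrow> real) \<Rightarrow> real" where
  "mu M f = (\<integral>w. min 1 \<bar>f w\<bar> \<partial>M)"

section \<open>Essential unions, suprema and infima of arbitrary families\<close>

context prob_space
begin

text \<open>A countable subfamily is chosen whose union has the largest measure among all countable
  unions; a member not almost contained in that union would enlarge it. All reductions to countable
  subfamilies rest on this.\<close>

lemma countable_essential_union:
  assumes "\<A> \<subseteq> sets M"
  shows "\<exists>C\<subseteq>\<A>. countable C \<and> (\<forall>A\<in>\<A>. AE w in M. w \<in> A \<longrightarrow> w \<in> \<Union>C)"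
proof -
  define R where "R = (\<lambda>C. measure M (\<Union>C)) ` {C. C \<subseteq> \<A> \<and> countable C}"
  define s where "s = Sup R"
  have bdd: "bdd_above R" unfolding R_def by (auto intro!: bdd_aboveI[of _ 1])
  have ne: "R \<noteq> {}" unfolding R_def by auto
  have "\<exists>C. C \<subseteq> \<A> \<and> countable C \<and> measure M (\<Union>C) > s - 1 / (real n + 1)" for n
  proof -
    have "\<exists>r\<in>R. s - 1 / (real n + 1) < r"
      using less_cSup_iff[OF ne bdd, of "s - 1 / (real n + 1)"] by (simp add: s_def)
    then show ?thesis unfolding R_def by auto
  qed
  then obtain C where C: "\<And>n. C n \<subseteq> \<A>" "\<And>n. countable (C n)"
      "\<And>n. measure M (\<Union>(C n)) > s - 1 / (real n + 1)" by metis
  define U where "U = (\<Union>n. C n)"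
  have U: "U \<subseteq> \<A>" "countable U" using C by (auto simp: U_def)
  have setsU: "\<Union>D \<in> sets M" if "D \<subseteq> \<A>" "countable D" for D
    using that assms by (intro sets.countable_Union) auto
  have up: "measure M (\<Union>D) \<le> s" if "D \<subseteq> \<A>" "countable D" for D
    unfolding s_def using that bdd by (intro cSup_upper) (auto simp: R_def)
  have low: "s \<le> measure M (\<Union>U)"
  proof (rule field_le_epsilon)
    fix e :: real assume "0 < e"
    then obtain n where n: "1 / (real n + 1) < e" using nat_approx_posE by (metis add.commute of_nat_Suc)
    have "s - 1 / (real n + 1) < measure M (\<Union>(C n))" by (rule C)
    also have "\<dots> \<le> measure M (\<Union>U)"
      using setsU[OF U] by (intro finite_measure_mono) (auto simp: U_def)
    finally show "s \<le> measure M (\<Union>U) + e" using n by simp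
  qed
  have "AE w in M. w \<in> A \<longrightarrow> w \<in> \<Union>U" if A: "A \<in> \<A>" for A
  proof -
    have sA: "A \<in> sets M" using A assms by auto
    have "measure M (\<Union>(insert A U)) \<le> s" using A U by (intro up) auto
    moreover have "measure M (\<Union>(insert A U)) = measure M (\<Union>U) + measure M (A - \<Union>U)"
      using finite_measure_Union[of "\<Union>U" "A - \<Union>U"] setsU[OF U] sA by (auto simp: Un_commute)
    ultimately have "measure M (A - \<Union>U) = 0" using low measure_nonneg[of M "A - \<Union>U"] by linarith
    then have "A - \<Union>U \<in> null_sets M" using sA setsU[OF U]
      by (intro null_setsI) (auto simp: emeasure_eq_measure)
    then have "AE w in M. w \<notin> A - \<Union>U" by (rule AE_not_in)
    then show ?thesis by eventually_elim auto
  qed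
  then show ?thesis using U by blast
qed

text \<open>For each rational q the sets where a member exceeds q have a countable essential union,
  and the members occurring there for some q are collected. If f exceeded their supremum at w, a
  rational would lie strictly between.\<close>

lemma countable_ess_sup:
  fixes \<F> :: "('a \<Rightarrow> ereal) set"
  assumes F: "\<F> \<subseteq> \<L> M"
  shows "\<exists>C\<subseteq>\<F>. countable C \<and> (\<forall>f\<in>\<F>. AE w in M. f w \<le> (SUP g\<in>C. g w))"
proof -
  define lev where "lev q f = {w \<in> space M. f w > ereal (real_of_rat q)}" for q and f :: "'a \<Rightarrow> ereal"
  have "\<exists>C\<subseteq>\<F>. countable C \<and> (\<forall>f\<in>\<F>. AE w in M. w \<in> lev q f \<longrightarrow> (\<exists>g\<in>C. w \<in> lev q g))" for q
  proof -
    have "lev q ` \<F> \<subseteq> sets M" using F by (auto simp: lev_def)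
    from countable_essential_union[OF this] obtain B where
      B: "B \<subseteq> lev q ` \<F>" "countable B" "\<forall>A\<in>lev q ` \<F>. AE w in M. w \<in> A \<longrightarrow> w \<in> \<Union>B" by blast
    from B(1,2) obtain C where "C \<subseteq> \<F>" "countable C" "B = lev q ` C"
      by (metis countable_subset_image)
    with B(3) show ?thesis by (intro exI[of _ C]) auto
  qed
  then have "\<forall>q. \<exists>C. C \<subseteq> \<F> \<and> countable C \<and> (\<forall>f\<in>\<F>. AE w in M. w \<in> lev q f \<longrightarrow> (\<exists>g\<in>C. w \<in> lev q g))"
    by blast
  from choice[OF this] obtain C where C0: "\<forall>q. C q \<subseteq> \<F> \<and> countable (C q) \<and>
      (\<forall>f\<in>\<F>. AE w in M. w \<in> lev q f \<longrightarrow> (\<exists>g\<in>C q. w \<in> lev q g))" by (rule exE)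
  have C: "C q \<subseteq> \<F>" "countable (C q)"
    "f \<in> \<F> \<Longrightarrow> AE w in M. w \<in> lev q f \<longrightarrow> (\<exists>g\<in>C q. w \<in> lev q g)" for q f
    using C0[rule_format, of q] by simp_all
  define D where "D = (\<Union>q. C q)"
  have "AE w in M. f w \<le> (SUP g\<in>D. g w)" if f: "f \<in> \<F>" for f
  proof -
    have "AE w in M. \<forall>q. w \<in> lev q f \<longrightarrow> (\<exists>g\<in>C q. w \<in> lev q g)"
      unfolding AE_all_countable using C(3)[OF f] by blast
    then show ?thesis using AE_space
    proof eventually_elim
      fix w assume w: "\<forall>q. w \<in> lev q f \<longrightarrow> (\<exists>g\<in>C q. w \<in> lev q g)" "w \<in> space M"
      show "f w \<le> (SUP g\<in>D. g w)"
      proof (rule ccontr)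
        assume "\<not> f w \<le> (SUP g\<in>D. g w)"
        then obtain q where q: "(SUP g\<in>D. g w) < ereal (real_of_rat q)" "ereal (real_of_rat q) < f w"
          using ereal_dense3 not_le by metis
        then obtain g where "g \<in> C q" "w \<in> lev q g" using w by (auto simp: lev_def)
        then have "g \<in> D" "ereal (real_of_rat q) < g w" by (auto simp: D_def lev_def)
        moreover have "g w \<le> (SUP g\<in>D. g w)" using \<open>g \<in> D\<close> by (rule SUP_upper)
        ultimately show False using q by (metis less_le_not_le order_less_le_trans)
      qed
    qed
  qed
  moreover have "D \<subseteq> \<F>" "countable D" using C by (auto simp: D_def)
  ultimately show ?thesis by blast
qed

text \<open>The lower bound \<open>l\<close> keeps the infimum \<open>m\<close> real. The sequence
  \<open>g\<close> approaches \<open>m\<close> pointwise only, with an index that depends on w and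
  on the precision; this suffices to transfer almost sure lower bounds from the family to
  \<open>m\<close>.\<close>

lemma real_inf:
  fixes \<F> :: "('a \<Rightarrow> real) set"
  assumes F: "\<F> \<subseteq> \<L> M" "\<F> \<noteq> {}"
    and l: "l \<in> \<L> M" "\<And>f. f \<in> \<F> \<Longrightarrow> AE w in M. l w \<le> f w"
  obtains m g where "m \<in> \<L> M" "\<And>f. f \<in> \<F> \<Longrightarrow> AE w in M. m w \<le> f w"
    "\<And>n::nat. g n \<in> \<F>" "AE w in M. \<forall>e>0. \<exists>n. g n w < m w + e"
proof -
  define G where "G = (\<lambda>f w. ereal (- f w)) ` \<F>"
  have "G \<subseteq> \<L> M" using F by (auto simp: G_def)
  from countable_ess_sup[OF this] obtain C where
    C: "C \<subseteq> G" "countable C" "\<forall>f\<in>G. AE w in M. f w \<le> (SUP g\<in>C. g w)" by blast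
  from C(1,2) obtain D where D: "D \<subseteq> \<F>" "countable D" "C = (\<lambda>f w. ereal (- f w)) ` D"
    unfolding G_def by (metis countable_subset_image)
  obtain f0 where f0: "f0 \<in> \<F>" using F by auto
  \<comment> \<open>Adding \<open>f0\<close> makes the countable set nonempty, so that
    \<open>from_nat_into\<close> enumerates exactly this set and every \<open>g n\<close> belongs to
    the family.\<close>
  define D' where "D' = insert f0 D"
  have D': "D' \<subseteq> \<F>" "countable D'" "D' \<noteq> {}" using D f0 by (auto simp: D'_def)
  define g where "g = from_nat_into D'"
  have rg: "range g = D'" using D' by (simp add: g_def range_from_nat_into)
  have gF: "g n \<in> \<F>" for n using rg D' by auto
  define h where "h w = (SUP n. ereal (- g n w))" for w
  have [measurable]: "g n \<in> \<L> M" for n using gF F by auto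
  have hm[measurable]: "h \<in> \<L> M" unfolding h_def by measurable
  have hup: "AE w in M. ereal (- f w) \<le> h w" if "f \<in> \<F>" for f
  proof -
    have "AE w in M. ereal (- f w) \<le> (SUP g\<in>C. g w)" using C(3) that by (auto simp: G_def)
    then show ?thesis
    proof eventually_elim
      fix w assume "ereal (- f w) \<le> (SUP g\<in>C. g w)"
      also have "\<dots> \<le> h w"
      proof (rule SUP_least)
        fix g' assume "g' \<in> C"
        then obtain k where k: "k \<in> D" "g' = (\<lambda>w. ereal (- k w))" using D(3) by auto
        then have "k \<in> range g" using rg by (auto simp: D'_def)
        then obtain n where "k = g n" by auto
        then show "g' w \<le> h w" unfolding h_def k(2) by (intro SUP_upper2[of n]) auto
      qed
      finally show "ereal (- f w) \<le> h w" .
    qed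
  qed
  have "AE w in M. \<forall>n. l w \<le> g n w" unfolding AE_all_countable using l(2)[OF gF] by blast
  then have hlow: "AE w in M. h w \<le> ereal (- l w)"
    by eventually_elim (auto simp: h_def intro!: SUP_least)
  define m where "m w = - real_of_ereal (h w)" for w
  have hm': "AE w in M. h w = ereal (- m w)"
    using hlow hup[OF f0]
  proof eventually_elim
    fix w assume "h w \<le> ereal (- l w)" "ereal (- f0 w) \<le> h w"
    then show "h w = ereal (- m w)" by (cases "h w") (auto simp: m_def)
  qed
  have 1: "m \<in> \<L> M" unfolding m_def by measurable
  have 2: "AE w in M. m w \<le> f w" if "f \<in> \<F>" for f
    using hup[OF that] hm' by eventually_elim auto
  have 3: "AE w in M. \<forall>e>0. \<exists>n. g n w < m w + e" using hm'
  proof eventually_elim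
    fix w assume hw: "h w = ereal (- m w)"
    show "\<forall>e>0. \<exists>n. g n w < m w + e"
    proof (intro allI impI)
      fix e :: real assume "0 < e"
      then have "ereal (- m w - e) < h w" using hw by simp
      then obtain n where "ereal (- m w - e) < ereal (- g n w)" unfolding h_def less_SUP_iff by auto
      then show "\<exists>n. g n w < m w + e" by (intro exI[of _ n]) simp
    qed
  qed
  show ?thesis using that[OF 1 2 gF 3] .
qed

lemma inf_greatest:
  assumes "AE w in M. \<forall>e>0. \<exists>n. g n w < m w + (e::real)"
    and "\<And>n::nat. AE w in M. h w \<le> g n w"
  shows "AE w in M. h w \<le> m w"
proof -
  have "AE w in M. \<forall>n. h w \<le> g n w" unfolding AE_all_countable using assms(2) by blast
  then show ?thesis using assms(1)
  proof eventually_elim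
    fix w assume a: "\<forall>n. h w \<le> g n w" "\<forall>e>0. \<exists>n. g n w < m w + e"
    show "h w \<le> m w"
    proof (rule field_le_epsilon)
      fix e :: real assume "0 < e"
      then obtain n where "g n w < m w + e" using a by blast
      then show "h w \<le> m w + e" using a(1)[rule_format, of n] by linarith
    qed
  qed
qed

text \<open>Where \<open>c\<close> is positive one divides by it and uses the infimum; where
  \<open>c\<close> vanishes, the bound by the single function \<open>g 0\<close> already says that
  \<open>h\<close> is at most 0.\<close>

lemma inf_greatest_mult:
  assumes "AE w in M. \<forall>e>0. \<exists>n. g n w < m w + (e::real)"
    and "\<And>n::nat. AE w in M. h w \<le> c w * g n w" and c: "AE w in M. 0 \<le> c w"
  shows "AE w in M. h w \<le> c w * m w"
proof -
  have "AE w in M. (if c w > 0 then h w / c w else m w) \<le> m w"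
  proof (rule AE_mp)
    show "AE w in M. \<forall>n. h w \<le> c w * g n w" unfolding AE_all_countable using assms(2) by blast
  next
    show "AE w in M. (\<forall>n. h w \<le> c w * g n w) \<longrightarrow> (if c w > 0 then h w / c w else m w) \<le> m w"
      using assms(1)
    proof eventually_elim
      fix w assume e: "\<forall>e>0. \<exists>n. g n w < m w + e"
      show "(\<forall>n. h w \<le> c w * g n w) \<longrightarrow> (if c w > 0 then h w / c w else m w) \<le> m w"
      proof (intro impI, cases "c w > 0")
        assume a: "\<forall>n. h w \<le> c w * g n w" and cp: "c w > 0"
        have "h w / c w \<le> m w"
        proof (rule field_le_epsilon)
          fix d :: real assume "0 < d"
          then obtain n where "g n w < m w + d" using e by blast
          moreover have "h w / c w \<le> g n w" using a cp by (simp add: divide_le_eq mult.commute)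
          ultimately show "h w / c w \<le> m w + d" by linarith
        qed
        then show "(if c w > 0 then h w / c w else m w) \<le> m w" using cp by simp
      qed simp
    qed
  qed
  moreover have "AE w in M. h w \<le> c w * g 0 w" by (rule assms)
  ultimately show ?thesis using c
  proof eventually_elim
    fix w assume "(if c w > 0 then h w / c w else m w) \<le> m w" "h w \<le> c w * g 0 w" "0 \<le> c w"
    then show "h w \<le> c w * m w" by (cases "c w > 0") (auto simp: divide_le_eq mult.commute)
  qed
qed

section \<open>The functional that measures smallness in probability\<close>

lemma mu_int[simp]:
  "f \<in> \<L> M \<Longrightarrow> integrable M (\<lambda>w. min 1 \<bar>f w :: real\<bar>)"
  by (rule integrable_const_bound[of _ 1]) auto

lemma mu_nonneg: "0 \<le> mu M f"
  unfolding mu_def by (rule integral_nonneg_AE) auto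

lemma mu_mono:
  assumes "f \<in> \<L> M" "g \<in> \<L> M" "AE w in M. \<bar>f w\<bar> \<le> \<bar>g w\<bar>"
  shows "mu M f \<le> mu M g"
  unfolding mu_def using assms by (intro integral_mono_AE) (auto elim!: eventually_mono)

lemma mu_cong:
  assumes "f \<in> \<L> M" "g \<in> \<L> M" "AE w in M. f w = g w"
  shows "mu M f = mu M g"
  using assms by (intro antisym mu_mono) (auto elim!: eventually_mono)

lemma mu_add:
  assumes [measurable]: "f \<in> \<L> M" "g \<in> \<L> M"
  shows "mu M (\<lambda>w. f w + g w) \<le> mu M f + mu M g"
proof -
  have "mu M (\<lambda>w. f w + g w) \<le> (\<integral>w. min 1 \<bar>f w\<bar> + min 1 \<bar>g w\<bar> \<partial>M)"
    unfolding mu_def by (intro integral_mono mu_int Bochner_Integration.integrable_add) auto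
  also have "\<dots> = mu M f + mu M g" unfolding mu_def by (intro Bochner_Integration.integral_add mu_int) auto
  finally show ?thesis .
qed

lemma mu_le_add:
  assumes "f \<in> \<L> M" "g \<in> \<L> M" "h \<in> \<L> M"
    "AE w in M. \<bar>h w\<bar> \<le> \<bar>f w\<bar> + \<bar>g w\<bar>"
  shows "mu M h \<le> mu M f + mu M g"
proof -
  have "mu M h \<le> mu M (\<lambda>w. \<bar>f w\<bar> + \<bar>g w\<bar>)" using assms by (intro mu_mono) auto
  also have "\<dots> \<le> mu M (\<lambda>w. \<bar>f w\<bar>) + mu M (\<lambda>w. \<bar>g w\<bar>)" using assms by (intro mu_add) auto
  also have "\<dots> = mu M f + mu M g" by (simp add: mu_def)
  finally show ?thesis .
qed

lemma mu_eq_0: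
  assumes "f \<in> \<L> M"
  shows "mu M f = 0 \<longleftrightarrow> (AE w in M. f w = 0)"
proof -
  have "mu M f = 0 \<longleftrightarrow> (AE w in M. min 1 \<bar>f w\<bar> = 0)"
    unfolding mu_def using assms by (intro integral_nonneg_eq_0_iff_AE) auto
  also have "\<dots> \<longleftrightarrow> (AE w in M. f w = 0)" by (intro AE_cong) (auto simp: min_def)
  finally show ?thesis .
qed

lemma mu_scale:
  assumes [measurable]: "f \<in> \<L> M" and "1 \<le> k"
  shows "mu M (\<lambda>w. k * f w) \<le> k * mu M f"
proof -
  have "min 1 \<bar>k * f w\<bar> \<le> k * min 1 \<bar>f w\<bar>" for w
    using \<open>1 \<le> k\<close> mult_mono[of 1 k 1 "\<bar>f w\<bar>"] by (cases "\<bar>f w\<bar> \<le> 1") (auto simp: min_def abs_mult)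
  then have "mu M (\<lambda>w. k * f w) \<le> (\<integral>w. k * min 1 \<bar>f w\<bar> \<partial>M)"
    unfolding mu_def by (intro integral_mono mu_int integrable_mult_right) auto
  then show ?thesis by (simp add: mu_def)
qed

lemma integrable_ind[simp]: "A \<in> sets M \<Longrightarrow> integrable M (indicator A :: 'a \<Rightarrow> real)"
  by (rule integrable_const_bound[of _ 1]) auto

lemma mu_ge_prob:
  assumes [measurable]: "f \<in> \<L> M" and e: "0 < e"
  shows "min 1 e * prob {w \<in> space M. e \<le> \<bar>f w\<bar>} \<le> mu M f"
proof -
  have "(\<integral>w. min 1 e * indicator {w \<in> space M. e \<le> \<bar>f w\<bar>} w \<partial>M) \<le> mu M f"
    unfolding mu_def using e
    by (intro integral_mono mu_int integrable_mult_right) (auto simp: min_def split: split_indicator)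
  then show ?thesis by simp
qed

lemma mu_le_prob:
  assumes [measurable]: "f \<in> \<L> M" and e: "0 \<le> e"
  shows "mu M f \<le> e + prob {w \<in> space M. e \<le> \<bar>f w\<bar>}"
proof -
  have "mu M f \<le> (\<integral>w. e + indicator {w \<in> space M. e \<le> \<bar>f w\<bar>} w \<partial>M)"
    unfolding mu_def using e
    by (intro integral_mono mu_int Bochner_Integration.integrable_add) (auto simp: min_def split: split_indicator)
  then show ?thesis by (simp add: prob_space)
qed

lemma mu_indicator_le:
  assumes [measurable]: "f \<in> \<L> M" "A \<in> sets M" and "AE w in M. w \<notin> A \<longrightarrow> f w = 0"
  shows "mu M f \<le> prob A"
proof -
  have "mu M f \<le> (\<integral>w. indicator A w \<partial>M)"
    unfolding mu_def using assms(3)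
    by (intro integral_mono_AE mu_int) (auto elim!: eventually_mono split: split_indicator)
  then show ?thesis by simp
qed

lemma mu_tendsto_0:
  assumes [measurable]: "\<And>n. f n \<in> \<L> M" and "AE w in M. (\<lambda>n. f n w) \<longlonglongrightarrow> 0"
  shows "(\<lambda>n. mu M (f n)) \<longlonglongrightarrow> 0"
proof -
  have "(\<lambda>n. \<integral>w. min 1 \<bar>f n w\<bar> \<partial>M) \<longlonglongrightarrow> (\<integral>w. 0 \<partial>M)"
  proof (rule integral_dominated_convergence[where w="\<lambda>_. 1"])
    show "AE w in M. (\<lambda>n. min 1 \<bar>f n w\<bar>) \<longlonglongrightarrow> 0" using assms(2)
    proof eventually_elim
      fix w assume "(\<lambda>n. f n w) \<longlonglongrightarrow> 0"
      then have "(\<lambda>n. min 1 \<bar>f n w\<bar>) \<longlonglongrightarrow> min 1 \<bar>0\<bar>" by (intro tendsto_intros)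
      then show "(\<lambda>n. min 1 \<bar>f n w\<bar>) \<longlonglongrightarrow> 0" by simp
    qed
  qed auto
  then show ?thesis by (simp add: mu_def)
qed

text \<open>Multiplication by a fixed random variable is continuous in probability. For k so large
  that \<open>mu M (a / k)\<close> is small, the product is controlled by k |f| where |a| <= k,
  while the set where |a| > k is charged to the first summand.\<close>

lemma mu_mult_small:
  assumes [measurable]: "a \<in> \<L> M" and "0 < e"
  obtains d where "0 < d" "\<And>f. f \<in> \<L> M \<Longrightarrow> mu M f < d \<Longrightarrow> mu M (\<lambda>w. a w * f w) < e"
proof -
  have "(\<lambda>n. mu M (\<lambda>w. a w / real (Suc n))) \<longlonglongrightarrow> 0"
    by (rule mu_tendsto_0, simp, rule AE_I2, rule real_tendsto_divide_at_top[OF tendsto_const])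
      (rule filterlim_compose[OF filterlim_real_sequentially filterlim_Suc])
  then have "eventually (\<lambda>n. mu M (\<lambda>w. a w / real (Suc n)) < e / 2) sequentially"
    using \<open>0 < e\<close> by (intro order_tendstoD) auto
  then obtain n where n: "mu M (\<lambda>w. a w / real (Suc n)) < e / 2" using eventually_happens'[OF sequentially_bot] by blast
  define k where "k = real (Suc n)"
  have k: "1 \<le> k" "0 < k" by (auto simp: k_def)
  show ?thesis
  proof (rule that[of "e / (4 * k)"])
    show "0 < e / (4 * k)" using k \<open>0 < e\<close> by simp
    fix f assume [measurable]: "f \<in> \<L> M" and f: "mu M f < e / (4 * k)"
    have *: "min 1 \<bar>a w * f w\<bar> \<le> min 1 \<bar>a w / k\<bar> + k * min 1 \<bar>f w\<bar>" for w
    proof (cases "\<bar>a w\<bar> \<le> k")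
      case True
      then have "\<bar>a w * f w\<bar> \<le> k * \<bar>f w\<bar>" by (simp add: abs_mult mult_right_mono)
      then have "min 1 \<bar>a w * f w\<bar> \<le> k * min 1 \<bar>f w\<bar>" using k by (cases "\<bar>f w\<bar> \<le> 1") (auto simp: min_def)
      moreover have "0 \<le> min 1 \<bar>a w / k\<bar>" by simp
      ultimately show ?thesis by linarith
    next
      case False
      then have "1 \<le> \<bar>a w / k\<bar>" using k by (simp add: abs_divide le_divide_eq)
      then have "min 1 \<bar>a w / k\<bar> = 1" by simp
      moreover have "0 \<le> k * min 1 \<bar>f w\<bar>" "min 1 \<bar>a w * f w\<bar> \<le> 1" using k by auto
      ultimately show ?thesis by linarith
    qed
    have "mu M (\<lambda>w. a w * f w) \<le> (\<integral>w. min 1 \<bar>a w / k\<bar> + k * min 1 \<bar>f w\<bar> \<partial>M)"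
      unfolding mu_def using * by (intro integral_mono mu_int Bochner_Integration.integrable_add integrable_mult_right) auto
    also have "\<dots> = mu M (\<lambda>w. a w / k) + k * mu M f"
      unfolding mu_def by (subst Bochner_Integration.integral_add[OF mu_int integrable_mult_right[OF mu_int]]) simp_all
    also have "\<dots> < e / 2 + k * (e / (4 * k))"
      using n f k by (intro add_strict_mono mult_strict_left_mono) (auto simp: k_def)
    also have "\<dots> < e" using k \<open>0 < e\<close> by simp
    finally show "mu M (\<lambda>w. a w * f w) < e" .
  qed
qed

text \<open>The index at which \<open>g\<close> comes close to \<open>m\<close> depends on w.
  Directedness replaces \<open>g\<close> by an almost surely decreasing sequence of members, to
  which dominated convergence applies; so a single member is close to \<open>m\<close> in
  probability.\<close>

lemma directed_inf_mu:
  fixes m :: "'a \<Rightarrow> real"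
  assumes F: "\<F> \<subseteq> \<L> M"
    and m: "m \<in> \<L> M" "\<And>f. f \<in> \<F> \<Longrightarrow> AE w in M. m w \<le> f w"
    and g: "\<And>n::nat. g n \<in> \<F>" "AE w in M. \<forall>e>0. \<exists>n. g n w < m w + e"
    and dir: "\<And>f g. f \<in> \<F> \<Longrightarrow> g \<in> \<F> \<Longrightarrow> \<exists>h\<in>\<F>. AE w in M. h w \<le> f w \<and> h w \<le> g w"
    and d: "0 < d"
  shows "\<exists>f\<in>\<F>. mu M (\<lambda>w. f w - m w) < d"
proof -
  have "\<exists>h. \<forall>n. (h n \<in> \<F> \<and> (AE w in M. h n w \<le> g n w)) \<and> (AE w in M. h (Suc n) w \<le> h n w)"
  proof (rule dependent_nat_choice)
    show "\<exists>f. f \<in> \<F> \<and> (AE w in M. f w \<le> g 0 w)" using g(1)[of 0] by (intro exI[of _ "g 0"]) auto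
    fix f and n assume f: "f \<in> \<F> \<and> (AE w in M. f w \<le> g n w)"
    then obtain h where "h \<in> \<F>" "AE w in M. h w \<le> f w \<and> h w \<le> g (Suc n) w"
      using dir[of f "g (Suc n)"] g(1) by blast
    then show "\<exists>h. (h \<in> \<F> \<and> (AE w in M. h w \<le> g (Suc n) w)) \<and> (AE w in M. h w \<le> f w)"
      by (intro exI[of _ h]) (auto elim!: eventually_mono)
  qed
  then obtain h where h: "\<And>n. h n \<in> \<F>" "\<And>n. AE w in M. h n w \<le> g n w" "\<And>n. AE w in M. h (Suc n) w \<le> h n w"
    by blast
  have [measurable]: "h n \<in> \<L> M" for n using h F by auto
  note [measurable] = m(1)
  have a: "AE w in M. \<forall>n. h n w \<le> g n w \<and> h (Suc n) w \<le> h n w \<and> m w \<le> h n w"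
    unfolding AE_all_countable using h(2,3) m(2)[OF h(1)] by auto
  have "(\<lambda>n. mu M (\<lambda>w. h n w - m w)) \<longlonglongrightarrow> 0"
  proof (rule mu_tendsto_0)
    show "AE w in M. (\<lambda>n. h n w - m w) \<longlonglongrightarrow> 0" using a g(2)
    proof eventually_elim
      fix w assume w: "\<forall>n. h n w \<le> g n w \<and> h (Suc n) w \<le> h n w \<and> m w \<le> h n w"
         "\<forall>e>0. \<exists>n. g n w < m w + e"
      have dec: "decseq (\<lambda>n. h n w)" using w by (intro decseq_SucI) auto
      show "(\<lambda>n. h n w - m w) \<longlonglongrightarrow> 0"
      proof (rule LIMSEQ_I)
        fix r :: real assume "0 < r"
        then obtain N where N: "g N w < m w + r" using w by blast
        have "norm (h n w - m w - 0) < r" if "n \<ge> N" for n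
        proof -
          have "h n w \<le> h N w" using dec that by (auto simp: decseq_def)
          then show ?thesis using w N by (smt (verit) real_norm_def)
        qed
        then show "\<exists>N. \<forall>n\<ge>N. norm (h n w - m w - 0) < r" by blast
      qed
    qed
  qed simp
  then have "eventually (\<lambda>n. mu M (\<lambda>w. h n w - m w) < d) sequentially"
    using d by (intro order_tendstoD) auto
  then obtain n where "mu M (\<lambda>w. h n w - m w) < d" using eventually_happens'[OF sequentially_bot] by blast
  then show ?thesis using h(1) by blast
qed

end

section \<open>Modules over the algebra of random variables\<close>

text \<open>Scalars are measurable functions instead of classes, so that scalar identities can be checked pointwise.\<close>
locale rmodule = prob_space M for M :: "'w measure" +
  fixes X :: "'x set" and pl :: "'x \<Rightarrow> 'x \<Rightarrow> 'x" and zr :: 'x and ac :: "('w \<Rightarrow> real) \<Rightarrow> 'x \<Rightarrow> 'x"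
  assumes pl_in[simp]: "\<lbrakk>x \<in> X; y \<in> X\<rbrakk> \<Longrightarrow> pl x y \<in> X"
    and zr_in[simp]: "zr \<in> X"
    and ac_in[simp]: "\<lbrakk>a \<in> \<L> M; x \<in> X\<rbrakk> \<Longrightarrow> ac a x \<in> X"
    and pl_comm: "\<lbrakk>x \<in> X; y \<in> X\<rbrakk> \<Longrightarrow> pl x y = pl y x"
    and pl_assoc: "\<lbrakk>x \<in> X; y \<in> X; z \<in> X\<rbrakk> \<Longrightarrow> pl (pl x y) z = pl x (pl y z)"
    and pl_zr[simp]: "x \<in> X \<Longrightarrow> pl x zr = x"
    and ac_addl: "\<lbrakk>a \<in> \<L> M; b \<in> \<L> M; x \<in> X\<rbrakk> \<Longrightarrow>
      ac (\<lambda>w. a w + b w) x = pl (ac a x) (ac b x)"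
    and ac_addr: "\<lbrakk>a \<in> \<L> M; x \<in> X; y \<in> X\<rbrakk> \<Longrightarrow> ac a (pl x y) = pl (ac a x) (ac a y)"
    and ac_mult: "\<lbrakk>a \<in> \<L> M; b \<in> \<L> M; x \<in> X\<rbrakk> \<Longrightarrow>
      ac (\<lambda>w. a w * b w) x = ac a (ac b x)"
    and ac_one[simp]: "x \<in> X \<Longrightarrow> ac (\<lambda>_. 1) x = x"
    and ac_zero[simp]: "x \<in> X \<Longrightarrow> ac (\<lambda>_. 0) x = zr"
begin

lemma zr_pl[simp]: "x \<in> X \<Longrightarrow> pl zr x = x"
  by (simp add: pl_comm[of zr])

lemma pl_lcomm: "\<lbrakk>x \<in> X; y \<in> X; z \<in> X\<rbrakk> \<Longrightarrow> pl x (pl y z) = pl y (pl x z)"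
  using pl_assoc[of x y z] pl_assoc[of y x z] pl_comm[of x y] by simp

lemmas pl_ac = pl_assoc pl_comm pl_lcomm

abbreviation neg :: "'x \<Rightarrow> 'x" where "neg x \<equiv> ac (\<lambda>_. - 1) x"

definition glue :: "'w set \<Rightarrow> 'x \<Rightarrow> 'x \<Rightarrow> 'x" where
  "glue A x y = pl (ac (indicator A) x) (ac (\<lambda>w. 1 - indicator A w) y)"

lemma pl_ac_cancel:
  "\<lbrakk>a \<in> \<L> M; b \<in> \<L> M; x \<in> X; \<And>w. a w + b w = 0\<rbrakk> \<Longrightarrow> pl (ac a x) (ac b x) = zr"
  using ac_addl[of a b x] by simp

lemma pl_neg[simp]: "x \<in> X \<Longrightarrow> pl x (neg x) = zr"
  using pl_ac_cancel[of "\<lambda>_. 1" "\<lambda>_. - 1" x] by simp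

lemma neg_pl[simp]: "x \<in> X \<Longrightarrow> pl (neg x) x = zr"
  by (simp add: pl_comm)

lemma neg_unique: "\<lbrakk>x \<in> X; y \<in> X; pl x (neg y) = zr\<rbrakk> \<Longrightarrow> x = y"
  using pl_assoc[of x "neg y" y] by simp

lemma glue_in[simp]: "\<lbrakk>A \<in> sets M; x \<in> X; y \<in> X\<rbrakk> \<Longrightarrow> glue A x y \<in> X"
  by (simp add: glue_def)

text \<open>Stated for a function with values 0 and 1, since it is applied to an indicator and to
  its complement. Gluing x back onto the glued element recovers x, which turns one-sided estimates
  for glued elements into equalities.\<close>

lemma glue_glue:
  assumes I: "I \<in> \<L> M" "\<And>w. I w = 0 \<or> I w = (1::real)" and x: "x \<in> X" and y: "y \<in> X"
  shows "pl (ac I (pl (ac I x) (ac (\<lambda>w. 1 - I w) y))) (ac (\<lambda>w. 1 - I w) x) = x"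
proof -
  let ?J = "\<lambda>w. 1 - I w"
  have m: "I \<in> \<L> M" "?J \<in> \<L> M" using I by auto
  have "I w * I w = I w" for w using I(2)[of w] by auto
  then have "(\<lambda>w. I w * I w) = I" by auto
  then have 1: "ac I (ac I x) = ac I x" using ac_mult[OF m(1) m(1) x] by simp
  have "I w * ?J w = 0" for w using I(2)[of w] by auto
  then have "(\<lambda>w. I w * ?J w) = (\<lambda>_. 0)" by blast
  then have 2: "ac I (ac ?J y) = zr" using ac_mult[OF m y] y by simp
  have "pl (ac I x) (ac ?J x) = x" using ac_addl[OF m x] x by simp
  then show ?thesis using m x y 1 2 by (simp add: ac_addr)
qed

section \<open>Linear and sublinear functionals with random values\<close>

definition rlin :: "('x \<Rightarrow> 'w \<Rightarrow> real) \<Rightarrow> bool" where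
  "rlin u \<longleftrightarrow> (\<forall>x\<in>X. u x \<in> \<L> M) \<and>
     (\<forall>x\<in>X. \<forall>y\<in>X. AE w in M. u (pl x y) w = u x w + u y w) \<and>
     (\<forall>a\<in>\<L> M. \<forall>x\<in>X. AE w in M. u (ac a x) w = a w * u x w)"

text \<open>Homogeneity is required as an inequality because this is what an essential infimum
  satisfies directly; equality is recovered in \<open>rsublin_eq\<close>.\<close>

definition rsublin :: "('x \<Rightarrow> 'w \<Rightarrow> real) \<Rightarrow> bool" where
  "rsublin p \<longleftrightarrow> (\<forall>x\<in>X. p x \<in> \<L> M) \<and>
     (\<forall>x\<in>X. \<forall>y\<in>X. AE w in M. p (pl x y) w \<le> p x w + p y w) \<and>
     (\<forall>a\<in>\<L> M. \<forall>x\<in>X. (\<forall>w. 0 \<le> a w) \<longrightarrow> (AE w in M. p (ac a x) w \<le> a w * p x w))"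

definition rseminorm :: "('x \<Rightarrow> 'w \<Rightarrow> real) \<Rightarrow> bool" where
  "rseminorm q \<longleftrightarrow> (\<forall>x\<in>X. q x \<in> \<L> M) \<and> (\<forall>x\<in>X. AE w in M. 0 \<le> q x w) \<and>
     (\<forall>x\<in>X. \<forall>y\<in>X. AE w in M. q (pl x y) w \<le> q x w + q y w) \<and>
     (\<forall>a\<in>\<L> M. \<forall>x\<in>X. AE w in M. q (ac a x) w = \<bar>a w\<bar> * q x w)"

lemma rlinD:
  assumes "rlin u"
  shows "x \<in> X \<Longrightarrow> u x \<in> \<L> M"
    and "\<lbrakk>x \<in> X; y \<in> X\<rbrakk> \<Longrightarrow> AE w in M. u (pl x y) w = u x w + u y w"
    and "\<lbrakk>a \<in> \<L> M; x \<in> X\<rbrakk> \<Longrightarrow> AE w in M. u (ac a x) w = a w * u x w"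
  using assms by (auto simp: rlin_def)

lemma rsublinD:
  assumes "rsublin p"
  shows "x \<in> X \<Longrightarrow> p x \<in> \<L> M"
    and "\<lbrakk>x \<in> X; y \<in> X\<rbrakk> \<Longrightarrow> AE w in M. p (pl x y) w \<le> p x w + p y w"
    and "\<lbrakk>a \<in> \<L> M; x \<in> X; \<And>w. 0 \<le> a w\<rbrakk> \<Longrightarrow> AE w in M. p (ac a x) w \<le> a w * p x w"
  using assms by (auto simp: rsublin_def)

lemma rseminormD:
  assumes "rseminorm q"
  shows "x \<in> X \<Longrightarrow> q x \<in> \<L> M"
    and "x \<in> X \<Longrightarrow> AE w in M. 0 \<le> q x w"
    and "\<lbrakk>x \<in> X; y \<in> X\<rbrakk> \<Longrightarrow> AE w in M. q (pl x y) w \<le> q x w + q y w"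
    and "\<lbrakk>a \<in> \<L> M; x \<in> X\<rbrakk> \<Longrightarrow> AE w in M. q (ac a x) w = \<bar>a w\<bar> * q x w"
  using assms by (auto simp: rseminorm_def)

lemma rlin_zr: "rlin u \<Longrightarrow> AE w in M. u zr w = 0"
  using rlinD(3)[of u "\<lambda>_. 0" zr] by simp

lemma rlin_diff:
  assumes "rlin u" "x \<in> X" "y \<in> X"
  shows "AE w in M. u (pl x (neg y)) w = u x w - u y w"
  using rlinD(2)[OF assms(1), of x "neg y"] rlinD(3)[OF assms(1), of "\<lambda>_. - 1" y] assms
  by (auto elim: eventually_elim2)

lemma rlin_glue:
  assumes "rlin u" "x \<in> X" "y \<in> X" and A: "A \<in> sets M"
  shows "AE w in M. u (glue A x y) w = (if w \<in> A then u x w else u y w)"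
proof -
  have m: "(indicator A :: 'w \<Rightarrow> real) \<in> \<L> M" "(\<lambda>w. 1 - indicator A w :: real) \<in> \<L> M"
    using A by auto
  show ?thesis unfolding glue_def
    using rlinD(2)[OF assms(1) ac_in[OF m(1) assms(2)] ac_in[OF m(2) assms(3)]]
      rlinD(3)[OF assms(1) m(1) assms(2)] rlinD(3)[OF assms(1) m(2) assms(3)]
    by eventually_elim (auto simp: indicator_def)
qed

lemma rsublin_zr: assumes p: "rsublin p" shows "AE w in M. p zr w = 0"
proof -
  have "AE w in M. p zr w \<le> p zr w + p zr w" "AE w in M. p zr w \<le> 0"
    using rsublinD(2)[OF p, of zr zr] rsublinD(3)[OF p, of "\<lambda>_. 0" zr] by simp_all
  then show ?thesis by eventually_elim simp
qed

text \<open>The reverse inequality is the assumed one applied to the partial inverse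
  \<open>b\<close> of \<open>a\<close>. On the set where \<open>a\<close> vanishes there is no
  inverse; multiplying by its indicator \<open>J\<close> shows that both sides are zero
  there.\<close>

lemma rsublin_eq:
  assumes p: "rsublin p" and a: "a \<in> \<L> M" "\<And>w. 0 \<le> a w" and x: "x \<in> X"
  shows "AE w in M. p (ac a x) w = a w * p x w"
proof -
  define I where "I w = (if a w > 0 then 1 else 0 :: real)" for w
  define J where "J w = (if a w > 0 then 0 else 1 :: real)" for w
  define b where "b w = (if a w > 0 then 1 / a w else 0)" for w
  note [measurable] = a(1)
  have m: "I \<in> \<L> M" "J \<in> \<L> M" "b \<in> \<L> M"
    unfolding I_def J_def b_def by measurable
  have bI: "(\<lambda>w. b w * a w) = I" by (auto simp: b_def I_def)
  have ja: "(\<lambda>w. J w * a w) = (\<lambda>_. 0)" using a(2) by (force simp: J_def less_le)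
  have IJ: "(\<lambda>w. I w + J w) = (\<lambda>_. 1)" by (auto simp: I_def J_def)
  have ax: "ac a x \<in> X" using a x by simp
  have eI: "ac b (ac a x) = ac I x" using ac_mult[OF m(3) a(1) x] bI by simp
  have ez: "ac J (ac a x) = zr" using ac_mult[OF m(2) a(1) x] ja x by simp
  have ex: "pl (ac I x) (ac J x) = x" using ac_addl[OF m(1,2) x] IJ x by simp
  have 1: "AE w in M. p (ac I x) w \<le> b w * p (ac a x) w"
    using rsublinD(3)[OF p m(3) ax] eI by (simp add: b_def)
  have 2: "AE w in M. p x w \<le> p (ac I x) w + p (ac J x) w"
    using rsublinD(2)[OF p, of "ac I x" "ac J x"] ex m x by simp
  have 3: "AE w in M. p (ac J x) w \<le> J w * p x w"
    using rsublinD(3)[OF p m(2) x] by (simp add: J_def)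
  have 4: "AE w in M. p zr w \<le> J w * p (ac a x) w"
    using rsublinD(3)[OF p m(2) ax] ez by (simp add: J_def)
  show ?thesis using 1 2 3 4 rsublin_zr[OF p] rsublinD(3)[OF p a(1) x a(2)]
  proof eventually_elim
    case (elim w)
    show ?case
    proof (cases "a w > 0")
      case True
      then have "p x w \<le> p (ac a x) w / a w" using elim by (simp add: b_def J_def I_def)
      then have "a w * p x w \<le> p (ac a x) w" using True by (simp add: le_divide_eq mult.commute)
      then show ?thesis using elim by linarith
    next
      case False
      then have "a w = 0" using a(2)[of w] by linarith
      then show ?thesis using elim by (simp add: J_def)
    qed
  qed
qed

text \<open>A scalar is the difference of its positive and negative parts; additivity reduces
  homogeneity to these, where sublinearity gives it.\<close>

lemma rlin_sublinI:
  assumes p: "rsublin p" and add: "\<And>x y. x \<in> X \<Longrightarrow> y \<in> X \<Longrightarrow> AE w in M. p (pl x y) w = p x w + p y w"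
  shows "rlin p"
  unfolding rlin_def
proof (intro conjI ballI)
  fix a :: "'w \<Rightarrow> real" and x assume a[measurable]: "a \<in> \<L> M" and x: "x \<in> X"
  define b c where "b w = max 0 (a w)" and "c w = max 0 (- a w)" for w
  have bc[measurable]: "b \<in> \<L> M" "c \<in> \<L> M" unfolding b_def c_def by measurable
  have "(\<lambda>w. b w + (- 1) * c w) = a" by (auto simp: b_def c_def)
  then have e: "ac a x = pl (ac b x) (neg (ac c x))"
    using ac_addl[of b "\<lambda>w. (- 1) * c w" x] ac_mult[of "\<lambda>_. - 1" c x] bc x by simp
  have cx: "ac c x \<in> X" "ac b x \<in> X" using bc x by auto
  have n: "AE w in M. p (neg (ac c x)) w = - p (ac c x) w"
    using add[of "ac c x" "neg (ac c x)"] cx rsublin_zr[OF p] by (auto elim: eventually_elim2)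
  have "AE w in M. p (ac a x) w = p (ac b x) w + p (neg (ac c x)) w"
    using add[of "ac b x" "neg (ac c x)"] cx e by simp
  moreover have "AE w in M. p (ac b x) w = b w * p x w"
    by (rule rsublin_eq[OF p bc(1) _ x]) (simp add: b_def)
  moreover have "AE w in M. p (ac c x) w = c w * p x w"
    by (rule rsublin_eq[OF p bc(2) _ x]) (simp add: c_def)
  ultimately show "AE w in M. p (ac a x) w = a w * p x w" using n
    by eventually_elim (auto simp: b_def c_def max_def split: if_splits)
qed (use p add in \<open>auto simp: rsublin_def\<close>)

text \<open>Pointwise essential infima of families that are compatible with sums and positive
  multiples form a sublinear functional. This produces lower bounds of chains and the comparison
  functional in the Hahn-Banach theorem, and the dominating functional in the separation theorem.
  The bound \<open>l\<close> keeps the infima real.\<close>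

lemma inf_family_sublin:
  fixes \<F> :: "'x \<Rightarrow> ('w \<Rightarrow> real) set"
  assumes F: "\<And>x. x \<in> X \<Longrightarrow> \<F> x \<subseteq> \<L> M" "\<And>x. x \<in> X \<Longrightarrow> \<F> x \<noteq> {}"
    and l: "\<And>x. x \<in> X \<Longrightarrow> l x \<in> \<L> M"
      "\<And>x f. x \<in> X \<Longrightarrow> f \<in> \<F> x \<Longrightarrow> AE w in M. l x w \<le> f w"
    and add: "\<And>x y f g. \<lbrakk>x \<in> X; y \<in> X; f \<in> \<F> x; g \<in> \<F> y\<rbrakk> \<Longrightarrow> \<exists>h\<in>\<F> (pl x y). AE w in M. h w \<le> f w + g w"
    and mul: "\<And>a x f. \<lbrakk>a \<in> \<L> M; \<And>w. 0 \<le> a w; x \<in> X; f \<in> \<F> x\<rbrakk> \<Longrightarrow>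
       \<exists>h\<in>\<F> (ac a x). AE w in M. h w \<le> a w * f w"
  obtains p where "rsublin p" "\<And>x f. \<lbrakk>x \<in> X; f \<in> \<F> x\<rbrakk> \<Longrightarrow> AE w in M. p x w \<le> f w"
    "\<And>x k. \<lbrakk>x \<in> X; \<And>f. f \<in> \<F> x \<Longrightarrow> AE w in M. k w \<le> f w\<rbrakk> \<Longrightarrow> AE w in M. k w \<le> p x w"
proof -
  have "\<exists>m g. m \<in> \<L> M \<and> (\<forall>f\<in>\<F> x. AE w in M. m w \<le> f w) \<and> (\<forall>n::nat. g n \<in> \<F> x) \<and>
     (AE w in M. \<forall>e>0. \<exists>n. g n w < m w + e)" if x: "x \<in> X" for x
    by (rule real_inf[OF F(1)[OF x] F(2)[OF x] l(1)[OF x] l(2)[OF x]], assumption) blast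
  then have "\<forall>x. \<exists>m g. x \<in> X \<longrightarrow> m \<in> \<L> M \<and> (\<forall>f\<in>\<F> x. AE w in M. m w \<le> f w) \<and> (\<forall>n::nat. g n \<in> \<F> x) \<and>
     (AE w in M. \<forall>e>0. \<exists>n. g n w < m w + e)" by blast
  from choice[OF this] obtain p where "\<forall>x. \<exists>g. x \<in> X \<longrightarrow> p x \<in> \<L> M \<and> (\<forall>f\<in>\<F> x. AE w in M. p x w \<le> f w) \<and> (\<forall>n::nat. g n \<in> \<F> x) \<and>
     (AE w in M. \<forall>e>0. \<exists>n. g n w < p x w + e)" by (rule exE)
  from choice[OF this] obtain g where pg: "\<forall>x. x \<in> X \<longrightarrow> p x \<in> \<L> M \<and> (\<forall>f\<in>\<F> x. AE w in M. p x w \<le> f w) \<and> (\<forall>n::nat. g x n \<in> \<F> x) \<and>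
     (AE w in M. \<forall>e>0. \<exists>n. g x n w < p x w + e)" by (rule exE)
  have pm: "p x \<in> \<L> M" and pl_le: "f \<in> \<F> x \<Longrightarrow> AE w in M. p x w \<le> f w"
    and gF: "g x n \<in> \<F> x" and ge: "AE w in M. \<forall>e>0. \<exists>n. g x n w < p x w + e" if "x \<in> X" for x f n
    using pg that by auto
  have "rsublin p" unfolding rsublin_def
  proof (intro conjI ballI impI)
    fix x y assume x: "x \<in> X" and y: "y \<in> X"
    have *: "AE w in M. p (pl x y) w - f w \<le> p y w" if f: "f \<in> \<F> x" for f
    proof (rule inf_greatest[OF ge[OF y]])
      fix n
      obtain h where "h \<in> \<F> (pl x y)" "AE w in M. h w \<le> f w + g y n w" using add[OF x y f gF[OF y]] by blast
      then show "AE w in M. p (pl x y) w - f w \<le> g y n w"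
        using pl_le[of "pl x y" h] x y by (auto elim: eventually_elim2)
    qed
    have "AE w in M. p (pl x y) w - p y w \<le> g x n w" for n
      using *[OF gF[OF x, of n]] by eventually_elim linarith
    then have "AE w in M. p (pl x y) w - p y w \<le> p x w" by (rule inf_greatest[OF ge[OF x]])
    then show "AE w in M. p (pl x y) w \<le> p x w + p y w" by eventually_elim simp
  next
    fix a :: "'w \<Rightarrow> real" and x assume a: "a \<in> \<L> M" and x: "x \<in> X" and a0: "\<forall>w. 0 \<le> a w"
    show "AE w in M. p (ac a x) w \<le> a w * p x w"
    proof (rule inf_greatest_mult[OF ge[OF x]])
      fix n
      obtain h where "h \<in> \<F> (ac a x)" "AE w in M. h w \<le> a w * g x n w" using mul[OF a _ x gF[OF x]] a0 by blast
      then show "AE w in M. p (ac a x) w \<le> a w * g x n w"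
        using pl_le[of "ac a x" h] x a by (auto elim: eventually_elim2)
    qed (use a0 in auto)
  qed (use pm in auto)
  then show ?thesis
  proof (rule that)
    show "AE w in M. p x w \<le> f w" if "x \<in> X" "f \<in> \<F> x" for x f using pl_le that by blast
    show "AE w in M. k w \<le> p x w" if "x \<in> X" "\<And>f. f \<in> \<F> x \<Longrightarrow> AE w in M. k w \<le> f w" for x k
      using inf_greatest[OF ge[OF that(1)], of k] gF[OF that(1)] that(2) by blast
  qed
qed

text \<open>Zorn's lemma needs an antisymmetric order, but functionals agreeing almost surely at
  each point may be different functions. Replacing each value by the chosen representative of its
  class, and by 0 off \<open>X\<close>, identifies them.\<close>

definition canon :: "('x \<Rightarrow> 'w \<Rightarrow> real) \<Rightarrow> 'x \<Rightarrow> 'w \<Rightarrow> real" where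
  "canon p x = (if x \<in> X then rep (cls M (p x)) else (\<lambda>_. 0))"

lemma canon_AE: "p x \<in> \<L> M \<Longrightarrow> x \<in> X \<Longrightarrow> AE w in M. canon p x w = p x w"
  by (simp add: canon_def rep_cls)

lemma canon_meas: "p x \<in> \<L> M \<Longrightarrow> x \<in> X \<Longrightarrow> canon p x \<in> \<L> M"
  by (simp add: canon_def rep_props(1) cls_in)

lemma canon_idem: "(\<And>x. x \<in> X \<Longrightarrow> p x \<in> \<L> M) \<Longrightarrow> canon (canon p) = canon p"
  by (rule ext) (simp add: canon_def rep_props(2) cls_in)

lemma canon_eqI:
  assumes "\<And>x. x \<in> X \<Longrightarrow> p x \<in> \<L> M" "\<And>x. x \<in> X \<Longrightarrow> q x \<in> \<L> M"
    "\<And>x. x \<in> X \<Longrightarrow> AE w in M. p x w = q x w"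
  shows "canon p = canon q"
proof
  fix x show "canon p x = canon q x"
    using assms cls_eq_iff[of "p x" M "q x"] by (auto simp: canon_def)
qed

lemma rsublin_canon: assumes p: "rsublin p" shows "rsublin (canon p)"
proof -
  have e: "AE w in M. canon p x w = p x w" if "x \<in> X" for x
    using canon_AE[of p x] rsublinD(1)[OF p] that by simp
  show ?thesis unfolding rsublin_def
  proof (intro conjI ballI impI)
    fix x y assume x: "x \<in> X" and y: "y \<in> X"
    show "AE w in M. canon p (pl x y) w \<le> canon p x w + canon p y w"
      using e[OF x] e[OF y] e[OF pl_in[OF x y]] rsublinD(2)[OF p x y] by eventually_elim simp
  next
    fix a :: "'w \<Rightarrow> real" and x assume a: "a \<in> \<L> M" and x: "x \<in> X" and a0: "\<forall>w. 0 \<le> a w"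
    show "AE w in M. canon p (ac a x) w \<le> a w * canon p x w"
      using e[OF x] e[OF ac_in[OF a x]] rsublinD(3)[OF p a x] a0 by (auto elim: eventually_elim2 elim!: eventually_rev_mp)
  qed (use rsublinD(1)[OF p] in \<open>auto intro: canon_meas\<close>)
qed

text \<open>By Zorn's lemma there is a minimal sublinear functional below \<open>p\<close>; comparing it with
  \<open>y \<mapsto> \<Sqinter>\<^sub>a m(y + a x) - a m(x)\<close> shows that it is additive.\<close>
theorem hahn_banach:
  assumes p: "rsublin p"
  obtains u where "rlin u" "\<And>x. x \<in> X \<Longrightarrow> AE w in M. u x w \<le> p x w"
proof -
  define \<A> where "\<A> = {q. rsublin q \<and> canon q = q \<and> (\<forall>x\<in>X. AE w in M. q x w \<le> p x w)}"
  define P where "P q r \<longleftrightarrow> (\<forall>x\<in>X. AE w in M. r x w \<le> q x w)" for q r :: "'x \<Rightarrow> 'w \<Rightarrow> real"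
  have cA: "canon q \<in> \<A>" if "rsublin q" "\<And>x. x \<in> X \<Longrightarrow> AE w in M. q x w \<le> p x w" for q
  proof -
    have "AE w in M. canon q x w \<le> p x w" if "x \<in> X" for x
      using canon_AE[of q x] rsublinD(1)[OF \<open>rsublin q\<close> that] that \<open>x \<in> X \<Longrightarrow> AE w in M. q x w \<le> p x w\<close>
      by (auto elim: eventually_elim2)
    then show ?thesis using that rsublin_canon canon_idem[of q] rsublinD(1) by (auto simp: \<A>_def)
  qed
  have "\<exists>m\<in>\<A>. \<forall>a\<in>\<A>. P m a \<longrightarrow> a = m"
  proof (rule predicate_Zorn)
    show "partial_order_on \<A> (relation_of P \<A>)"
    proof (rule partial_order_on_relation_ofI)
      show "P a a" for a by (auto simp: P_def)
      show "P a c" if "P a b" "P b c" for a b c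
        unfolding P_def
      proof
        fix x assume "x \<in> X"
        then have "AE w in M. b x w \<le> a x w" "AE w in M. c x w \<le> b x w" using that by (simp_all add: P_def)
        then show "AE w in M. c x w \<le> a x w" by eventually_elim linarith
      qed
      show "a = b" if "a \<in> \<A>" "b \<in> \<A>" "P a b" "P b a" for a b
      proof -
        have "canon a = canon b"
        proof (rule canon_eqI)
          show "AE w in M. a x w = b x w" if x: "x \<in> X" for x
          proof -
            have "AE w in M. b x w \<le> a x w" "AE w in M. a x w \<le> b x w"
              using \<open>P a b\<close> \<open>P b a\<close> x by (simp_all add: P_def)
            then show ?thesis by eventually_elim linarith
          qed
        qed (use that in \<open>auto simp: \<A>_def rsublin_def\<close>)
        then show ?thesis using that by (simp add: \<A>_def)
      qed
    qed
  next
    fix C assume C: "C \<in> Chains (relation_of P \<A>)"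
    show "\<exists>u\<in>\<A>. \<forall>a\<in>C. P a u"
    proof (cases "C = {}")
      case True
      then show ?thesis using cA[OF p] by auto
    next
      case False
      have CA: "q \<in> \<A>" if "q \<in> C" for q using C that by (auto simp: Chains_def relation_of_def)
      have Cs: "rsublin q" "x \<in> X \<Longrightarrow> q x \<in> \<L> M" "x \<in> X \<Longrightarrow> AE w in M. q x w \<le> p x w" if "q \<in> C" for q x
        using CA[OF that] by (auto simp: \<A>_def rsublin_def)
      have tot: "P q r \<or> P r q" if "q \<in> C" "r \<in> C" for q r using C that by (auto simp: Chains_def relation_of_def)
      show ?thesis
      \<comment> \<open>The chain is bounded below by x \<mapsto> - p(-x), because 0 <= q(x) + q(-x)
        <= q(x) + p(-x) for each of its members q.\<close>
      proof (rule inf_family_sublin[of "\<lambda>x. (\<lambda>q. q x) ` C" "\<lambda>x w. - p (neg x) w"])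
        show "(\<lambda>q. q x) ` C \<subseteq> \<L> M" if "x \<in> X" for x using Cs(2) that by auto
        show "(\<lambda>q. q x) ` C \<noteq> {}" for x using False by auto
        show "(\<lambda>w. - p (neg x) w) \<in> \<L> M" if "x \<in> X" for x
          using rsublinD(1)[OF p, of "neg x"] that by simp
        show "AE w in M. - p (neg x) w \<le> f w" if x: "x \<in> X" and f: "f \<in> (\<lambda>q. q x) ` C" for x f
        proof -
          obtain q where q: "q \<in> C" "f = q x" using f by auto
          have "AE w in M. q (neg x) w \<le> p (neg x) w" "AE w in M. q zr w \<le> q x w + q (neg x) w"
            using Cs(3)[OF q(1), of "neg x"] rsublinD(2)[OF Cs(1)[OF q(1)], of x "neg x"] x by simp_all
          then show ?thesis using rsublin_zr[OF Cs(1)[OF q(1)]] unfolding q(2) by eventually_elim linarith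
        qed
        show "\<exists>h\<in>(\<lambda>q. q (pl x y)) ` C. AE w in M. h w \<le> f w + g w"
          if x: "x \<in> X" and y: "y \<in> X" and f: "f \<in> (\<lambda>q. q x) ` C" and g: "g \<in> (\<lambda>q. q y) ` C" for x y f g
        proof -
          obtain q r where q: "q \<in> C" "f = q x" and r: "r \<in> C" "g = r y" using f g by auto
          from tot[OF q(1) r(1)] show ?thesis
          proof
            assume "P q r"
            then have "AE w in M. r x w \<le> q x w" using x by (simp add: P_def)
            then have "AE w in M. r (pl x y) w \<le> f w + g w"
              using rsublinD(2)[OF Cs(1)[OF r(1)] x y] unfolding q(2) r(2) by eventually_elim linarith
            then show ?thesis using r by auto
          next
            assume "P r q"
            then have "AE w in M. q y w \<le> r y w" using y by (simp add: P_def)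
            then have "AE w in M. q (pl x y) w \<le> f w + g w"
              using rsublinD(2)[OF Cs(1)[OF q(1)] x y] unfolding q(2) r(2) by eventually_elim linarith
            then show ?thesis using q by auto
          qed
        qed
        show "\<exists>h\<in>(\<lambda>q. q (ac a x)) ` C. AE w in M. h w \<le> a w * f w"
          if "a \<in> \<L> M" "\<And>w. 0 \<le> a w" "x \<in> X" "f \<in> (\<lambda>q. q x) ` C" for a x f
        proof -
          obtain q where "q \<in> C" "f = q x" using \<open>f \<in> (\<lambda>q. q x) ` C\<close> by auto
          then show ?thesis using rsublinD(3)[OF Cs(1) that(1,3), of q] that(2) by (intro bexI[of _ "q (ac a x)"]) auto
        qed
        fix m assume m: "rsublin m" "\<And>x f. \<lbrakk>x \<in> X; f \<in> (\<lambda>q. q x) ` C\<rbrakk> \<Longrightarrow> AE w in M. m x w \<le> f w"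
        obtain q0 where q0: "q0 \<in> C" using False by auto
        have mp: "AE w in M. m x w \<le> p x w" if "x \<in> X" for x
          using m(2)[OF that, of "q0 x"] Cs(3)[OF q0 that] q0 by (auto elim: eventually_elim2)
        have "P a (canon m)" if "a \<in> C" for a unfolding P_def
        proof
          fix x assume x: "x \<in> X"
          show "AE w in M. canon m x w \<le> a x w"
            using canon_AE[of m x] rsublinD(1)[OF m(1) x] x m(2)[OF x, of "a x"] that
            by (auto elim: eventually_elim2)
        qed
        then show ?thesis using cA[OF m(1) mp] by blast
      qed
    qed
  qed
  then obtain m where m: "m \<in> \<A>" and min: "\<And>a. a \<in> \<A> \<Longrightarrow> P m a \<Longrightarrow> a = m" by blast
  have ms: "rsublin m" and mp: "\<And>x. x \<in> X \<Longrightarrow> AE w in M. m x w \<le> p x w" using m by (auto simp: \<A>_def)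
  have mm: "x \<in> X \<Longrightarrow> m x \<in> \<L> M" for x using ms by (simp add: rsublin_def)
  have "AE w in M. m (pl y x) w = m y w + m x w" if x: "x \<in> X" and y: "y \<in> X" for x y
  proof -
    \<comment> \<open>The choice a = 0 puts the infimum q below m, so that minimality gives q = m;
      the choice a = 1 then gives m(y) <= m(y + x) - m(x), the inequality that subadditivity
      lacks.\<close>
    define \<F> where "\<F> y = {\<lambda>w. m (pl y (ac a x)) w - a w * m x w |a. a \<in> \<L> M \<and> (\<forall>w. 0 \<le> a w)}" for y
    obtain q where q: "rsublin q" "\<And>x f. \<lbrakk>x \<in> X; f \<in> \<F> x\<rbrakk> \<Longrightarrow> AE w in M. q x w \<le> f w"
    proof (rule inf_family_sublin[of \<F> "\<lambda>y w. - m (neg y) w"])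
      show "\<F> y \<subseteq> \<L> M" if "y \<in> X" for y
        using that x mm by (auto simp: \<F>_def intro!: borel_measurable_diff borel_measurable_times)
      show "\<F> y \<noteq> {}" for y unfolding \<F>_def by (auto intro!: exI[of _ "\<lambda>_. 0"])
      show "(\<lambda>w. - m (neg y) w) \<in> \<L> M" if "y \<in> X" for y
        using mm[of "neg y"] that by simp
      show "AE w in M. - m (neg y) w \<le> f w" if y: "y \<in> X" and f: "f \<in> \<F> y" for y f
      proof -
        obtain a where a: "a \<in> \<L> M" "\<forall>w. 0 \<le> a w" "f = (\<lambda>w. m (pl y (ac a x)) w - a w * m x w)"
          using f by (auto simp: \<F>_def)
        have ax: "ac a x \<in> X" using a x by simp
        have "pl (pl y (ac a x)) (neg y) = pl (ac a x) (pl y (neg y))"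
          using ax y by (simp add: pl_ac del: pl_neg)
        then have "pl (pl y (ac a x)) (neg y) = ac a x" using ax y by simp
        then have "AE w in M. m (ac a x) w \<le> m (pl y (ac a x)) w + m (neg y) w"
          using rsublinD(2)[OF ms, of "pl y (ac a x)" "neg y"] ax y by simp
        then show ?thesis using rsublin_eq[OF ms a(1) _ x] a(2) unfolding a(3)
          by (auto elim: eventually_elim2)
      qed
      show "\<exists>h\<in>\<F> (pl y z). AE w in M. h w \<le> f w + g w"
        if y: "y \<in> X" and z: "z \<in> X" and f: "f \<in> \<F> y" and g: "g \<in> \<F> z" for y z f g
      proof -
        obtain a where a: "a \<in> \<L> M" "\<forall>w. 0 \<le> a w" "f = (\<lambda>w. m (pl y (ac a x)) w - a w * m x w)"
          using f by (auto simp: \<F>_def)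
        obtain b where b: "b \<in> \<L> M" "\<forall>w. 0 \<le> b w" "g = (\<lambda>w. m (pl z (ac b x)) w - b w * m x w)"
          using g by (auto simp: \<F>_def)
        have ax: "ac a x \<in> X" "ac b x \<in> X" using a b x by auto
        let ?h = "\<lambda>w. m (pl (pl y z) (ac (\<lambda>w. a w + b w) x)) w - (a w + b w) * m x w"
        have e: "pl (pl y z) (ac (\<lambda>w. a w + b w) x) = pl (pl y (ac a x)) (pl z (ac b x))"
          using ac_addl[OF a(1) b(1) x] ax y z by (simp add: pl_ac)
        have "AE w in M. ?h w \<le> f w + g w" unfolding e a(3) b(3)
          using rsublinD(2)[OF ms pl_in[OF y ax(1)] pl_in[OF z ax(2)]]
          by eventually_elim (simp add: algebra_simps)
        moreover have "?h \<in> \<F> (pl y z)" unfolding \<F>_def using a b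
          by (intro CollectI exI[of _ "\<lambda>w. a w + b w"]) auto
        ultimately show ?thesis by (rule bexI[of _ ?h])
      qed
      show "\<exists>h\<in>\<F> (ac b y). AE w in M. h w \<le> b w * f w"
        if b: "b \<in> \<L> M" "\<And>w. 0 \<le> b w" and y: "y \<in> X" and f: "f \<in> \<F> y" for b y f
      proof -
        obtain a where a: "a \<in> \<L> M" "\<forall>w. 0 \<le> a w" "f = (\<lambda>w. m (pl y (ac a x)) w - a w * m x w)"
          using f by (auto simp: \<F>_def)
        have ax: "ac a x \<in> X" using a x by simp
        let ?h = "\<lambda>w. m (pl (ac b y) (ac (\<lambda>w. b w * a w) x)) w - (b w * a w) * m x w"
        have e: "pl (ac b y) (ac (\<lambda>w. b w * a w) x) = ac b (pl y (ac a x))"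
          using ac_mult[OF b(1) a(1) x] ax y b by (simp add: ac_addr)
        have "AE w in M. ?h w \<le> b w * f w" unfolding e a(3)
          using rsublinD(3)[OF ms b(1) pl_in[OF y ax] b(2)]
          by eventually_elim (simp add: algebra_simps)
        moreover have "?h \<in> \<F> (ac b y)" unfolding \<F>_def using a b
          by (intro CollectI exI[of _ "\<lambda>w. b w * a w"]) auto
        ultimately show ?thesis by (rule bexI[of _ ?h])
      qed
      fix q assume "rsublin q" "\<And>x f. \<lbrakk>x \<in> X; f \<in> \<F> x\<rbrakk> \<Longrightarrow> AE w in M. q x w \<le> f w"
      then show thesis by (rule that)
    qed
    have qm: "AE w in M. q z w \<le> m z w" if z: "z \<in> X" for z
    proof -
      have "m z = (\<lambda>w. m (pl z (ac (\<lambda>_. 0) x)) w - (\<lambda>_. 0) w * m x w)" using x z by simp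
      then have "m z \<in> \<F> z" unfolding \<F>_def by (intro CollectI exI[of _ "\<lambda>_. 0"]) simp
      then show ?thesis using q(2)[OF z] by blast
    qed
    have "AE w in M. q z w \<le> p z w" if "z \<in> X" for z using qm[OF that] mp[OF that] by eventually_elim linarith
    from cA[OF q(1) this] have "canon q \<in> \<A>" .
    moreover have ce: "AE w in M. canon q z w = q z w" if "z \<in> X" for z
      using canon_AE[of q z] rsublinD(1)[OF q(1) that] that by simp
    have "P m (canon q)" unfolding P_def
    proof
      fix z assume "z \<in> X" then show "AE w in M. canon q z w \<le> m z w"
        using ce[of z] qm[of z] by (auto elim: eventually_elim2)
    qed
    ultimately have "canon q = m" by (rule min)
    then have my: "AE w in M. m y w = q y w" using ce[OF y] by simp
    have "(\<lambda>w. m (pl y x) w - m x w) \<in> \<F> y" unfolding \<F>_def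
      using x by (intro CollectI exI[of _ "\<lambda>_. 1"]) simp
    from q(2)[OF y this] my rsublinD(2)[OF ms y x] show ?thesis
      by eventually_elim linarith
  qed
  then have "rlin m" by (intro rlin_sublinI[OF ms]) auto
  then show ?thesis using mp by (rule that)
qed

section \<open>Separation of convex sets from points\<close>

definition rconvex :: "'x set \<Rightarrow> bool" where
  "rconvex G \<longleftrightarrow> (\<forall>g\<in>G. \<forall>h\<in>G. \<forall>t\<in>\<L> M. (\<forall>w. 0 \<le> t w \<and> t w \<le> 1) \<longrightarrow>
      pl (ac t g) (ac (\<lambda>w. 1 - t w) h) \<in> G)"

text \<open>The functional is dominated by \<open>h \<mapsto> \<Sqinter> q(h - l(g - z0)) - l d\<close>, the infimum over
  \<open>l \<ge> 0\<close> and \<open>g \<in> G\<close>.\<close>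
theorem separation:
  assumes q: "rseminorm q" and G: "G \<subseteq> X" "G \<noteq> {}" "rconvex G" and z0: "z0 \<in> X"
    and d: "d \<in> \<L> M" "\<And>g. g \<in> G \<Longrightarrow> AE w in M. d w \<le> q (pl g (neg z0)) w"
  obtains u where "rlin u" "\<And>x. x \<in> X \<Longrightarrow> AE w in M. \<bar>u x w\<bar> \<le> q x w"
    "\<And>g. g \<in> G \<Longrightarrow> AE w in M. u g w \<le> u z0 w - d w"
proof -
  define D where "D g = pl g (neg z0)" for g
  have D_in[simp]: "D g \<in> X" if "g \<in> G" for g using that G z0 by (auto simp: D_def)
  have qm: "q x \<in> \<L> M" if "x \<in> X" for x using q that by (simp add: rseminorm_def)
  define \<F> where "\<F> h = {\<lambda>w. q (pl h (ac (\<lambda>w. - l w) (D g))) w - l w * d w |l g.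
      l \<in> \<L> M \<and> (\<forall>w. 0 \<le> l w) \<and> g \<in> G}" for h
  have q0: "AE w in M. q zr w = 0" using rseminormD(4)[OF q, of "\<lambda>_. 0" zr] by simp
  have qneg: "AE w in M. q (neg x) w = q x w" if "x \<in> X" for x
    using rseminormD(4)[OF q, of "\<lambda>_. - 1" x] that by simp
  obtain p where p: "rsublin p" "\<And>x f. \<lbrakk>x \<in> X; f \<in> \<F> x\<rbrakk> \<Longrightarrow> AE w in M. p x w \<le> f w"
  proof (rule inf_family_sublin[of \<F> "\<lambda>x w. - q x w"])
    show "\<F> x \<subseteq> \<L> M" if "x \<in> X" for x
      using that qm d(1) by (auto simp: \<F>_def intro!: borel_measurable_diff borel_measurable_times)
    show "\<F> x \<noteq> {}" for x
    proof -
      obtain g where "g \<in> G" using G(2) by auto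
      then have "(\<lambda>w. q (pl x (ac (\<lambda>w. - (\<lambda>_. 0) w) (D g))) w - (\<lambda>_. 0) w * d w) \<in> \<F> x"
        unfolding \<F>_def by (intro CollectI exI[of _ "\<lambda>_. 0"] exI[of _ g]) auto
      then show ?thesis by blast
    qed
    show "(\<lambda>w. - q x w) \<in> \<L> M" if "x \<in> X" for x using qm that by simp
    show "AE w in M. - q x w \<le> f w" if x: "x \<in> X" and f: "f \<in> \<F> x" for x f
    proof -
      obtain l g where l: "l \<in> \<L> M" "\<forall>w. 0 \<le> l w" "g \<in> G"
        "f = (\<lambda>w. q (pl x (ac (\<lambda>w. - l w) (D g))) w - l w * d w)" using f by (auto simp: \<F>_def)
      let ?y = "pl x (ac (\<lambda>w. - l w) (D g))"
      have lD: "ac (\<lambda>w. - l w) (D g) \<in> X" "ac l (D g) \<in> X" using l by auto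
      have "neg (ac (\<lambda>w. - l w) (D g)) = ac l (D g)"
        using ac_mult[of "\<lambda>_. - 1" "\<lambda>w. - l w" "D g"] l by simp
      then have "pl x (neg ?y) = pl x (pl (neg x) (ac l (D g)))"
        using x lD by (simp add: ac_addr)
      also have "\<dots> = ac l (D g)" using x lD by (simp add: pl_assoc[symmetric])
      finally have e: "ac l (D g) = pl x (neg ?y)" ..
      have 1: "AE w in M. q (ac l (D g)) w \<le> q x w + q (neg ?y) w"
        unfolding e using x lD by (intro rseminormD(3)[OF q]) auto
      show ?thesis using 1 qneg[of ?y, OF pl_in[OF x lD(1)]]
          rseminormD(4)[OF q l(1) D_in[OF l(3)]] d(2)[OF l(3)] unfolding l(4)
      proof eventually_elim
        case (elim w)
        have "l w * d w \<le> l w * q (D g) w" using elim(4) l(2) by (intro mult_left_mono) (auto simp: D_def)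
        moreover have "\<bar>l w\<bar> = l w" using l(2) by simp
        ultimately show ?case using elim(1-3) by simp
      qed
    qed
    show "\<exists>h\<in>\<F> (pl x y). AE w in M. h w \<le> f w + g w"
      if x: "x \<in> X" and y: "y \<in> X" and f: "f \<in> \<F> x" and g: "g \<in> \<F> y" for x y f g
    proof -
      obtain l1 g1 where l1: "l1 \<in> \<L> M" "\<forall>w. 0 \<le> l1 w" "g1 \<in> G"
        "f = (\<lambda>w. q (pl x (ac (\<lambda>w. - l1 w) (D g1))) w - l1 w * d w)" using f by (auto simp: \<F>_def)
      obtain l2 g2 where l2: "l2 \<in> \<L> M" "\<forall>w. 0 \<le> l2 w" "g2 \<in> G"
        "g = (\<lambda>w. q (pl y (ac (\<lambda>w. - l2 w) (D g2))) w - l2 w * d w)" using g by (auto simp: \<F>_def)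
      define l where "l w = l1 w + l2 w" for w
      \<comment> \<open>The sum of l1 (g1 - z0) and l2 (g2 - z0) equals l (k - z0) for the convex
        combination k with weight l1 / l on g1. Where l = 0 both summands vanish, and the weight 1
        is an arbitrary value in [0, 1].\<close>
      define t where "t w = (if l w = 0 then 1 else l1 w / l w)" for w
      note [measurable] = l1(1) l2(1)
      have lm[measurable]: "l \<in> \<L> M" unfolding l_def by measurable
      have tm[measurable]: "t \<in> \<L> M" unfolding t_def by measurable
      have t01: "0 \<le> t w \<and> t w \<le> 1" for w
        using l1(2)[rule_format, of w] l2(2)[rule_format, of w] by (auto simp: t_def l_def divide_le_eq)
      have "l w * t w = l1 w" for w
        using l1(2)[rule_format, of w] l2(2)[rule_format, of w] by (cases "l w = 0") (auto simp: t_def l_def)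
      then have lt: "- l w * t w = - l1 w" "- l w * (1 - t w) = - l2 w" for w
        by (simp_all add: right_diff_distrib) (simp add: l_def)
      define k where "k = pl (ac t g1) (ac (\<lambda>w. 1 - t w) g2)"
      have kG: "k \<in> G" unfolding k_def using G(3) l1(3) l2(3) t01 tm by (auto simp: rconvex_def)
      have gX: "g1 \<in> X" "g2 \<in> X" using G l1 l2 by auto
      have m1: "(\<lambda>w. - l w) \<in> \<L> M" "(\<lambda>w. 1 - t w) \<in> \<L> M"
         "(\<lambda>w. - l1 w) \<in> \<L> M" "(\<lambda>w. - l2 w) \<in> \<L> M" by measurable
      have a1: "ac (\<lambda>w. - l w) (ac t g1) = ac (\<lambda>w. - l1 w) g1"
        using ac_mult[OF m1(1) tm gX(1)] lt(1) by simp
      have a2: "ac (\<lambda>w. - l w) (ac (\<lambda>w. 1 - t w) g2) = ac (\<lambda>w. - l2 w) g2"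
        using ac_mult[OF m1(1) m1(2) gX(2)] lt(2) by simp
      have nz: "neg z0 \<in> X" using z0 by simp
      have a3: "ac (\<lambda>w. - l w) (neg z0) = pl (ac (\<lambda>w. - l1 w) (neg z0)) (ac (\<lambda>w. - l2 w) (neg z0))"
        using ac_addl[OF m1(3,4) nz] by (simp add: l_def)
      have e1: "ac (\<lambda>w. - l w) (D k) = pl (ac (\<lambda>w. - l1 w) (D g1)) (ac (\<lambda>w. - l2 w) (D g2))"
        unfolding D_def k_def using gX nz m1 tm a1 a2 a3 by (simp add: ac_addr pl_ac)
      have DX: "ac (\<lambda>w. - l1 w) (D g1) \<in> X" "ac (\<lambda>w. - l2 w) (D g2) \<in> X" using m1 l1 l2 by auto
      have e2: "pl (pl x y) (ac (\<lambda>w. - l w) (D k)) =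
         pl (pl x (ac (\<lambda>w. - l1 w) (D g1))) (pl y (ac (\<lambda>w. - l2 w) (D g2)))"
        unfolding e1 using x y DX by (simp add: pl_ac)
      let ?h = "\<lambda>w. q (pl (pl x y) (ac (\<lambda>w. - l w) (D k))) w - l w * d w"
      have "AE w in M. ?h w \<le> f w + g w" unfolding e2 l1(4) l2(4)
        using rseminormD(3)[OF q pl_in[OF x DX(1)] pl_in[OF y DX(2)]]
        by eventually_elim (simp add: l_def algebra_simps)
      moreover have "?h \<in> \<F> (pl x y)" unfolding \<F>_def using lm kG l1(2) l2(2)
        by (intro CollectI exI[of _ l] exI[of _ k]) (auto simp: l_def)
      ultimately show ?thesis by (rule bexI[of _ ?h])
    qed
    show "\<exists>h\<in>\<F> (ac a x). AE w in M. h w \<le> a w * f w"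
      if a: "a \<in> \<L> M" "\<And>w. 0 \<le> a w" and x: "x \<in> X" and f: "f \<in> \<F> x" for a x f
    proof -
      obtain l g where l: "l \<in> \<L> M" "\<forall>w. 0 \<le> l w" "g \<in> G"
        "f = (\<lambda>w. q (pl x (ac (\<lambda>w. - l w) (D g))) w - l w * d w)" using f by (auto simp: \<F>_def)
      have m1: "(\<lambda>w. - l w) \<in> \<L> M" using l by simp
      have lD: "ac (\<lambda>w. - l w) (D g) \<in> X" using l by auto
      have "(\<lambda>w. - (a w * l w)) = (\<lambda>w. a w * - l w)" by auto
      then have e: "pl (ac a x) (ac (\<lambda>w. - (a w * l w)) (D g)) = ac a (pl x (ac (\<lambda>w. - l w) (D g)))"
        using ac_mult[OF a(1) m1 D_in[OF l(3)]] a x lD by (simp add: ac_addr)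
      let ?h = "\<lambda>w. q (pl (ac a x) (ac (\<lambda>w. - (a w * l w)) (D g))) w - (a w * l w) * d w"
      have "AE w in M. ?h w \<le> a w * f w" unfolding e l(4)
        using rseminormD(4)[OF q a(1) pl_in[OF x lD]]
        by eventually_elim (use a(2) in \<open>simp add: algebra_simps\<close>)
      moreover have "?h \<in> \<F> (ac a x)" unfolding \<F>_def using a l
        by (intro CollectI exI[of _ "\<lambda>w. a w * l w"] exI[of _ g]) auto
      ultimately show ?thesis by (rule bexI[of _ ?h])
    qed
    fix p assume "rsublin p" "\<And>x f. \<lbrakk>x \<in> X; f \<in> \<F> x\<rbrakk> \<Longrightarrow> AE w in M. p x w \<le> f w"
    then show thesis by (rule that)
  qed
  obtain u where u: "rlin u" "\<And>x. x \<in> X \<Longrightarrow> AE w in M. u x w \<le> p x w" using hahn_banach[OF p(1)] by blast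
  obtain g0 where g0: "g0 \<in> G" using G by auto
  have uq: "AE w in M. u x w \<le> q x w" if x: "x \<in> X" for x
  proof -
    \<comment> \<open>The multiplier l = 0 shows that the functional is dominated by q.\<close>
    have "q x = (\<lambda>w. q (pl x (ac (\<lambda>w. - (\<lambda>_. 0) w) (D g0))) w - (\<lambda>_. 0) w * d w)" using x g0 by simp
    then have "q x \<in> \<F> x" unfolding \<F>_def using g0 by (intro CollectI exI[of _ "\<lambda>_. 0"] exI[of _ g0]) simp
    from p(2)[OF x this] u(2)[OF x] show ?thesis by eventually_elim linarith
  qed
  show ?thesis
  proof (rule that[OF u(1)])
    show "AE w in M. \<bar>u x w\<bar> \<le> q x w" if x: "x \<in> X" for x
    proof -
      have "AE w in M. u (neg x) w \<le> q (neg x) w" "AE w in M. u (neg x) w = - u x w"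
        using uq[of "neg x"] rlinD(3)[OF u(1), of "\<lambda>_. - 1" x] x by simp_all
      then show ?thesis using uq[OF x] qneg[OF x] by eventually_elim linarith
    qed
    show "AE w in M. u g w \<le> u z0 w - d w" if g: "g \<in> G" for g
    proof -
      \<comment> \<open>With the multiplier l = 1 the infimum at g - z0 contains the term q(0) - d,
        which is the required gap.\<close>
      let ?f = "\<lambda>w. q (pl (D g) (ac (\<lambda>w. - (\<lambda>_. 1) w) (D g))) w - (\<lambda>_. 1) w * d w"
      have "?f \<in> \<F> (D g)" unfolding \<F>_def using g by (intro CollectI exI[of _ "\<lambda>_. 1"] exI[of _ g]) simp
      from p(2)[OF D_in[OF g] this] have 1: "AE w in M. p (D g) w \<le> q zr w - d w"
        using g by simp
      have "AE w in M. u (D g) w = u g w - u z0 w"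
        using rlin_diff[OF u(1), of g z0] g G z0 by (auto simp: D_def)
      then show ?thesis using 1 u(2)[OF D_in[OF g]] q0 by eventually_elim linarith
    qed
  qed
qed

end

definition aff_minor :: "'w measure \<Rightarrow> 'x set \<Rightarrow> ('x \<Rightarrow> 'w \<Rightarrow> ereal) \<Rightarrow> ('x \<Rightarrow> 'w \<Rightarrow> real) \<Rightarrow> ('w \<Rightarrow> real) \<Rightarrow> bool" where
  "aff_minor M X F v a \<longleftrightarrow> (\<forall>x\<in>X. AE w in M. ereal (v x w + a w) \<le> F x w)"

context rmodule
begin

lemma prod_rmodule:
  "rmodule M (X \<times> \<L> M) (\<lambda>(x, r) (y, s). (pl x y, \<lambda>w. r w + s w)) (zr, \<lambda>_. 0)
     (\<lambda>a (x, r). (ac a x, \<lambda>w. a w * r w :: real))"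
proof (unfold_locales, goal_cases)
  case (1 x y) then show ?case by (auto simp: split_beta)
next
  case 2 then show ?case by simp
next
  case (3 a x) then show ?case by (auto simp: split_beta)
next
  case (4 x y) then show ?case by (auto intro: pl_comm simp: add.commute)
next
  case (5 x y z) then show ?case by (auto intro: pl_assoc simp: add.assoc)
next
  case (6 x) then show ?case by (cases x) simp
next
  case (7 a b x) then show ?case by (cases x) (simp add: ac_addl distrib_right)
next
  case (8 a x y) then show ?case by (cases x, cases y) (simp add: ac_addr distrib_left)
next
  case (9 a b x) then show ?case by (cases x) (simp add: ac_mult mult.assoc)
next
  case (10 x) then show ?case by (cases x) simp
next
  case (11 x) then show ?case by (cases x) simp
qed

lemma seminorm_neg: "rseminorm q \<Longrightarrow> x \<in> X \<Longrightarrow> AE w in M. q (neg x) w = q x w"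
  using rseminormD(4)[of q "\<lambda>_. - 1" x] by simp

text \<open>If a point lies nowhere in a closed convex set, then it is nowhere at distance zero from
  that set for countably many of the seminorms: on the set where all these distances
  vanish it could be glued to a point of \<open>G\<close> by a limit.\<close>
lemma distance_pos:
  assumes Q: "\<And>q. q \<in> \<Q> \<Longrightarrow> rseminorm q" "\<Q> \<noteq> {}"
    and G: "G \<subseteq> X" "G \<noteq> {}" "rconvex G"
    and cl: "\<And>z. z \<in> X \<Longrightarrow> (\<And>q d. q \<in> \<Q> \<Longrightarrow> 0 < d \<Longrightarrow> \<exists>g\<in>G. mu M (q (pl g (neg z))) < d) \<Longrightarrow> z \<in> G"
    and z0: "z0 \<in> X" and B: "B \<in> sets M"
    and disj: "\<And>A g. A \<in> sets M \<Longrightarrow> A \<subseteq> B \<Longrightarrow> g \<in> G \<Longrightarrow> glue A z0 g \<in> G \<Longrightarrow> AE w in M. w \<notin> A"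
  obtains Qs ds where "\<And>n::nat. Qs n \<in> \<Q>" "\<And>n. ds n \<in> \<L> M" "\<And>n. AE w in M. (0::real) \<le> ds n w"
    "\<And>n g. g \<in> G \<Longrightarrow> AE w in M. ds n w \<le> Qs n (pl g (neg z0)) w"
    "AE w in M. w \<in> B \<longrightarrow> (\<exists>n. 0 < ds n w)"
proof -
  define \<F> where "\<F> q = (\<lambda>g. q (pl g (neg z0))) ` G" for q :: "'x \<Rightarrow> 'w \<Rightarrow> real"
  have DX: "pl g (neg z0) \<in> X" if "g \<in> G" for g using that G z0 by auto
  have FM: "\<F> q \<subseteq> \<L> M" if "q \<in> \<Q>" for q
    using rseminormD(1)[OF Q(1)[OF that] DX] by (auto simp: \<F>_def)
  have "\<exists>m g. m \<in> \<L> M \<and> (\<forall>f\<in>\<F> q. AE w in M. m w \<le> f w) \<and> (\<forall>n::nat. g n \<in> \<F> q) \<and>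
     (AE w in M. \<forall>e>0. \<exists>n. g n w < m w + e)" if q: "q \<in> \<Q>" for q
    by (rule real_inf[OF FM[OF q], of "\<lambda>_. 0"])
      (use G(2) rseminormD(2)[OF Q(1)[OF q] DX] in \<open>auto simp: \<F>_def\<close>, blast)
  then have "\<forall>q. \<exists>m g. q \<in> \<Q> \<longrightarrow> m \<in> \<L> M \<and> (\<forall>f\<in>\<F> q. AE w in M. m w \<le> f w) \<and> (\<forall>n::nat. g n \<in> \<F> q) \<and>
     (AE w in M. \<forall>e>0. \<exists>n. g n w < m w + e)" by blast
  from choice[OF this] obtain D where "\<forall>q. \<exists>g. q \<in> \<Q> \<longrightarrow> D q \<in> \<L> M \<and> (\<forall>f\<in>\<F> q. AE w in M. D q w \<le> f w) \<and> (\<forall>n::nat. g n \<in> \<F> q) \<and>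
     (AE w in M. \<forall>e>0. \<exists>n. g n w < D q w + e)" by (rule exE)
  from choice[OF this] obtain s where Ds: "\<forall>q. q \<in> \<Q> \<longrightarrow> D q \<in> \<L> M \<and> (\<forall>f\<in>\<F> q. AE w in M. D q w \<le> f w) \<and> (\<forall>n::nat. s q n \<in> \<F> q) \<and>
     (AE w in M. \<forall>e>0. \<exists>n. s q n w < D q w + e)" by (rule exE)
  have Dm: "D q \<in> \<L> M" and Dle: "f \<in> \<F> q \<Longrightarrow> AE w in M. D q w \<le> f w"
    and sF: "s q n \<in> \<F> q" and Dge: "AE w in M. \<forall>e>0. \<exists>n. s q n w < D q w + e" if "q \<in> \<Q>" for q f n
    using Ds that by auto
  have D0: "AE w in M. 0 \<le> D q w" if q: "q \<in> \<Q>" for q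
  proof (rule inf_greatest[OF Dge[OF q]])
    fix n
    obtain g where "g \<in> G" "s q n = q (pl g (neg z0))" using sF[OF q, of n] by (auto simp: \<F>_def)
    then show "AE w in M. 0 \<le> s q n w" using rseminormD(2)[OF Q(1)[OF q] DX] by simp
  qed
  define lev where "lev q = {w \<in> space M. 0 < D q w}" for q
  have "lev ` \<Q> \<subseteq> sets M" using Dm by (auto simp: lev_def)
  from countable_essential_union[OF this] obtain C where
    C: "C \<subseteq> lev ` \<Q>" "countable C" "\<forall>A\<in>lev ` \<Q>. AE w in M. w \<in> A \<longrightarrow> w \<in> \<Union>C" by blast
  from C(1,2) obtain K where K: "K \<subseteq> \<Q>" "countable K" "C = lev ` K" by (metis countable_subset_image)
  obtain q0 where q0: "q0 \<in> \<Q>" using Q(2) by auto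
  define K' where "K' = insert q0 K"
  have K': "K' \<subseteq> \<Q>" "countable K'" "K' \<noteq> {}" using K q0 by (auto simp: K'_def)
  define Qs where "Qs = from_nat_into K'"
  have rQ: "range Qs = K'" using range_from_nat_into[OF K'(3,2)] by (simp add: Qs_def)
  have QsQ: "Qs n \<in> \<Q>" for n using rQ K' by auto
  \<comment> \<open>On A the countably many selected distances vanish. By the choice of the
    essential union, so does the distance with respect to each other seminorm, which makes A the set
    on which z0 could be reached from \<open>G\<close>.\<close>
  define A where "A = B - (\<Union>n. lev (Qs n))"
  have A: "A \<in> sets M" using B Dm[OF QsQ] by (auto simp: A_def lev_def)
  have DA: "AE w in M. w \<in> A \<longrightarrow> D q w = 0" if q: "q \<in> \<Q>" for q
  proof -
    have "AE w in M. w \<in> lev q \<longrightarrow> w \<in> \<Union>C" using C(3) q by auto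
    then show ?thesis using D0[OF q] AE_space
    proof eventually_elim
      case (elim w)
      show ?case
      proof
        assume wA: "w \<in> A"
        have "lev k \<subseteq> (\<Union>n. lev (Qs n))" if "k \<in> K" for k
        proof -
          have "k \<in> range Qs" using that rQ by (simp add: K'_def)
          then obtain n where "k = Qs n" by (rule rangeE)
          then show ?thesis by blast
        qed
        then have "\<Union>C \<subseteq> (\<Union>n. lev (Qs n))" unfolding K(3) by blast
        then have "w \<notin> lev q" using wA elim by (auto simp: A_def)
        then show "D q w = 0" using elim by (simp add: lev_def)
      qed
    qed
  qed
  obtain g0 where g0: "g0 \<in> G" using G by auto
  have conv: "glue T g h \<in> G" if "T \<in> sets M" "g \<in> G" "h \<in> G" for T g h
  proof -
    have "(indicator T :: 'w \<Rightarrow> real) \<in> \<L> M" "\<forall>w. 0 \<le> (indicator T w :: real) \<and> indicator T w \<le> (1::real)"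
      using that by (simp_all add: indicator_def)
    then show ?thesis using G(3) that unfolding rconvex_def glue_def by blast
  qed
  have "glue A z0 g0 \<in> G"
  proof (rule cl)
    show "glue A z0 g0 \<in> X" using A z0 g0 G by auto
    fix q and d :: real assume q: "q \<in> \<Q>" and d: "0 < d"
    note qs = Q(1)[OF q]
    have "\<exists>f\<in>\<F> q. mu M (\<lambda>w. f w - D q w) < d"
    proof (rule directed_inf_mu[OF FM[OF q] Dm[OF q] Dle[OF q] sF[OF q] Dge[OF q] _ d])
      fix f f' assume "f \<in> \<F> q" "f' \<in> \<F> q"
      then obtain g g' where g: "g \<in> G" "g' \<in> G" "f = q (pl g (neg z0))" "f' = q (pl g' (neg z0))"
        by (auto simp: \<F>_def)
      have fm: "f \<in> \<L> M" "f' \<in> \<L> M" using g rseminormD(1)[OF qs DX] by auto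
      \<comment> \<open>Gluing along the set where the first distance is the smaller one gives a
        point of \<open>G\<close> whose distance lies below both; so the distances are downward
        directed.\<close>
      define T where "T = {w \<in> space M. f w \<le> f' w}"
      have T: "T \<in> sets M" unfolding T_def using fm by measurable
      have Im: "(indicator T :: 'w \<Rightarrow> real) \<in> \<L> M" "(\<lambda>w. 1 - indicator T w :: real) \<in> \<L> M"
        using T by auto
      have nz: "neg z0 \<in> X" and gX: "g \<in> X" "g' \<in> X" using z0 g G by auto
      have z: "neg z0 = pl (ac (indicator T) (neg z0)) (ac (\<lambda>w. 1 - indicator T w) (neg z0))"
        using ac_addl[OF Im nz] nz by simp
      have "pl (glue T g g') (neg z0) = pl (ac (indicator T) (pl g (neg z0))) (ac (\<lambda>w. 1 - indicator T w) (pl g' (neg z0)))"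
        by (subst z) (use Im nz gX in \<open>simp add: glue_def ac_addr pl_ac\<close>)
      then have "AE w in M. q (pl (glue T g g') (neg z0)) w \<le>
          q (ac (indicator T) (pl g (neg z0))) w + q (ac (\<lambda>w. 1 - indicator T w) (pl g' (neg z0))) w"
        using rseminormD(3)[OF qs, of "ac (indicator T) (pl g (neg z0))" "ac (\<lambda>w. 1 - indicator T w) (pl g' (neg z0))"]
          Im DX g by simp
      then have "AE w in M. q (pl (glue T g g') (neg z0)) w \<le> f w \<and> q (pl (glue T g g') (neg z0)) w \<le> f' w"
        using rseminormD(4)[OF qs Im(1) DX[OF g(1)]] rseminormD(4)[OF qs Im(2) DX[OF g(2)]] AE_space
      proof eventually_elim
        case (elim w)
        then have "w \<in> T \<longleftrightarrow> f w \<le> f' w" by (simp add: T_def)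
        then show ?case using elim(1-3) by (cases "w \<in> T") (simp_all add: g)
      qed
      then show "\<exists>h\<in>\<F> q. AE w in M. h w \<le> f w \<and> h w \<le> f' w"
        using conv[OF T g(1,2)] by (auto simp: \<F>_def)
    qed
    then obtain g where g: "g \<in> G" "mu M (\<lambda>w. q (pl g (neg z0)) w - D q w) < d" by (auto simp: \<F>_def)
    have Im: "(indicator A :: 'w \<Rightarrow> real) \<in> \<L> M" "(\<lambda>w. 1 - indicator A w :: real) \<in> \<L> M"
      "(\<lambda>w. - indicator A w :: real) \<in> \<L> M" "(\<lambda>w. - (1 - indicator A w) :: real) \<in> \<L> M"
      using A by auto
    have nz: "neg z0 \<in> X" and gX: "g \<in> X" "g0 \<in> X" using z0 g g0 G by auto
    have e1: "neg (ac (indicator A) z0) = ac (indicator A) (neg z0)"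
      using ac_mult[of "\<lambda>_. - 1" "indicator A" z0] ac_mult[of "indicator A" "\<lambda>_. - 1" z0] Im z0 by simp
    have e2: "pl (ac (\<lambda>w. 1 - indicator A w) g0) (neg (ac (\<lambda>w. 1 - indicator A w) g0)) = zr"
      using Im gX by (intro pl_neg) simp
    \<comment> \<open>The two glued points agree off A, and on A they differ by g - z0. Since
      \<open>D q\<close> vanishes on A, the seminorm of this difference is at most the small excess
      of q(g - z0) over \<open>D q\<close>.\<close>
    have "pl (glue A g g0) (neg (glue A z0 g0)) =
      pl (pl (ac (indicator A) g) (ac (indicator A) (neg z0)))
         (pl (ac (\<lambda>w. 1 - indicator A w) g0) (neg (ac (\<lambda>w. 1 - indicator A w) g0)))"
      unfolding glue_def using Im gX z0 nz by (simp add: ac_addr pl_ac e1 del: pl_neg neg_pl)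
    also have "\<dots> = ac (indicator A) (pl g (neg z0))" using e2 Im gX nz by (simp add: ac_addr)
    finally have "AE w in M. q (pl (glue A g g0) (neg (glue A z0 g0))) w = indicator A w * q (pl g (neg z0)) w"
      using rseminormD(4)[OF qs Im(1) DX[OF g(1)]] by (auto elim!: eventually_mono)
    moreover have "AE w in M. D q w \<le> q (pl g (neg z0)) w" using Dle[OF q] g(1) by (auto simp: \<F>_def)
    ultimately have "AE w in M. \<bar>q (pl (glue A g g0) (neg (glue A z0 g0))) w\<bar> \<le> \<bar>q (pl g (neg z0)) w - D q w\<bar>"
      using DA[OF q]
    proof eventually_elim
      case (elim w)
      then show ?case by (cases "w \<in> A") simp_all
    qed
    then have "mu M (q (pl (glue A g g0) (neg (glue A z0 g0)))) \<le> mu M (\<lambda>w. q (pl g (neg z0)) w - D q w)"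
      using rseminormD(1)[OF qs] Dm[OF q] conv[OF A g(1) g0] G g DX A z0 gX by (intro mu_mono) auto
    then show "\<exists>h\<in>G. mu M (q (pl h (neg (glue A z0 g0)))) < d"
      using g(2) conv[OF A g(1) g0] by (intro bexI[of _ "glue A g g0"]) auto
  qed
  then have "AE w in M. w \<notin> A" using disj[OF A _ g0] by (auto simp: A_def)
  then have "AE w in M. w \<in> B \<longrightarrow> (\<exists>n. 0 < D (Qs n) w)"
    using AE_space by eventually_elim (auto simp: A_def lev_def)
  then show ?thesis
    by (intro that[of Qs "\<lambda>n. D (Qs n)"] QsQ Dm D0 Dle) (auto simp: \<F>_def)
qed

end

section \<open>Convex functions, their epigraphs and affine minorants\<close>

locale convex_fun = rmodule M X pl zr ac
  for M :: "'w measure" and X :: "'x set" and pl zr ac +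
  fixes F :: "'x \<Rightarrow> 'w \<Rightarrow> ereal" and x1 :: 'x
  assumes F_meas: "x \<in> X \<Longrightarrow> F x \<in> \<L> M"
    and F_ninf: "x \<in> X \<Longrightarrow> AE w in M. - \<infinity> < F x w"
    and x1: "x1 \<in> X" "AE w in M. F x1 w < \<infinity>"
    and F_conv: "\<lbrakk>x \<in> X; y \<in> X; t \<in> \<L> M; \<And>w. 0 \<le> t w \<and> t w \<le> 1\<rbrakk> \<Longrightarrow>
      AE w in M. F (pl (ac t x) (ac (\<lambda>w. 1 - t w) y)) w \<le> ereal (t w) * F x w + ereal (1 - t w) * F y w"
begin

text \<open>The difference of two points in the product of \<open>X\<close> and the scalars, as the simplifier leaves it.\<close>
abbreviation minus_ep :: "'x \<times> ('w \<Rightarrow> real) \<Rightarrow> 'x \<times> ('w \<Rightarrow> real) \<Rightarrow> 'x \<times> ('w \<Rightarrow> real)" where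
  "minus_ep g z \<equiv> (case g of (x, r) \<Rightarrow> \<lambda>(y, s). (pl x y, \<lambda>w. r w + s w)) (case z of (x, r) \<Rightarrow> (ac (\<lambda>_. - 1) x, \<lambda>w. - 1 * r w))"

text \<open>Convexity with a coefficient in {0, 1} bounds the glued value by F x where the
  coefficient is 1. By \<open>glue_glue\<close>, x is itself obtained by gluing from the glued
  point, and the same bound gives the reverse inequality.\<close>

lemma F_glue_fun:
  assumes I: "I \<in> \<L> M" "\<And>w. I w = 0 \<or> I w = 1" and xy: "x \<in> X" "y \<in> X"
  shows "AE w in M. I w = 1 \<longrightarrow> F (pl (ac I x) (ac (\<lambda>w. 1 - I w) y)) w = F x w"
proof -
  have 01: "0 \<le> I w \<and> I w \<le> 1" for w using I(2)[of w] by auto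
  have 1: "AE w in M. I w = 1 \<longrightarrow> F (pl (ac I x) (ac (\<lambda>w. 1 - I w) y)) w \<le> F x w" if "x \<in> X" "y \<in> X" for x y
    using F_conv[OF that I(1) 01] by eventually_elim (auto simp flip: zero_ereal_def one_ereal_def)
  have "AE w in M. I w = 1 \<longrightarrow> F (pl (ac I (pl (ac I x) (ac (\<lambda>w. 1 - I w) y))) (ac (\<lambda>w. 1 - I w) x)) w
      \<le> F (pl (ac I x) (ac (\<lambda>w. 1 - I w) y)) w"
    using xy I by (intro 1) auto
  then show ?thesis using 1[OF xy] unfolding glue_glue[OF I xy]
    by eventually_elim auto
qed

lemma F_glue:
  assumes A: "A \<in> sets M" and xy: "x \<in> X" "y \<in> X"
  shows "AE w in M. F (glue A x y) w = (if w \<in> A then F x w else F y w)"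
proof -
  have m: "(indicator A :: 'w \<Rightarrow> real) \<in> \<L> M" "(\<lambda>w. 1 - indicator A w :: real) \<in> \<L> M"
    using A by auto
  have "AE w in M. indicator A w = (1::real) \<longrightarrow> F (glue A x y) w = F x w"
    unfolding glue_def by (rule F_glue_fun[OF m(1) _ xy]) (simp add: indicator_def)
  moreover have "AE w in M. 1 - indicator A w = (1::real) \<longrightarrow> F (glue A x y) w = F y w"
  proof -
    have e: "pl (ac (\<lambda>w. 1 - indicator A w) y) (ac (\<lambda>w. 1 - (1 - indicator A w)) x) = glue A x y"
      using m xy by (simp add: glue_def pl_comm)
    show ?thesis
      by (rule F_glue_fun[OF m(2) _ xy(2,1), unfolded e]) (simp add: indicator_def)
  qed
  ultimately show ?thesis by eventually_elim (auto split: split_indicator_asm)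
qed

definition ep :: "('x \<times> ('w \<Rightarrow> real)) set" where
  "ep = {(x, r). x \<in> X \<and> r \<in> \<L> M \<and> (AE w in M. F x w \<le> ereal (r w))}"

sublocale prd: rmodule M "X \<times> \<L> M" "\<lambda>(x, r) (y, s). (pl x y, \<lambda>w. r w + s w)" "(zr, \<lambda>_. 0)"
     "\<lambda>a (x, r). (ac a x, \<lambda>w. a w * r w :: real)"
  by (rule prod_rmodule)

lemma ep_in: "(x1, \<lambda>w. real_of_ereal (F x1 w)) \<in> ep"
proof -
  have "AE w in M. F x1 w \<le> ereal (real_of_ereal (F x1 w))"
    using F_ninf[OF x1(1)] x1(2)
  proof eventually_elim
    case (elim w)
    then show ?case by (cases "F x1 w") auto
  qed
  then show ?thesis using x1(1) F_meas[OF x1(1)] by (simp add: ep_def)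
qed

lemma ep_sub: "ep \<subseteq> X \<times> \<L> M"
  by (auto simp: ep_def)

lemma ep_convex: "prd.rconvex ep"
  unfolding prd.rconvex_def
proof (intro ballI allI impI)
  fix g h and t :: "'w \<Rightarrow> real"
  assume g: "g \<in> ep" and h: "h \<in> ep" and t: "t \<in> \<L> M" "\<forall>w. 0 \<le> t w \<and> t w \<le> 1"
  obtain x r y s where xy: "g = (x, r)" "h = (y, s)" by (cases g, cases h)
  have x: "x \<in> X" "r \<in> \<L> M" "AE w in M. F x w \<le> ereal (r w)" using g xy by (auto simp: ep_def)
  have y: "y \<in> X" "s \<in> \<L> M" "AE w in M. F y w \<le> ereal (s w)" using h xy by (auto simp: ep_def)
  have "AE w in M. F (pl (ac t x) (ac (\<lambda>w. 1 - t w) y)) w \<le> ereal (t w) * F x w + ereal (1 - t w) * F y w"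
    using t by (intro F_conv x y) auto
  then have "AE w in M. F (pl (ac t x) (ac (\<lambda>w. 1 - t w) y)) w \<le> ereal (t w * r w + (1 - t w) * s w)"
    using x(3) y(3)
  proof eventually_elim
    case (elim w)
    have "ereal (t w) * F x w + ereal (1 - t w) * F y w \<le> ereal (t w) * ereal (r w) + ereal (1 - t w) * ereal (s w)"
      using t(2) elim by (intro add_mono ereal_mult_left_mono) auto
    with elim(1) show ?case by simp
  qed
  then show "(case case g of (x, r) \<Rightarrow> (ac t x, \<lambda>w. t w * r w) of
        (x, r) \<Rightarrow> \<lambda>(y, s). (pl x y, \<lambda>w. r w + s w))
        (case h of (x, r) \<Rightarrow> (ac (\<lambda>w. 1 - t w) x, \<lambda>w. (1 - t w) * r w)) \<in> ep"
    using x y t by (auto simp: xy ep_def)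
qed

text \<open>Supplies the hypothesis \<open>disj\<close> of \<open>distance_pos\<close>: a point
  strictly below the graph on \<open>B\<close> cannot be brought into the epigraph by gluing when it
  is kept on a set of positive measure in \<open>B\<close>.\<close>

lemma ep_disjoint:
  assumes x0: "x0 \<in> X" "r0 \<in> \<L> M" and B: "AE w in M. w \<in> B \<longrightarrow> ereal (r0 w) < F x0 w"
    and A: "A \<in> sets M" "A \<subseteq> B" and g: "g \<in> ep" "prd.glue A (x0, r0) g \<in> ep"
  shows "AE w in M. w \<notin> A"
proof -
  obtain x r where xr: "g = (x, r)" by (cases g)
  have x: "x \<in> X" using g xr by (auto simp: ep_def)
  have "AE w in M. F (glue A x0 x) w \<le> ereal (indicator A w * r0 w + (1 - indicator A w) * r w)"
    using g(2) by (simp add: prd.glue_def xr ep_def glue_def)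
  then show ?thesis using B F_glue[OF A(1) x0(1) x]
    by eventually_elim (use A in \<open>auto simp: indicator_def\<close>)
qed

text \<open>A point of the epigraph has a finite value on all of \<Omega>. Where F x is infinite, x
  is therefore replaced by the domain point \<open>x1\<close>, and the bound is read off on the
  remaining set.\<close>

lemma lin_bound_ext:
  assumes w: "rlin v" and c: "c \<in> \<L> M" and k: "k \<in> \<L> M"
    and le: "\<And>x r. (x, r) \<in> ep \<Longrightarrow> AE w in M. v x w + c w * r w \<le> k w"
    and x: "x \<in> X"
  shows "AE w in M. F x w < \<infinity> \<longrightarrow> v x w + c w * real_of_ereal (F x w) \<le> k w"
proof -
  define A where "A = {w \<in> space M. F x w < \<infinity>}"
  note [measurable] = F_meas[OF x] F_meas[OF x1(1)]
  have A[measurable]: "A \<in> sets M" unfolding A_def by measurable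
  define r where "r w = (if w \<in> A then real_of_ereal (F x w) else real_of_ereal (F x1 w))" for w
  have rm: "r \<in> \<L> M" unfolding r_def by measurable
  have "AE w in M. F (glue A x x1) w \<le> ereal (r w)"
    using F_glue[OF A x x1(1)] F_ninf[OF x] F_ninf[OF x1(1)] x1(2) AE_space
  proof eventually_elim
    case (elim w)
    then show ?case by (cases "F x w"; cases "F x1 w") (auto simp: r_def A_def)
  qed
  then have "(glue A x x1, r) \<in> ep" using A x x1 rm by (auto simp: ep_def)
  from le[OF this] rlin_glue[OF w x x1(1) A] AE_space show ?thesis
    by eventually_elim (auto simp: A_def r_def)
qed

text \<open>The epigraph contains the points above \<open>x1\<close> shifted upwards by every
  natural number; a positive slope would make the left side unbounded along them.\<close>

lemma lin_bound_slope:
  assumes w: "rlin v" and c: "c \<in> \<L> M" and k: "k \<in> \<L> M"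
    and le: "\<And>x r. (x, r) \<in> ep \<Longrightarrow> AE w in M. v x w + c w * r w \<le> k w"
  shows "AE w in M. c w \<le> 0"
proof -
  have e: "AE w in M. \<forall>n::nat. v x1 w + c w * (real_of_ereal (F x1 w) + real n) \<le> k w"
    unfolding AE_all_countable
  proof
    fix n :: nat
    have "AE w in M. F x1 w \<le> ereal (real_of_ereal (F x1 w))" using ep_in by (simp add: ep_def)
    then have "AE w in M. F x1 w \<le> ereal (real_of_ereal (F x1 w) + real n)"
      by eventually_elim (rule order_trans, assumption, simp)
    then have "(x1, \<lambda>w. real_of_ereal (F x1 w) + real n) \<in> ep"
      using ep_in F_meas[OF x1(1)] by (simp add: ep_def)
    from le[OF this] show "AE w in M. v x1 w + c w * (real_of_ereal (F x1 w) + real n) \<le> k w" .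
  qed
  then show ?thesis
  proof eventually_elim
    case (elim w)
    show ?case
    proof (rule ccontr)
      assume "\<not> c w \<le> 0"
      then obtain n where "real n * c w > k w - v x1 w - c w * real_of_ereal (F x1 w)"
        using ex_less_of_nat_mult[of "c w"] by auto
      with elim[rule_format, of n] show False by (simp add: algebra_simps)
    qed
  qed
qed

text \<open>A separating functional with negative \<open>\<real>\<close>-component is an affine minorant; where that component
  vanishes, large multiples of it are added to an affine minorant found before.\<close>
lemma fenchel_moreau_step:
  fixes W :: "('x \<Rightarrow> 'w \<Rightarrow> real) set"
  assumes W: "\<And>v. v \<in> W \<Longrightarrow> rlin v"
    and comb: "\<And>v v' a b. \<lbrakk>v \<in> W; v' \<in> W; a \<in> \<L> M; b \<in> \<L> M\<rbrakk> \<Longrightarrow>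
       \<exists>v''\<in>W. \<forall>x\<in>X. AE w in M. v'' x w = a w * v x w + b w * v' x w"
    and sep: "\<And>x0 r0 B. \<lbrakk>x0 \<in> X; r0 \<in> \<L> M; B \<in> sets M; AE w in M. w \<in> B \<longrightarrow> ereal (r0 w) < F x0 w\<rbrakk> \<Longrightarrow>
       \<exists>v\<in>W. \<exists>c\<in>\<L> M. \<exists>d\<in>\<L> M. (AE w in M. 0 \<le> d w) \<and> (AE w in M. w \<in> B \<longrightarrow> 0 < d w) \<and>
        (\<forall>x r. (x, r) \<in> ep \<longrightarrow> (AE w in M. v x w + c w * r w \<le> v x0 w + c w * r0 w - d w))"
  shows "\<exists>v\<in>W. \<exists>a\<in>\<L> M. aff_minor M X F v a"
    and "\<lbrakk>x0 \<in> X; r0 \<in> \<L> M; B \<in> sets M; AE w in M. w \<in> B \<longrightarrow> ereal (r0 w) < F x0 w\<rbrakk> \<Longrightarrow>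
       \<exists>v\<in>W. \<exists>a\<in>\<L> M. aff_minor M X F v a \<and> (AE w in M. w \<in> B \<longrightarrow> r0 w \<le> v x0 w + a w)"
proof -
  have Wm: "v x \<in> \<L> M" if "v \<in> W" "x \<in> X" for v x
    using rlinD(1)[OF W] that by blast
  show ex: "\<exists>v\<in>W. \<exists>a\<in>\<L> M. aff_minor M X F v a"
  proof -
    \<comment> \<open>Being 1 below the graph on all of \<Omega> makes \<open>d\<close> positive
      everywhere. Comparison with the point of the graph above \<open>x1\<close> then gives c * 1 <=
      - d, so the slope c is negative and one can divide by it.\<close>
    define r0 where "r0 w = real_of_ereal (F x1 w) - 1" for w
    have r0m: "r0 \<in> \<L> M" unfolding r0_def using F_meas[OF x1(1)] by measurable
    have r0l: "AE w in M. w \<in> space M \<longrightarrow> ereal (r0 w) < F x1 w"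
      using F_ninf[OF x1(1)] x1(2)
    proof eventually_elim
      case (elim w) then show ?case by (cases "F x1 w") (auto simp: r0_def)
    qed
    obtain v c d where v: "v \<in> W" and c: "c \<in> \<L> M" and d: "d \<in> \<L> M"
      and d0: "AE w in M. w \<in> space M \<longrightarrow> 0 < d w"
      and le: "\<And>x r. (x, r) \<in> ep \<Longrightarrow> AE w in M. v x w + c w * r w \<le> v x1 w + c w * r0 w - d w"
      using sep[OF x1(1) r0m sets.top r0l] by blast
    note [measurable] = c d r0m Wm[OF v x1(1)]
    have km: "(\<lambda>w. v x1 w + c w * r0 w - d w) \<in> \<L> M" by measurable
    have cneg: "AE w in M. c w < 0"
      using le[OF ep_in] d0 AE_space
    proof eventually_elim
      case (elim w)
      then have "c w * (real_of_ereal (F x1 w) - r0 w) \<le> - d w" "0 < d w" by (auto simp: algebra_simps)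
      then show ?case by (simp add: r0_def)
    qed
    obtain v' where v': "v' \<in> W" "\<forall>x\<in>X. AE w in M. v' x w = (- 1 / c w) * v x w + 0 * v x w"
      using comb[OF v v, of "\<lambda>w. - 1 / c w" "\<lambda>_. 0"] by auto
    define a where "a w = (v x1 w + c w * r0 w - d w) / c w" for w
    have am: "a \<in> \<L> M" unfolding a_def by measurable
    have "aff_minor M X F v' a" unfolding aff_minor_def
    proof
      fix x assume x: "x \<in> X"
      have vx: "AE w in M. v' x w = (- 1 / c w) * v x w + 0 * v x w" using v'(2) x by blast
      have lb: "AE w in M. F x w < \<infinity> \<longrightarrow> v x w + c w * real_of_ereal (F x w) \<le> v x1 w + c w * r0 w - d w"
        by (rule lin_bound_ext[OF W[OF v] c km _ x]) (rule le)
      show "AE w in M. ereal (v' x w + a w) \<le> F x w"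
        using vx lb cneg F_ninf[OF x]
      proof eventually_elim
        case (elim w)
        show ?case
        proof (cases "F x w")
          case (real r)
          then have "v x w + c w * r \<le> v x1 w + c w * r0 w - d w" using elim by simp
          then have "(v x1 w + c w * r0 w - d w) / c w \<le> (v x w + c w * r) / c w"
            using elim(3) by (intro divide_right_mono_neg) auto
          also have "\<dots> = v x w / c w + r" using elim(3) by (simp add: add_divide_distrib)
          finally show ?thesis using real elim by (simp add: a_def)
        qed (use elim in auto)
      qed
    qed
    then show ?thesis using v' am by blast
  qed
  assume x0: "x0 \<in> X" and r0: "r0 \<in> \<L> M" and B: "B \<in> sets M"
    and r0l: "AE w in M. w \<in> B \<longrightarrow> ereal (r0 w) < F x0 w"
  obtain v0 a0 where v0: "v0 \<in> W" "a0 \<in> \<L> M" "aff_minor M X F v0 a0" using ex by blast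
  obtain v c d where v: "v \<in> W" and c: "c \<in> \<L> M" and d: "d \<in> \<L> M"
    and dnn: "AE w in M. 0 \<le> d w" and d0: "AE w in M. w \<in> B \<longrightarrow> 0 < d w"
    and le: "\<And>x r. (x, r) \<in> ep \<Longrightarrow> AE w in M. v x w + c w * r w \<le> v x0 w + c w * r0 w - d w"
    using sep[OF x0 r0 B r0l] by blast
  note [measurable] = c d r0 Wm[OF v x0] Wm[OF v0(1) x0] v0(2) B
  define k where "k w = v x0 w + c w * r0 w - d w" for w
  have km[measurable]: "k \<in> \<L> M" unfolding k_def by measurable
  have le': "\<And>x r. (x, r) \<in> ep \<Longrightarrow> AE w in M. v x w + c w * r w \<le> k w" using le by (simp add: k_def)
  have slope: "AE w in M. c w \<le> 0"
    by (rule lin_bound_slope[OF W[OF v] c km]) (rule le')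
  \<comment> \<open>On B the separating functional is divided by -c where c < 0; where c = 0 it is
    added \<kappa> times to the old minorant, \<kappa> being chosen so that \<kappa> d covers the
    amount by which the old minorant misses \<open>r0\<close> at \<open>x0\<close>. Off B the old
    minorant is kept.\<close>
  define \<kappa> where "\<kappa> w = max 0 ((r0 w - (v0 x0 w + a0 w)) / d w)" for w
  define \<alpha> where "\<alpha> w = (if w \<in> B then (if c w < 0 then - 1 / c w else \<kappa> w) else 0)" for w
  define \<beta> where "\<beta> w = (if w \<in> B \<and> c w < 0 then 0 else 1 :: real)" for w
  define a where "a w = (if w \<in> B then (if c w < 0 then k w / c w else a0 w - \<kappa> w * k w) else a0 w)" for w
  have [measurable]: "\<kappa> \<in> \<L> M" unfolding \<kappa>_def by measurable
  have m: "\<alpha> \<in> \<L> M" "\<beta> \<in> \<L> M" "a \<in> \<L> M"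
    unfolding \<alpha>_def \<beta>_def a_def by measurable
  obtain v' where v': "v' \<in> W" "\<And>x. x \<in> X \<Longrightarrow> AE w in M. v' x w = \<alpha> w * v x w + \<beta> w * v0 x w"
    using comb[OF v v0(1) m(1,2)] by blast
  have "aff_minor M X F v' a" unfolding aff_minor_def
  proof
    fix x assume x: "x \<in> X"
    have m0: "AE w in M. ereal (v0 x w + a0 w) \<le> F x w" using v0(3) x by (simp add: aff_minor_def)
    have lb: "AE w in M. F x w < \<infinity> \<longrightarrow> v x w + c w * real_of_ereal (F x w) \<le> k w"
      by (rule lin_bound_ext[OF W[OF v] c km _ x]) (rule le')
    show "AE w in M. ereal (v' x w + a w) \<le> F x w"
      using v'(2)[OF x] lb slope F_ninf[OF x] m0
    proof eventually_elim
      case (elim w)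
      show ?case
      proof (cases "F x w")
        case (real r)
        then have b: "v x w + c w * r \<le> k w" "v0 x w + a0 w \<le> r" using elim by auto
        have "v' x w + a w \<le> r"
        proof (cases "w \<in> B")
          case wB: True
          show ?thesis
          proof (cases "c w < 0")
            case True
            have "k w / c w \<le> (v x w + c w * r) / c w"
              using b(1) True by (intro divide_right_mono_neg) auto
            also have "\<dots> = v x w / c w + r" using True by (simp add: add_divide_distrib)
            finally show ?thesis using elim(1) wB True by (simp add: a_def \<alpha>_def \<beta>_def)
          next
            case False
            then have "v x w - k w \<le> 0" using b(1) elim(3) by simp
            then have "\<kappa> w * (v x w - k w) \<le> 0" by (intro mult_nonneg_nonpos) (auto simp: \<kappa>_def)
            then show ?thesis using elim(1) wB False b(2)
              by (simp add: a_def \<alpha>_def \<beta>_def algebra_simps)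
          qed
        qed (use elim(1) b(2) in \<open>simp add: a_def \<alpha>_def \<beta>_def\<close>)
        then show ?thesis using real by simp
      qed (use elim in auto)
    qed
  qed
  moreover have "AE w in M. w \<in> B \<longrightarrow> r0 w \<le> v' x0 w + a w"
    using v'(2)[OF x0] slope d0 r0l
  proof eventually_elim
    case (elim w)
    show ?case
    proof
      assume wB: "w \<in> B"
      then have dp: "0 < d w" using elim by simp
      show "r0 w \<le> v' x0 w + a w"
      proof (cases "c w < 0")
        case True
        have "k w / c w = v x0 w / c w + r0 w - d w / c w"
          using True by (simp add: k_def add_divide_distrib diff_divide_distrib)
        moreover have "d w / c w \<le> 0" using dp True by (simp add: divide_le_0_iff)
        ultimately show ?thesis using elim(1) wB True by (simp add: a_def \<alpha>_def \<beta>_def)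
      next
        case False
        then have c0: "c w = 0" using elim by simp
        have "(r0 w - (v0 x0 w + a0 w)) / d w * d w \<le> \<kappa> w * d w"
          using dp by (intro mult_right_mono) (auto simp: \<kappa>_def)
        then have "r0 w - (v0 x0 w + a0 w) \<le> \<kappa> w * d w" using dp by simp
        then show ?thesis using elim(1) wB c0 by (simp add: a_def \<alpha>_def \<beta>_def k_def algebra_simps)
      qed
    qed
  qed
  ultimately show "\<exists>v\<in>W. \<exists>a\<in>\<L> M. aff_minor M X F v a \<and> (AE w in M. w \<in> B \<longrightarrow> r0 w \<le> v x0 w + a w)"
    using v'(1) m(3) by blast
qed

end

section \<open>Suprema of affine functions on a dual pair\<close>

definition ess_lub :: "'w measure \<Rightarrow> ('w \<Rightarrow> ereal) set \<Rightarrow> 'w \<Rightarrow> ereal" where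
  "ess_lub M \<F> = (SOME h. h \<in> \<L> M \<and> (\<forall>f\<in>\<F>. AE w in M. f w \<le> h w) \<and>
     (\<forall>g\<in>\<L> M. (\<forall>f\<in>\<F>. AE w in M. f w \<le> g w) \<longrightarrow> (AE w in M. h w \<le> g w)))"

text \<open>The pointwise supremum of a suitable countable subfamily is measurable, dominates every
  member almost surely and lies below every measurable upper bound; so the choice in
  \<open>ess_lub\<close> is well founded.\<close>

lemma (in prob_space) ess_lub:
  assumes "\<F> \<subseteq> \<L> M"
  shows "ess_lub M \<F> \<in> \<L> M"
    and "f \<in> \<F> \<Longrightarrow> AE w in M. f w \<le> ess_lub M \<F> w"
    and "\<lbrakk>g \<in> \<L> M; \<And>f. f \<in> \<F> \<Longrightarrow> AE w in M. f w \<le> g w\<rbrakk> \<Longrightarrow> AE w in M. ess_lub M \<F> w \<le> g w"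
proof -
  obtain C where C: "C \<subseteq> \<F>" "countable C" "\<forall>f\<in>\<F>. AE w in M. f w \<le> (SUP g\<in>C. g w)"
    using countable_ess_sup[OF assms] by blast
  have "\<exists>h. h \<in> \<L> M \<and> (\<forall>f\<in>\<F>. AE w in M. f w \<le> h w) \<and>
     (\<forall>g\<in>\<L> M. (\<forall>f\<in>\<F>. AE w in M. f w \<le> g w) \<longrightarrow> (AE w in M. h w \<le> g w))"
  proof (intro exI conjI ballI impI)
    show "(\<lambda>w. SUP g\<in>C. g w) \<in> \<L> M"
      using C(1,2) assms by (intro borel_measurable_SUP) auto
    show "AE w in M. f w \<le> (SUP g\<in>C. g w)" if "f \<in> \<F>" for f using C(3) that by blast
    fix g assume g: "\<forall>f\<in>\<F>. AE w in M. f w \<le> g w"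
    then have "AE w in M. \<forall>f\<in>C. f w \<le> g w" using C(1) by (subst AE_ball_countable[OF C(2)]) blast
    then show "AE w in M. (SUP g\<in>C. g w) \<le> g w" by eventually_elim (auto intro: SUP_least)
  qed
  from someI_ex[OF this] show "ess_lub M \<F> \<in> \<L> M"
    and "f \<in> \<F> \<Longrightarrow> AE w in M. f w \<le> ess_lub M \<F> w"
    and "\<lbrakk>g \<in> \<L> M; \<And>f. f \<in> \<F> \<Longrightarrow> AE w in M. f w \<le> g w\<rbrakk> \<Longrightarrow> AE w in M. ess_lub M \<F> w \<le> g w"
    unfolding ess_lub_def[symmetric] by auto
qed

definition aminor :: "'w measure \<Rightarrow> 'x set \<Rightarrow> 'y set \<Rightarrow> ('x \<Rightarrow> 'y \<Rightarrow> 'w \<Rightarrow> real) \<Rightarrow>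
    ('x \<Rightarrow> ('w \<Rightarrow> ereal) set) \<Rightarrow> 'y \<Rightarrow> ('w \<Rightarrow> real) \<Rightarrow> bool" where
  "aminor M X Y b F y a \<longleftrightarrow> y \<in> Y \<and> a \<in> \<L> M \<and>
     (\<forall>x\<in>X. AE w in M. ereal (b x y w + a w) \<le> rep (F x) w)"

text \<open>Being the supremum of its affine minorants is expressed through arbitrary upper bounds
  \<open>h\<close>, so that no supremum has to be selected. The conditions mention the pairing and
  no topology, so one definition serves for functions on a module and on its dual.\<close>

definition fcl :: "'w measure \<Rightarrow> 'x set \<Rightarrow> 'y set \<Rightarrow> ('x \<Rightarrow> 'y \<Rightarrow> 'w \<Rightarrow> real) \<Rightarrow>
    ('x \<Rightarrow> ('w \<Rightarrow> ereal) set) set" where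
  "fcl M X Y b = {F \<in> X \<rightarrow>\<^sub>E ae_classes M. (\<exists>x\<in>X. AE w in M. rep (F x) w < \<infinity>) \<and>
     (\<exists>y a. aminor M X Y b F y a) \<and>
     (\<forall>x\<in>X. \<forall>h\<in>\<L> M. (\<forall>y a. aminor M X Y b F y a \<longrightarrow> (AE w in M. ereal (b x y w + a w) \<le> h w)) \<longrightarrow>
        (AE w in M. rep (F x) w \<le> h w))}"

definition affine :: "'w measure \<Rightarrow> 'x set \<Rightarrow> ('x \<Rightarrow> 'y \<Rightarrow> 'w \<Rightarrow> real) \<Rightarrow> 'y \<Rightarrow> ('w \<Rightarrow> real) \<Rightarrow>
    'x \<Rightarrow> ('w \<Rightarrow> ereal) set" where
  "affine M X b y a = (\<lambda>x\<in>X. cls M (\<lambda>w. ereal (b x y w + a w)))"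

definition supf :: "'w measure \<Rightarrow> 'x set \<Rightarrow> ('x \<Rightarrow> 'y \<Rightarrow> 'w \<Rightarrow> real) \<Rightarrow> ('y \<times> ('w \<Rightarrow> real)) set \<Rightarrow>
    'x \<Rightarrow> ('w \<Rightarrow> ereal) set" where
  "supf M X b \<A> = (\<lambda>x\<in>X. cls M (ess_lub M ((\<lambda>(y, a) w. ereal (b x y w + a w)) ` \<A>)))"

text \<open>The function with value \<open>c\<close> where \<open>x' = x\<close> locally and \<open>\<infinity>\<close> elsewhere, written as a supremum of affine functions.\<close>
definition point_fun :: "'w measure \<Rightarrow> 'x set \<Rightarrow> 'y set \<Rightarrow> ('x \<Rightarrow> 'y \<Rightarrow> 'w \<Rightarrow> real) \<Rightarrow> 'x \<Rightarrow> ('w \<Rightarrow> real) \<Rightarrow>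
    'x \<Rightarrow> ('w \<Rightarrow> ereal) set" where
  "point_fun M X Y b x c = supf M X b ((\<lambda>y. (y, \<lambda>w. c w - b x y w)) ` Y)"

lemma bounded_multiples_zero:
  assumes "\<And>n::nat. real n * t \<le> k" "\<And>n::nat. - (real n * t) \<le> k"
  shows "t = (0::real)"
proof (rule ccontr)
  assume "t \<noteq> 0"
  then obtain n where "real n * \<bar>t\<bar> > k" using ex_less_of_nat_mult[of "\<bar>t\<bar>"] by auto
  then show False using assms(1)[of n] assms(2)[of n] by (auto simp: abs_if split: if_splits)
qed

text \<open>The conditions are symmetric in the two modules, so \<open>swap\<close> turns each
  result about functions on \<open>X\<close> into one about functions on \<open>Y\<close>.
  Separation on both sides makes points identifiable from their pairings.\<close>

locale rpair = X: rmodule M X plX zrX acX + Y: rmodule M Y plY zrY acY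
  for M :: "'w measure" and X :: "'x set" and plX zrX acX and Y :: "'y set" and plY zrY acY +
  fixes b :: "'x \<Rightarrow> 'y \<Rightarrow> 'w \<Rightarrow> real"
  assumes linX: "y \<in> Y \<Longrightarrow> X.rlin (\<lambda>x. b x y)"
    and linY: "x \<in> X \<Longrightarrow> Y.rlin (b x)"
    and sepX: "\<lbrakk>x \<in> X; \<And>y. y \<in> Y \<Longrightarrow> AE w in M. b x y w = 0\<rbrakk> \<Longrightarrow> x = zrX"
    and sepY: "\<lbrakk>y \<in> Y; \<And>x. x \<in> X \<Longrightarrow> AE w in M. b x y w = 0\<rbrakk> \<Longrightarrow> y = zrY"
begin

lemma swap: "rpair M Y plY zrY acY X plX zrX acX (\<lambda>y x. b x y)"
  by (unfold_locales) (auto intro: linX linY sepX sepY)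

abbreviation "C \<equiv> fcl M X Y b"
abbreviation "C' \<equiv> fcl M Y X (\<lambda>y x. b x y)"
abbreviation "aff \<equiv> affine M X b"
abbreviation "aff' \<equiv> affine M Y (\<lambda>y x. b x y)"
abbreviation "ind \<equiv> point_fun M X Y b"
abbreviation "ind' \<equiv> point_fun M Y X (\<lambda>y x. b x y)"

lemma b_meas[measurable]: "x \<in> X \<Longrightarrow> y \<in> Y \<Longrightarrow> b x y \<in> \<L> M"
  using X.rlinD(1)[OF linX] by blast

lemma eq_X: "\<lbrakk>x \<in> X; x' \<in> X; \<And>y. y \<in> Y \<Longrightarrow> AE w in M. b x y w = b x' y w\<rbrakk> \<Longrightarrow> x = x'"
proof -
  assume x: "x \<in> X" and x': "x' \<in> X" and e: "\<And>y. y \<in> Y \<Longrightarrow> AE w in M. b x y w = b x' y w"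
  have "plX x (X.neg x') = zrX"
  proof (rule sepX)
    show "AE w in M. b (plX x (X.neg x')) y w = 0" if "y \<in> Y" for y
      using X.rlin_diff[OF linX[OF that] x x'] e[OF that] by eventually_elim simp
  qed (use x x' in simp)
  then show "x = x'" using X.neg_unique[OF x x'] by simp
qed

lemma fclD:
  assumes "F \<in> C"
  shows "x \<in> X \<Longrightarrow> F x \<in> ae_classes M" and "F \<in> extensional X"
    and "\<exists>x\<in>X. AE w in M. rep (F x) w < \<infinity>" and "\<exists>y a. aminor M X Y b F y a"
    and "\<lbrakk>x \<in> X; h \<in> \<L> M; \<And>y a. aminor M X Y b F y a \<Longrightarrow> AE w in M. ereal (b x y w + a w) \<le> h w\<rbrakk> \<Longrightarrow>
       AE w in M. rep (F x) w \<le> h w"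
    and "x \<in> X \<Longrightarrow> rep (F x) \<in> \<L> M"
    and "x \<in> X \<Longrightarrow> AE w in M. - \<infinity> < rep (F x) w"
proof -
  show "x \<in> X \<Longrightarrow> F x \<in> ae_classes M" "F \<in> extensional X" "\<exists>x\<in>X. AE w in M. rep (F x) w < \<infinity>"
    and ex: "\<exists>y a. aminor M X Y b F y a"
    and "\<lbrakk>x \<in> X; h \<in> \<L> M; \<And>y a. aminor M X Y b F y a \<Longrightarrow> AE w in M. ereal (b x y w + a w) \<le> h w\<rbrakk> \<Longrightarrow>
       AE w in M. rep (F x) w \<le> h w"
    using assms unfolding fcl_def by (auto simp: PiE_iff)
  then show "x \<in> X \<Longrightarrow> rep (F x) \<in> \<L> M" by (simp add: rep_props)
  assume x: "x \<in> X"
  from ex obtain y a where "AE w in M. ereal (b x y w + a w) \<le> rep (F x) w"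
    using x by (auto simp: aminor_def)
  then show "AE w in M. - \<infinity> < rep (F x) w" by eventually_elim (auto intro: less_le_trans[rotated])
qed

lemma antisym_fun:
  assumes "F \<in> C" "G \<in> C" "fun_le M X F G" "fun_le M X G F"
  shows "F = G"
proof (rule extensionalityI[OF fclD(2)[OF assms(1)] fclD(2)[OF assms(2)]])
  fix x assume x: "x \<in> X"
  have "AE w in M. rep (F x) w \<le> rep (G x) w" "AE w in M. rep (G x) w \<le> rep (F x) w"
    using assms(3,4) x by (simp_all add: fun_le_def ae_le_def)
  then have "AE w in M. rep (F x) w = rep (G x) w" by eventually_elim simp
  then have "cls M (rep (F x)) = cls M (rep (G x))"
    using fclD(6)[OF assms(1) x] fclD(6)[OF assms(2) x] by (simp add: cls_eq_iff)
  then show "F x = G x" using rep_props(2) fclD(1)[OF assms(1) x] fclD(1)[OF assms(2) x] by metis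
qed

lemma supf_rep:
  assumes \<A>: "\<A> \<subseteq> Y \<times> \<L> M" and x: "x \<in> X"
  shows "AE w in M. rep (supf M X b \<A> x) w = ess_lub M ((\<lambda>(y, a) w. ereal (b x y w + a w)) ` \<A>) w"
    and "(\<lambda>(y, a) w. ereal (b x y w + a w)) ` \<A> \<subseteq> \<L> M"
    and "supf M X b \<A> x \<in> ae_classes M"
proof -
  show 1: "(\<lambda>(y, a) w. ereal (b x y w + a w)) ` \<A> \<subseteq> \<L> M"
    using \<A> x by (auto intro!: borel_measurable_ereal borel_measurable_add b_meas)
  show "AE w in M. rep (supf M X b \<A> x) w = ess_lub M ((\<lambda>(y, a) w. ereal (b x y w + a w)) ` \<A>) w"
    "supf M X b \<A> x \<in> ae_classes M"
    using x X.ess_lub(1)[OF 1] by (simp_all add: supf_def rep_cls cls_in)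
qed

lemma supf_ge:
  assumes "\<A> \<subseteq> Y \<times> \<L> M" "x \<in> X" "(y, a) \<in> \<A>"
  shows "AE w in M. ereal (b x y w + a w) \<le> rep (supf M X b \<A> x) w"
  using supf_rep(1)[OF assms(1,2)] X.ess_lub(2)[OF supf_rep(2)[OF assms(1,2)], of "\<lambda>w. ereal (b x y w + a w)"] assms(3)
  by (force elim: eventually_elim2)

lemma supf_le:
  assumes "\<A> \<subseteq> Y \<times> \<L> M" "x \<in> X" "h \<in> \<L> M"
    "\<And>y a. (y, a) \<in> \<A> \<Longrightarrow> AE w in M. ereal (b x y w + a w) \<le> h w"
  shows "AE w in M. rep (supf M X b \<A> x) w \<le> h w"
proof -
  have "AE w in M. ess_lub M ((\<lambda>(y, a) w. ereal (b x y w + a w)) ` \<A>) w \<le> h w"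
    using assms(4) by (intro X.ess_lub(3)[OF supf_rep(2)[OF assms(1,2)] assms(3)]) auto
  then show ?thesis using supf_rep(1)[OF assms(1,2)] by eventually_elim simp
qed

lemma supf_in:
  assumes \<A>: "\<A> \<subseteq> Y \<times> \<L> M" "\<A> \<noteq> {}" and x1: "x1 \<in> X" and k: "k \<in> \<L> M"
    and le: "\<And>y a. (y, a) \<in> \<A> \<Longrightarrow> AE w in M. ereal (b x1 y w + a w) \<le> ereal (k w)"
  shows "supf M X b \<A> \<in> C"
proof -
  have am: "aminor M X Y b (supf M X b \<A>) y a" if "(y, a) \<in> \<A>" for y a
    using that \<A>(1) supf_ge[OF \<A>(1) _ that] by (auto simp: aminor_def)
  have "AE w in M. rep (supf M X b \<A> x1) w \<le> ereal (k w)"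
    using k le by (intro supf_le[OF \<A>(1) x1]) auto
  then have 1: "AE w in M. rep (supf M X b \<A> x1) w < \<infinity>" by eventually_elim auto
  have "supf M X b \<A> \<in> X \<rightarrow>\<^sub>E ae_classes M"
    using supf_rep(3)[OF \<A>(1)] by (auto simp: supf_def)
  moreover have "\<exists>y a. aminor M X Y b (supf M X b \<A>) y a" using am \<A>(2) by fast
  moreover have "AE w in M. rep (supf M X b \<A> x) w \<le> h w"
    if "x \<in> X" "h \<in> \<L> M"
      "\<forall>y a. aminor M X Y b (supf M X b \<A>) y a \<longrightarrow> (AE w in M. ereal (b x y w + a w) \<le> h w)" for x h
    using that am by (intro supf_le[OF \<A>(1)]) auto
  ultimately show ?thesis using 1 x1 unfolding fcl_def by blast
qed

section \<open>Affine functions\<close>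

lemma affine_rep:
  assumes "x \<in> X" "y \<in> Y" "a \<in> \<L> M"
  shows "AE w in M. rep (aff y a x) w = ereal (b x y w + a w)"
  using assms by (simp add: affine_def rep_cls)

lemma affine_in:
  assumes y: "y \<in> Y" and a: "a \<in> \<L> M"
  shows "aff y a \<in> C"
proof -
  have am: "aminor M X Y b (aff y a) y a" unfolding aminor_def
  proof (intro conjI ballI y a)
    fix x assume "x \<in> X"
    from affine_rep[OF this y a] show "AE w in M. ereal (b x y w + a w) \<le> rep (aff y a x) w"
      by eventually_elim simp
  qed
  have "aff y a \<in> X \<rightarrow>\<^sub>E ae_classes M" using y a by (auto simp: affine_def intro!: cls_in)
  moreover have "AE w in M. rep (aff y a zrX) w < \<infinity>"
    using affine_rep[OF X.zr_in y a] by eventually_elim simp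
  moreover have "AE w in M. rep (aff y a x) w \<le> h w"
    if "x \<in> X" "\<forall>y' a'. aminor M X Y b (aff y a) y' a' \<longrightarrow> (AE w in M. ereal (b x y' w + a' w) \<le> h w)" for x h
  proof -
    have "AE w in M. ereal (b x y w + a w) \<le> h w" using that(2) am by blast
    then show ?thesis using affine_rep[OF that(1) y a] by eventually_elim simp
  qed
  ultimately show ?thesis using am X.zr_in unfolding fcl_def by blast
qed

lemma aminor_iff:
  assumes y: "y \<in> Y" and a: "a \<in> \<L> M"
  shows "aminor M X Y b F y a \<longleftrightarrow> fun_le M X (aff y a) F"
proof -
  have "(AE w in M. ereal (b x y w + a w) \<le> rep (F x) w) \<longleftrightarrow> ae_le M (aff y a x) (F x)" if "x \<in> X" for x
  proof -
    note r = affine_rep[OF that y a]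
    show ?thesis unfolding ae_le_def
    proof
      assume "AE w in M. ereal (b x y w + a w) \<le> rep (F x) w"
      with r show "AE w in M. rep (aff y a x) w \<le> rep (F x) w" by eventually_elim simp
    next
      assume "AE w in M. rep (aff y a x) w \<le> rep (F x) w"
      with r show "AE w in M. ereal (b x y w + a w) \<le> rep (F x) w" by eventually_elim simp
    qed
  qed
  then show ?thesis using y a by (simp add: aminor_def fun_le_def)
qed

text \<open>A function affine in s and bounded above for all s has slope zero. Only the integers are
  used for s, so that countably many null sets are combined.\<close>

lemma multiples_zero:
  assumes x: "x \<in> X" and y: "y \<in> Y" and y': "y' \<in> Y" and k: "AE w in M. k w < \<infinity>"
    and le: "\<And>s::real. AE w in M. ereal (s * (b x y w - b x y' w) + a w) \<le> k w"
  shows "AE w in M. b x y w = b x y' w"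
proof -
  have "AE w in M. \<forall>n::nat. ereal (real n * (b x y w - b x y' w) + a w) \<le> k w"
    "AE w in M. \<forall>n::nat. ereal (- real n * (b x y w - b x y' w) + a w) \<le> k w"
    unfolding AE_all_countable using le[of "real n" for n] le[of "- real n" for n] by blast+
  then show ?thesis using k
  proof eventually_elim
    case (elim w)
    have kr: "ereal r \<le> k w \<Longrightarrow> r \<le> real_of_ereal (k w)" for r using elim(3) by (cases "k w") auto
    have "real n * (b x y w - b x y' w) \<le> real_of_ereal (k w) - a w"
      "- (real n * (b x y w - b x y' w)) \<le> real_of_ereal (k w) - a w" for n
      using kr[OF elim(1)[rule_format, of n]] kr[OF elim(2)[rule_format, of n]] by simp_all
    then have "b x y w - b x y' w = 0" by (rule bounded_multiples_zero)
    then show ?case by simp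
  qed
qed

text \<open>Evaluating the inequality at all multiples of x bounds a linear function of the
  multiplier; hence comparable affine functions have the same linear part, and only their constants
  are compared.\<close>

lemma affine_leD:
  assumes y: "y \<in> Y" "y' \<in> Y" and a: "a \<in> \<L> M" "a' \<in> \<L> M"
    and le: "fun_le M X (aff y a) (aff y' a')"
  shows "y = y'" "AE w in M. a w \<le> a' w"
proof -
  have le': "AE w in M. b x y w + a w \<le> b x y' w + a' w" if x: "x \<in> X" for x
  proof -
    have "AE w in M. rep (aff y a x) w \<le> rep (aff y' a' x) w" using le x by (simp add: fun_le_def ae_le_def)
    then show ?thesis using affine_rep[OF x y(1) a(1)] affine_rep[OF x y(2) a(2)] by eventually_elim simp
  qed
  have e: "AE w in M. b x y w = b x y' w" if x: "x \<in> X" for x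
  proof (rule multiples_zero[OF x y, of "\<lambda>w. ereal (a' w)" a])
    fix s :: real
    have sx: "acX (\<lambda>_. s) x \<in> X" using x by simp
    show "AE w in M. ereal (s * (b x y w - b x y' w) + a w) \<le> ereal (a' w)"
      using le'[OF sx] X.rlinD(3)[OF linX[OF y(1)] _ x, of "\<lambda>_. s"] X.rlinD(3)[OF linX[OF y(2)] _ x, of "\<lambda>_. s"]
      by (auto simp: algebra_simps elim!: eventually_rev_mp)
  qed simp
  interpret sw: rpair M Y plY zrY acY X plX zrX acX "\<lambda>y x. b x y" by (rule swap)
  show "y = y'" by (rule sw.eq_X[OF y e])
  show "AE w in M. a w \<le> a' w" using le'[OF X.zr_in] e[OF X.zr_in] by eventually_elim simp
qed

text \<open>Each affine minorant takes at a glued point the glued values, by linearity; the supremum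
  of the minorants inherits the upper bound.\<close>

lemma fcl_local:
  assumes F: "F \<in> C" and x: "x \<in> X" "x' \<in> X" and A: "A \<in> sets M"
  shows "AE w in M. rep (F (X.glue A x x')) w \<le> (if w \<in> A then rep (F x) w else rep (F x') w)"
proof (rule fclD(5)[OF F])
  show "X.glue A x x' \<in> X" using A x by simp
  note [measurable] = fclD(6)[OF F x(1)] fclD(6)[OF F x(2)] A
  show "(\<lambda>w. if w \<in> A then rep (F x) w else rep (F x') w) \<in> \<L> M" by measurable
  fix y a assume am: "aminor M X Y b F y a"
  then have y: "y \<in> Y" and le: "AE w in M. ereal (b x y w + a w) \<le> rep (F x) w" "AE w in M. ereal (b x' y w + a w) \<le> rep (F x') w"
    using x by (auto simp: aminor_def)
  show "AE w in M. ereal (b (X.glue A x x') y w + a w) \<le> (if w \<in> A then rep (F x) w else rep (F x') w)"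
    using X.rlin_glue[OF linX[OF y] x A] le by eventually_elim simp
qed

section \<open>Point functions and the order\<close>

lemma point_family: "x \<in> X \<Longrightarrow> c \<in> \<L> M \<Longrightarrow>
    (\<lambda>y. (y, \<lambda>w. c w - b x y w)) ` Y \<subseteq> Y \<times> \<L> M"
  by auto

lemma point_fun_in: "x \<in> X \<Longrightarrow> c \<in> \<L> M \<Longrightarrow> ind x c \<in> C"
proof -
  assume x: "x \<in> X" and c: "c \<in> \<L> M"
  have "Y \<noteq> {}" using Y.zr_in by blast
  then show ?thesis unfolding point_fun_def using x c by (intro supf_in[of _ x c] point_family) auto
qed

lemma point_fun_ge:
  "\<lbrakk>x \<in> X; c \<in> \<L> M; x' \<in> X; y \<in> Y\<rbrakk> \<Longrightarrow> AE w in M. ereal (b x' y w + (c w - b x y w)) \<le> rep (ind x c x') w"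
  unfolding point_fun_def by (intro supf_ge point_family) auto

lemma point_fun_le:
  "\<lbrakk>x \<in> X; c \<in> \<L> M; x' \<in> X; h \<in> \<L> M;
    \<And>y. y \<in> Y \<Longrightarrow> AE w in M. ereal (b x' y w + (c w - b x y w)) \<le> h w\<rbrakk> \<Longrightarrow> AE w in M. rep (ind x c x') w \<le> h w"
  unfolding point_fun_def by (intro supf_le point_family) auto

lemma point_fun_self:
  assumes "x \<in> X" "c \<in> \<L> M"
  shows "AE w in M. rep (ind x c x) w = ereal (c w)"
proof -
  have "AE w in M. rep (ind x c x) w \<le> ereal (c w)" using assms by (intro point_fun_le) auto
  then show ?thesis using point_fun_ge[OF assms assms(1) Y.zr_in] by eventually_elim simp
qed

text \<open>Point functions encode the epigraph in the order. An affine minorant with value at most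
  c at x lies below the affine function of the same linear part with value c there, and the latter
  is one of those whose supremum is \<open>ind x c\<close>.\<close>

lemma le_point_fun_iff:
  assumes F: "F \<in> C" and x: "x \<in> X" and c: "c \<in> \<L> M"
  shows "fun_le M X F (ind x c) \<longleftrightarrow> (AE w in M. rep (F x) w \<le> ereal (c w))"
proof
  assume "fun_le M X F (ind x c)"
  then have "AE w in M. rep (F x) w \<le> rep (ind x c x) w" using x by (simp add: fun_le_def ae_le_def)
  then show "AE w in M. rep (F x) w \<le> ereal (c w)" using point_fun_self[OF x c] by eventually_elim simp
next
  assume le: "AE w in M. rep (F x) w \<le> ereal (c w)"
  show "fun_le M X F (ind x c)" unfolding fun_le_def ae_le_def
  proof
    fix x' assume x': "x' \<in> X"
    show "AE w in M. rep (F x') w \<le> rep (ind x c x') w"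
    proof (rule fclD(5)[OF F x' fclD(6)[OF point_fun_in[OF x c] x']])
      fix y a assume am: "aminor M X Y b F y a"
      then have y: "y \<in> Y" and am': "AE w in M. ereal (b x y w + a w) \<le> rep (F x) w" using x by (auto simp: aminor_def)
      show "AE w in M. ereal (b x' y w + a w) \<le> rep (ind x c x') w"
        using am' le point_fun_ge[OF x c x' y]
      proof eventually_elim
        case (elim w)
        then have "ereal (b x y w + a w) \<le> ereal (c w)" by (meson order_trans)
        then have "ereal (b x' y w + a w) \<le> ereal (b x' y w + (c w - b x y w))" by simp
        then show ?case using elim(3) by (meson order_trans)
      qed
    qed
  qed
qed

lemma point_fun_mono:
  assumes "x \<in> X" "c \<in> \<L> M" "c' \<in> \<L> M"
  shows "fun_le M X (ind x c) (ind x c') \<longleftrightarrow> (AE w in M. c w \<le> c' w)"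
proof -
  have "(AE w in M. rep (ind x c x) w \<le> ereal (c' w)) \<longleftrightarrow> (AE w in M. c w \<le> c' w)"
    using point_fun_self[OF assms(1,2)] by (intro iffI; auto elim: eventually_elim2)
  then show ?thesis using le_point_fun_iff[OF point_fun_in[OF assms(1,2)] assms(1,3)] by simp
qed

text \<open>All affine functions with value c at x lie below F. Scaling their linear part by s keeps
  this true, so a finite value of F at x' forces each linear part to agree at x' and x.\<close>

lemma above_point_fun_dom:
  assumes F: "F \<in> C" and x: "x \<in> X" and c: "c \<in> \<L> M"
    and le: "fun_le M X (ind x c) F" and x': "x' \<in> X" and fin: "AE w in M. rep (F x') w < \<infinity>"
  shows "x' = x"
proof (rule eq_X[OF x' x])
  fix y assume y: "y \<in> Y"
  interpret sw: rpair M Y plY zrY acY X plX zrX acX "\<lambda>y x. b x y" by (rule swap)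
  show "AE w in M. b x' y w = b x y w"
  proof (rule sw.multiples_zero[OF y x' x fin, of c])
    fix s :: real
    have sy: "acY (\<lambda>_. s) y \<in> Y" using y by simp
    have "AE w in M. rep (ind x c x') w \<le> rep (F x') w" using le x' by (simp add: fun_le_def ae_le_def)
    then show "AE w in M. ereal (s * (b x' y w - b x y w) + c w) \<le> rep (F x') w"
      using point_fun_ge[OF x c x' sy] Y.rlinD(3)[OF linY[OF x] _ y, of "\<lambda>_. s", simplified] Y.rlinD(3)[OF linY[OF x'] _ y, of "\<lambda>_. s", simplified]
    proof eventually_elim
      case (elim w)
      have "s * (b x' y w - b x y w) + c w = b x' (acY (\<lambda>_. s) y) w + (c w - b x (acY (\<lambda>_. s) y) w)"
        using elim(3,4) by (simp add: algebra_simps)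
      then show ?case using elim(1,2) by (metis order_trans)
    qed
  qed
qed

lemma singleton_dom_point_fun:
  assumes F: "F \<in> C" and x: "x \<in> X" and dom: "\<And>x'. x' \<in> X \<Longrightarrow> AE w in M. rep (F x') w < \<infinity> \<Longrightarrow> x' = x"
  obtains c where "c \<in> \<L> M" "F = ind x c"
proof -
  have fin: "AE w in M. rep (F x) w < \<infinity>" using fclD(3)[OF F] dom by metis
  define c where "c w = real_of_ereal (rep (F x) w)" for w
  have c: "c \<in> \<L> M" unfolding c_def using fclD(6)[OF F x] by measurable
  have Fc: "AE w in M. rep (F x) w = ereal (c w)"
    using fin fclD(7)[OF F x]
  proof eventually_elim
    case (elim w) then show ?case by (cases "rep (F x) w") (auto simp: c_def)
  qed
  have "fun_le M X F (ind x c)"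
    unfolding le_point_fun_iff[OF F x c] using Fc by eventually_elim simp
  moreover have "fun_le M X (ind x c) F" unfolding fun_le_def ae_le_def
  proof
    fix x' assume x': "x' \<in> X"
    note [measurable] = fclD(6)[OF F x']
    define A where "A = {w \<in> space M. rep (F x') w < \<infinity>}"
    have A: "A \<in> sets M" unfolding A_def by measurable
    \<comment> \<open>On the set A where F x' is finite, x' is kept; off A it is replaced by x. The
      resulting point has finite values everywhere and must be x, so that x' agrees with x on A,
      while F x' is infinite off A.\<close>
    have "AE w in M. rep (F (X.glue A x' x)) w < \<infinity>"
      using fcl_local[OF F x' x A] Fc AE_space by eventually_elim (auto simp: A_def split: if_splits)
    then have e: "X.glue A x' x = x" using A x x' by (intro dom) auto
    show "AE w in M. rep (ind x c x') w \<le> rep (F x') w"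
    proof (rule point_fun_le[OF x c x' fclD(6)[OF F x']])
      fix y assume y: "y \<in> Y"
      show "AE w in M. ereal (b x' y w + (c w - b x y w)) \<le> rep (F x') w"
        using fcl_local[OF F x' x A] X.rlin_glue[OF linX[OF y] x' x A] Fc AE_space unfolding e
        by eventually_elim (auto simp: A_def split: if_splits)
    qed
  qed
  ultimately have "F = ind x c" using antisym_fun[OF F point_fun_in[OF x c]] by blast
  then show ?thesis using c that by blast
qed

text \<open>Everything above a point function sits at the same point. An order reversing bijection
  thus turns this upper set, one copy of the scalars, into the functions below the image.\<close>

lemma above_point_fun:
  assumes F: "F \<in> C" and x: "x \<in> X" and c: "c \<in> \<L> M" and le: "fun_le M X (ind x c) F"
  obtains c' where "c' \<in> \<L> M" "F = ind x c'"
  using singleton_dom_point_fun[OF F x above_point_fun_dom[OF F x c le]] .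

lemma point_fun_local:
  assumes x: "x \<in> X" and c: "c \<in> \<L> M" "c' \<in> \<L> M" and x': "x' \<in> X"
    and A: "A \<in> sets M" and e: "AE w in M. w \<in> A \<longrightarrow> c w = c' w"
  shows "AE w in M. w \<in> A \<longrightarrow> rep (ind x c x') w = rep (ind x c' x') w"
proof -
  have "AE w in M. w \<in> A \<longrightarrow> rep (ind x c x') w \<le> rep (ind x c' x') w"
    if c: "c \<in> \<L> M" "c' \<in> \<L> M" and e: "AE w in M. w \<in> A \<longrightarrow> c w = c' w" for c c'
  proof -
    note [measurable] = A fclD(6)[OF point_fun_in[OF x c(2)] x']
    have "AE w in M. rep (ind x c x') w \<le> (if w \<in> A then rep (ind x c' x') w else \<infinity>)"
    proof (rule point_fun_le[OF x c(1) x'])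
      show "(\<lambda>w. if w \<in> A then rep (ind x c' x') w else \<infinity>) \<in> \<L> M" by measurable
      fix y assume y: "y \<in> Y"
      show "AE w in M. ereal (b x' y w + (c w - b x y w)) \<le> (if w \<in> A then rep (ind x c' x') w else \<infinity>)"
        using point_fun_ge[OF x c(2) x' y] e by eventually_elim auto
    qed
    then show ?thesis by eventually_elim auto
  qed
  note * = this
  have e': "AE w in M. w \<in> A \<longrightarrow> c' w = c w" using e by eventually_elim simp
  show ?thesis using *[OF c e] *[OF c(2,1) e'] by eventually_elim auto
qed

lemma paste_rep:
  assumes "x \<in> X" "F x \<in> ae_classes M" "G x \<in> ae_classes M" and A: "A \<in> sets M"
  shows "AE w in M. rep (paste M X A F G x) w = (if w \<in> A then rep (F x) w else rep (G x) w)"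
    and "paste M X A F G x \<in> ae_classes M"
proof -
  have [measurable]: "rep (F x) \<in> \<L> M" "rep (G x) \<in> \<L> M" "A \<in> sets M"
    using assms by (auto simp: rep_props)
  have i: "(indicator B :: 'w \<Rightarrow> ereal) \<in> \<L> M" if "B \<in> sets M" for B using that by measurable
  have m: "rep (cls M (indicator B :: 'w \<Rightarrow> ereal)) \<in> \<L> M" if "B \<in> sets M" for B
    using rep_props(1)[OF cls_in[OF i[OF that]]] .
  have [measurable]: "rep (cls M (indicator A :: 'w \<Rightarrow> ereal)) \<in> \<L> M"
    "rep (cls M (indicator (space M - A) :: 'w \<Rightarrow> ereal)) \<in> \<L> M"
    using A by (auto intro!: m)
  let ?f = "\<lambda>w. rep (cls M (indicator A)) w * rep (F x) w"
  let ?g = "\<lambda>w. rep (cls M (indicator (space M - A))) w * rep (G x) w"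
  have [measurable]: "?f \<in> \<L> M" "?g \<in> \<L> M" by measurable
  have [measurable]: "rep (cls M ?f) \<in> \<L> M" "rep (cls M ?g) \<in> \<L> M"
    by (auto intro!: rep_props(1) cls_in)
  have p: "paste M X A F G x = cls M (\<lambda>w. rep (cls M ?f) w + rep (cls M ?g) w)"
    using assms(1) by (simp add: paste_def lift2_def)
  show "paste M X A F G x \<in> ae_classes M" unfolding p by (intro cls_in) measurable
  have "AE w in M. rep (paste M X A F G x) w = rep (cls M ?f) w + rep (cls M ?g) w"
    unfolding p by (intro rep_cls) measurable
  moreover have "AE w in M. rep (cls M ?f) w = ?f w" "AE w in M. rep (cls M ?g) w = ?g w"
    by (auto intro!: rep_cls)
  moreover have "AE w in M. rep (cls M (indicator A)) w = (indicator A w :: ereal)"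
      "AE w in M. rep (cls M (indicator (space M - A))) w = (indicator (space M - A) w :: ereal)"
    using A by (auto intro!: rep_cls i)
  ultimately show "AE w in M. rep (paste M X A F G x) w = (if w \<in> A then rep (F x) w else rep (G x) w)"
    using AE_space by eventually_elim (auto simp: indicator_def)
qed

text \<open>Brings stability into play: when the constants agree on A, the pasted function is a
  known point function, and a stable operator must then have images that agree on A.\<close>

lemma paste_point_fun:
  assumes x: "x \<in> X" and c: "c \<in> \<L> M" "c' \<in> \<L> M" and A: "A \<in> sets M"
    and e: "AE w in M. w \<in> A \<longrightarrow> c w = c' w"
  shows "paste M X A (ind x c) (ind x c') = ind x c'"
proof (rule extensionalityI[where A=X])
  show "paste M X A (ind x c) (ind x c') \<in> extensional X" by (simp add: paste_def)
  show "ind x c' \<in> extensional X" using fclD(2)[OF point_fun_in[OF x c(2)]] .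
  fix x' assume x': "x' \<in> X"
  note cl = fclD(1)[OF point_fun_in[OF x c(1)] x'] fclD(1)[OF point_fun_in[OF x c(2)] x']
  note p = paste_rep[of x' "ind x c" "ind x c'", OF x' cl A]
  have "AE w in M. rep (paste M X A (ind x c) (ind x c') x') w = rep (ind x c' x') w"
    using p(1) point_fun_local[OF x c x' A e] by eventually_elim auto
  then have "cls M (rep (paste M X A (ind x c) (ind x c') x')) = cls M (rep (ind x c' x'))"
    using p(2) cl(2) by (subst cls_eq_iff) (auto simp: rep_props)
  then show "paste M X A (ind x c) (ind x c') x' = ind x c' x'"
    using p(2) cl(2) by (simp add: rep_props)
qed

lemma affine_le_iff:
  assumes y: "y \<in> Y" and a: "a \<in> \<L> M" "a' \<in> \<L> M"
  shows "fun_le M X (aff y a) (aff y a') \<longleftrightarrow> (AE w in M. a w \<le> a' w)"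
proof
  assume le: "AE w in M. a w \<le> a' w"
  show "fun_le M X (aff y a) (aff y a')" unfolding fun_le_def ae_le_def
  proof
    fix x assume x: "x \<in> X"
    show "AE w in M. rep (aff y a x) w \<le> rep (aff y a' x) w"
      using affine_rep[OF x y a(1)] affine_rep[OF x y a(2)] le by eventually_elim simp
  qed
qed (rule affine_leD(2)[OF y y a])

section \<open>Images of point functions under an order reversing bijection\<close>

definition rev_bij :: "(('x \<Rightarrow> ('w \<Rightarrow> ereal) set) \<Rightarrow> ('y \<Rightarrow> ('w \<Rightarrow> ereal) set)) \<Rightarrow> bool" where
  "rev_bij S \<longleftrightarrow> S ` C = C' \<and> (\<forall>F\<in>C. \<forall>G\<in>C. fun_le M X F G \<longleftrightarrow> fun_le M Y (S G) (S F))"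

lemma rev_bijD:
  assumes "rev_bij S"
  shows "F \<in> C \<Longrightarrow> S F \<in> C'" "g \<in> C' \<Longrightarrow> \<exists>F\<in>C. S F = g"
    "F \<in> C \<Longrightarrow> G \<in> C \<Longrightarrow> fun_le M X F G \<longleftrightarrow> fun_le M Y (S G) (S F)"
proof -
  have im: "S ` C = C'" using assms by (simp add: rev_bij_def)
  show "F \<in> C \<Longrightarrow> S F \<in> C'" using im by auto
  show "g \<in> C' \<Longrightarrow> \<exists>F\<in>C. S F = g" unfolding im[symmetric] by auto
  show "F \<in> C \<Longrightarrow> G \<in> C \<Longrightarrow> fun_le M X F G \<longleftrightarrow> fun_le M Y (S G) (S F)"
    using assms by (simp add: rev_bij_def)
qed

lemma rev_bij_inj: assumes S: "rev_bij S" shows "inj_on S C"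
proof
  fix F G assume F: "F \<in> C" and G: "G \<in> C" and e: "S F = S G"
  have "fun_le M Y (S F) (S F)" by (simp add: fun_le_def ae_le_def)
  then have "fun_le M X F G" "fun_le M X G F" using rev_bijD(3)[OF S F G] rev_bijD(3)[OF S G F] e by simp_all
  then show "F = G" by (rule antisym_fun[OF F G])
qed

text \<open>The preimage of an affine minorant of S(ind x c) lies above \<open>ind x c\<close>, and
  everything above a point function is a point function at the same point.\<close>

lemma point_image_minorant:
  assumes S: "rev_bij S" and x: "x \<in> X" and c: "c \<in> \<L> M"
    and am: "aminor M Y X (\<lambda>y x. b x y) (S (ind x c)) z a"
  obtains c' where "c' \<in> \<L> M" "S (ind x c') = aff' z a"
proof -
  interpret sw: rpair M Y plY zrY acY X plX zrX acX "\<lambda>y x. b x y" by (rule swap)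
  have z: "z \<in> X" and a: "a \<in> \<L> M" using am by (auto simp: aminor_def)
  obtain F where F: "F \<in> C" "S F = aff' z a" using rev_bijD(2)[OF S sw.affine_in[OF z a]] by blast
  have "fun_le M Y (S F) (S (ind x c))" using am sw.aminor_iff[OF z a] F by simp
  then have "fun_le M X (ind x c) F" using rev_bijD(3)[OF S point_fun_in[OF x c] F(1)] by simp
  from above_point_fun[OF F(1) x c this] show ?thesis using F(2) that by metis
qed

text \<open>The point function with the larger constant lies above both given ones, so its image
  lies below both affine functions. Any affine minorant of this image has the linear part of the one
  and of the other.\<close>

lemma point_image_unique:
  assumes S: "rev_bij S" and x: "x \<in> X" and c: "c \<in> \<L> M" "c' \<in> \<L> M"
    and z: "z \<in> X" "z' \<in> X" and a: "a \<in> \<L> M" "a' \<in> \<L> M"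
    and e: "S (ind x c) = aff' z a" "S (ind x c') = aff' z' a'"
  shows "z = z'"
proof -
  interpret sw: rpair M Y plY zrY acY X plX zrX acX "\<lambda>y x. b x y" by (rule swap)
  define m where "m w = max (c w) (c' w)" for w
  have m: "m \<in> \<L> M" unfolding m_def using c by measurable
  have le: "fun_le M X (ind x c) (ind x m)" "fun_le M X (ind x c') (ind x m)"
    by (subst point_fun_mono[OF x _ m]; auto simp: m_def c)+
  have i: "ind x m \<in> C" "ind x c \<in> C" "ind x c' \<in> C" using x m c by (auto intro: point_fun_in)
  have le': "fun_le M Y (S (ind x m)) (aff' z a)" "fun_le M Y (S (ind x m)) (aff' z' a')"
    using le rev_bijD(3)[OF S i(2,1)] rev_bijD(3)[OF S i(3,1)] e by simp_all
  obtain z3 a3 where "aminor M Y X (\<lambda>y x. b x y) (S (ind x m)) z3 a3"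
    using sw.fclD(4)[OF rev_bijD(1)[OF S i(1)]] by blast
  then have z3: "z3 \<in> X" "a3 \<in> \<L> M" "fun_le M Y (aff' z3 a3) (S (ind x m))"
    using sw.aminor_iff by (auto simp: aminor_def)
  have tr: "fun_le M Y (aff' z3 a3) g" if g: "fun_le M Y (S (ind x m)) g" for g
    unfolding fun_le_def ae_le_def
  proof
    fix y assume "y \<in> Y"
    then have "AE w in M. rep (aff' z3 a3 y) w \<le> rep (S (ind x m) y) w" "AE w in M. rep (S (ind x m) y) w \<le> rep (g y) w"
      using z3(3) g by (auto simp: fun_le_def ae_le_def)
    then show "AE w in M. rep (aff' z3 a3 y) w \<le> rep (g y) w" by eventually_elim (rule order_trans)
  qed
  have "z3 = z" by (rule sw.affine_leD(1)[OF z3(1) z(1) z3(2) a(1) tr[OF le'(1)]])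
  moreover have "z3 = z'" by (rule sw.affine_leD(1)[OF z3(1) z(2) z3(2) a(2) tr[OF le'(2)]])
  ultimately show ?thesis by simp
qed

text \<open>All affine minorants of the image of a point function are images of functions at the same
  point, hence have the same linear part; so that image is itself affine.\<close>
lemma point_image_affine:
  assumes S: "rev_bij S" and x: "x \<in> X" and c: "c \<in> \<L> M"
  obtains z a where "z \<in> X" "a \<in> \<L> M" "S (ind x c) = aff' z a"
proof -
  interpret sw: rpair M Y plY zrY acY X plX zrX acX "\<lambda>y x. b x y" by (rule swap)
  let ?g = "S (ind x c)"
  have g: "?g \<in> C'" by (rule rev_bijD(1)[OF S point_fun_in[OF x c]])
  obtain z a0 where za: "aminor M Y X (\<lambda>y x. b x y) ?g z a0" using sw.fclD(4)[OF g] by blast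
  have z: "z \<in> X" using za by (simp add: aminor_def)
  have uniq: "z' = z" if am: "aminor M Y X (\<lambda>y x. b x y) ?g z' a'" for z' a'
  proof -
    obtain c1 where c1: "c1 \<in> \<L> M" "S (ind x c1) = aff' z a0" using point_image_minorant[OF S x c za] .
    obtain c2 where c2: "c2 \<in> \<L> M" "S (ind x c2) = aff' z' a'" using point_image_minorant[OF S x c am] .
    show ?thesis
      by (rule point_image_unique[OF S x c2(1) c1(1) _ z _ _ c2(2) c1(2)]) (use am za in \<open>auto simp: aminor_def\<close>)
  qed
  obtain y0 where y0: "y0 \<in> Y" "AE w in M. rep (?g y0) w < \<infinity>" using sw.fclD(3)[OF g] by blast
  define r where "r w = real_of_ereal (rep (?g y0) w)" for w
  have [measurable]: "r \<in> \<L> M" unfolding r_def using sw.fclD(6)[OF g y0(1)] by measurable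
  have gr: "AE w in M. rep (?g y0) w = ereal (r w)"
    using y0(2) sw.fclD(7)[OF g y0(1)]
  proof eventually_elim
    case (elim w) then show ?case by (cases "rep (?g y0) w") (auto simp: r_def)
  qed
  \<comment> \<open>All affine minorants of g have the linear part z, so that g - z is the supremum
    of their constants at every argument. It is computed at \<open>y0\<close>, where g is
    finite.\<close>
  define a where "a w = r w - b z y0 w" for w
  have a: "a \<in> \<L> M" unfolding a_def using z y0 by measurable
  have ub: "AE w in M. a' w \<le> a w" if am: "aminor M Y X (\<lambda>y x. b x y) ?g z' a'" for z' a'
  proof -
    have "AE w in M. ereal (b z y0 w + a' w) \<le> rep (?g y0) w"
      using am uniq[OF am] y0 by (auto simp: aminor_def)
    then show ?thesis using gr by eventually_elim (simp add: a_def)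
  qed
  have "fun_le M Y ?g (aff' z a)" unfolding fun_le_def ae_le_def
  proof
    fix y assume y: "y \<in> Y"
    note [measurable] = a b_meas[OF z y]
    have "AE w in M. rep (?g y) w \<le> ereal (b z y w + a w)"
    proof (rule sw.fclD(5)[OF g y])
      fix z' a' assume am: "aminor M Y X (\<lambda>y x. b x y) ?g z' a'"
      show "AE w in M. ereal (b z' y w + a' w) \<le> ereal (b z y w + a w)"
        using ub[OF am] unfolding uniq[OF am] by eventually_elim simp
    qed measurable
    then show "AE w in M. rep (?g y) w \<le> rep (aff' z a y) w"
      using sw.affine_rep[OF y z a] by eventually_elim simp
  qed
  moreover have "fun_le M Y (aff' z a) ?g" unfolding fun_le_def ae_le_def
  proof
    fix y assume y: "y \<in> Y"
    note [measurable] = a b_meas[OF z y] b_meas[OF z y0(1)] sw.fclD(6)[OF g y]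
    \<comment> \<open>Each minorant z + a' satisfies a' <= g(y) - z(y). Adding z(y0) gives an upper
      bound for all minorants at \<open>y0\<close>, hence for g there.\<close>
    have "AE w in M. rep (?g y0) w \<le> ereal (b z y0 w) + (rep (?g y) w - ereal (b z y w))"
    proof (rule sw.fclD(5)[OF g y0(1)])
      fix z' a' assume am: "aminor M Y X (\<lambda>y x. b x y) ?g z' a'"
      have "AE w in M. ereal (b z y w + a' w) \<le> rep (?g y) w"
        using am uniq[OF am] y by (auto simp: aminor_def)
      then show "AE w in M. ereal (b z' y0 w + a' w) \<le> ereal (b z y0 w) + (rep (?g y) w - ereal (b z y w))"
        unfolding uniq[OF am]
      proof eventually_elim
        case (elim w) then show ?case by (cases "rep (?g y) w") auto
      qed
    qed measurable
    then show "AE w in M. rep (aff' z a y) w \<le> rep (?g y) w"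
      using sw.affine_rep[OF y z a] gr
    proof eventually_elim
      case (elim w) then show ?case by (cases "rep (?g y) w") (auto simp: a_def)
    qed
  qed
  ultimately have "?g = aff' z a" using sw.antisym_fun[OF g sw.affine_in[OF z a]] by blast
  then show ?thesis using that z a by blast
qed

text \<open>The counterpart of \<open>point_image_unique\<close>: the affine function with the
  smaller constant lies below both images, so its preimage lies above both point functions; a point
  of its domain must then equal both x and x'.\<close>

lemma affine_common_upper:
  assumes S: "rev_bij S" and x: "x \<in> X" "x' \<in> X" and c: "c \<in> \<L> M" "c' \<in> \<L> M"
    and z: "z \<in> X" and a: "a \<in> \<L> M" "a' \<in> \<L> M"
    and e: "S (ind x c) = aff' z a" "S (ind x' c') = aff' z a'"
  shows "x = x'"
proof -
  interpret sw: rpair M Y plY zrY acY X plX zrX acX "\<lambda>y x. b x y" by (rule swap)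
  define m where "m w = min (a w) (a' w)" for w
  have m: "m \<in> \<L> M" unfolding m_def using a by measurable
  obtain K where K: "K \<in> C" "S K = aff' z m" using rev_bijD(2)[OF S sw.affine_in[OF z m]] by blast
  have "fun_le M Y (S K) (S (ind x c))" "fun_le M Y (S K) (S (ind x' c'))"
    unfolding K e by (subst sw.affine_le_iff[OF z m]; auto simp: m_def a)+
  then have le: "fun_le M X (ind x c) K" "fun_le M X (ind x' c') K"
    using rev_bijD(3)[OF S point_fun_in K(1)] x c by auto
  obtain x0 where x0: "x0 \<in> X" "AE w in M. rep (K x0) w < \<infinity>" using fclD(3)[OF K(1)] by blast
  show ?thesis
    using above_point_fun_dom[OF K(1) x(1) c(1) le(1) x0] above_point_fun_dom[OF K(1) x(2) c(2) le(2) x0] by simp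
qed

text \<open>Let F be the preimage. Each point of its domain carries a point function above F, whose
  image is affine and lies below the given affine function, hence has the linear part z. So all
  points of the domain coincide by \<open>affine_common_upper\<close>, and F is a point
  function.\<close>

lemma affine_from_point:
  assumes S: "rev_bij S" and z: "z \<in> X" and a: "a \<in> \<L> M"
  obtains x c where "x \<in> X" "c \<in> \<L> M" "S (ind x c) = aff' z a"
proof -
  interpret sw: rpair M Y plY zrY acY X plX zrX acX "\<lambda>y x. b x y" by (rule swap)
  obtain F where F: "F \<in> C" "S F = aff' z a" using rev_bijD(2)[OF S sw.affine_in[OF z a]] by blast
  have img: "\<exists>c\<in>\<L> M. \<exists>a'\<in>\<L> M. S (ind x c) = aff' z a'"
    if x: "x \<in> X" "AE w in M. rep (F x) w < \<infinity>" for x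
  proof -
    define c where "c w = real_of_ereal (rep (F x) w)" for w
    have c: "c \<in> \<L> M" unfolding c_def using fclD(6)[OF F(1) x(1)] by measurable
    have "AE w in M. rep (F x) w \<le> ereal (c w)"
      using x(2) fclD(7)[OF F(1) x(1)]
    proof eventually_elim
      case (elim w) then show ?case by (cases "rep (F x) w") (auto simp: c_def)
    qed
    then have "fun_le M X F (ind x c)" by (simp add: le_point_fun_iff[OF F(1) x(1) c])
    then have le: "fun_le M Y (S (ind x c)) (aff' z a)"
      using rev_bijD(3)[OF S F(1) point_fun_in[OF x(1) c]] F(2) by simp
    obtain z' a' where z': "z' \<in> X" "a' \<in> \<L> M" "S (ind x c) = aff' z' a'"
      using point_image_affine[OF S x(1) c] .
    have "z' = z" using sw.affine_leD(1)[OF z'(1) z z'(2) a] le z'(3) by simp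
    then show ?thesis using z' c by blast
  qed
  obtain x where x: "x \<in> X" "AE w in M. rep (F x) w < \<infinity>" using fclD(3)[OF F(1)] by blast
  have "x' = x" if x': "x' \<in> X" "AE w in M. rep (F x') w < \<infinity>" for x'
  proof -
    obtain c1 a1 where 1: "c1 \<in> \<L> M" "a1 \<in> \<L> M" "S (ind x' c1) = aff' z a1" using img[OF x'] by blast
    obtain c2 a2 where 2: "c2 \<in> \<L> M" "a2 \<in> \<L> M" "S (ind x c2) = aff' z a2" using img[OF x] by blast
    show ?thesis by (rule affine_common_upper[OF S x'(1) x(1) 1(1) 2(1) z 1(2) 2(2) 1(3) 2(3)])
  qed
  then obtain c where "c \<in> \<L> M" "F = ind x c" using singleton_dom_point_fun[OF F(1) x(1)] by blast
  then show ?thesis using that x F(2) by blast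
qed

text \<open>Together with \<open>swap\<close> this applies the results on images of point functions
  to the inverse, which gives that S maps affine functions to point functions.\<close>

lemma rev_bij_inverse:
  assumes S: "rev_bij S"
  shows "rpair.rev_bij M Y X (\<lambda>y x. b x y) (the_inv_into C S)"
proof -
  interpret sw: rpair M Y plY zrY acY X plX zrX acX "\<lambda>y x. b x y" by (rule swap)
  note inj = rev_bij_inj[OF S]
  have im: "S ` C = C'" using S by (simp add: rev_bij_def)
  have "the_inv_into C S ` C' = C" using the_inv_into_onto[OF inj] im by simp
  moreover have "fun_le M Y F G \<longleftrightarrow> fun_le M X (the_inv_into C S G) (the_inv_into C S F)"
    if FG: "F \<in> C'" "G \<in> C'" for F G
  proof -
    obtain f g where "f \<in> C" "g \<in> C" "F = S f" "G = S g"
      using FG unfolding im[symmetric] by blast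
    then show ?thesis using rev_bijD(3)[OF S, of g f] the_inv_into_f_f[OF inj] by simp
  qed
  ultimately show ?thesis unfolding sw.rev_bij_def by simp
qed

end

section \<open>Order reversing bijections\<close>

context prob_space
begin

text \<open>Additivity gives the claim for rational constants, locality for functions with values in
  \<open>\<int>/n\<close>, and monotonicity for all functions.\<close>
lemma affine_of_additive_local:
  fixes q :: "('a \<Rightarrow> real) \<Rightarrow> 'a \<Rightarrow> real"
  assumes add: "\<And>a r. a \<in> \<L> M \<Longrightarrow> r \<in> \<L> M \<Longrightarrow>
      AE w in M. q (\<lambda>w. a w + r w) w = q a w + q r w - q (\<lambda>_. 0) w"
    and anti: "\<And>a r. \<lbrakk>a \<in> \<L> M; r \<in> \<L> M; AE w in M. a w \<le> r w\<rbrakk> \<Longrightarrow> AE w in M. q r w \<le> q a w"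
    and local: "\<And>A a r. \<lbrakk>A \<in> sets M; a \<in> \<L> M; r \<in> \<L> M; AE w in M. w \<in> A \<longrightarrow> a w = r w\<rbrakk> \<Longrightarrow>
      AE w in M. w \<in> A \<longrightarrow> q a w = q r w"
    and a: "a \<in> \<L> M"
  shows "AE w in M. q a w = q (\<lambda>_. 0) w - (q (\<lambda>_. 0) w - q (\<lambda>_. 1) w) * a w"
proof -
  define \<kappa> where "\<kappa> a w = q a w - q (\<lambda>_. 0) w" for a w
  define t where "t w = q (\<lambda>_. 0) w - q (\<lambda>_. 1) w" for w
  have kadd: "AE w in M. \<kappa> (\<lambda>w. a w + r w) w = \<kappa> a w + \<kappa> r w"
    if "a \<in> \<L> M" "r \<in> \<L> M" for a r
    using add[OF that] by eventually_elim (simp add: \<kappa>_def)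
  have knat: "AE w in M. \<kappa> (\<lambda>_. real k * c) w = real k * \<kappa> (\<lambda>_. c) w" for k :: nat and c
  proof (induction k)
    case 0 show ?case by (simp add: \<kappa>_def)
  next
    case (Suc k)
    have "AE w in M. \<kappa> (\<lambda>w. real k * c + c) w = \<kappa> (\<lambda>_. real k * c) w + \<kappa> (\<lambda>_. c) w"
      using kadd[of "\<lambda>_. real k * c" "\<lambda>_. c"] by simp
    with Suc have "AE w in M. \<kappa> (\<lambda>w. real k * c + c) w = real (Suc k) * \<kappa> (\<lambda>_. c) w"
      by eventually_elim (simp add: algebra_simps)
    then show ?case by (simp add: algebra_simps)
  qed
  have kneg: "AE w in M. \<kappa> (\<lambda>_. - c) w = - \<kappa> (\<lambda>_. c) w" for c
    using kadd[of "\<lambda>_. c" "\<lambda>_. - c"] by (auto simp: \<kappa>_def elim!: eventually_mono)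
  have kint: "AE w in M. \<kappa> (\<lambda>_. real_of_int j * c) w = real_of_int j * \<kappa> (\<lambda>_. c) w" for j c
  proof (cases "0 \<le> j")
    case True then show ?thesis using knat[of "nat j" c] by simp
  next
    case False
    then have e: "- (real (nat (- j)) * c) = real_of_int j * c" by simp
    show ?thesis using knat[of "nat (- j)" c] kneg[of "real (nat (- j)) * c"] False unfolding e
      by (auto elim: eventually_elim2)
  qed
  have krat: "AE w in M. \<kappa> (\<lambda>_. real_of_int j / real n) w = - (real_of_int j / real n) * t w" if n: "0 < n" for j and n :: nat
  proof -
    have "AE w in M. \<kappa> (\<lambda>_. real n * (1 / real n)) w = real n * \<kappa> (\<lambda>_. 1 / real n) w" by (rule knat)
    then have "AE w in M. \<kappa> (\<lambda>_. 1) w = real n * \<kappa> (\<lambda>_. 1 / real n) w" using n by simp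
    moreover have "AE w in M. \<kappa> (\<lambda>_. real_of_int j * (1 / real n)) w = real_of_int j * \<kappa> (\<lambda>_. 1 / real n) w"
      by (rule kint)
    ultimately show ?thesis
    proof eventually_elim
      case (elim w)
      then have "\<kappa> (\<lambda>_. 1 / real n) w = - t w / real n" using n by (simp add: \<kappa>_def t_def field_simps)
      then show ?case using elim(2) by simp
    qed
  qed
  define f where "f n w = real_of_int \<lfloor>real n * a w\<rfloor> / real n" for n :: nat and w
  note [measurable] = a
  have fm: "f n \<in> \<L> M" for n unfolding f_def by measurable
  have kf: "AE w in M. \<kappa> (f n) w = - f n w * t w" if n: "0 < n" for n
  proof -
    \<comment> \<open>There are countably many values of the floor, and on each level set
      \<open>f n\<close> is a rational constant; \<open>local\<close> reduces the claim to
      \<open>krat\<close>.\<close>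
    have "AE w in M. \<forall>j. \<lfloor>real n * a w\<rfloor> = j \<longrightarrow> \<kappa> (f n) w = - f n w * t w"
      unfolding AE_all_countable
    proof
      fix j
      define A where "A = {w \<in> space M. \<lfloor>real n * a w\<rfloor> = j}"
      have A: "A \<in> sets M" unfolding A_def by measurable
      have "AE w in M. w \<in> A \<longrightarrow> q (f n) w = q (\<lambda>_. real_of_int j / real n) w"
        by (rule local[OF A fm]) (auto simp: A_def f_def)
      then show "AE w in M. \<lfloor>real n * a w\<rfloor> = j \<longrightarrow> \<kappa> (f n) w = - f n w * t w"
        using krat[OF n, of j] AE_space by eventually_elim (auto simp: A_def f_def \<kappa>_def)
    qed
    then show ?thesis by eventually_elim blast
  qed
  have bd: "f n w \<le> a w" "a w \<le> f n w + 1 / real n" if "0 < n" for n w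
    using that unfolding f_def by (simp_all add: field_simps) linarith+
  \<comment> \<open>As a lies between \<open>f n\<close> and \<open>f n + 1 / n\<close>,
    monotonicity encloses \<open>\<kappa> a\<close> in an interval of length t / n.\<close>
  have key: "AE w in M. \<forall>n::nat. 0 < n \<longrightarrow> \<kappa> a w \<le> - f n w * t w \<and> - f n w * t w - t w / real n \<le> \<kappa> a w"
    unfolding AE_all_countable
  proof
    fix n :: nat
    show "AE w in M. 0 < n \<longrightarrow> \<kappa> a w \<le> - f n w * t w \<and> - f n w * t w - t w / real n \<le> \<kappa> a w"
    proof (cases "0 < n")
      case True
      have fm': "(\<lambda>w. f n w + 1 / real n) \<in> \<L> M" using fm by measurable
      have 1: "AE w in M. q a w \<le> q (f n) w" using bd[OF True] by (intro anti[OF fm a]) auto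
      have 2: "AE w in M. q (\<lambda>w. f n w + 1 / real n) w \<le> q a w" using bd[OF True] by (intro anti[OF a fm']) auto
      have 3: "AE w in M. \<kappa> (\<lambda>w. f n w + (\<lambda>_. 1 / real n) w) w = \<kappa> (f n) w + \<kappa> (\<lambda>_. 1 / real n) w"
        by (rule kadd[OF fm]) simp
      show ?thesis using 1 2 3 kf[OF True] krat[OF True, of 1]
        by eventually_elim (auto simp: \<kappa>_def)
    qed simp
  qed
  have "AE w in M. q (\<lambda>_. 1) w \<le> q (\<lambda>_. 0) w" by (rule anti) auto
  with key show ?thesis
  proof eventually_elim
    case (elim w)
    have t0: "0 \<le> t w" using elim(2) by (simp add: t_def)
    have "\<kappa> a w = - a w * t w"
    proof (rule antisym; rule field_le_epsilon)
      fix e :: real assume "0 < e"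
      obtain n0 where n0: "real n0 * e > t w" using ex_less_of_nat_mult[OF \<open>0 < e\<close>] by auto
      define n where "n = Suc n0"
      have n: "0 < n" "t w / real n < e" using n0 \<open>0 < e\<close> by (auto simp: n_def field_simps intro: less_le_trans)
      have f1: "f n w * t w \<le> a w * t w" "a w * t w \<le> (f n w + 1 / real n) * t w"
        using bd[OF n(1), of w] t0 by (auto intro: mult_right_mono)
      have k: "\<kappa> a w \<le> - f n w * t w" "- f n w * t w - t w / real n \<le> \<kappa> a w" using elim(1) n(1) by auto
      show "\<kappa> a w \<le> - a w * t w + e" using k f1 n(2) by (simp add: algebra_simps)
      show "- a w * t w \<le> \<kappa> a w + e" using k f1 n(2) by (simp add: algebra_simps)
    qed
    then show ?case by (simp add: \<kappa>_def t_def algebra_simps)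
  qed
qed

end

section \<open>The form of a stable order reversing bijection\<close>

context rpair
begin

text \<open>The proof determines the functions \<open>\<eta>\<close>, \<open>R\<close>,
  \<open>P\<close>, \<open>Q\<close> for which S maps \<open>ind x c\<close> to the affine function
  with linear part \<open>\<eta> x\<close> and constant \<open>R x c\<close>, and
  \<open>aff u r\<close> to the point function at \<open>P u\<close> with value
  \<open>Q u r\<close>. S F u is described by its upper bounds \<open>k\<close>, which says that it
  is an essential supremum without selecting one. The identity relating H to a surjective map on
  \<open>Y\<close> is recorded because it is what makes the graph of H closed.\<close>

theorem operator_form:
  assumes S: "rev_bij S"
    and st: "\<And>A F G. \<lbrakk>A \<in> sets M; F \<in> C; G \<in> C\<rbrakk> \<Longrightarrow> S (paste M X A F G) = paste M Y A (S F) (S G)"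
    and unit: "x1 \<in> X" "y1 \<in> Y" "AE w in M. b x1 y1 w = 1"
  obtains H \<eta>0 p0 P \<tau> \<rho> where
    "\<eta>0 \<in> X" "p0 \<in> Y" "\<tau> \<in> \<L> M" "\<rho> \<in> \<L> M" "\<And>w. 0 < \<tau> w"
    "bij_betw H X X" "\<And>x y. x \<in> X \<Longrightarrow> y \<in> X \<Longrightarrow> H (plX x y) = plX (H x) (H y)"
    "\<And>a x. a \<in> \<L> M \<Longrightarrow> x \<in> X \<Longrightarrow> H (acX a x) = acX a (H x)"
    "P ` Y = Y" "\<And>x u. x \<in> X \<Longrightarrow> u \<in> Y \<Longrightarrow> AE w in M. b (H x) (P u) w = b x u w"
    "\<And>F u k. \<lbrakk>F \<in> C; u \<in> Y; k \<in> \<L> M\<rbrakk> \<Longrightarrow> (AE w in M. rep (S F u) w \<le> k w) \<longleftrightarrow>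
      (\<forall>x\<in>X. AE w in M. ereal (\<tau> w * (b (H x) u w - b (H x) p0 w) + b \<eta>0 u w + \<rho> w) - ereal (\<tau> w) * rep (F x) w \<le> k w)"
proof -
  interpret sw: rpair M Y plY zrY acY X plX zrX acX "\<lambda>y x. b x y" by (rule swap)
  let ?L = "\<L> M :: ('w \<Rightarrow> real) set"
  let ?T = "the_inv_into C S"
  have T: "sw.rev_bij ?T" by (rule rev_bij_inverse[OF S])
  have inj: "inj_on S C" by (rule rev_bij_inj[OF S])
  have ST: "S (?T g) = g" if "g \<in> C'" for g
    using f_the_inv_into_f[OF inj, of g] rev_bijD(2)[OF S that] by blast
  have TS: "?T (S F) = F" if "F \<in> C" for F using the_inv_into_f_f[OF inj that] .
  have "\<exists>z. z \<in> X \<and> (\<forall>c\<in>?L. \<exists>a. a \<in> ?L \<and> S (ind x c) = aff' z a)" if x: "x \<in> X" for x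
  proof -
    obtain z a0 where z: "z \<in> X" "a0 \<in> ?L" "S (ind x (\<lambda>_. 0)) = aff' z a0"
      using point_image_affine[OF S x, of "\<lambda>_. 0"] by auto
    have "\<exists>a. a \<in> ?L \<and> S (ind x c) = aff' z a" if c: "c \<in> ?L" for c
    proof -
      obtain z' a where z': "z' \<in> X" "a \<in> ?L" "S (ind x c) = aff' z' a"
        using point_image_affine[OF S x c] .
      have "z' = z" by (rule point_image_unique[OF S x c _ z'(1) z(1) z'(2) z(2) z'(3) z(3)]) simp
      then show ?thesis using z' by blast
    qed
    then show ?thesis using z(1) by blast
  qed
  then have "\<forall>x. \<exists>z. x \<in> X \<longrightarrow> z \<in> X \<and> (\<forall>c\<in>?L. \<exists>a. a \<in> ?L \<and> S (ind x c) = aff' z a)" by blast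
  from choice[OF this] obtain \<eta> where "\<forall>x. x \<in> X \<longrightarrow> \<eta> x \<in> X \<and> (\<forall>c\<in>?L. \<exists>a. a \<in> ?L \<and> S (ind x c) = aff' (\<eta> x) a)"
    by (rule exE)
  then have \<eta>: "\<eta> x \<in> X" and R_ex: "c \<in> ?L \<Longrightarrow> \<exists>a. a \<in> ?L \<and> S (ind x c) = aff' (\<eta> x) a" if "x \<in> X" for x c
    using that by auto
  define R where "R x c = (SOME a. a \<in> ?L \<and> S (ind x c) = aff' (\<eta> x) a)" for x c
  have R: "R x c \<in> ?L" "S (ind x c) = aff' (\<eta> x) (R x c)" if "x \<in> X" "c \<in> ?L" for x c
    using someI_ex[OF R_ex[OF that]] unfolding R_def by auto
  have "\<exists>p. p \<in> Y \<and> (\<forall>r\<in>?L. \<exists>c. c \<in> ?L \<and> S (aff u r) = ind' p c)" if u: "u \<in> Y" for u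
  proof -
    obtain p c0 where p: "p \<in> Y" "c0 \<in> ?L" "?T (ind' p c0) = aff u (\<lambda>_. 0)"
      using sw.affine_from_point[OF T u, of "\<lambda>_. 0"] by auto
    have "\<exists>c. c \<in> ?L \<and> S (aff u r) = ind' p c" if r: "r \<in> ?L" for r
    proof -
      obtain p' c where p': "p' \<in> Y" "c \<in> ?L" "?T (ind' p' c) = aff u r"
        using sw.affine_from_point[OF T u r] by auto
      have "p' = p" by (rule sw.affine_common_upper[OF T p'(1) p(1) p'(2) p(2) u r _ p'(3) p(3)]) simp
      then show ?thesis using p' ST[OF sw.point_fun_in[OF p'(1,2)]] by auto
    qed
    then show ?thesis using p(1) by blast
  qed
  then have "\<forall>u. \<exists>p. u \<in> Y \<longrightarrow> p \<in> Y \<and> (\<forall>r\<in>?L. \<exists>c. c \<in> ?L \<and> S (aff u r) = ind' p c)" by blast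
  from choice[OF this] obtain P where "\<forall>u. u \<in> Y \<longrightarrow> P u \<in> Y \<and> (\<forall>r\<in>?L. \<exists>c. c \<in> ?L \<and> S (aff u r) = ind' (P u) c)"
    by (rule exE)
  then have P: "P u \<in> Y" and Q_ex: "r \<in> ?L \<Longrightarrow> \<exists>c. c \<in> ?L \<and> S (aff u r) = ind' (P u) c" if "u \<in> Y" for u r
    using that by auto
  define Q where "Q u r = (SOME c. c \<in> ?L \<and> S (aff u r) = ind' (P u) c)" for u r
  have Q: "Q u r \<in> ?L" "S (aff u r) = ind' (P u) (Q u r)" if "u \<in> Y" "r \<in> ?L" for u r
    using someI_ex[OF Q_ex[OF that]] unfolding Q_def by auto
  note [measurable] = R(1) Q(1)
  have P_onto: "\<exists>u\<in>Y. P u = p" if p: "p \<in> Y" for p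
  proof -
    obtain u r where u: "u \<in> Y" "r \<in> ?L" "?T (ind' p (\<lambda>_. 0)) = aff u r"
      using sw.point_image_affine[OF T p, of "\<lambda>_. 0"] by auto
    have e: "?T (ind' (P u) (Q u r)) = aff u r" using Q(2)[OF u(1,2)] TS[OF affine_in[OF u(1,2)]] by simp
    have "p = P u"
      by (rule sw.affine_common_upper[OF T p P[OF u(1)] _ Q(1)[OF u(1,2)] u(1,2,2,3) e]) simp
    then show ?thesis using u(1) by blast
  qed
  have \<eta>_inj: "x = x'" if x: "x \<in> X" "x' \<in> X" and e: "\<eta> x = \<eta> x'" for x x'
  proof -
    have z: "(\<lambda>_. 0 :: real) \<in> ?L" by simp
    show ?thesis
      by (rule affine_common_upper[OF S x z z \<eta>[OF x(1)] R(1)[OF x(1) z] R(1)[OF x(2) z] R(2)[OF x(1) z]])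
        (simp add: R(2)[OF x(2) z] e)
  qed
  have \<eta>_onto: "\<exists>x\<in>X. \<eta> x = z" and R_onto: "x \<in> X \<Longrightarrow> \<eta> x = z \<Longrightarrow> \<exists>c\<in>?L. AE w in M. R x c w = \<rho> w"
    if z: "z \<in> X" and \<rho>: "\<rho> \<in> ?L" for z \<rho> x
  proof -
    obtain x' c where x': "x' \<in> X" "c \<in> ?L" "S (ind x' c) = aff' z \<rho>" using affine_from_point[OF S z \<rho>] .
    have e: "\<eta> x' = z"
      by (rule point_image_unique[OF S x'(1) x'(2) x'(2) \<eta>[OF x'(1)] z R(1)[OF x'(1,2)] \<rho> R(2)[OF x'(1,2)] x'(3)])
    then show "\<exists>x\<in>X. \<eta> x = z" using x' by blast
    assume x: "x \<in> X" "\<eta> x = z"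
    then have xx: "x' = x" using \<eta>_inj[OF x'(1) x(1)] e by simp
    have "aff' z (R x c) = aff' z \<rho>" using R(2)[OF x(1) x'(2)] x'(3) x(2) xx by simp
    then have "fun_le M Y (aff' z (R x c)) (aff' z \<rho>)" "fun_le M Y (aff' z \<rho>) (aff' z (R x c))"
      by (simp_all add: fun_le_def ae_le_def)
    then have "AE w in M. R x c w \<le> \<rho> w" "AE w in M. \<rho> w \<le> R x c w"
      using sw.affine_le_iff[OF z R(1)[OF x(1) x'(2)] \<rho>] sw.affine_le_iff[OF z \<rho> R(1)[OF x(1) x'(2)]] by simp_all
    then have "AE w in M. R x c w = \<rho> w" by eventually_elim simp
    then show "\<exists>c\<in>?L. AE w in M. R x c w = \<rho> w" using x'(2) by blast
  qed
  \<comment> \<open>Both sides express that \<open>aff u r\<close> lies below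
    \<open>ind x c\<close>, the left one by evaluation at x, the right one after applying S, where
    the roles of affine and point functions are exchanged.\<close>
  have KEY: "(AE w in M. b x u w + r w \<le> c w) \<longleftrightarrow> (AE w in M. b (\<eta> x) (P u) w + R x c w \<le> Q u r w)"
    if x: "x \<in> X" and u: "u \<in> Y" and r: "r \<in> ?L" and c: "c \<in> ?L" for x u r c
  proof -
    have "(AE w in M. b x u w + r w \<le> c w) \<longleftrightarrow> (AE w in M. rep (aff u r x) w \<le> ereal (c w))"
      using affine_rep[OF x u r] by (intro iffI; auto elim: eventually_elim2)
    also have "\<dots> \<longleftrightarrow> fun_le M X (aff u r) (ind x c)"
      by (rule le_point_fun_iff[OF affine_in[OF u r] x c, symmetric])
    also have "\<dots> \<longleftrightarrow> fun_le M Y (aff' (\<eta> x) (R x c)) (ind' (P u) (Q u r))"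
      using rev_bijD(3)[OF S affine_in[OF u r] point_fun_in[OF x c]] R(2)[OF x c] Q(2)[OF u r] by simp
    also have "\<dots> \<longleftrightarrow> (AE w in M. rep (aff' (\<eta> x) (R x c) (P u)) w \<le> ereal (Q u r w))"
      by (rule sw.le_point_fun_iff[OF sw.affine_in[OF \<eta>[OF x] R(1)[OF x c]] P[OF u] Q(1)[OF u r]])
    also have "\<dots> \<longleftrightarrow> (AE w in M. b (\<eta> x) (P u) w + R x c w \<le> Q u r w)"
      using sw.affine_rep[OF P[OF u] \<eta>[OF x] R(1)[OF x c]] by (intro iffI; auto elim: eventually_elim2)
    finally show ?thesis .
  qed
  have R_mono: "(AE w in M. c w \<le> c' w) \<longleftrightarrow> (AE w in M. R x c' w \<le> R x c w)"
    if x: "x \<in> X" and c: "c \<in> ?L" "c' \<in> ?L" for x c c'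
    using point_fun_mono[OF x c] rev_bijD(3)[OF S point_fun_in[OF x c(1)] point_fun_in[OF x c(2)]]
      R(2)[OF x c(1)] R(2)[OF x c(2)] sw.affine_le_iff[OF \<eta>[OF x] R(1)[OF x c(2)] R(1)[OF x c(1)]] by simp
  have R_cong: "AE w in M. R x c w = R x c' w"
    if x: "x \<in> X" and c: "c \<in> ?L" "c' \<in> ?L" and e: "AE w in M. c w = c' w" for x c c'
  proof -
    have "AE w in M. c w \<le> c' w" "AE w in M. c' w \<le> c w" using e by (auto elim: eventually_mono)
    then have "AE w in M. R x c' w \<le> R x c w" "AE w in M. R x c w \<le> R x c' w"
      using R_mono[OF x c] R_mono[OF x c(2,1)] by simp_all
    then show ?thesis by eventually_elim simp
  qed
  \<comment> \<open>At the critical value c = u(x) + r the right side of \<open>KEY\<close> is an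
    equality: \<open>R_onto\<close> supplies a c' for which equality holds, \<open>KEY\<close> shows
    c <= c', and \<open>R_mono\<close> compares the two constants.\<close>
  have STAR: "AE w in M. R x (\<lambda>w. b x u w + r w) w = Q u r w - b (\<eta> x) (P u) w"
    if x: "x \<in> X" and u: "u \<in> Y" and r[measurable]: "r \<in> ?L" for x u r
  proof -
    let ?c = "\<lambda>w. b x u w + r w" and ?\<rho> = "\<lambda>w. Q u r w - b (\<eta> x) (P u) w"
    have c: "?c \<in> ?L" using x u by measurable
    have \<rho>: "?\<rho> \<in> ?L" using \<eta>[OF x] P[OF u] u r by measurable
    have 1: "AE w in M. b (\<eta> x) (P u) w + R x ?c w \<le> Q u r w" using KEY[OF x u r c] by simp
    obtain c' where c': "c' \<in> ?L" "AE w in M. R x c' w = ?\<rho> w" using R_onto[OF \<eta>[OF x] \<rho> x refl] by blast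
    have "AE w in M. b (\<eta> x) (P u) w + R x c' w \<le> Q u r w" using c'(2) by eventually_elim simp
    then have "AE w in M. ?c w \<le> c' w" using KEY[OF x u r c'(1)] by simp
    then have "AE w in M. R x c' w \<le> R x ?c w" using R_mono[OF x c c'(1)] by simp
    then show ?thesis using 1 c'(2) by eventually_elim simp
  qed
  \<comment> \<open>Stability enters here: pasting \<open>ind x c\<close> on A into
    \<open>ind x c'\<close> changes nothing, so the constants of the two images agree on A.\<close>
  have R_local: "AE w in M. w \<in> A \<longrightarrow> R x c w = R x c' w"
    if x: "x \<in> X" and c: "c \<in> ?L" "c' \<in> ?L" and A: "A \<in> sets M" and e: "AE w in M. w \<in> A \<longrightarrow> c w = c' w" for x c c' A
  proof -
    have i: "ind x c \<in> C" "ind x c' \<in> C" using x c by (auto intro: point_fun_in)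
    have "aff' (\<eta> x) (R x c') = paste M Y A (aff' (\<eta> x) (R x c)) (aff' (\<eta> x) (R x c'))"
      using st[OF A i] paste_point_fun[OF x c A e] R(2)[OF x c(1)] R(2)[OF x c(2)] by simp
    then have p: "paste M Y A (aff' (\<eta> x) (R x c)) (aff' (\<eta> x) (R x c')) zrY = aff' (\<eta> x) (R x c') zrY" by simp
    have "AE w in M. rep (aff' (\<eta> x) (R x c') zrY) w = (if w \<in> A then rep (aff' (\<eta> x) (R x c) zrY) w else rep (aff' (\<eta> x) (R x c') zrY) w)"
      using sw.paste_rep(1)[of zrY "aff' (\<eta> x) (R x c)" "aff' (\<eta> x) (R x c')" A, OF Y.zr_in _ _ A] unfolding p
      by (simp add: sw.fclD(1)[OF sw.affine_in] \<eta>[OF x] R(1) x c)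
    then show ?thesis
      using sw.affine_rep[OF Y.zr_in \<eta>[OF x] R(1)[OF x c(1)]] sw.affine_rep[OF Y.zr_in \<eta>[OF x] R(1)[OF x c(2)]]
      by eventually_elim (auto split: if_splits)
  qed
  \<comment> \<open>The operator may shift the origin on both sides, so \<open>\<eta>\<close> and
    \<open>P\<close> are expected to be affine; their values at zero will be subtracted.\<close>
  define p0 where "p0 = P zrY"
  define \<eta>0 where "\<eta>0 = \<eta> zrX"
  define q where "q = Q zrY"
  have p0: "p0 \<in> Y" and \<eta>0: "\<eta>0 \<in> X" using P \<eta> by (auto simp: p0_def \<eta>0_def)
  have qm: "q r \<in> ?L" if "r \<in> ?L" for r using Q(1) that by (simp add: q_def)
  \<comment> \<open>The choice u = 0 in \<open>STAR\<close> expresses R through q, and x = 0 then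
    expresses Q through q, so that a single function q of one scalar remains.\<close>
  have Rq: "AE w in M. R x r w = q r w - b (\<eta> x) p0 w" if x: "x \<in> X" and r[measurable]: "r \<in> ?L" for x r
  proof -
    have m: "(\<lambda>w. b x zrY w + r w) \<in> ?L" using x by measurable
    have "AE w in M. b x zrY w + r w = r w" using Y.rlin_zr[OF linY[OF x]] by eventually_elim simp
    from R_cong[OF x m r this] STAR[OF x Y.zr_in r] show ?thesis
      unfolding q_def p0_def by eventually_elim simp
  qed
  have Qq: "AE w in M. Q u r w = q r w + b \<eta>0 (P u) w - b \<eta>0 p0 w" if u: "u \<in> Y" and r[measurable]: "r \<in> ?L" for u r
  proof -
    have m: "(\<lambda>w. b zrX u w + r w) \<in> ?L" using u by measurable
    have "AE w in M. b zrX u w + r w = r w" using X.rlin_zr[OF linX[OF u]] by eventually_elim simp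
    from R_cong[OF X.zr_in m r this] STAR[OF X.zr_in u r] Rq[OF X.zr_in r] show ?thesis
      unfolding \<eta>0_def by eventually_elim simp
  qed
  have qshift: "AE w in M. q (\<lambda>w. b x u w + r w) w = q r w - (b (\<eta> x) (P u) w - b (\<eta> x) p0 w - b \<eta>0 (P u) w + b \<eta>0 p0 w)"
    if x: "x \<in> X" and u: "u \<in> Y" and r[measurable]: "r \<in> ?L" for x u r
  proof -
    have m: "(\<lambda>w. b x u w + r w) \<in> ?L" using x u by measurable
    show ?thesis using Rq[OF x m] STAR[OF x u r] Qq[OF u r] by eventually_elim simp
  qed
  have q_mono: "(AE w in M. c w \<le> c' w) \<longleftrightarrow> (AE w in M. q c' w \<le> q c w)" if c: "c \<in> ?L" "c' \<in> ?L" for c c'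
  proof -
    have "(AE w in M. R zrX c' w \<le> R zrX c w) \<longleftrightarrow> (AE w in M. q c' w \<le> q c w)"
      using AE_conjI[OF Rq[OF X.zr_in c(1)] Rq[OF X.zr_in c(2)]] by (intro iffI; auto elim: eventually_elim2)
    then show ?thesis using R_mono[OF X.zr_in c] by simp
  qed
  have q_local: "AE w in M. w \<in> A \<longrightarrow> q c w = q c' w"
    if "A \<in> sets M" "c \<in> ?L" "c' \<in> ?L" "AE w in M. w \<in> A \<longrightarrow> c w = c' w" for A c c'
    using R_local[OF X.zr_in that(2,3,1,4)] Rq[OF X.zr_in that(2)] Rq[OF X.zr_in that(3)]
    by eventually_elim auto
  have q_cong: "AE w in M. q c w = q c' w" if "c \<in> ?L" "c' \<in> ?L" "AE w in M. c w = c' w" for c c'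
    using q_local[OF sets.top that(1,2)] that(3) AE_space by (auto elim!: eventually_rev_mp)
  have q_add: "AE w in M. q (\<lambda>w. a w + r w) w = q a w + q r w - q (\<lambda>_. 0) w" if a[measurable]: "a \<in> ?L" and r[measurable]: "r \<in> ?L" for a r
  proof -
    \<comment> \<open>Scaling the point that has pairing 1 with \<open>y1\<close> makes the pairing
      an arbitrary scalar a, which turns \<open>qshift\<close> into additivity of q.\<close>
    let ?x = "acX a x1"
    have x: "?x \<in> X" using a unit by simp
    have m[measurable]: "b ?x y1 \<in> ?L" using x unit by measurable
    have ba: "AE w in M. b ?x y1 w = a w"
      using X.rlinD(3)[OF linX[OF unit(2)] a unit(1)] unit(3) by eventually_elim simp
    have 1: "AE w in M. q (\<lambda>w. b ?x y1 w + r w) w = q (\<lambda>w. a w + r w) w"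
      by (rule q_cong) (use ba in \<open>auto elim!: eventually_mono\<close>)
    have 2: "AE w in M. q (\<lambda>w. b ?x y1 w + (\<lambda>_. 0) w) w = q a w"
      by (rule q_cong) (use ba in \<open>auto elim!: eventually_mono\<close>)
    show ?thesis using 1 2 qshift[OF x unit(2) r] qshift[OF x unit(2), of "\<lambda>_. 0", simplified]
      by (auto elim!: eventually_rev_mp)
  qed
  define t where "t w = q (\<lambda>_. 0) w - q (\<lambda>_. 1) w" for w
  have [measurable]: "q (\<lambda>_. 0) \<in> ?L" "q (\<lambda>_. 1) \<in> ?L" using qm by auto
  have tm[measurable]: "t \<in> ?L" unfolding t_def by measurable
  have q_lin0: "AE w in M. q a w = q (\<lambda>_. 0) w - t w * a w" if "a \<in> ?L" for a
    unfolding t_def using q_add q_mono q_local by (intro X.affine_of_additive_local that) auto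
  have tpos: "AE w in M. 0 < t w"
  proof -
    \<comment> \<open>On the set where t <= 0, raising the argument of q from 0 to 1 does not lower
      q. By \<open>q_mono\<close> this implies that the indicator of the set is at most 0, so the
      set is null.\<close>
    define A where "A = {w \<in> space M. t w \<le> 0}"
    have A[measurable]: "A \<in> sets M" unfolding A_def by measurable
    have Im: "(indicator A :: 'w \<Rightarrow> real) \<in> ?L" by measurable
    have "AE w in M. q (\<lambda>_. 0) w \<le> q (indicator A) w"
      using q_lin0[OF Im] AE_space by eventually_elim (auto simp: A_def indicator_def)
    then have "AE w in M. indicator A w \<le> (0::real)" using q_mono[OF Im, of "\<lambda>_. 0"] by simp
    then show ?thesis using AE_space
    proof eventually_elim
      case (elim w)
      then show ?case by (cases "t w \<le> 0") (simp_all add: A_def)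
    qed
  qed
  \<comment> \<open>A change on a null set makes the slope positive everywhere, so that 1 / \<tau>
    is its inverse as a function and the scalar laws apply literally.\<close>
  define \<tau> where "\<tau> w = (if 0 < t w then t w else 1)" for w
  have \<tau>m[measurable]: "\<tau> \<in> ?L" unfolding \<tau>_def by measurable
  have \<tau>0: "0 < \<tau> w" for w by (simp add: \<tau>_def)
  have q_lin: "AE w in M. q a w = q (\<lambda>_. 0) w - \<tau> w * a w" if "a \<in> ?L" for a
    using q_lin0[OF that] tpos by eventually_elim (simp add: \<tau>_def)
  define d where "d x = plX (\<eta> x) (X.neg \<eta>0)" for x
  define P' where "P' u = plY (P u) (Y.neg p0)" for u
  have dX: "d x \<in> X" if "x \<in> X" for x using \<eta>[OF that] \<eta>0 by (simp add: d_def)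
  have P'Y: "P' u \<in> Y" if "u \<in> Y" for u using P[OF that] p0 by (simp add: P'_def)
  have bd: "AE w in M. b (d x) y w = b (\<eta> x) y w - b \<eta>0 y w" if "x \<in> X" "y \<in> Y" for x y
    unfolding d_def by (rule X.rlin_diff[OF linX[OF that(2)] \<eta>[OF that(1)] \<eta>0])
  have bP: "AE w in M. b x (P' u) w = b x (P u) w - b x p0 w" if "x \<in> X" "u \<in> Y" for x u
    unfolding P'_def by (rule Y.rlin_diff[OF linY[OF that(1)] P[OF that(2)] p0])
  have P'_onto: "P' ` Y = Y"
  proof
    show "P' ` Y \<subseteq> Y" using P'Y by auto
    show "Y \<subseteq> P' ` Y"
    proof
      fix y assume y: "y \<in> Y"
      then obtain u where u: "u \<in> Y" "P u = plY y p0" using P_onto[of "plY y p0"] p0 by auto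
      have "P' u = y" unfolding P'_def u(2) using y p0 by (simp add: Y.pl_assoc)
      then show "y \<in> P' ` Y" using u(1) by blast
    qed
  qed
  have dP: "AE w in M. b (d x) (P' u) w = \<tau> w * b x u w" if x: "x \<in> X" and u: "u \<in> Y" for x u
  proof -
    have m: "b x u \<in> ?L" using x u by measurable
    show ?thesis
      using qshift[OF x u, of "\<lambda>_. 0", simplified] q_lin[OF m] bd[OF x P'Y[OF u]] bP[OF \<eta>[OF x] u] bP[OF \<eta>0 u]
      by eventually_elim simp
  qed
  \<comment> \<open>Since \<open>P'\<close> is onto, two points that pair equally with all
    \<open>P' u\<close> coincide. Through this, the bilinear right side of \<open>dP\<close> forces
    d to be linear.\<close>
  have eqP: "x = x'" if "x \<in> X" "x' \<in> X" "\<And>u. u \<in> Y \<Longrightarrow> AE w in M. b x (P' u) w = b x' (P' u) w" for x x'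
  proof (rule eq_X[OF that(1,2)])
    fix y assume "y \<in> Y"
    then obtain u where "u \<in> Y" "y = P' u" using P'_onto by blast
    then show "AE w in M. b x y w = b x' y w" using that(3) by simp
  qed
  have d_add: "d (plX x y) = plX (d x) (d y)" if x: "x \<in> X" and y: "y \<in> X" for x y
  proof (rule eqP)
    fix u assume u: "u \<in> Y"
    show "AE w in M. b (d (plX x y)) (P' u) w = b (plX (d x) (d y)) (P' u) w"
      using dP[OF X.pl_in[OF x y] u] dP[OF x u] dP[OF y u] X.rlinD(2)[OF linX[OF u] x y]
        X.rlinD(2)[OF linX[OF P'Y[OF u]] dX[OF x] dX[OF y]]
      by eventually_elim (simp add: algebra_simps)
  qed (use x y dX in auto)
  have d_ac: "d (acX a x) = acX a (d x)" if a: "a \<in> ?L" and x: "x \<in> X" for a x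
  proof (rule eqP)
    fix u assume u: "u \<in> Y"
    show "AE w in M. b (d (acX a x)) (P' u) w = b (acX a (d x)) (P' u) w"
      using dP[OF X.ac_in[OF a x] u] dP[OF x u] X.rlinD(3)[OF linX[OF u] a x]
        X.rlinD(3)[OF linX[OF P'Y[OF u]] a dX[OF x]]
      by eventually_elim simp
  qed (use x a dX in auto)
  define i where "i w = 1 / \<tau> w" for w
  have im[measurable]: "i \<in> ?L" unfolding i_def by measurable
  have "(\<lambda>w. i w * \<tau> w) = (\<lambda>_. 1)" "(\<lambda>w. \<tau> w * i w) = (\<lambda>_. 1)"
    using \<tau>0 by (auto simp: i_def less_imp_neq[symmetric])
  then have it: "acX i (acX \<tau> x) = x" "acX \<tau> (acX i x) = x" if "x \<in> X" for x
    using X.ac_mult[OF im \<tau>m that] X.ac_mult[OF \<tau>m im that] that by simp_all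
  \<comment> \<open>Division by \<tau> removes the factor in \<open>dP\<close>, so that H preserves
    the pairing when the functional is moved by \<open>P'\<close>.\<close>
  define H where "H x = acX i (d x)" for x
  have HX: "H x \<in> X" if "x \<in> X" for x using dX[OF that] by (simp add: H_def)
  have bH: "AE w in M. b (d x) y w = \<tau> w * b (H x) y w" if x: "x \<in> X" and y: "y \<in> Y" for x y
    using X.rlinD(3)[OF linX[OF y] im dX[OF x]]
    by eventually_elim (use \<tau>0 in \<open>simp add: H_def i_def less_imp_neq[symmetric]\<close>)
  have "bij_betw H X X" unfolding bij_betw_def
  proof
    show "inj_on H X"
    proof
      fix x x' assume x: "x \<in> X" "x' \<in> X" and "H x = H x'"
      then have "acX \<tau> (acX i (d x)) = acX \<tau> (acX i (d x'))" by (simp add: H_def)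
      then have "d x = d x'" using it(2) dX x by simp
      then have "plX (plX (\<eta> x) (X.neg \<eta>0)) \<eta>0 = plX (plX (\<eta> x') (X.neg \<eta>0)) \<eta>0" by (simp add: d_def)
      then have "\<eta> x = \<eta> x'" using \<eta> x \<eta>0 by (simp add: X.pl_assoc)
      then show "x = x'" using \<eta>_inj x by blast
    qed
    show "H ` X = X"
    proof
      show "H ` X \<subseteq> X" using HX by auto
      show "X \<subseteq> H ` X"
      proof
        fix z assume z: "z \<in> X"
        then have "plX (acX \<tau> z) \<eta>0 \<in> X" using \<eta>0 by simp
        then obtain x where x: "x \<in> X" "\<eta> x = plX (acX \<tau> z) \<eta>0" using \<eta>_onto[of _ "\<lambda>_. 0"] by auto
        have "d x = acX \<tau> z" unfolding d_def x(2) using z \<eta>0 by (simp add: X.pl_assoc)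
        then have "H x = z" using it(1)[OF z] by (simp add: H_def)
        then show "z \<in> H ` X" using x by blast
      qed
    qed
  qed
  moreover have "H (plX x y) = plX (H x) (H y)" if "x \<in> X" "y \<in> X" for x y
    using d_add that dX by (simp add: H_def X.ac_addr)
  moreover have "H (acX a x) = acX a (H x)" if a: "a \<in> ?L" and x: "x \<in> X" for a x
  proof -
    have "(\<lambda>w. i w * a w) = (\<lambda>w. a w * i w)" by (simp add: mult.commute)
    then show ?thesis using d_ac[OF a x] X.ac_mult[OF im a dX[OF x]] X.ac_mult[OF a im dX[OF x]]
      by (simp add: H_def)
  qed
  moreover have "AE w in M. b (H x) (P' u) w = b x u w" if x: "x \<in> X" and u: "u \<in> Y" for x u
    using bH[OF x P'Y[OF u]] dP[OF x u]
    by eventually_elim (use \<tau>0 in \<open>simp add: less_imp_neq[symmetric]\<close>)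
  moreover
  define \<rho> where "\<rho> w = q (\<lambda>_. 0) w - b \<eta>0 p0 w" for w
  have \<rho>m: "\<rho> \<in> ?L" unfolding \<rho>_def using \<eta>0 p0 by measurable
  have val: "AE w in M. b (\<eta> x) u w + R x c w = \<tau> w * (b (H x) u w - b (H x) p0 w) + b \<eta>0 u w + \<rho> w - \<tau> w * c w"
    if x: "x \<in> X" and u: "u \<in> Y" and c: "c \<in> ?L" for x u c
    using Rq[OF x c] q_lin[OF c] bd[OF x u] bd[OF x p0] bH[OF x u] bH[OF x p0]
    by eventually_elim (simp add: \<rho>_def algebra_simps)
  have "(AE w in M. rep (S F u) w \<le> k w) \<longleftrightarrow>
      (\<forall>x\<in>X. AE w in M. ereal (\<tau> w * (b (H x) u w - b (H x) p0 w) + b \<eta>0 u w + \<rho> w) - ereal (\<tau> w) * rep (F x) w \<le> k w)"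
    if F: "F \<in> C" and u: "u \<in> Y" and k: "k \<in> \<L> M" for F u k
  proof
    assume le: "AE w in M. rep (S F u) w \<le> k w"
    obtain x0 where x0: "x0 \<in> X" "AE w in M. rep (F x0) w < \<infinity>" using fclD(3)[OF F] by blast
    show "\<forall>x\<in>X. AE w in M. ereal (\<tau> w * (b (H x) u w - b (H x) p0 w) + b \<eta>0 u w + \<rho> w) - ereal (\<tau> w) * rep (F x) w \<le> k w"
    proof
      fix x assume x: "x \<in> X"
      note [measurable] = fclD(6)[OF F x]
      define A where "A = {w \<in> space M. rep (F x) w < \<infinity>}"
      have A: "A \<in> sets M" unfolding A_def by measurable
      \<comment> \<open>A point function needs a real value, so where F x is infinite x is replaced
        by the domain point \<open>x0\<close>. There the term to be bounded is -\<infinity>, and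
        nothing is lost.\<close>
      define z where "z = X.glue A x x0"
      have z: "z \<in> X" using A x x0 by (simp add: z_def)
      have Fz: "AE w in M. rep (F z) w \<le> (if w \<in> A then rep (F x) w else rep (F x0) w)"
        unfolding z_def by (rule fcl_local[OF F x x0(1) A])
      define c where "c w = real_of_ereal (rep (F z) w)" for w
      have c: "c \<in> ?L" unfolding c_def using fclD(6)[OF F z] by measurable
      have Fc: "AE w in M. rep (F z) w = ereal (c w)"
        using Fz x0(2) fclD(7)[OF F z] AE_space
      proof eventually_elim
        case (elim w) then show ?case by (cases "rep (F z) w") (auto simp: c_def A_def split: if_splits)
      qed
      have Hz: "H z = X.glue A (H x) (H x0)"
        unfolding z_def X.glue_def using x x0 A dX HX d_add d_ac
        by (simp add: \<open>\<And>y x. x \<in> X \<Longrightarrow> y \<in> X \<Longrightarrow> H (plX x y) = plX (H x) (H y)\<close> \<open>\<And>x a. a \<in> ?L \<Longrightarrow> x \<in> X \<Longrightarrow> H (acX a x) = acX a (H x)\<close>)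
      from Fc have "AE w in M. rep (F z) w \<le> ereal (c w)" by eventually_elim simp
      then have "fun_le M X F (ind z c)" using le_point_fun_iff[OF F z c] by simp
      then have "fun_le M Y (aff' (\<eta> z) (R z c)) (S F)"
        using rev_bijD(3)[OF S F point_fun_in[OF z c]] R(2)[OF z c] by simp
      then have "AE w in M. rep (aff' (\<eta> z) (R z c) u) w \<le> rep (S F u) w" using u by (simp add: fun_le_def ae_le_def)
      then show "AE w in M. ereal (\<tau> w * (b (H x) u w - b (H x) p0 w) + b \<eta>0 u w + \<rho> w) - ereal (\<tau> w) * rep (F x) w \<le> k w"
        using le sw.affine_rep[OF u \<eta>[OF z] R(1)[OF z c]] val[OF z u c] Fc Fz fclD(7)[OF F x] AE_space
          X.rlin_glue[OF linX[OF u] HX[OF x] HX[OF x0(1)] A] X.rlin_glue[OF linX[OF p0] HX[OF x] HX[OF x0(1)] A]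
        unfolding Hz
      proof eventually_elim
        case (elim w)
        show ?case
        proof (cases "rep (F x) w")
          case (real r)
          then have wA: "w \<in> A" using elim by (simp add: A_def)
          then have "c w \<le> r" using elim real by simp
          then have "\<tau> w * c w \<le> \<tau> w * r" using \<tau>0[of w] by simp
          moreover have "b (\<eta> z) u w + R z c w = \<tau> w * (b (H x) u w - b (H x) p0 w) + b \<eta>0 u w + \<rho> w - \<tau> w * c w"
            using elim(4,9,10) wA by simp
          ultimately have "ereal (\<tau> w * (b (H x) u w - b (H x) p0 w) + b \<eta>0 u w + \<rho> w - \<tau> w * r) \<le>
             ereal (b (\<eta> z) u w + R z c w)" by simp
          also have "\<dots> \<le> k w" using order_trans[OF elim(1,2)] elim(3) by simp
          finally have "ereal (\<tau> w * (b (H x) u w - b (H x) p0 w) + b \<eta>0 u w + \<rho> w - \<tau> w * r) \<le> k w" .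
          then show ?thesis using real by simp
        next
          case PInf then show ?thesis using \<tau>0[of w] by simp
        next
          case MInf then show ?thesis using elim by simp
        qed
      qed
    qed
  next
    assume le: "\<forall>x\<in>X. AE w in M. ereal (\<tau> w * (b (H x) u w - b (H x) p0 w) + b \<eta>0 u w + \<rho> w) - ereal (\<tau> w) * rep (F x) w \<le> k w"
    show "AE w in M. rep (S F u) w \<le> k w"
    proof (rule sw.fclD(5)[OF rev_bijD(1)[OF S F] u k])
      fix z a assume am: "aminor M Y X (\<lambda>y x. b x y) (S F) z a"
      then have z: "z \<in> X" and a: "a \<in> ?L" by (auto simp: aminor_def)
      \<comment> \<open>An affine minorant of S F is the image of some \<open>ind x c\<close>, which
        lies above F as S reverses the order. Hence c is at least F x, and the minorant is bounded
        by the term at x.\<close>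
      obtain x c where x: "x \<in> X" "c \<in> ?L" "S (ind x c) = aff' z a" using affine_from_point[OF S z a] .
      have "fun_le M Y (S (ind x c)) (S F)" using am sw.aminor_iff[OF z a] x(3) by simp
      then have "fun_le M X F (ind x c)" using rev_bijD(3)[OF S F point_fun_in[OF x(1,2)]] by simp
      then have Fc: "AE w in M. rep (F x) w \<le> ereal (c w)" using le_point_fun_iff[OF F x(1,2)] by simp
      have e: "aff' (\<eta> x) (R x c) = aff' z a" using R(2)[OF x(1,2)] x(3) by simp
      have "AE w in M. ereal (b z u w + a w) = ereal (b (\<eta> x) u w + R x c w)"
        using sw.affine_rep[OF u z a] sw.affine_rep[OF u \<eta>[OF x(1)] R(1)[OF x(1,2)]] unfolding e
        by eventually_elim simp
      moreover have "AE w in M. ereal (\<tau> w * (b (H x) u w - b (H x) p0 w) + b \<eta>0 u w + \<rho> w) - ereal (\<tau> w) * rep (F x) w \<le> k w"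
        using le x(1) by blast
      ultimately show "AE w in M. ereal (b z u w + a w) \<le> k w"
        using val[OF x(1) u x(2)] Fc fclD(7)[OF F x(1)]
      proof eventually_elim
        case (elim w)
        show ?case
        proof (cases "rep (F x) w")
          case (real r)
          then have "\<tau> w * r \<le> \<tau> w * c w" using elim \<tau>0[of w] by simp
          then have "ereal (b z u w + a w) \<le> ereal (\<tau> w * (b (H x) u w - b (H x) p0 w) + b \<eta>0 u w + \<rho> w) - ereal (\<tau> w) * rep (F x) w"
            using elim real by simp
          then show ?thesis using elim(2) by (rule order_trans)
        qed (use elim in auto)
      qed
    qed
  qed
  ultimately show ?thesis using P'_onto \<eta>0 p0 \<tau>m \<tau>0 \<rho>m by (intro that[of \<eta>0 p0 \<tau> \<rho> H P'])
qed

end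

section \<open>Arithmetic of classes in terms of their representatives\<close>

lemma L0_carrier: "carrier (L0 M) = ae_classes M"
  by (simp add: L0_def)

lemma cls_L0[simp]: "a \<in> \<L> M \<Longrightarrow> cls M a \<in> carrier (L0 M)"
  by (simp add: L0_carrier cls_in)

lemma rep_L0:
  assumes "X \<in> carrier (L0 M)"
  shows "rep X \<in> \<L> M" "cls M (rep X) = X"
  using rep_props[of X M] assms by (auto simp: L0_carrier)

lemma ae_classes_eqI:
  assumes "X \<in> ae_classes M" "Y \<in> ae_classes M" "AE w in M. rep X w = rep Y w"
  shows "X = Y"
  using assms cls_eq_iff[of "rep X" M "rep Y"] rep_props by metis

lemma L0_eqI:
  "\<lbrakk>X \<in> carrier (L0 M); Y \<in> carrier (L0 M); AE w in M. rep X w = rep Y w\<rbrakk> \<Longrightarrow> X = Y"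
  unfolding L0_carrier by (rule ae_classes_eqI)

lemma rep_add_L0:
  assumes "X \<in> carrier (L0 M)" "Y \<in> carrier (L0 M)"
  shows "AE w in M. rep (X \<oplus>\<^bsub>L0 M\<^esub> Y) w = rep X w + rep Y w"
  using rep_L0(1)[OF assms(1)] rep_L0(1)[OF assms(2)] unfolding L0_def lift2_def by (simp add: rep_cls)

lemma rep_mult_L0:
  assumes "X \<in> carrier (L0 M)" "Y \<in> carrier (L0 M)"
  shows "AE w in M. rep (X \<otimes>\<^bsub>L0 M\<^esub> Y) w = rep X w * rep Y w"
  using rep_L0(1)[OF assms(1)] rep_L0(1)[OF assms(2)] unfolding L0_def lift2_def by (simp add: rep_cls)

lemma smult_L0: "X \<odot>\<^bsub>L0 M\<^esub> Y = X \<otimes>\<^bsub>L0 M\<^esub> Y"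
  by (simp add: L0_def)

lemma zero_L0: "\<zero>\<^bsub>L0 M\<^esub> = cls M (\<lambda>_. 0)" and one_L0: "\<one>\<^bsub>L0 M\<^esub> = cls M (\<lambda>_. 1)"
  by (simp_all add: L0_def)

lemma rep_zero_L0: "AE w in M. rep \<zero>\<^bsub>L0 M\<^esub> w = 0"
  by (simp add: zero_L0 rep_cls)

lemma rep_one_L0: "AE w in M. rep \<one>\<^bsub>L0 M\<^esub> w = 1"
  by (simp add: one_L0 rep_cls)

lemma cls_add:
  assumes [measurable]: "a \<in> \<L> M" "b \<in> \<L> M"
  shows "cls M (\<lambda>w. a w + b w) = cls M a \<oplus>\<^bsub>L0 M\<^esub> cls M b"
proof -
  interpret cring "L0 M" by (rule cring_L0)
  have "AE w in M. rep (cls M (\<lambda>w. a w + b w)) w = a w + b w" by (rule rep_cls) measurable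
  then have "AE w in M. rep (cls M (\<lambda>w. a w + b w)) w = rep (cls M a \<oplus>\<^bsub>L0 M\<^esub> cls M b) w"
    using rep_add_L0[OF cls_L0[OF assms(1)] cls_L0[OF assms(2)]] rep_cls[OF assms(1)] rep_cls[OF assms(2)]
    by eventually_elim simp
  then show ?thesis by (intro L0_eqI add.m_closed cls_L0) auto
qed

lemma cls_mult:
  assumes [measurable]: "a \<in> \<L> M" "b \<in> \<L> M"
  shows "cls M (\<lambda>w. a w * b w) = cls M a \<otimes>\<^bsub>L0 M\<^esub> cls M b"
proof -
  interpret cring "L0 M" by (rule cring_L0)
  have "AE w in M. rep (cls M (\<lambda>w. a w * b w)) w = a w * b w" by (rule rep_cls) measurable
  then have "AE w in M. rep (cls M (\<lambda>w. a w * b w)) w = rep (cls M a \<otimes>\<^bsub>L0 M\<^esub> cls M b) w"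
    using rep_mult_L0[OF cls_L0[OF assms(1)] cls_L0[OF assms(2)]] rep_cls[OF assms(1)] rep_cls[OF assms(2)]
    by eventually_elim simp
  then show ?thesis by (intro L0_eqI m_closed cls_L0) auto
qed

lemma rep_abs_L0:
  assumes "X \<in> carrier (L0 M)"
  shows "AE w in M. rep (L0_abs M X) w = \<bar>rep X w\<bar>" "L0_abs M X \<in> carrier (L0 M)"
  using rep_L0(1)[OF assms] unfolding lift1_def by (simp_all add: rep_cls)

lemma rep_minus_L0:
  assumes "X \<in> carrier (L0 M)" "Y \<in> carrier (L0 M)"
  shows "AE w in M. rep (X \<ominus>\<^bsub>L0 M\<^esub> Y) w = rep X w - rep Y w"
proof -
  interpret cring "L0 M" by (rule cring_L0)
  have "(X \<ominus>\<^bsub>L0 M\<^esub> Y) \<oplus>\<^bsub>L0 M\<^esub> Y = X" using assms by (simp add: minus_eq a_assoc l_neg)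
  then show ?thesis using rep_add_L0[of "X \<ominus>\<^bsub>L0 M\<^esub> Y" M Y] assms
    by (auto elim!: eventually_mono)
qed

lemma L0_posI:
  assumes "X \<in> carrier (L0 M)" "AE w in M. 0 \<le> rep X w"
  shows "X \<in> L0_pos M"
proof -
  have "AE w in M. rep \<zero>\<^bsub>L0 M\<^esub> w \<le> rep X w" using assms(2) rep_zero_L0[of M] by eventually_elim simp
  then show ?thesis using assms(1) by (simp add: L0_pos_def ae_le_def)
qed

lemma L0_posD:
  assumes "X \<in> L0_pos M"
  shows "X \<in> carrier (L0 M)" "AE w in M. 0 \<le> rep X w" "rep X \<in> \<L> M"
proof -
  show 1: "X \<in> carrier (L0 M)" using assms by (simp add: L0_pos_def)
  have "AE w in M. rep \<zero>\<^bsub>L0 M\<^esub> w \<le> rep X w" using assms by (simp add: L0_pos_def ae_le_def)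
  then show "AE w in M. 0 \<le> rep X w" using rep_zero_L0[of M] by eventually_elim simp
  show "rep X \<in> \<L> M" by (rule rep_L0(1)[OF 1])
qed

lemma module_rmodule:
  assumes P: "prob_space M" and mod: "module (L0 M) X"
  shows "rmodule M (carrier X) (add X) \<zero>\<^bsub>X\<^esub> (\<lambda>a x. cls M a \<odot>\<^bsub>X\<^esub> x)"
proof -
  interpret prob_space M by fact
  interpret X: module "L0 M" X by fact
  show ?thesis
  proof (unfold_locales, goal_cases)
    case 7 then show ?case by (simp add: cls_add X.smult_l_distr)
  next
    case 9 then show ?case by (simp add: cls_mult X.smult_assoc1)
  next
    case (10 x) then show ?case using X.smult_one[of x] by (simp add: one_L0)
  next
    case (11 x) then show ?case using X.smult_l_null[of x] by (simp add: zero_L0)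
  qed (auto simp: X.a_assoc X.smult_r_distr intro: X.a_comm)
qed

lemma (in prob_space) minus_neg:
  assumes mod: "module (L0 M) X" and x: "x \<in> carrier X" "y \<in> carrier X"
  shows "x \<ominus>\<^bsub>X\<^esub> y = x \<oplus>\<^bsub>X\<^esub> (cls M (\<lambda>_. - 1) \<odot>\<^bsub>X\<^esub> y)" "x \<ominus>\<^bsub>X\<^esub> y \<in> carrier X"
proof -
  interpret X: module "L0 M" X by fact
  interpret R: rmodule M "carrier X" "add X" "\<zero>\<^bsub>X\<^esub>" "\<lambda>a x. cls M a \<odot>\<^bsub>X\<^esub> x"
    by (rule module_rmodule[OF prob_space_axioms mod])
  have "\<ominus>\<^bsub>X\<^esub> y = cls M (\<lambda>_. - 1) \<odot>\<^bsub>X\<^esub> y"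
    using X.M.minus_equality[of "cls M (\<lambda>_. - 1) \<odot>\<^bsub>X\<^esub> y" y] R.neg_pl[OF x(2)] x by simp
  then show "x \<ominus>\<^bsub>X\<^esub> y = x \<oplus>\<^bsub>X\<^esub> (cls M (\<lambda>_. - 1) \<odot>\<^bsub>X\<^esub> y)" by (simp add: X.M.minus_eq)
  show "x \<ominus>\<^bsub>X\<^esub> y \<in> carrier X" using x by simp
qed

lemma module_L0: "module (L0 M) (L0 M)"
proof -
  interpret cring "L0 M" by (rule cring_L0)
  show ?thesis
    by (rule moduleI) (auto intro: is_cring is_abelian_group simp: smult_L0 l_distr r_distr m_assoc)
qed

lemma module_module_prod:
  assumes "module R E" "module R F"
  shows "module R (module_prod E F)"
proof -
  interpret E: module R E by fact
  interpret F: module R F by fact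
  show ?thesis
  proof (rule moduleI)
    show "abelian_group (module_prod E F)"
    proof (rule abelian_groupI)
      fix x assume "x \<in> carrier (module_prod E F)"
      then show "\<exists>y\<in>carrier (module_prod E F). y \<oplus>\<^bsub>module_prod E F\<^esub> x = \<zero>\<^bsub>module_prod E F\<^esub>"
        by (intro bexI[of _ "(\<ominus>\<^bsub>E\<^esub> fst x, \<ominus>\<^bsub>F\<^esub> snd x)"])
          (auto simp: module_prod_def E.M.l_neg F.M.l_neg)
    qed (auto simp: module_prod_def E.M.a_assoc F.M.a_assoc intro: E.M.a_comm F.M.a_comm)
  qed (auto simp: module_prod_def E.is_cring E.smult_l_distr F.smult_l_distr E.smult_r_distr F.smult_r_distr
      E.smult_assoc1 F.smult_assoc1)
qed

lemma carrier_module_prod: "carrier (module_prod E F) = carrier E \<times> carrier F"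
  by (simp add: module_prod_def)

lemma minus_module_prod:
  assumes "module R E" "module R F" "x \<in> carrier E" "y \<in> carrier E" "r \<in> carrier F" "s \<in> carrier F"
  shows "(x, r) \<ominus>\<^bsub>module_prod E F\<^esub> (y, s) = (x \<ominus>\<^bsub>E\<^esub> y, r \<ominus>\<^bsub>F\<^esub> s)"
proof -
  interpret E: module R E by fact
  interpret F: module R F by fact
  interpret P: module R "module_prod E F" by (rule module_module_prod) fact+
  have "\<ominus>\<^bsub>module_prod E F\<^esub> (y, s) = (\<ominus>\<^bsub>E\<^esub> y, \<ominus>\<^bsub>F\<^esub> s)"
    by (rule P.M.minus_equality) (use assms in \<open>auto simp: module_prod_def E.M.l_neg F.M.l_neg\<close>)
  then show ?thesis by (simp add: P.M.minus_eq E.M.minus_eq F.M.minus_eq) (simp add: module_prod_def)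
qed

section \<open>Topologies of convergence in probability\<close>

context prob_space
begin

text \<open>Markov's inequality for the truncated modulus. Together with
  \<open>prob_imp_mu_lt\<close> it shows that the balls defined by probabilities and those defined
  by \<open>mu\<close> generate the same neighbourhoods.\<close>

lemma mu_lt_imp_prob:
  assumes [measurable]: "f \<in> \<L> M" and e: "0 < e" and l: "0 < l" and mu: "mu M f < l * min 1 e"
  shows "prob {w \<in> space M. f w < e} > 1 - l"
proof -
  have "min 1 e * prob {w \<in> space M. e \<le> \<bar>f w\<bar>} < min 1 e * l"
    using mu_ge_prob[OF assms(1) e] mu by (simp add: mult.commute)
  then have "prob {w \<in> space M. e \<le> \<bar>f w\<bar>} < l" using e by (simp add: mult_less_cancel_left)
  moreover have "prob (space M - {w \<in> space M. e \<le> \<bar>f w\<bar>}) = 1 - prob {w \<in> space M. e \<le> \<bar>f w\<bar>}"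
    by (rule prob_compl) measurable
  moreover have "prob (space M - {w \<in> space M. e \<le> \<bar>f w\<bar>}) \<le> prob {w \<in> space M. f w < e}"
    by (intro finite_measure_mono) auto
  ultimately show ?thesis by linarith
qed

text \<open>The bound d is split evenly between the values below the threshold and the probability
  of exceeding it.\<close>

lemma prob_imp_mu_lt:
  assumes [measurable]: "f \<in> \<L> M" and f: "AE w in M. 0 \<le> f w" and d: "0 < d"
    and p: "prob {w \<in> space M. f w < d / 2} > 1 - d / 2"
  shows "mu M f < d"
proof -
  have "prob {w \<in> space M. d / 2 \<le> \<bar>f w\<bar>} = prob (space M - {w \<in> space M. f w < d / 2})"
    using f by (intro finite_measure_eq_AE) (auto elim!: eventually_mono)
  also have "\<dots> = 1 - prob {w \<in> space M. f w < d / 2}" by (rule prob_compl) measurable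
  finally show ?thesis using mu_le_prob[of f "d / 2"] p d by simp
qed

lemma open_prob_topology:
  assumes mod: "module (L0 M) X" and p: "\<And>p z. p \<in> \<P> \<Longrightarrow> z \<in> carrier X \<Longrightarrow> p z \<in> L0_pos M"
  shows "openin (prob_topology M X \<P>) U \<longleftrightarrow> U \<subseteq> carrier X \<and> (\<forall>x\<in>U. \<exists>Q d. finite Q \<and> Q \<subseteq> \<P> \<and> 0 < d \<and>
     (\<forall>y\<in>carrier X. (\<forall>p\<in>Q. mu M (rep (p (y \<ominus>\<^bsub>X\<^esub> x))) < d) \<longrightarrow> y \<in> U))"
proof -
  interpret X: module "L0 M" X by fact
  have "istopology (\<lambda>U. U \<subseteq> carrier X \<and>
    (\<forall>x\<in>U. \<exists>Q \<epsilon> l. finite Q \<and> Q \<subseteq> \<P> \<and> 0 < \<epsilon> \<and> 0 < l \<and> l < 1 \<and> prob_ball M X Q x \<epsilon> l \<subseteq> U))"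
    by (rule istopology_prob_topology) (auto intro: finite_measure_axioms L0_posD(1)[OF p])
  then have o: "openin (prob_topology M X \<P>) U \<longleftrightarrow> U \<subseteq> carrier X \<and>
    (\<forall>x\<in>U. \<exists>Q \<epsilon> l. finite Q \<and> Q \<subseteq> \<P> \<and> 0 < \<epsilon> \<and> 0 < l \<and> l < 1 \<and> prob_ball M X Q x \<epsilon> l \<subseteq> U)"
    unfolding prob_topology_def by (simp add: topology_inverse')
  have "(\<exists>Q \<epsilon> l. finite Q \<and> Q \<subseteq> \<P> \<and> 0 < \<epsilon> \<and> 0 < l \<and> l < 1 \<and> prob_ball M X Q x \<epsilon> l \<subseteq> U) \<longleftrightarrow>
    (\<exists>Q d. finite Q \<and> Q \<subseteq> \<P> \<and> 0 < d \<and> (\<forall>y\<in>carrier X. (\<forall>p\<in>Q. mu M (rep (p (y \<ominus>\<^bsub>X\<^esub> x))) < d) \<longrightarrow> y \<in> U))"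
    (is "?L \<longleftrightarrow> ?R") if x: "x \<in> carrier X" for x
  proof
    assume ?L
    then obtain Q e l where Q: "finite Q" "Q \<subseteq> \<P>" "0 < e" "0 < l" "l < 1" "prob_ball M X Q x e l \<subseteq> U" by blast
    have "y \<in> U" if y: "y \<in> carrier X" and m: "\<forall>p\<in>Q. mu M (rep (p (y \<ominus>\<^bsub>X\<^esub> x))) < l * min 1 e" for y
    proof -
      have "prob {w \<in> space M. rep (q (y \<ominus>\<^bsub>X\<^esub> x)) w < e} > 1 - l" if "q \<in> Q" for q
        using L0_posD(3)[OF p, of q "y \<ominus>\<^bsub>X\<^esub> x"] Q that m x y by (intro mu_lt_imp_prob) auto
      then have "y \<in> prob_ball M X Q x e l" using y by (simp add: prob_ball_def)
      then show ?thesis using Q by blast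
    qed
    then show ?R using Q by (intro exI[of _ Q] exI[of _ "l * min 1 e"]) auto
  next
    assume ?R
    then obtain Q d where Q: "finite Q" "Q \<subseteq> \<P>" "0 < d"
      "\<And>y. y \<in> carrier X \<Longrightarrow> (\<forall>p\<in>Q. mu M (rep (p (y \<ominus>\<^bsub>X\<^esub> x))) < d) \<Longrightarrow> y \<in> U" by blast
    \<comment> \<open>Capping d at 1 keeps d' / 2 below 1, as a confidence parameter must
      be.\<close>
    define d' where "d' = min d 1"
    have d': "0 < d'" "d' \<le> d" "d' \<le> 1" using Q(3) by (auto simp: d'_def)
    have "prob_ball M X Q x (d' / 2) (d' / 2) \<subseteq> U"
    proof
      fix y assume y: "y \<in> prob_ball M X Q x (d' / 2) (d' / 2)"
      then have yc: "y \<in> carrier X" by (simp add: prob_ball_def)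
      have "mu M (rep (q (y \<ominus>\<^bsub>X\<^esub> x))) < d" if "q \<in> Q" for q
      proof -
        have pos: "q (y \<ominus>\<^bsub>X\<^esub> x) \<in> L0_pos M" using Q that x yc by (intro p) auto
        have "mu M (rep (q (y \<ominus>\<^bsub>X\<^esub> x))) < d'"
          using y that d' by (intro prob_imp_mu_lt L0_posD[OF pos]) (auto simp: prob_ball_def)
        then show ?thesis using d' by simp
      qed
      then show "y \<in> U" using Q(4) yc by blast
    qed
    then show ?L using Q d' by (intro exI[of _ Q] exI[of _ "d' / 2"] exI[of _ "d' / 2"]) auto
  qed
  note eq = this
  show ?thesis unfolding o
  proof (intro conj_cong ball_cong refl)
    fix x assume "U \<subseteq> carrier X" "x \<in> U"
    then have "x \<in> carrier X" by blast
    then show "(\<exists>Q \<epsilon> l. finite Q \<and> Q \<subseteq> \<P> \<and> 0 < \<epsilon> \<and> 0 < l \<and> l < 1 \<and> prob_ball M X Q x \<epsilon> l \<subseteq> U) \<longleftrightarrow>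
      (\<exists>Q d. finite Q \<and> Q \<subseteq> \<P> \<and> 0 < d \<and> (\<forall>y\<in>carrier X. (\<forall>p\<in>Q. mu M (rep (p (y \<ominus>\<^bsub>X\<^esub> x))) < d) \<longrightarrow> y \<in> U))"
      by (rule eq)
  qed
qed

lemma topspace_prob_topology:
  assumes mod: "module (L0 M) X" and p: "\<And>p z. p \<in> \<P> \<Longrightarrow> z \<in> carrier X \<Longrightarrow> p z \<in> L0_pos M"
  shows "topspace (prob_topology M X \<P>) = carrier X"
proof -
  have op: "openin (prob_topology M X \<P>) U \<longleftrightarrow> U \<subseteq> carrier X \<and> (\<forall>x\<in>U. \<exists>Q d. finite Q \<and> Q \<subseteq> \<P> \<and> 0 < d \<and>
     (\<forall>y\<in>carrier X. (\<forall>p\<in>Q. mu M (rep (p (y \<ominus>\<^bsub>X\<^esub> x))) < d) \<longrightarrow> y \<in> U))" for U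
    by (rule open_prob_topology[OF mod]) (rule p)
  have "openin (prob_topology M X \<P>) (carrier X)" unfolding op
    by (auto intro!: exI[of _ "{}"] exI[of _ 1])
  then have "carrier X \<subseteq> topspace (prob_topology M X \<P>)" by (rule openin_subset)
  moreover have "topspace (prob_topology M X \<P>) \<subseteq> carrier X" using openin_topspace op by blast
  ultimately show ?thesis by simp
qed

lemma closed_prob_topology:
  assumes mod: "module (L0 M) X" and p: "\<And>p z. p \<in> \<P> \<Longrightarrow> z \<in> carrier X \<Longrightarrow> p z \<in> L0_pos M"
    and G: "G \<subseteq> carrier X"
  shows "closedin (prob_topology M X \<P>) G \<longleftrightarrow> (\<forall>x\<in>carrier X. (\<forall>Q d. finite Q \<longrightarrow> Q \<subseteq> \<P> \<longrightarrow> 0 < d \<longrightarrow>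
     (\<exists>y\<in>G. \<forall>p\<in>Q. mu M (rep (p (y \<ominus>\<^bsub>X\<^esub> x))) < d)) \<longrightarrow> x \<in> G)"
proof -
  have "closedin (prob_topology M X \<P>) G \<longleftrightarrow> (\<forall>x\<in>carrier X - G. \<exists>Q d. finite Q \<and> Q \<subseteq> \<P> \<and> 0 < d \<and>
     (\<forall>y\<in>carrier X. (\<forall>p\<in>Q. mu M (rep (p (y \<ominus>\<^bsub>X\<^esub> x))) < d) \<longrightarrow> y \<in> carrier X - G))"
  proof -
    have "topspace (prob_topology M X \<P>) = carrier X" by (rule topspace_prob_topology[OF mod]) (rule p)
    moreover have "openin (prob_topology M X \<P>) U \<longleftrightarrow> U \<subseteq> carrier X \<and> (\<forall>x\<in>U. \<exists>Q d. finite Q \<and> Q \<subseteq> \<P> \<and> 0 < d \<and>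
      (\<forall>y\<in>carrier X. (\<forall>p\<in>Q. mu M (rep (p (y \<ominus>\<^bsub>X\<^esub> x))) < d) \<longrightarrow> y \<in> U))" for U
      by (rule open_prob_topology[OF mod]) (rule p)
    ultimately show ?thesis unfolding closedin_def using G by simp
  qed
  also have "\<dots> \<longleftrightarrow> (\<forall>x\<in>carrier X. (\<forall>Q d. finite Q \<longrightarrow> Q \<subseteq> \<P> \<longrightarrow> 0 < d \<longrightarrow>
     (\<exists>y\<in>G. \<forall>p\<in>Q. mu M (rep (p (y \<ominus>\<^bsub>X\<^esub> x))) < d)) \<longrightarrow> x \<in> G)"
  proof (intro iffI ballI impI)
    fix x
    assume A: "\<forall>x\<in>carrier X - G. \<exists>Q d. finite Q \<and> Q \<subseteq> \<P> \<and> 0 < d \<and>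
       (\<forall>y\<in>carrier X. (\<forall>p\<in>Q. mu M (rep (p (y \<ominus>\<^bsub>X\<^esub> x))) < d) \<longrightarrow> y \<in> carrier X - G)"
      and x: "x \<in> carrier X"
      and H: "\<forall>Q d. finite Q \<longrightarrow> Q \<subseteq> \<P> \<longrightarrow> 0 < d \<longrightarrow> (\<exists>y\<in>G. \<forall>p\<in>Q. mu M (rep (p (y \<ominus>\<^bsub>X\<^esub> x))) < d)"
    show "x \<in> G"
    proof (rule ccontr)
      assume "x \<notin> G"
      then obtain Q d where Q: "finite Q" "Q \<subseteq> \<P>" "0 < d"
        "\<forall>y\<in>carrier X. (\<forall>p\<in>Q. mu M (rep (p (y \<ominus>\<^bsub>X\<^esub> x))) < d) \<longrightarrow> y \<in> carrier X - G"
        using bspec[OF A, of x] x by auto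
      obtain y where "y \<in> G" "\<forall>p\<in>Q. mu M (rep (p (y \<ominus>\<^bsub>X\<^esub> x))) < d"
        using H[rule_format, OF Q(1-3)] by auto
      then show False using Q(4) G by auto
    qed
  next
    fix x
    assume B: "\<forall>x\<in>carrier X. (\<forall>Q d. finite Q \<longrightarrow> Q \<subseteq> \<P> \<longrightarrow> 0 < d \<longrightarrow>
       (\<exists>y\<in>G. \<forall>p\<in>Q. mu M (rep (p (y \<ominus>\<^bsub>X\<^esub> x))) < d)) \<longrightarrow> x \<in> G"
      and x: "x \<in> carrier X - G"
    have "\<not> (\<forall>Q d. finite Q \<longrightarrow> Q \<subseteq> \<P> \<longrightarrow> 0 < d \<longrightarrow> (\<exists>y\<in>G. \<forall>p\<in>Q. mu M (rep (p (y \<ominus>\<^bsub>X\<^esub> x))) < d))"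
      using bspec[OF B, of x] x by auto
    then obtain Q d where "finite Q" "Q \<subseteq> \<P>" "0 < d" "\<not> (\<exists>y\<in>G. \<forall>p\<in>Q. mu M (rep (p (y \<ominus>\<^bsub>X\<^esub> x))) < d)" by auto
    then show "\<exists>Q d. finite Q \<and> Q \<subseteq> \<P> \<and> 0 < d \<and>
       (\<forall>y\<in>carrier X. (\<forall>p\<in>Q. mu M (rep (p (y \<ominus>\<^bsub>X\<^esub> x))) < d) \<longrightarrow> y \<in> carrier X - G)"
      by (intro exI[of _ Q] exI[of _ d]) auto
  qed
  finally show ?thesis .
qed

text \<open>What the absolute value on the scalars and the norm of E share, so that continuity of
  functionals and of endomorphisms is handled by one lemma.\<close>

definition l0norm :: "(('a \<Rightarrow> real) set, 'e) module \<Rightarrow> ('e \<Rightarrow> ('a \<Rightarrow> real) set) \<Rightarrow> bool" where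
  "l0norm X p \<longleftrightarrow> module (L0 M) X \<and> (\<forall>x\<in>carrier X. p x \<in> L0_pos M) \<and> p \<zero>\<^bsub>X\<^esub> = \<zero>\<^bsub>L0 M\<^esub> \<and>
     (\<forall>x\<in>carrier X. \<forall>y\<in>carrier X. AE w in M. rep (p (x \<oplus>\<^bsub>X\<^esub> y)) w \<le> rep (p x) w + rep (p y) w)"

lemma l0normD:
  assumes "l0norm X p"
  shows "module (L0 M) X" "x \<in> carrier X \<Longrightarrow> p x \<in> L0_pos M"
    "x \<in> carrier X \<Longrightarrow> rep (p x) \<in> \<L> M" "x \<in> carrier X \<Longrightarrow> AE w in M. 0 \<le> rep (p x) w"
    "x \<in> carrier X \<Longrightarrow> y \<in> carrier X \<Longrightarrow> mu M (rep (p (x \<oplus>\<^bsub>X\<^esub> y))) \<le> mu M (rep (p x)) + mu M (rep (p y))"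
    "mu M (rep (p \<zero>\<^bsub>X\<^esub>)) = 0"
proof -
  interpret X: module "L0 M" X using assms by (simp add: l0norm_def)
  show mod: "module (L0 M) X" and pos: "x \<in> carrier X \<Longrightarrow> p x \<in> L0_pos M" for x
    using assms by (simp_all add: l0norm_def)
  show m: "x \<in> carrier X \<Longrightarrow> rep (p x) \<in> \<L> M" and nn: "x \<in> carrier X \<Longrightarrow> AE w in M. 0 \<le> rep (p x) w" for x
    using L0_posD[OF pos] by auto
  show "mu M (rep (p \<zero>\<^bsub>X\<^esub>)) = 0"
    using mu_eq_0[OF m[OF X.M.zero_closed]] rep_zero_L0[of M] assms by (simp add: l0norm_def)
  assume x: "x \<in> carrier X" and y: "y \<in> carrier X"
  have "AE w in M. rep (p (x \<oplus>\<^bsub>X\<^esub> y)) w \<le> rep (p x) w + rep (p y) w"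
    using assms x y by (simp add: l0norm_def)
  then have "AE w in M. \<bar>rep (p (x \<oplus>\<^bsub>X\<^esub> y)) w\<bar> \<le> \<bar>rep (p x) w\<bar> + \<bar>rep (p y) w\<bar>"
    using nn[OF x] nn[OF y] nn[OF X.M.a_closed[OF x y]] by eventually_elim simp
  then show "mu M (rep (p (x \<oplus>\<^bsub>X\<^esub> y))) \<le> mu M (rep (p x)) + mu M (rep (p y))"
    using m x y by (intro mu_le_add) auto
qed

lemma hom_minus:
  assumes E: "module (L0 M) X" and F: "module (L0 M) Y" and h: "h \<in> module_homs (L0 M) X Y"
    and x: "x \<in> carrier X" "y \<in> carrier X"
  shows "h (x \<ominus>\<^bsub>X\<^esub> y) = h x \<ominus>\<^bsub>Y\<^esub> h y"
proof -
  interpret X: module "L0 M" X by fact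
  interpret Y: module "L0 M" Y by fact
  have c: "h z \<in> carrier Y" if "z \<in> carrier X" for z using h that by (auto simp: module_homs_def)
  have "cls M (\<lambda>_. - 1) \<odot>\<^bsub>X\<^esub> y \<in> carrier X" using x by simp
  then have "h (x \<oplus>\<^bsub>X\<^esub> cls M (\<lambda>_. - 1) \<odot>\<^bsub>X\<^esub> y) = h x \<oplus>\<^bsub>Y\<^esub> (cls M (\<lambda>_. - 1) \<odot>\<^bsub>Y\<^esub> h y)"
    using h x by (auto simp: module_homs_def)
  then show ?thesis by (simp add: minus_neg(1)[OF E x] minus_neg(1)[OF F c[OF x(1)] c[OF x(2)]])
qed

text \<open>A homomorphism commutes with differences, so continuity at zero spreads to every point.
  It is the form in which continuity is used throughout.\<close>

lemma continuous_hom_iff: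
  assumes p: "l0norm X p" and q: "l0norm Y q" and h: "h \<in> module_homs (L0 M) X Y"
  shows "continuous_map (eps_lambda_topology M X p) (eps_lambda_topology M Y q) h \<longleftrightarrow>
    (\<forall>e>0. \<exists>d>0. \<forall>x\<in>carrier X. mu M (rep (p x)) < d \<longrightarrow> mu M (rep (q (h x))) < e)" (is "?C \<longleftrightarrow> ?E")
proof -
  note mp = l0normD(1)[OF p] and mq = l0normD(1)[OF q]
  interpret X: module "L0 M" X by (rule mp)
  interpret Y: module "L0 M" Y by (rule mq)
  have opX: "openin (eps_lambda_topology M X p) U \<longleftrightarrow> U \<subseteq> carrier X \<and> (\<forall>x\<in>U. \<exists>Q d. finite Q \<and> Q \<subseteq> {p} \<and> 0 < d \<and>
     (\<forall>y\<in>carrier X. (\<forall>p\<in>Q. mu M (rep (p (y \<ominus>\<^bsub>X\<^esub> x))) < d) \<longrightarrow> y \<in> U))" for U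
    by (rule open_prob_topology[OF mp]) (use l0normD(2)[OF p] in auto)
  have opY: "openin (eps_lambda_topology M Y q) U \<longleftrightarrow> U \<subseteq> carrier Y \<and> (\<forall>x\<in>U. \<exists>Q d. finite Q \<and> Q \<subseteq> {q} \<and> 0 < d \<and>
     (\<forall>y\<in>carrier Y. (\<forall>p\<in>Q. mu M (rep (p (y \<ominus>\<^bsub>Y\<^esub> x))) < d) \<longrightarrow> y \<in> U))" for U
    by (rule open_prob_topology[OF mq]) (use l0normD(2)[OF q] in auto)
  have tX: "topspace (eps_lambda_topology M X p) = carrier X"
    by (rule topspace_prob_topology[OF mp]) (use l0normD(2)[OF p] in auto)
  have tY: "topspace (eps_lambda_topology M Y q) = carrier Y"
    by (rule topspace_prob_topology[OF mq]) (use l0normD(2)[OF q] in auto)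
  have hc: "h z \<in> carrier Y" if "z \<in> carrier X" for z using h that by (auto simp: module_homs_def)
  have h0: "h \<zero>\<^bsub>X\<^esub> = \<zero>\<^bsub>Y\<^esub>"
    using hom_minus[OF mp mq h, of "\<zero>\<^bsub>X\<^esub>" "\<zero>\<^bsub>X\<^esub>"] hc[of "\<zero>\<^bsub>X\<^esub>"] by (simp add: X.M.r_neg X.M.minus_eq Y.M.minus_eq Y.M.r_neg)
  show ?thesis
  proof
    assume C: ?C
    show ?E
    proof (intro allI impI)
      fix e :: real assume e: "0 < e"
      define U where "U = {z \<in> carrier Y. mu M (rep (q z)) < e}"
      have "openin (eps_lambda_topology M Y q) U" unfolding opY
      proof (intro conjI ballI)
        show "U \<subseteq> carrier Y" by (auto simp: U_def)
        fix x assume x: "x \<in> U"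
        then have xc: "x \<in> carrier Y" and mx: "mu M (rep (q x)) < e" by (auto simp: U_def)
        have "y \<in> U" if y: "y \<in> carrier Y" and m: "mu M (rep (q (y \<ominus>\<^bsub>Y\<^esub> x))) < e - mu M (rep (q x))" for y
        proof -
          have "(y \<ominus>\<^bsub>Y\<^esub> x) \<oplus>\<^bsub>Y\<^esub> x = y" using y xc by (simp add: Y.M.minus_eq Y.M.a_assoc Y.M.l_neg)
          then have "mu M (rep (q y)) \<le> mu M (rep (q (y \<ominus>\<^bsub>Y\<^esub> x))) + mu M (rep (q x))"
            using l0normD(5)[OF q, of "y \<ominus>\<^bsub>Y\<^esub> x" x] y xc by simp
          then show ?thesis using m y by (simp add: U_def)
        qed
        then show "\<exists>Q d. finite Q \<and> Q \<subseteq> {q} \<and> 0 < d \<and> (\<forall>y\<in>carrier Y. (\<forall>p\<in>Q. mu M (rep (p (y \<ominus>\<^bsub>Y\<^esub> x))) < d) \<longrightarrow> y \<in> U)"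
          using mx by (intro exI[of _ "{q}"] exI[of _ "e - mu M (rep (q x))"]) auto
      qed
      then have o: "openin (eps_lambda_topology M X p) {x \<in> carrier X. h x \<in> U}"
        using C tX by (simp add: continuous_map_def)
      have "\<zero>\<^bsub>X\<^esub> \<in> {x \<in> carrier X. h x \<in> U}"
        using l0normD(6)[OF q] e by (simp add: U_def h0)
      from o[unfolded opX, THEN conjunct2, rule_format, OF this]
      obtain Q d where Q: "Q \<subseteq> {p}" "0 < d"
        "\<And>y. y \<in> carrier X \<Longrightarrow> (\<forall>p\<in>Q. mu M (rep (p (y \<ominus>\<^bsub>X\<^esub> \<zero>\<^bsub>X\<^esub>))) < d) \<Longrightarrow> y \<in> {x \<in> carrier X. h x \<in> U}"
        by blast
      have "mu M (rep (q (h x))) < e" if x: "x \<in> carrier X" and m: "mu M (rep (p x)) < d" for x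
      proof -
        have "x \<ominus>\<^bsub>X\<^esub> \<zero>\<^bsub>X\<^esub> = x" using x by (simp add: X.M.minus_eq)
        then show ?thesis using Q(3)[OF x] Q(1) m by (auto simp: U_def)
      qed
      then show "\<exists>d>0. \<forall>x\<in>carrier X. mu M (rep (p x)) < d \<longrightarrow> mu M (rep (q (h x))) < e"
        using Q(2) by blast
    qed
  next
    assume E: ?E
    show ?C unfolding continuous_map_def tX tY
    proof (intro conjI allI impI)
      show "h \<in> carrier X \<rightarrow> carrier Y" using hc by auto
      fix U assume "openin (eps_lambda_topology M Y q) U"
      note U = this[unfolded opY, THEN conjunct2, rule_format]
      show "openin (eps_lambda_topology M X p) {x \<in> carrier X. h x \<in> U}" unfolding opX
      proof (intro conjI ballI)
        fix x assume "x \<in> {x \<in> carrier X. h x \<in> U}"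
        then have x: "x \<in> carrier X" "h x \<in> U" by auto
        obtain Q e where Q: "finite Q" "Q \<subseteq> {q}" "0 < e"
          "\<And>y. y \<in> carrier Y \<Longrightarrow> (\<forall>p\<in>Q. mu M (rep (p (y \<ominus>\<^bsub>Y\<^esub> h x))) < e) \<Longrightarrow> y \<in> U" using U[OF x(2)] by blast
        obtain d where d: "0 < d" "\<And>x. x \<in> carrier X \<Longrightarrow> mu M (rep (p x)) < d \<Longrightarrow> mu M (rep (q (h x))) < e"
          using E Q(3) by blast
        have "h y \<in> U" if y: "y \<in> carrier X" and m: "mu M (rep (p (y \<ominus>\<^bsub>X\<^esub> x))) < d" for y
        proof (rule Q(4)[OF hc[OF y]])
          show "\<forall>p\<in>Q. mu M (rep (p (h y \<ominus>\<^bsub>Y\<^esub> h x))) < e"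
            using d(2)[of "y \<ominus>\<^bsub>X\<^esub> x"] m x y Q(2) hom_minus[OF mp mq h y x(1)] by auto
        qed
        then show "\<exists>Q d. finite Q \<and> Q \<subseteq> {p} \<and> 0 < d \<and> (\<forall>y\<in>carrier X. (\<forall>p\<in>Q. mu M (rep (p (y \<ominus>\<^bsub>X\<^esub> x))) < d) \<longrightarrow> y \<in> {x \<in> carrier X. h x \<in> U})"
          using d(1) by (intro exI[of _ "{p}"] exI[of _ d]) auto
      qed auto
    qed
  qed
qed

end

section \<open>Random normed modules and their duals\<close>

context prob_space
begin

lemma l0norm_L0: "l0norm (L0 M) (L0_abs M)"
proof -
  interpret cring "L0 M" by (rule cring_L0)
  have "L0_abs M x \<in> L0_pos M" if "x \<in> carrier (L0 M)" for x
    using rep_abs_L0[OF that] by (intro L0_posI) (auto elim: eventually_mono)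
  moreover have "L0_abs M \<zero>\<^bsub>L0 M\<^esub> = \<zero>\<^bsub>L0 M\<^esub>"
  proof (rule L0_eqI)
    show "AE w in M. rep (L0_abs M \<zero>\<^bsub>L0 M\<^esub>) w = rep \<zero>\<^bsub>L0 M\<^esub> w"
      using rep_abs_L0(1)[OF zero_closed] rep_zero_L0 by eventually_elim simp
  qed (auto intro: rep_abs_L0)
  moreover have "AE w in M. rep (L0_abs M (x \<oplus>\<^bsub>L0 M\<^esub> y)) w \<le> rep (L0_abs M x) w + rep (L0_abs M y) w"
    if "x \<in> carrier (L0 M)" "y \<in> carrier (L0 M)" for x y
    using rep_abs_L0(1)[OF that(1)] rep_abs_L0(1)[OF that(2)] rep_abs_L0(1)[OF add.m_closed[OF that]] rep_add_L0[OF that]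
    by eventually_elim simp
  ultimately show ?thesis using module_L0[of M] by (simp add: l0norm_def)
qed

lemma mu_abs_L0: "x \<in> carrier (L0 M) \<Longrightarrow> mu M (rep (L0_abs M x)) = mu M (rep x)"
  using rep_abs_L0[of x M] rep_L0(1)[of _ M] by (intro antisym mu_mono) (auto elim: eventually_mono)

lemma mu_minus_L0:
  "x \<in> carrier (L0 M) \<Longrightarrow> y \<in> carrier (L0 M) \<Longrightarrow> mu M (rep (x \<ominus>\<^bsub>L0 M\<^esub> y)) = mu M (\<lambda>w. rep x w - rep y w)"
proof -
  interpret cring "L0 M" by (rule cring_L0)
  assume "x \<in> carrier (L0 M)" "y \<in> carrier (L0 M)"
  then show ?thesis using rep_minus_L0[of x M y] rep_L0(1)[of _ M]
    by (intro mu_cong) auto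
qed

text \<open>The lattice supremum is defined by choice. The class of the essential supremum of the
  representatives is a least upper bound, so one exists and the chosen one has the stated
  properties.\<close>

lemma sup_L0bar:
  assumes A: "A \<subseteq> ae_classes M"
  shows "\<Squnion>\<^bsub>L0bar M\<^esub> A \<in> ae_classes M" "X \<in> A \<Longrightarrow> AE w in M. rep X w \<le> rep (\<Squnion>\<^bsub>L0bar M\<^esub> A) w"
    "\<lbrakk>h \<in> \<L> M; \<And>X. X \<in> A \<Longrightarrow> AE w in M. rep X w \<le> h w\<rbrakk> \<Longrightarrow> AE w in M. rep (\<Squnion>\<^bsub>L0bar M\<^esub> A) w \<le> h w"
proof -
  have F: "rep ` A \<subseteq> \<L> M" using A rep_props(1) by auto
  let ?h = "ess_lub M (rep ` A)"
  have hm: "?h \<in> \<L> M" by (rule ess_lub(1)[OF F])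
  have "least (L0bar M) (cls M ?h) (Upper (L0bar M) A)"
    unfolding least_def
  proof (intro conjI ballI)
    have "AE w in M. rep X w \<le> rep (cls M ?h) w" if "X \<in> A" for X
      using ess_lub(2)[OF F, of "rep X"] that rep_cls[OF hm] by (auto elim: eventually_elim2)
    then show "cls M ?h \<in> Upper (L0bar M) A" using A cls_in[OF hm] by (auto simp: Upper_def L0bar_def ae_le_def)
    fix U assume "U \<in> Upper (L0bar M) A"
    then have U: "U \<in> ae_classes M" "\<And>X. X \<in> A \<Longrightarrow> AE w in M. rep X w \<le> rep U w"
      using A by (auto simp: Upper_def L0bar_def ae_le_def)
    have "AE w in M. ?h w \<le> rep U w" using U by (intro ess_lub(3)[OF F]) (auto simp: rep_props)
    then show "cls M ?h \<sqsubseteq>\<^bsub>L0bar M\<^esub> U" using rep_cls[OF hm]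
      by (auto simp: L0bar_def ae_le_def elim: eventually_elim2)
  qed (auto simp: L0bar_def Upper_def)
  then have l: "least (L0bar M) (\<Squnion>\<^bsub>L0bar M\<^esub> A) (Upper (L0bar M) A)"
    unfolding sup_def by (rule someI[of "\<lambda>x. least (L0bar M) x (Upper (L0bar M) A)"])
  then show 1: "\<Squnion>\<^bsub>L0bar M\<^esub> A \<in> ae_classes M" by (simp add: least_def Upper_def L0bar_def)
  show "X \<in> A \<Longrightarrow> AE w in M. rep X w \<le> rep (\<Squnion>\<^bsub>L0bar M\<^esub> A) w"
    using l A by (auto simp: least_def Upper_def L0bar_def ae_le_def)
  assume h: "h \<in> \<L> M" "\<And>X. X \<in> A \<Longrightarrow> AE w in M. rep X w \<le> h w"
  have "AE w in M. rep X w \<le> rep (cls M h) w" if "X \<in> A" for X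
    using h(2)[OF that] rep_cls[OF h(1)] by eventually_elim simp
  then have "cls M h \<in> Upper (L0bar M) A" using A cls_in[OF h(1)] by (auto simp: Upper_def L0bar_def ae_le_def)
  then have "AE w in M. rep (\<Squnion>\<^bsub>L0bar M\<^esub> A) w \<le> rep (cls M h) w"
    using l by (auto simp: least_def L0bar_def ae_le_def)
  then show "AE w in M. rep (\<Squnion>\<^bsub>L0bar M\<^esub> A) w \<le> h w" using rep_cls[OF h(1)] by eventually_elim simp
qed

lemma open_mu_ball:
  assumes p: "l0norm X p" and x: "x \<in> carrier X"
  shows "openin (eps_lambda_topology M X p) {y \<in> carrier X. mu M (rep (p (y \<ominus>\<^bsub>X\<^esub> x))) < e}" (is "openin _ ?U")
proof -
  interpret X: module "L0 M" X by (rule l0normD(1)[OF p])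
  have op: "openin (eps_lambda_topology M X p) U \<longleftrightarrow> U \<subseteq> carrier X \<and> (\<forall>x\<in>U. \<exists>Q d. finite Q \<and> Q \<subseteq> {p} \<and> 0 < d \<and>
     (\<forall>y\<in>carrier X. (\<forall>p\<in>Q. mu M (rep (p (y \<ominus>\<^bsub>X\<^esub> x))) < d) \<longrightarrow> y \<in> U))" for U
    by (rule open_prob_topology[OF l0normD(1)[OF p]]) (use l0normD(2)[OF p] in auto)
  show ?thesis unfolding op
  proof (intro conjI ballI)
    fix z assume z: "z \<in> ?U"
    have "y \<in> ?U" if y: "y \<in> carrier X" and m: "mu M (rep (p (y \<ominus>\<^bsub>X\<^esub> z))) < e - mu M (rep (p (z \<ominus>\<^bsub>X\<^esub> x)))" for y
    proof -
      have "\<ominus>\<^bsub>X\<^esub> z \<oplus>\<^bsub>X\<^esub> (z \<oplus>\<^bsub>X\<^esub> \<ominus>\<^bsub>X\<^esub> x) = \<ominus>\<^bsub>X\<^esub> x"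
        using z x by (simp add: X.M.a_assoc[symmetric] X.M.l_neg)
      then have "(y \<ominus>\<^bsub>X\<^esub> z) \<oplus>\<^bsub>X\<^esub> (z \<ominus>\<^bsub>X\<^esub> x) = y \<ominus>\<^bsub>X\<^esub> x" using y z x by (simp add: X.M.minus_eq X.M.a_assoc)
      then show ?thesis using l0normD(5)[OF p, of "y \<ominus>\<^bsub>X\<^esub> z" "z \<ominus>\<^bsub>X\<^esub> x"] m y z x by simp
    qed
    then show "\<exists>Q d. finite Q \<and> Q \<subseteq> {p} \<and> 0 < d \<and> (\<forall>y\<in>carrier X. (\<forall>p\<in>Q. mu M (rep (p (y \<ominus>\<^bsub>X\<^esub> z))) < d) \<longrightarrow> y \<in> ?U)"
      using z by (intro exI[of _ "{p}"] exI[of _ "e - mu M (rep (p (z \<ominus>\<^bsub>X\<^esub> x)))"]) auto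
  qed auto
qed

end

context random_normed_module
begin

abbreviation ac :: "('w \<Rightarrow> real) \<Rightarrow> 'e \<Rightarrow> 'e" where "ac a x \<equiv> cls M a \<odot>\<^bsub>E\<^esub> x"
abbreviation N :: "'e \<Rightarrow> 'w \<Rightarrow> real" where "N x \<equiv> rep (nrm x)"
abbreviation D where "D \<equiv> dual M E nrm"

abbreviation add_E (infixl "\<oplus>\<^sub>E" 65) where "x \<oplus>\<^sub>E y \<equiv> x \<oplus>\<^bsub>E\<^esub> y"
abbreviation diff_E (infixl "\<ominus>\<^sub>E" 65) where "x \<ominus>\<^sub>E y \<equiv> x \<ominus>\<^bsub>E\<^esub> y"
abbreviation uminus_E ("\<ominus>\<^sub>E _" [81] 80) where "\<ominus>\<^sub>E x \<equiv> \<ominus>\<^bsub>E\<^esub> x"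
abbreviation smult_E (infixl "\<odot>\<^sub>E" 70) where "a \<odot>\<^sub>E x \<equiv> a \<odot>\<^bsub>E\<^esub> x"
abbreviation zero_E ("\<zero>\<^sub>E") where "\<zero>\<^sub>E \<equiv> \<zero>\<^bsub>E\<^esub>"
abbreviation add_D (infixl "\<oplus>\<^sub>D" 65) where "u \<oplus>\<^sub>D v \<equiv> u \<oplus>\<^bsub>D\<^esub> v"
abbreviation diff_D (infixl "\<ominus>\<^sub>D" 65) where "u \<ominus>\<^sub>D v \<equiv> u \<ominus>\<^bsub>D\<^esub> v"
abbreviation smult_D (infixl "\<odot>\<^sub>D" 70) where "a \<odot>\<^sub>D u \<equiv> a \<odot>\<^bsub>D\<^esub> u"
abbreviation zero_D ("\<zero>\<^sub>D") where "\<zero>\<^sub>D \<equiv> \<zero>\<^bsub>D\<^esub>"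

lemma module_E: "module (L0 M) E" by (rule module_axioms)

sublocale rE: rmodule M "carrier E" "add E" "\<zero>\<^sub>E" "\<lambda>a x. cls M a \<odot>\<^sub>E x"
  by (rule module_rmodule[OF prob_space_axioms module_E])

lemma N_props:
  assumes "x \<in> carrier E"
  shows "nrm x \<in> carrier (L0 M)" "AE w in M. 0 \<le> N x w" "N x \<in> \<L> M"
  using L0_posD[OF nrm_closed[OF assms]] by auto

lemma N_tri: "x \<in> carrier E \<Longrightarrow> y \<in> carrier E \<Longrightarrow> AE w in M. N (x \<oplus>\<^sub>E y) w \<le> N x w + N y w"
  using nrm_triangle[of x y] rep_add_L0[OF N_props(1) N_props(1), of x y]
  by (auto simp: ae_le_def elim: eventually_elim2)

lemma N_ac:
  assumes a: "a \<in> \<L> M" and x: "x \<in> carrier E"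
  shows "AE w in M. N (ac a x) w = \<bar>a w\<bar> * N x w"
  unfolding nrm_smult[OF cls_L0[OF a] x] using rep_mult_L0[OF rep_abs_L0(2)[OF cls_L0[OF a]] N_props(1)[OF x]]
    rep_abs_L0(1)[OF cls_L0[OF a]] rep_cls[OF a] by eventually_elim simp

lemma N_seminorm: "rE.rseminorm N"
  unfolding rE.rseminorm_def using N_props N_tri N_ac by auto

lemma N_zero: "AE w in M. N \<zero>\<^sub>E w = 0"
  using N_ac[of "\<lambda>_. 0" "\<zero>\<^sub>E"] by simp

lemma N_eq_0:
  assumes "x \<in> carrier E" "AE w in M. N x w = 0"
  shows "x = \<zero>\<^sub>E"
proof (rule nrm_zeroD[OF assms(1)])
  show "nrm x = \<zero>\<^bsub>L0 M\<^esub>"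
  proof (rule L0_eqI[OF N_props(1)[OF assms(1)]])
    show "AE w in M. N x w = rep \<zero>\<^bsub>L0 M\<^esub> w" using assms(2) rep_zero_L0 by eventually_elim simp
  qed simp
qed

lemma l0norm_E: "l0norm E nrm"
proof -
  have "nrm \<zero>\<^sub>E = \<zero>\<^bsub>L0 M\<^esub>"
  proof (rule L0_eqI)
    show "AE w in M. N \<zero>\<^sub>E w = rep \<zero>\<^bsub>L0 M\<^esub> w" using N_zero rep_zero_L0 by eventually_elim simp
  qed (simp_all add: N_props(1))
  then show ?thesis using module_E nrm_closed N_tri by (simp add: l0norm_def)
qed

lemma minus_E: "x \<in> carrier E \<Longrightarrow> y \<in> carrier E \<Longrightarrow> x \<ominus>\<^sub>E y = x \<oplus>\<^sub>E rE.neg y"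
  using minus_neg[OF module_E] by blast

section \<open>The random conjugate space and its pairing with E\<close>

lemma dual_carrier:
  "u \<in> carrier D \<longleftrightarrow> u \<in> module_homs (L0 M) E (L0 M) \<and> u \<in> extensional (carrier E) \<and>
     (\<forall>e>0. \<exists>d>0. \<forall>x\<in>carrier E. mu M (N x) < d \<longrightarrow> mu M (rep (u x)) < e)"
proof (cases "u \<in> module_homs (L0 M) E (L0 M)")
  case True
  have "mu M (rep (L0_abs M (u x))) = mu M (rep (u x))" if "x \<in> carrier E" for x
    using True that by (intro mu_abs_L0) (auto simp: module_homs_def)
  then show ?thesis using continuous_hom_iff[OF l0norm_E l0norm_L0 True] True by (simp add: dual_def)
qed (simp add: dual_def)

lemma dualD:
  assumes "u \<in> carrier D"
  shows "x \<in> carrier E \<Longrightarrow> u x \<in> carrier (L0 M)" "x \<in> carrier E \<Longrightarrow> rep (u x) \<in> \<L> M"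
    "x \<in> carrier E \<Longrightarrow> y \<in> carrier E \<Longrightarrow> u (x \<oplus>\<^sub>E y) = u x \<oplus>\<^bsub>L0 M\<^esub> u y"
    "\<xi> \<in> carrier (L0 M) \<Longrightarrow> x \<in> carrier E \<Longrightarrow> u (\<xi> \<odot>\<^sub>E x) = \<xi> \<otimes>\<^bsub>L0 M\<^esub> u x"
    "u \<in> extensional (carrier E)"
    "0 < e \<Longrightarrow> \<exists>d>0. \<forall>x\<in>carrier E. mu M (N x) < d \<longrightarrow> mu M (rep (u x)) < e"
  using assms rep_L0(1)[of "u x" M] unfolding dual_carrier by (auto simp: module_homs_def smult_L0)

lemma module_dual: "module (L0 M) D"
proof -
  have ops: "u \<oplus>\<^sub>D v = (\<lambda>x\<in>carrier E. u x \<oplus>\<^bsub>L0 M\<^esub> v x)" "\<zero>\<^sub>D = (\<lambda>x\<in>carrier E. \<zero>\<^bsub>L0 M\<^esub>)"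
    "\<xi> \<odot>\<^sub>D u = (\<lambda>x\<in>carrier E. \<xi> \<otimes>\<^bsub>L0 M\<^esub> u x)" for u v \<xi> by (simp_all add: dual_def)
  have add: "u \<oplus>\<^sub>D v \<in> carrier D" if u: "u \<in> carrier D" and v: "v \<in> carrier D" for u v
    unfolding dual_carrier
  proof (intro conjI allI impI)
    show "u \<oplus>\<^sub>D v \<in> module_homs (L0 M) E (L0 M)"
      using dualD[OF u] dualD[OF v] unfolding module_homs_def ops
      by (auto simp: smult_L0 R.r_distr R.a_ac)
    show "u \<oplus>\<^sub>D v \<in> extensional (carrier E)" unfolding ops by simp
    fix e :: real assume "0 < e"
    then obtain d1 d2 where d: "0 < d1" "\<forall>x\<in>carrier E. mu M (N x) < d1 \<longrightarrow> mu M (rep (u x)) < e / 2"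
      "0 < d2" "\<forall>x\<in>carrier E. mu M (N x) < d2 \<longrightarrow> mu M (rep (v x)) < e / 2"
      using dualD(6)[OF u, of "e / 2"] dualD(6)[OF v, of "e / 2"] by auto
    have "mu M (rep ((u \<oplus>\<^sub>D v) x)) < e" if x: "x \<in> carrier E" and m: "mu M (N x) < min d1 d2" for x
    proof -
      have "AE w in M. \<bar>rep (u x \<oplus>\<^bsub>L0 M\<^esub> v x) w\<bar> \<le> \<bar>rep (u x) w\<bar> + \<bar>rep (v x) w\<bar>"
        using rep_add_L0[OF dualD(1)[OF u x] dualD(1)[OF v x]] by eventually_elim simp
      then have "mu M (rep (u x \<oplus>\<^bsub>L0 M\<^esub> v x)) \<le> mu M (rep (u x)) + mu M (rep (v x))"
        using dualD(1,2)[OF u x] dualD(1,2)[OF v x] by (intro mu_le_add rep_L0(1)) auto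
      moreover have "mu M (rep (u x)) < e / 2" "mu M (rep (v x)) < e / 2" using d x m by auto
      ultimately show ?thesis using x by (simp add: ops)
    qed
    then show "\<exists>d>0. \<forall>x\<in>carrier E. mu M (N x) < d \<longrightarrow> mu M (rep ((u \<oplus>\<^sub>D v) x)) < e"
      using d by (intro exI[of _ "min d1 d2"]) auto
  qed
  have sm: "\<xi> \<odot>\<^sub>D u \<in> carrier D" if \<xi>: "\<xi> \<in> carrier (L0 M)" and u: "u \<in> carrier D" for u \<xi>
    unfolding dual_carrier
  proof (intro conjI allI impI)
    show "\<xi> \<odot>\<^sub>D u \<in> module_homs (L0 M) E (L0 M)"
      using dualD[OF u] \<xi> unfolding module_homs_def ops
      by (auto simp: smult_L0 R.r_distr R.m_ac)
    show "\<xi> \<odot>\<^sub>D u \<in> extensional (carrier E)" unfolding ops by simp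
    fix e :: real assume "0 < e"
    \<comment> \<open>Continuity of a multiple of u needs that multiplication by the fixed random
      scalar preserves smallness in probability.\<close>
    obtain d' where d': "0 < d'" "\<And>f. f \<in> \<L> M \<Longrightarrow> mu M f < d' \<Longrightarrow> mu M (\<lambda>w. rep \<xi> w * f w) < e"
      by (rule mu_mult_small[OF rep_L0(1)[OF \<xi>] \<open>0 < e\<close>]) (rule that)
    obtain d where d: "0 < d" "\<forall>x\<in>carrier E. mu M (N x) < d \<longrightarrow> mu M (rep (u x)) < d'"
      using dualD(6)[OF u d'(1)] by auto
    have "mu M (rep ((\<xi> \<odot>\<^sub>D u) x)) < e" if x: "x \<in> carrier E" and m: "mu M (N x) < d" for x
    proof -
      have "mu M (rep (\<xi> \<otimes>\<^bsub>L0 M\<^esub> u x)) = mu M (\<lambda>w. rep \<xi> w * rep (u x) w)"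
        using rep_mult_L0[OF \<xi> dualD(1)[OF u x]] dualD(2)[OF u x] rep_L0(1)[OF \<xi>]
          rep_L0(1)[OF R.m_closed[OF \<xi> dualD(1)[OF u x]]]
        by (intro mu_cong) auto
      then show ?thesis using d'(2)[OF dualD(2)[OF u x]] d(2) x m by (simp add: ops)
    qed
    then show "\<exists>d>0. \<forall>x\<in>carrier E. mu M (N x) < d \<longrightarrow> mu M (rep ((\<xi> \<odot>\<^sub>D u) x)) < e" using d by blast
  qed
  have zero: "\<zero>\<^sub>D \<in> carrier D"
    unfolding dual_carrier
  proof (intro conjI allI impI)
    show "\<zero>\<^sub>D \<in> module_homs (L0 M) E (L0 M)" unfolding module_homs_def ops by (auto simp: smult_L0)
    show "\<zero>\<^sub>D \<in> extensional (carrier E)" unfolding ops by simp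
    fix e :: real assume "0 < e"
    moreover have "mu M (rep \<zero>\<^bsub>L0 M\<^esub>) = 0"
      using mu_eq_0[OF rep_L0(1)[OF R.zero_closed]] rep_zero_L0[of M] by simp
    ultimately show "\<exists>d>0. \<forall>x\<in>carrier E. mu M (N x) < d \<longrightarrow> mu M (rep (\<zero>\<^sub>D x)) < e"
      unfolding ops by (intro exI[of _ 1]) auto
  qed
  have eqI: "u = v" if "u \<in> carrier D" "v \<in> carrier D" "\<And>x. x \<in> carrier E \<Longrightarrow> u x = v x" for u v
    using that by (intro extensionalityI[of u "carrier E" v] dualD(5)) auto
  note c = dualD(1)
  show ?thesis
  proof (rule moduleI)
    show "cring (L0 M)" by (rule cring_L0)
    show "abelian_group D"
    proof (rule abelian_groupI)
      fix u v w assume "u \<in> carrier D" "v \<in> carrier D" "w \<in> carrier D"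
      then show "u \<oplus>\<^sub>D v \<oplus>\<^sub>D w = u \<oplus>\<^sub>D (v \<oplus>\<^sub>D w)"
        by (intro eqI add) (auto simp: ops c R.a_assoc)
    next
      fix u v assume "u \<in> carrier D" "v \<in> carrier D"
      then show "u \<oplus>\<^sub>D v = v \<oplus>\<^sub>D u"
        by (intro eqI add) (auto simp: ops c R.a_comm)
    next
      fix u assume u: "u \<in> carrier D"
      then show "\<zero>\<^sub>D \<oplus>\<^sub>D u = u" by (intro eqI add zero) (auto simp: ops c)
      have "(\<ominus>\<^bsub>L0 M\<^esub> \<one>\<^bsub>L0 M\<^esub>) \<odot>\<^sub>D u \<oplus>\<^sub>D u = \<zero>\<^sub>D"
        using u by (intro eqI add zero sm) (auto simp: ops c R.l_minus R.l_neg)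
      then show "\<exists>v\<in>carrier D. v \<oplus>\<^sub>D u = \<zero>\<^sub>D" using sm[OF _ u] by blast
    qed (use add zero in auto)
  next
    fix a b u assume "a \<in> carrier (L0 M)" "b \<in> carrier (L0 M)" "u \<in> carrier D"
    then show "(a \<oplus>\<^bsub>L0 M\<^esub> b) \<odot>\<^sub>D u = a \<odot>\<^sub>D u \<oplus>\<^sub>D b \<odot>\<^sub>D u"
      by (intro eqI add sm) (auto simp: ops c R.l_distr)
  next
    fix a u v assume "a \<in> carrier (L0 M)" "u \<in> carrier D" "v \<in> carrier D"
    then show "a \<odot>\<^sub>D (u \<oplus>\<^sub>D v) = a \<odot>\<^sub>D u \<oplus>\<^sub>D a \<odot>\<^sub>D v"
      by (intro eqI add sm) (auto simp: ops c R.r_distr)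
  next
    fix a b u assume "a \<in> carrier (L0 M)" "b \<in> carrier (L0 M)" "u \<in> carrier D"
    then show "(a \<otimes>\<^bsub>L0 M\<^esub> b) \<odot>\<^sub>D u = a \<odot>\<^sub>D (b \<odot>\<^sub>D u)"
      by (intro eqI sm) (auto simp: ops c R.m_assoc)
  next
    fix u assume "u \<in> carrier D"
    then show "\<one>\<^bsub>L0 M\<^esub> \<odot>\<^sub>D u = u" by (intro eqI sm) (auto simp: ops c)
  qed (rule sm)
qed

lemma dual_ops:
  "x \<in> carrier E \<Longrightarrow> (u \<oplus>\<^sub>D v) x = u x \<oplus>\<^bsub>L0 M\<^esub> v x" "x \<in> carrier E \<Longrightarrow> (\<xi> \<odot>\<^sub>D u) x = \<xi> \<otimes>\<^bsub>L0 M\<^esub> u x"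
  "x \<in> carrier E \<Longrightarrow> \<zero>\<^sub>D x = \<zero>\<^bsub>L0 M\<^esub>"
  by (simp_all add: dual_def)

sublocale rD: rmodule M "carrier D" "add D" "\<zero>\<^sub>D" "\<lambda>a u. cls M a \<odot>\<^sub>D u"
  by (rule module_rmodule[OF prob_space_axioms module_dual])

abbreviation pr :: "'e \<Rightarrow> ('e \<Rightarrow> ('w \<Rightarrow> real) set) \<Rightarrow> 'w \<Rightarrow> real" where "pr x u \<equiv> rep (u x)"

lemma dual_rlin: "u \<in> carrier D \<Longrightarrow> rE.rlin (\<lambda>x. pr x u)"
  unfolding rE.rlin_def
proof (intro conjI ballI)
  assume u: "u \<in> carrier D"
  show "pr x u \<in> \<L> M" if "x \<in> carrier E" for x using dualD(2)[OF u that] .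
  show "AE w in M. pr (x \<oplus>\<^sub>E y) u w = pr x u w + pr y u w" if "x \<in> carrier E" "y \<in> carrier E" for x y
    using rep_add_L0[OF dualD(1)[OF u that(1)] dualD(1)[OF u that(2)]] by (simp add: dualD(3)[OF u that])
  show "AE w in M. pr (ac a x) u w = a w * pr x u w" if "a \<in> \<L> M" "x \<in> carrier E" for a x
    using rep_mult_L0[OF cls_L0[OF that(1)] dualD(1)[OF u that(2)]] rep_cls[OF that(1)]
    unfolding dualD(4)[OF u cls_L0[OF that(1)] that(2)] by eventually_elim simp
qed

lemma eval_rlin: "x \<in> carrier E \<Longrightarrow> rD.rlin (pr x)"
  unfolding rD.rlin_def
proof (intro conjI ballI)
  assume x: "x \<in> carrier E"
  show "pr x u \<in> \<L> M" if "u \<in> carrier D" for u using dualD(2)[OF that x] .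
  show "AE w in M. pr x (u \<oplus>\<^sub>D v) w = pr x u w + pr x v w" if "u \<in> carrier D" "v \<in> carrier D" for u v
    using rep_add_L0[OF dualD(1)[OF that(1) x] dualD(1)[OF that(2) x]] by (simp add: dual_ops x)
  show "AE w in M. pr x (cls M a \<odot>\<^sub>D u) w = a w * pr x u w" if "a \<in> \<L> M" "u \<in> carrier D" for a u
    using rep_mult_L0[OF cls_L0[OF that(1)] dualD(1)[OF that(2) x]] rep_cls[OF that(1)]
    unfolding dual_ops(2)[OF x] by eventually_elim simp
qed

lemma dual_of_rlin:
  assumes v: "rE.rlin v" and le: "\<And>x. x \<in> carrier E \<Longrightarrow> AE w in M. \<bar>v x w\<bar> \<le> N x w"
  shows "(\<lambda>x\<in>carrier E. cls M (v x)) \<in> carrier D"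
    and "x \<in> carrier E \<Longrightarrow> AE w in M. pr x (\<lambda>x\<in>carrier E. cls M (v x)) w = v x w"
proof -
  let ?u = "\<lambda>x\<in>carrier E. cls M (v x)"
  note vm = rE.rlinD(1)[OF v]
  show e: "AE w in M. pr x ?u w = v x w" if "x \<in> carrier E" for x using that vm by (simp add: rep_cls)
  have c: "?u x \<in> carrier (L0 M)" if "x \<in> carrier E" for x using that vm by simp
  show "?u \<in> carrier D" unfolding dual_carrier
  proof (intro conjI allI impI)
    show "?u \<in> module_homs (L0 M) E (L0 M)" unfolding module_homs_def
    proof (intro CollectI conjI ballI)
      show "?u \<in> carrier E \<rightarrow> carrier (L0 M)" using c by auto
      fix x assume x: "x \<in> carrier E"
      show "?u (x \<oplus>\<^sub>E y) = ?u x \<oplus>\<^bsub>L0 M\<^esub> ?u y" if y: "y \<in> carrier E" for y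
      proof (rule L0_eqI)
        show "AE w in M. rep (?u (x \<oplus>\<^sub>E y)) w = rep (?u x \<oplus>\<^bsub>L0 M\<^esub> ?u y) w"
          using rep_add_L0[OF c[OF x] c[OF y]] e[OF x] e[OF y] e[OF M.a_closed[OF x y]] rE.rlinD(2)[OF v x y]
          by eventually_elim simp
      qed (use c x y in auto)
      show "?u (\<xi> \<odot>\<^sub>E x) = \<xi> \<odot>\<^bsub>L0 M\<^esub> ?u x" if \<xi>: "\<xi> \<in> carrier (L0 M)" for \<xi>
        unfolding smult_L0
      proof (rule L0_eqI)
        have "AE w in M. v (\<xi> \<odot>\<^sub>E x) w = rep \<xi> w * v x w"
          using rE.rlinD(3)[OF v rep_L0(1)[OF \<xi>] x] by (simp add: rep_L0(2)[OF \<xi>])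
        then show "AE w in M. rep (?u (\<xi> \<odot>\<^sub>E x)) w = rep (\<xi> \<otimes>\<^bsub>L0 M\<^esub> ?u x) w"
          using rep_mult_L0[OF \<xi> c[OF x]] e[OF x] e[OF smult_closed[OF \<xi> x]] by eventually_elim simp
      qed (use c x \<xi> in auto)
    qed
    fix d :: real assume "0 < d"
    have "mu M (rep (?u x)) < d" if x: "x \<in> carrier E" and m: "mu M (N x) < d" for x
    proof -
      have "AE w in M. \<bar>rep (?u x) w\<bar> \<le> \<bar>N x w\<bar>" using e[OF x] le[OF x] by eventually_elim simp
      then have "mu M (rep (?u x)) \<le> mu M (N x)" using N_props[OF x] rep_L0(1)[OF c[OF x]] by (intro mu_mono)
      then show ?thesis using m by simp
    qed
    then show "\<exists>d'>0. \<forall>x\<in>carrier E. mu M (N x) < d' \<longrightarrow> mu M (rep (?u x)) < d" using \<open>0 < d\<close> by blast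
  qed simp
qed

text \<open>The set {0} is separated from x with the distance d = |x| (the random norm): the
  functional satisfies u(0) <= u(x) - |x|, and domination by the norm gives the other
  inequality.\<close>

lemma norming_functional:
  assumes x: "x \<in> carrier E"
  obtains u where "u \<in> carrier D" "AE w in M. pr x u w = N x w"
proof -
  have nx: "rE.neg x \<in> carrier E" using x by simp
  have d: "AE w in M. N x w \<le> N (g \<oplus>\<^sub>E rE.neg x) w" if "g \<in> {\<zero>\<^sub>E}" for g
    using that nx rE.seminorm_neg[OF N_seminorm x] by (auto elim!: eventually_mono)
  have conv: "rE.rconvex {\<zero>\<^sub>E}" by (simp add: rE.rconvex_def)
  obtain v where v: "rE.rlin v" "\<And>y. y \<in> carrier E \<Longrightarrow> AE w in M. \<bar>v y w\<bar> \<le> N y w"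
    "\<And>g. g \<in> {\<zero>\<^sub>E} \<Longrightarrow> AE w in M. v g w \<le> v x w - N x w"
    by (rule rE.separation[OF N_seminorm _ _ conv x N_props(3)[OF x] d]) auto
  have "AE w in M. v x w = N x w"
    using v(2)[OF x] v(3)[of "\<zero>\<^sub>E"] rE.rlin_zr[OF v(1)]
    by (auto elim!: eventually_rev_mp)
  then have "AE w in M. pr x (\<lambda>x\<in>carrier E. cls M (v x)) w = N x w"
    using dual_of_rlin(2)[OF v(1,2) x] by (auto elim: eventually_elim2)
  then show ?thesis using dual_of_rlin(1)[OF v(1,2)] that by blast
qed

text \<open>Norming functionals separate the points of E, and evaluations separate functionals; the
  order argument thereby becomes available for E and its dual.\<close>

sublocale pair: rpair M "carrier E" "add E" "\<zero>\<^sub>E" "\<lambda>a x. cls M a \<odot>\<^sub>E x"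
   "carrier D" "add D" "\<zero>\<^sub>D" "\<lambda>a u. cls M a \<odot>\<^sub>D u" pr
proof (unfold_locales, goal_cases)
  case (1 u) then show ?case by (rule dual_rlin)
next
  case (2 x) then show ?case by (rule eval_rlin)
next
  case (3 x)
  obtain u where "u \<in> carrier D" "AE w in M. pr x u w = N x w" using norming_functional[OF 3(1)] .
  then have "AE w in M. N x w = 0" using 3(2)[of u] by (auto elim: eventually_elim2)
  then show ?case by (rule N_eq_0[OF 3(1)])
next
  case (4 u)
  interpret Dm: module "L0 M" D by (rule module_dual)
  show ?case
  proof (rule extensionalityI[OF dualD(5)[OF 4(1)] dualD(5)[OF Dm.M.zero_closed]])
    fix x assume x: "x \<in> carrier E"
    have "AE w in M. rep (u x) w = rep \<zero>\<^bsub>L0 M\<^esub> w" using 4(2)[OF x] rep_zero_L0 by eventually_elim simp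
    then show "u x = \<zero>\<^sub>D x" using dualD(1)[OF 4(1) x] by (simp add: dual_ops(3)[OF x] L0_eqI)
  qed
qed

section \<open>Completeness and countable concatenation\<close>

lemma complete_mu:
  assumes "rn_complete M E nrm" and s: "\<And>n. s n \<in> carrier E"
    and c: "\<And>e. 0 < e \<Longrightarrow> \<exists>n0. \<forall>m\<ge>n0. \<forall>n\<ge>n0. mu M (N (s m \<ominus>\<^sub>E s n)) < e"
  obtains x where "x \<in> carrier E" "(\<lambda>n. mu M (N (s n \<ominus>\<^sub>E x))) \<longlonglongrightarrow> 0"
proof -
  have "\<exists>n0. \<forall>m\<ge>n0. \<forall>n\<ge>n0. s m \<in> prob_ball M E {nrm} (s n) e l" if el: "0 < e" "0 < l" "l < 1" for e l
  proof -
    obtain n0 where n0: "\<forall>m\<ge>n0. \<forall>n\<ge>n0. mu M (N (s m \<ominus>\<^sub>E s n)) < l * min 1 e"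
      using c[of "l * min 1 e"] el by auto
    have "s m \<in> prob_ball M E {nrm} (s n) e l" if "m \<ge> n0" "n \<ge> n0" for m n
      using n0 that s el unfolding prob_ball_def
      by (auto intro!: mu_lt_imp_prob N_props)
    then show ?thesis by blast
  qed
  then obtain x where x: "limitin (eps_lambda_topology M E nrm) s x sequentially"
    using assms(1) s unfolding rn_complete_def by blast
  have "topspace (eps_lambda_topology M E nrm) = carrier E"
    by (rule topspace_prob_topology[OF module_E]) (use nrm_closed in auto)
  then have xc: "x \<in> carrier E" using x by (simp add: limitin_def)
  have "(\<lambda>n. mu M (N (s n \<ominus>\<^sub>E x))) \<longlonglongrightarrow> 0"
  proof (rule order_tendstoI)
    fix a :: real assume "a < 0"
    then show "\<forall>\<^sub>F n in sequentially. a < mu M (N (s n \<ominus>\<^sub>E x))"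
      by (intro always_eventually allI less_le_trans[OF _ mu_nonneg])
  next
    fix a :: real assume "0 < a"
    have "x \<ominus>\<^sub>E x = \<zero>\<^sub>E" using xc by (simp add: M.minus_eq M.r_neg)
    then have "x \<in> {y \<in> carrier E. mu M (N (y \<ominus>\<^sub>E x)) < a}"
      using l0normD(6)[OF l0norm_E] xc \<open>0 < a\<close> by simp
    then have "\<forall>\<^sub>F n in sequentially. s n \<in> {y \<in> carrier E. mu M (N (y \<ominus>\<^sub>E x)) < a}"
      using x open_mu_ball[OF l0norm_E xc] unfolding limitin_def by blast
    then show "\<forall>\<^sub>F n in sequentially. mu M (N (s n \<ominus>\<^sub>E x)) < a" by eventually_elim simp
  qed
  then show ?thesis using that xc by blast
qed

lemma N_glue:
  assumes A: "A \<in> sets M" and x: "x \<in> carrier E" and y: "y \<in> carrier E" and z: "z \<in> carrier E"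
  shows "AE w in M. N (rE.glue A x y \<ominus>\<^sub>E z) w \<le> (if w \<in> A then N (x \<ominus>\<^sub>E z) w else N (y \<ominus>\<^sub>E z) w)"
proof -
  have m: "(indicator A :: 'w \<Rightarrow> real) \<in> \<L> M" "(\<lambda>w. 1 - indicator A w :: real) \<in> \<L> M"
    using A by auto
  have nz: "rE.neg z \<in> carrier E" using z by simp
  have "rE.neg z = ac (indicator A) (rE.neg z) \<oplus>\<^sub>E ac (\<lambda>w. 1 - indicator A w) (rE.neg z)"
    using rE.ac_addl[OF m nz] nz rE.ac_one[OF nz] by simp
  then have e: "rE.glue A x y \<ominus>\<^sub>E z = ac (indicator A) (x \<ominus>\<^sub>E z) \<oplus>\<^sub>E ac (\<lambda>w. 1 - indicator A w) (y \<ominus>\<^sub>E z)"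
    using A x y z nz m by (simp add: minus_E rE.glue_def rE.ac_addr) (simp add: rE.pl_ac)
  have d: "x \<ominus>\<^sub>E z \<in> carrier E" "y \<ominus>\<^sub>E z \<in> carrier E" using x y z by auto
  show ?thesis unfolding e
    using N_tri[OF rE.ac_in[OF m(1) d(1)] rE.ac_in[OF m(2) d(2)]] N_ac[OF m(1) d(1)] N_ac[OF m(2) d(2)]
  proof eventually_elim
    case (elim w) then show ?case by (cases "w \<in> A") auto
  qed
qed

text \<open>The finite gluings form a Cauchy sequence, since two of them differ only on a tail of
  the disjoint sets, and the tails have probabilities tending to 0. The limit agrees with
  \<open>x n\<close> on \<open>A n\<close> because all late gluings do.\<close>

lemma countable_concatenation:
  fixes A :: "nat \<Rightarrow> 'w set"
  assumes comp: "rn_complete M E nrm" and A: "\<And>n. A n \<in> sets M" "disjoint_family A" and x: "\<And>n. x n \<in> carrier E"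
  obtains z where "z \<in> carrier E" "\<And>n. AE w in M. w \<in> A n \<longrightarrow> N (z \<ominus>\<^sub>E x n) w = 0"
proof -
  define s where "s = rec_nat \<zero>\<^sub>E (\<lambda>n y. rE.glue (A n) (x n) y)"
  have s0: "s 0 = \<zero>\<^sub>E" and sS: "s (Suc n) = rE.glue (A n) (x n) (s n)" for n by (simp_all add: s_def)
  have s: "s n \<in> carrier E" for n by (induction n) (use A x s0 sS in auto)
  have selfz: "AE w in M. N (y \<ominus>\<^sub>E y) w = 0" if "y \<in> carrier E" for y
    using N_zero that by (simp add: M.minus_eq M.r_neg)
  define B where "B n = (\<Union>i\<in>{n..}. A i)" for n
  have B: "B n \<in> sets M" for n using A by (auto simp: B_def)
  have tail: "AE w in M. w \<notin> B n \<longrightarrow> N (s m \<ominus>\<^sub>E s n) w = 0" if "n \<le> m" for m n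
    using that
  proof (induction m rule: dec_induct)
    case base show ?case using selfz[OF s[of n]] by eventually_elim simp
  next
    case (step m)
    have d: "s (Suc m) \<ominus>\<^sub>E s n \<in> carrier E" using s by auto
    show ?case using step(3) N_glue[OF A(1) x s s, of m m m n] N_props(2)[OF d]
    proof eventually_elim
      case (elim w)
      have "w \<notin> B n \<Longrightarrow> w \<notin> A m" using step(1) by (auto simp: B_def)
      then show ?case using elim by (auto simp: sS)
    qed
  qed
  have B0: "(\<lambda>n. prob (B n)) \<longlonglongrightarrow> 0"
  proof -
    have "decseq B" unfolding decseq_def B_def by (intro allI impI UN_mono) auto
    moreover have "(\<Inter>n. B n) = {}"
    proof (rule ccontr)
      assume "(\<Inter>n. B n) \<noteq> {}"
      then obtain w where w: "\<And>n. w \<in> B n" by auto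
      obtain i where i: "w \<in> A i" using w[of 0] by (auto simp: B_def)
      obtain j where "j \<ge> Suc i" "w \<in> A j" using w[of "Suc i"] by (auto simp: B_def)
      then show False using i A(2) unfolding disjoint_family_on_def by (metis IntI UNIV_I empty_iff not_less_eq_eq order_refl)
    qed
    ultimately show ?thesis using finite_Lim_measure_decseq[of B] B by auto
  qed
  have sm: "mu M (N (s m \<ominus>\<^sub>E s n)) \<le> prob (B n)" if "n \<le> m" for m n
    by (rule mu_indicator_le[OF N_props(3) B tail[OF that]]) (use s in auto)
  have sym: "mu M (N (a \<ominus>\<^sub>E b)) = mu M (N (b \<ominus>\<^sub>E a))" if "a \<in> carrier E" "b \<in> carrier E" for a b
  proof -
    have "rE.neg (b \<ominus>\<^sub>E a) = a \<ominus>\<^sub>E b"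
    proof -
      have m1: "(\<lambda>w. - 1 :: real) \<in> \<L> M" by simp
      have "rE.neg (rE.neg a) = a" using rE.ac_mult[OF m1 m1 that(1)] that(1) rE.ac_one[OF that(1)] by simp
      then show ?thesis using that by (simp add: minus_E rE.ac_addr) (simp add: rE.pl_comm)
    qed
    then have "AE w in M. N (a \<ominus>\<^sub>E b) w = N (b \<ominus>\<^sub>E a) w"
      using rE.seminorm_neg[OF N_seminorm, of "b \<ominus>\<^sub>E a"] that by simp
    then show ?thesis using that by (intro mu_cong N_props) auto
  qed
  have cau: "\<exists>n0. \<forall>m\<ge>n0. \<forall>n\<ge>n0. mu M (N (s m \<ominus>\<^sub>E s n)) < e" if e: "0 < e" for e
  proof -
    obtain n0 where n0: "\<And>n. n \<ge> n0 \<Longrightarrow> prob (B n) < e"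
      using order_tendstoD(2)[OF B0 e] by (auto simp: eventually_sequentially)
    have "mu M (N (s m \<ominus>\<^sub>E s n)) < e" if "m \<ge> n0" "n \<ge> n0" for m n
      using sm[of n m] sm[of m n] sym[OF s s, of m n] n0 that by (cases "n \<le> m") (auto intro: le_less_trans)
    then show ?thesis by blast
  qed
  obtain z where z: "z \<in> carrier E" "(\<lambda>n. mu M (N (s n \<ominus>\<^sub>E z))) \<longlonglongrightarrow> 0"
    by (rule complete_mu[OF comp s cau])
  have onA: "AE w in M. w \<in> A i \<longrightarrow> N (s n \<ominus>\<^sub>E x i) w = 0" if "Suc i \<le> n" for i n
    using that
  proof (induction n rule: dec_induct)
    case base
    have d: "s (Suc i) \<ominus>\<^sub>E x i \<in> carrier E" using s x by auto
    show ?case using N_glue[OF A(1) x s x, of i i i i] selfz[OF x, of i] N_props(2)[OF d]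
      by eventually_elim (auto simp: sS)
  next
    case (step n)
    have d: "s (Suc n) \<ominus>\<^sub>E x i \<in> carrier E" using s x by auto
    have "A i \<inter> A n = {}" using A(2) step(1) unfolding disjoint_family_on_def by auto
    then have disj: "w \<in> A i \<Longrightarrow> w \<notin> A n" for w by blast
    show ?case using step(3) N_glue[OF A(1) x s x, of n n n i] N_props(2)[OF d]
    proof eventually_elim
      case (elim w)
      then show ?case using disj[of w] by (cases "w \<in> A i") (auto simp: sS)
    qed
  qed
  have "AE w in M. w \<in> A i \<longrightarrow> N (z \<ominus>\<^sub>E x i) w = 0" for i
  proof -
    have zx: "z \<ominus>\<^sub>E x i \<in> carrier E" using z x by auto
    have m: "(\<lambda>w. indicator A w * N (z \<ominus>\<^sub>E x i) w) \<in> \<L> M" if "A \<in> sets M" for A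
      using N_props(3)[OF zx] that by measurable
    have "mu M (\<lambda>w. indicator (A i) w * N (z \<ominus>\<^sub>E x i) w) \<le> mu M (N (s n \<ominus>\<^sub>E z))" if n: "Suc i \<le> n" for n
    proof (rule mu_mono[OF m[OF A(1)] N_props(3)])
      have c: "z \<ominus>\<^sub>E s n \<in> carrier E" "s n \<ominus>\<^sub>E x i \<in> carrier E" "s n \<ominus>\<^sub>E z \<in> carrier E" using z s x by auto
      have "\<ominus>\<^sub>E s n \<oplus>\<^sub>E (s n \<oplus>\<^sub>E \<ominus>\<^sub>E x i) = \<ominus>\<^sub>E x i"
        using s x by (simp add: M.a_assoc[symmetric] M.l_neg)
      then have e: "z \<ominus>\<^sub>E x i = (z \<ominus>\<^sub>E s n) \<oplus>\<^sub>E (s n \<ominus>\<^sub>E x i)"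
        using z s x by (simp add: M.minus_eq M.a_assoc)
      have "rE.neg (z \<ominus>\<^sub>E s n) = s n \<ominus>\<^sub>E z"
      proof -
        have m1: "(\<lambda>w. - 1 :: real) \<in> \<L> M" by simp
        have "rE.neg (rE.neg (s n)) = s n" using rE.ac_mult[OF m1 m1 s] s rE.ac_one[OF s] by simp
        then show ?thesis using z s by (simp add: minus_E rE.ac_addr) (simp add: rE.pl_comm)
      qed
      then have n2: "AE w in M. N (s n \<ominus>\<^sub>E z) w = N (z \<ominus>\<^sub>E s n) w"
        using rE.seminorm_neg[OF N_seminorm c(1)] by simp
      show "AE w in M. \<bar>indicator (A i) w * N (z \<ominus>\<^sub>E x i) w\<bar> \<le> \<bar>N (s n \<ominus>\<^sub>E z) w\<bar>"
        using N_tri[OF c(1,2)] n2 onA[OF n] N_props(2)[OF zx] unfolding e[symmetric]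
      proof eventually_elim
        case (elim w) then show ?case by (cases "w \<in> A i") auto
      qed
    qed (use s z in auto)
    then have "\<forall>\<^sub>F n in sequentially. mu M (\<lambda>w. indicator (A i) w * N (z \<ominus>\<^sub>E x i) w) \<le> mu M (N (s n \<ominus>\<^sub>E z))"
      by (auto simp: eventually_sequentially intro!: exI[of _ "Suc i"])
    then have "mu M (\<lambda>w. indicator (A i) w * N (z \<ominus>\<^sub>E x i) w) \<le> 0"
      by (rule tendsto_lowerbound[OF z(2)]) simp
    then have "AE w in M. indicator (A i) w * N (z \<ominus>\<^sub>E x i) w = 0"
      using mu_nonneg[of "\<lambda>w. indicator (A i) w * N (z \<ominus>\<^sub>E x i) w"] mu_eq_0[OF m[OF A(1), of i]] by simp
    then show ?thesis by eventually_elim auto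
  qed
  then show ?thesis using that z(1) by blast
qed

text \<open>Multiplied by the indicator of A, the difference has norm zero and so is the null
  element; homogeneity of v then gives v(x - y) = 0 on A.\<close>

lemma rlin_eq_on:
  assumes u: "rE.rlin v" and x: "x \<in> carrier E" "y \<in> carrier E" and A: "A \<in> sets M"
    and z: "AE w in M. w \<in> A \<longrightarrow> N (x \<ominus>\<^sub>E y) w = 0"
  shows "AE w in M. w \<in> A \<longrightarrow> v x w = v y w"
proof -
  have d: "x \<ominus>\<^sub>E y \<in> carrier E" using x by auto
  have m: "(indicator A :: 'w \<Rightarrow> real) \<in> \<L> M" using A by auto
  have "AE w in M. N (ac (indicator A) (x \<ominus>\<^sub>E y)) w = 0"
    using N_ac[OF m d] z by eventually_elim (auto simp: indicator_def)
  then have e: "ac (indicator A) (x \<ominus>\<^sub>E y) = \<zero>\<^sub>E" using d m by (intro N_eq_0) auto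
  have "AE w in M. v \<zero>\<^sub>E w = indicator A w * v (x \<ominus>\<^sub>E y) w"
    using rE.rlinD(3)[OF u m d] unfolding e .
  moreover have "AE w in M. v (x \<ominus>\<^sub>E y) w = v x w - v y w"
    using rE.rlin_diff[OF u x] by (simp add: minus_E[OF x])
  ultimately show ?thesis using rE.rlin_zr[OF u] by eventually_elim auto
qed

text \<open>Countably many of the sets where a norm is positive cover \<Omega>. Concatenating the
  corresponding points along a disjoint refinement yields a point with positive norm almost
  everywhere, and scaling it by the inverse of its norm gives pairing 1 with a norming
  functional.\<close>

lemma full_support_unit:
  assumes comp: "rn_complete M E nrm" and full: "full_support M E nrm"
  obtains x u where "x \<in> carrier E" "u \<in> carrier D" "AE w in M. pr x u w = 1"
proof -
  let ?S = "(\<lambda>x. to_ext M (nrm x)) ` carrier E"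
  have re: "AE w in M. rep (to_ext M (nrm x)) w = ereal (N x w)" "to_ext M (nrm x) \<in> ae_classes M" if "x \<in> carrier E" for x
    using N_props(3)[OF that] by (simp_all add: lift1_def rep_cls cls_in)
  have S: "?S \<subseteq> ae_classes M" using re by auto
  have pos: "AE w in M. 0 < rep (\<Squnion>\<^bsub>L0bar M\<^esub> ?S) w"
  proof -
    have "AE w in M. rep (cls M (\<lambda>_. 0 :: ereal)) w < rep (\<Squnion>\<^bsub>L0bar M\<^esub> ?S) w"
      using full AE_space unfolding full_support_def less_on_def by (auto elim: eventually_elim2)
    moreover have "AE w in M. rep (cls M (\<lambda>_. 0 :: ereal)) w = 0" by (rule rep_cls) simp
    ultimately show ?thesis by eventually_elim simp
  qed
  define lev where "lev x = {w \<in> space M. 0 < N x w}" for x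
  have levm: "lev x \<in> sets M" if "x \<in> carrier E" for x using N_props(3)[OF that] unfolding lev_def by measurable
  have "lev ` carrier E \<subseteq> sets M" using levm by auto
  from countable_essential_union[OF this] obtain C where
    C: "C \<subseteq> lev ` carrier E" "countable C" "\<forall>A\<in>lev ` carrier E. AE w in M. w \<in> A \<longrightarrow> w \<in> \<Union>C" by blast
  from C(1,2) obtain K where K: "K \<subseteq> carrier E" "countable K" "C = lev ` K" by (metis countable_subset_image)
  define K' where "K' = insert \<zero>\<^sub>E K"
  have K': "K' \<subseteq> carrier E" "countable K'" "K' \<noteq> {}" using K by (auto simp: K'_def)
  define x where "x = from_nat_into K'"
  have rx: "range x = K'" using range_from_nat_into[OF K'(3,2)] by (simp add: x_def)
  have xc: "x n \<in> carrier E" for n using rx K' by auto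
  have cover: "AE w in M. \<exists>n. w \<in> lev (x n)"
  proof -
    have CU: "\<Union>C \<subseteq> (\<Union>n. lev (x n))"
    proof -
      have "lev k \<subseteq> (\<Union>n. lev (x n))" if "k \<in> K" for k
      proof -
        have "k \<in> range x" using that rx by (simp add: K'_def)
        then obtain n where "k = x n" by (rule rangeE)
        then show ?thesis by blast
      qed
      then show ?thesis unfolding K(3) by blast
    qed
    \<comment> \<open>This is an upper bound of all norms that vanishes off the countable union. As
      their supremum is positive almost everywhere, the union must have full measure.\<close>
    define h where "h w = (if w \<in> (\<Union>n. lev (x n)) then \<infinity> else 0 :: ereal)" for w
    have [measurable]: "(\<Union>n. lev (x n)) \<in> sets M" using levm[OF xc] by auto
    have hm: "h \<in> \<L> M" unfolding h_def by measurable
    have "AE w in M. rep (\<Squnion>\<^bsub>L0bar M\<^esub> ?S) w \<le> h w"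
    proof (rule sup_L0bar(3)[OF S hm])
      fix X assume "X \<in> ?S"
      then obtain y where y: "y \<in> carrier E" "X = to_ext M (nrm y)" by auto
      have "AE w in M. w \<in> lev y \<longrightarrow> w \<in> \<Union>C" using C(3) y by auto
      then show "AE w in M. rep X w \<le> h w" using re(1)[OF y(1)] AE_space unfolding y(2)
        by eventually_elim (use CU in \<open>auto simp: h_def lev_def\<close>)
    qed
    then show ?thesis using pos by eventually_elim (auto simp: h_def split: if_splits)
  qed
  define A where "A = disjointed (\<lambda>n. lev (x n))"
  have A1: "A n \<in> sets M" for n
    using sets.range_disjointed_sets[of "\<lambda>n. lev (x n)" M] levm[OF xc] by (auto simp: A_def)
  have A2: "disjoint_family A" unfolding A_def by (rule disjoint_family_disjointed)
  obtain z where z: "z \<in> carrier E" "\<And>n. AE w in M. w \<in> A n \<longrightarrow> N (z \<ominus>\<^sub>E x n) w = 0"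
    by (rule countable_concatenation[OF comp A1 A2 xc]) (rule that)
  have pos: "AE w in M. \<forall>n. w \<in> A n \<longrightarrow> 0 < N z w"
    unfolding AE_all_countable
  proof
    fix n
    have d: "x n \<ominus>\<^sub>E z \<in> carrier E" "z \<ominus>\<^sub>E x n \<in> carrier E" using z xc by auto
    have e: "x n = z \<oplus>\<^sub>E rE.neg (z \<ominus>\<^sub>E x n)"
    proof -
      have m1: "(\<lambda>w. - 1 :: real) \<in> \<L> M" by simp
      have "rE.neg (rE.neg (x n)) = x n" using rE.ac_mult[OF m1 m1 xc] rE.ac_one[OF xc] by simp
      moreover have "z \<oplus>\<^sub>E (rE.neg z \<oplus>\<^sub>E x n) = x n" using z xc rE.pl_assoc[of z "rE.neg z" "x n"] by simp
      ultimately show ?thesis using z xc by (simp add: minus_E rE.ac_addr)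
    qed
    have "AE w in M. N (x n) w \<le> N z w + N (rE.neg (z \<ominus>\<^sub>E x n)) w"
      using N_tri[of z "rE.neg (z \<ominus>\<^sub>E x n)"] e z(1) d by simp
    then show "AE w in M. w \<in> A n \<longrightarrow> 0 < N z w"
      using z(2)[of n] rE.seminorm_neg[OF N_seminorm d(2)]
    proof eventually_elim
      case (elim w)
      have "A n \<subseteq> lev (x n)" unfolding A_def by (rule disjointed_subset)
      then show ?case using elim by (auto simp: lev_def)
    qed
  qed
  have "(\<Union>n. A n) = (\<Union>n. lev (x n))" unfolding A_def by (rule UN_disjointed_eq)
  then have ex: "w \<in> lev (x n) \<Longrightarrow> \<exists>n. w \<in> A n" for w n by blast
  have Nz: "AE w in M. 0 < N z w" using cover pos by eventually_elim (use ex in blast)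
  obtain u where u: "u \<in> carrier D" "AE w in M. pr z u w = N z w" using norming_functional[OF z(1)] .
  have im: "(\<lambda>w. 1 / N z w) \<in> \<L> M" using N_props(3)[OF z(1)] by measurable
  have "AE w in M. pr (ac (\<lambda>w. 1 / N z w) z) u w = 1"
    using rE.rlinD(3)[OF dual_rlin[OF u(1)] im z(1)] u(2) Nz by eventually_elim simp
  then show ?thesis using that[OF rE.ac_in[OF im z(1)] u(1)] by blast
qed

end

section \<open>Lower semicontinuous functions as suprema of affine functions\<close>

lemma rep_to_ext:
  assumes "\<xi> \<in> carrier (L0 M)"
  shows "AE w in M. rep (to_ext M \<xi>) w = ereal (rep \<xi> w)" "to_ext M \<xi> \<in> ae_classes M"
  using rep_L0(1)[OF assms] by (simp_all add: lift1_def rep_cls cls_in)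

lemma rep_ext_ops:
  fixes A B :: "('w \<Rightarrow> ereal) set"
  assumes "A \<in> ae_classes M" "B \<in> ae_classes M"
  shows "AE w in M. rep (ext_add M A B) w = rep A w + rep B w" "ext_add M A B \<in> ae_classes M"
    "AE w in M. rep (ext_diff M A B) w = rep A w - rep B w" "ext_diff M A B \<in> ae_classes M"
    "AE w in M. rep (ext_mult M A B) w = rep A w * rep B w" "ext_mult M A B \<in> ae_classes M"
  using rep_props(1)[OF assms(1)] rep_props(1)[OF assms(2)] by (simp_all add: lift2_def rep_cls cls_in)

section \<open>Proper convex functions with closed epigraph and suprema of affine functions\<close>

context prob_space
begin

lemma proper_convexD:
  assumes mod: "module (L0 M) X" and f: "f \<in> proper_convex_functions M X"
  shows "f \<in> carrier X \<rightarrow>\<^sub>E ae_classes M"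
    and "\<exists>x1. convex_fun M (carrier X) (add X) \<zero>\<^bsub>X\<^esub> (\<lambda>a x. cls M a \<odot>\<^bsub>X\<^esub> x) (\<lambda>x. rep (f x)) x1"
proof -
  interpret R: rmodule M "carrier X" "add X" "\<zero>\<^bsub>X\<^esub>" "\<lambda>a x. cls M a \<odot>\<^bsub>X\<^esub> x"
    by (rule module_rmodule[OF prob_space_axioms mod])
  interpret L: cring "L0 M" by (rule cring_L0)
  show fc: "f \<in> carrier X \<rightarrow>\<^sub>E ae_classes M" using f by (simp add: proper_convex_functions_def L0bar_def)
  then have fx: "f x \<in> ae_classes M" if "x \<in> carrier X" for x using that by auto
  have inf: "AE w in M. rep (cls M (\<lambda>_. c :: ereal)) w = c" for c by (rule rep_cls) simp
  obtain x1 where x1: "x1 \<in> carrier X" "less_on M (space M) (f x1) (cls M (\<lambda>_. \<infinity>))"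
    using f by (auto simp: proper_convex_functions_def eff_dom_def)
  have "convex_fun M (carrier X) (add X) \<zero>\<^bsub>X\<^esub> (\<lambda>a x. cls M a \<odot>\<^bsub>X\<^esub> x) (\<lambda>x. rep (f x)) x1"
  proof (unfold_locales, goal_cases)
    case (1 x) then show ?case using fx by (simp add: rep_props)
  next
    case (2 x)
    then have "less_on M (space M) (cls M (\<lambda>_. - \<infinity>)) (f x)" using f by (simp add: proper_convex_functions_def)
    then show ?case unfolding less_on_def using inf[of "- \<infinity>"] AE_space by eventually_elim simp
  next
    case 3 show ?case by (rule x1(1))
  next
    case 4 show ?case using x1(2) inf[of \<infinity>] AE_space unfolding less_on_def by eventually_elim simp
  next
    case (5 x y t)
    have t: "cls M t \<in> carrier (L0 M)" using 5(3) by simp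
    have rt: "AE w in M. rep (cls M t) w = t w" using 5(3) by (rule rep_cls)
    have tp: "cls M t \<in> L0_pos M" by (rule L0_posI[OF t]) (use rt 5(4) in \<open>auto elim: eventually_mono\<close>)
    have t1: "ae_le M (cls M t) \<one>\<^bsub>L0 M\<^esub>" unfolding ae_le_def
      using rt rep_one_L0 by eventually_elim (use 5(4) in simp)
    have m1: "(\<lambda>w. 1 - t w) \<in> \<L> M" using 5(3) by simp
    have e: "\<one>\<^bsub>L0 M\<^esub> \<ominus>\<^bsub>L0 M\<^esub> cls M t = cls M (\<lambda>w. 1 - t w)"
    proof (rule L0_eqI)
      show "AE w in M. rep (\<one>\<^bsub>L0 M\<^esub> \<ominus>\<^bsub>L0 M\<^esub> cls M t) w = rep (cls M (\<lambda>w. 1 - t w)) w"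
        using rep_minus_L0[OF L.one_closed t] rt rep_one_L0[of M] rep_cls[OF m1] by eventually_elim simp
    qed (use t m1 in auto)
    have c1: "cls M (\<lambda>w. 1 - t w) \<in> carrier (L0 M)" using m1 by simp
    let ?A = "ext_mult M (to_ext M (cls M t)) (f x)" and ?B = "ext_mult M (to_ext M (cls M (\<lambda>w. 1 - t w))) (f y)"
    note A = rep_ext_ops(5,6)[OF rep_to_ext(2)[OF t] fx[OF 5(1)]]
    note B = rep_ext_ops(5,6)[OF rep_to_ext(2)[OF c1] fx[OF 5(2)]]
    have "ae_le M (f (cls M t \<odot>\<^bsub>X\<^esub> x \<oplus>\<^bsub>X\<^esub> (\<one>\<^bsub>L0 M\<^esub> \<ominus>\<^bsub>L0 M\<^esub> cls M t) \<odot>\<^bsub>X\<^esub> y))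
      (ext_add M (ext_mult M (to_ext M (cls M t)) (f x)) (ext_mult M (to_ext M (\<one>\<^bsub>L0 M\<^esub> \<ominus>\<^bsub>L0 M\<^esub> cls M t)) (f y)))"
      using f 5(1,2) tp t1 unfolding proper_convex_functions_def by blast
    then have "AE w in M. rep (f (cls M t \<odot>\<^bsub>X\<^esub> x \<oplus>\<^bsub>X\<^esub> cls M (\<lambda>w. 1 - t w) \<odot>\<^bsub>X\<^esub> y)) w \<le> rep (ext_add M ?A ?B) w"
      unfolding e ae_le_def .
    then show ?case
      using rep_ext_ops(1)[OF A(2) B(2)] A(1) B(1) rep_to_ext(1)[OF t] rep_to_ext(1)[OF c1] rt rep_cls[OF m1]
      by eventually_elim simp
  qed
  then show "\<exists>x1. convex_fun M (carrier X) (add X) \<zero>\<^bsub>X\<^esub> (\<lambda>a x. cls M a \<odot>\<^bsub>X\<^esub> x) (\<lambda>x. rep (f x)) x1" ..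
qed

text \<open>If an upper bound h of the minorants were below f x on a set B, a real r0 could be
  placed strictly between them on B, and a minorant reaching r0 there would exceed h.\<close>

lemma fclI_of_minorants:
  assumes f: "f \<in> X \<rightarrow>\<^sub>E ae_classes M" and x1: "x1 \<in> X" "AE w in M. rep (f x1) w < \<infinity>"
    and b: "\<And>x y. x \<in> X \<Longrightarrow> y \<in> Y \<Longrightarrow> b x y \<in> \<L> M"
    and ex: "\<exists>y\<in>Y. \<exists>a\<in>\<L> M. aff_minor M X (\<lambda>x. rep (f x)) (\<lambda>x. b x y) a"
    and ap: "\<And>x0 r0 B. \<lbrakk>x0 \<in> X; r0 \<in> \<L> M; B \<in> sets M; AE w in M. w \<in> B \<longrightarrow> ereal (r0 w) < rep (f x0) w\<rbrakk> \<Longrightarrow>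
       \<exists>y\<in>Y. \<exists>a\<in>\<L> M. aff_minor M X (\<lambda>x. rep (f x)) (\<lambda>x. b x y) a \<and> (AE w in M. w \<in> B \<longrightarrow> r0 w \<le> b x0 y w + a w)"
  shows "f \<in> fcl M X Y b"
proof -
  have am: "aminor M X Y b f y a" if "y \<in> Y" "a \<in> \<L> M" "aff_minor M X (\<lambda>x. rep (f x)) (\<lambda>x. b x y) a" for y a
    using that by (simp add: aminor_def aff_minor_def)
  have "AE w in M. rep (f x) w \<le> h w"
    if x: "x \<in> X" and h[measurable]: "h \<in> \<L> M"
      and le: "\<And>y a. aminor M X Y b f y a \<Longrightarrow> AE w in M. ereal (b x y w + a w) \<le> h w" for x h
  proof -
    define B where "B = {w \<in> space M. h w < rep (f x) w}"
    have [measurable]: "rep (f x) \<in> \<L> M" using f x by (auto intro: rep_props)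
    have B: "B \<in> sets M" unfolding B_def by measurable
    \<comment> \<open>A real number strictly between h and f x, namely their mean when both are
      finite; the other cases treat infinite endpoints.\<close>
    define r0 where "r0 w = (if h w = - \<infinity> then (if rep (f x) w = \<infinity> then 0 else real_of_ereal (rep (f x) w) - 1)
      else if rep (f x) w = \<infinity> then real_of_ereal (h w) + 1 else (real_of_ereal (h w) + real_of_ereal (rep (f x) w)) / 2)" for w
    have r0m: "r0 \<in> \<L> M" unfolding r0_def by measurable
    have r0: "h w < ereal (r0 w) \<and> ereal (r0 w) < rep (f x) w" if "w \<in> B" for w
      using that unfolding B_def r0_def by (cases "h w"; cases "rep (f x) w") auto
    obtain y a where y: "y \<in> Y" "a \<in> \<L> M" "aff_minor M X (\<lambda>x. rep (f x)) (\<lambda>x. b x y) a"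
      "AE w in M. w \<in> B \<longrightarrow> r0 w \<le> b x y w + a w"
      using ap[OF x r0m B] r0 by auto
    have "AE w in M. w \<notin> B" using y(4) le[OF am[OF y(1-3)]]
    proof eventually_elim
      case (elim w)
      show ?case
      proof
        assume w: "w \<in> B"
        have "ereal (r0 w) \<le> ereal (b x y w + a w)" using elim(1) w by simp
        also have "\<dots> \<le> h w" by (rule elim(2))
        finally have "ereal (r0 w) \<le> h w" .
        then show False using r0[OF w] leD by blast
      qed
    qed
    then show ?thesis using AE_space by eventually_elim (auto simp: B_def not_less)
  qed
  moreover have "\<exists>y a. aminor M X Y b f y a" using ex am by blast
  ultimately show ?thesis using f x1 unfolding fcl_def by blast
qed

text \<open>An affine minorant at a convex combination is the combination of its values, hence below
  the combination of the values of f; the supremum inherits this.\<close>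

lemma proper_convex_of_fcl:
  assumes mod: "module (L0 M) X"
    and pair: "rpair M (carrier X) (add X) \<zero>\<^bsub>X\<^esub> (\<lambda>a x. cls M a \<odot>\<^bsub>X\<^esub> x) Y plY zrY acY b"
    and f: "f \<in> fcl M (carrier X) Y b"
  shows "f \<in> proper_convex_functions M X"
proof -
  interpret P: rpair M "carrier X" "add X" "\<zero>\<^bsub>X\<^esub>" "\<lambda>a x. cls M a \<odot>\<^bsub>X\<^esub> x" Y plY zrY acY b by (rule pair)
  interpret L: cring "L0 M" by (rule cring_L0)
  note fx = P.fclD(1)[OF f] and fm = P.fclD(6)[OF f]
  have inf: "AE w in M. rep (cls M (\<lambda>_. c :: ereal)) w = c" for c by (rule rep_cls) simp
  have 1: "f \<in> carrier X \<rightarrow>\<^sub>E carrier (L0bar M)" using f by (simp add: fcl_def L0bar_def)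
  have 2: "less_on M (space M) (cls M (\<lambda>_. - \<infinity>)) (f x)" if "x \<in> carrier X" for x
    unfolding less_on_def using P.fclD(7)[OF f that] inf[of "- \<infinity>"] by eventually_elim simp
  have 3: "eff_dom M X f \<noteq> {}"
  proof -
    obtain x where x: "x \<in> carrier X" "AE w in M. rep (f x) w < \<infinity>" using P.fclD(3)[OF f] by blast
    have "less_on M (space M) (f x) (cls M (\<lambda>_. \<infinity>))"
      unfolding less_on_def using x(2) inf[of \<infinity>] by eventually_elim simp
    then show ?thesis using x(1) by (auto simp: eff_dom_def)
  qed
  have 4: "ae_le M (f (\<xi> \<odot>\<^bsub>X\<^esub> x \<oplus>\<^bsub>X\<^esub> (\<one>\<^bsub>L0 M\<^esub> \<ominus>\<^bsub>L0 M\<^esub> \<xi>) \<odot>\<^bsub>X\<^esub> y))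
          (ext_add M (ext_mult M (to_ext M \<xi>) (f x)) (ext_mult M (to_ext M (\<one>\<^bsub>L0 M\<^esub> \<ominus>\<^bsub>L0 M\<^esub> \<xi>)) (f y)))"
    if x: "x \<in> carrier X" and y: "y \<in> carrier X" and \<xi>: "\<xi> \<in> L0_pos M" and le: "ae_le M \<xi> \<one>\<^bsub>L0 M\<^esub>" for x y \<xi>
  proof -
    note \<xi>c = L0_posD[OF \<xi>]
    have \<eta>c: "\<one>\<^bsub>L0 M\<^esub> \<ominus>\<^bsub>L0 M\<^esub> \<xi> \<in> carrier (L0 M)" using \<xi>c by simp
    let ?t = "rep \<xi>" and ?s = "rep (\<one>\<^bsub>L0 M\<^esub> \<ominus>\<^bsub>L0 M\<^esub> \<xi>)"
    note sm = rep_L0(1)[OF \<eta>c]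
    have st: "AE w in M. ?s w = 1 - ?t w" using rep_minus_L0[OF L.one_closed \<xi>c(1)] rep_one_L0[of M] by eventually_elim simp
    have t1: "AE w in M. ?t w \<le> 1" using le rep_one_L0[of M] unfolding ae_le_def by eventually_elim simp
    let ?A = "ext_mult M (to_ext M \<xi>) (f x)" and ?B = "ext_mult M (to_ext M (\<one>\<^bsub>L0 M\<^esub> \<ominus>\<^bsub>L0 M\<^esub> \<xi>)) (f y)"
    note A = rep_ext_ops(5,6)[OF rep_to_ext(2)[OF \<xi>c(1)] fx[OF x]]
    note B = rep_ext_ops(5,6)[OF rep_to_ext(2)[OF \<eta>c] fx[OF y]]
    have z: "\<xi> \<odot>\<^bsub>X\<^esub> x \<in> carrier X" "(\<one>\<^bsub>L0 M\<^esub> \<ominus>\<^bsub>L0 M\<^esub> \<xi>) \<odot>\<^bsub>X\<^esub> y \<in> carrier X"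
      using mod x y \<xi>c(1) \<eta>c by (auto intro: module.smult_closed)
    have "AE w in M. rep (f (\<xi> \<odot>\<^bsub>X\<^esub> x \<oplus>\<^bsub>X\<^esub> (\<one>\<^bsub>L0 M\<^esub> \<ominus>\<^bsub>L0 M\<^esub> \<xi>) \<odot>\<^bsub>X\<^esub> y)) w \<le> rep (ext_add M ?A ?B) w"
    proof (rule P.fclD(5)[OF f P.X.pl_in[OF z]])
      show "rep (ext_add M ?A ?B) \<in> \<L> M" using rep_ext_ops(2)[OF A(2) B(2)] by (rule rep_props)
      fix u a assume am: "aminor M (carrier X) Y b f u a"
      then have u: "u \<in> Y" and l: "AE w in M. ereal (b x u w + a w) \<le> rep (f x) w" "AE w in M. ereal (b y u w + a w) \<le> rep (f y) w"
        using x y by (auto simp: aminor_def)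
      have bx: "AE w in M. b (\<xi> \<odot>\<^bsub>X\<^esub> x) u w = ?t w * b x u w"
        using P.X.rlinD(3)[OF P.linX[OF u] \<xi>c(3) x] by (simp add: rep_L0(2)[OF \<xi>c(1)])
      have by': "AE w in M. b ((\<one>\<^bsub>L0 M\<^esub> \<ominus>\<^bsub>L0 M\<^esub> \<xi>) \<odot>\<^bsub>X\<^esub> y) u w = ?s w * b y u w"
        using P.X.rlinD(3)[OF P.linX[OF u] sm y] by (simp add: rep_L0(2)[OF \<eta>c])
      show "AE w in M. ereal (b (\<xi> \<odot>\<^bsub>X\<^esub> x \<oplus>\<^bsub>X\<^esub> (\<one>\<^bsub>L0 M\<^esub> \<ominus>\<^bsub>L0 M\<^esub> \<xi>) \<odot>\<^bsub>X\<^esub> y) u w + a w) \<le> rep (ext_add M ?A ?B) w"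
        using P.X.rlinD(2)[OF P.linX[OF u] z] bx by' l st t1 \<xi>c(2) rep_ext_ops(1)[OF A(2) B(2)] A(1) B(1)
          rep_to_ext(1)[OF \<xi>c(1)] rep_to_ext(1)[OF \<eta>c]
      proof eventually_elim
        case (elim w)
        have "ereal (?t w) * ereal (b x u w + a w) + ereal (?s w) * ereal (b y u w + a w) \<le>
            ereal (?t w) * rep (f x) w + ereal (?s w) * rep (f y) w"
          using elim(4-8) by (intro add_mono ereal_mult_left_mono) auto
        moreover have "?t w * (b x u w + a w) + ?s w * (b y u w + a w) = ?t w * b x u w + ?s w * b y u w + (?t w + ?s w) * a w"
          by (simp add: algebra_simps)
        then have "ereal (?t w) * ereal (b x u w + a w) + ereal (?s w) * ereal (b y u w + a w) =
           ereal (?t w * b x u w + ?s w * b y u w + a w)" using elim(6) by simp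
        ultimately show ?case using elim(1-3,9-13) by simp
      qed
    qed
    then show ?thesis by (simp add: ae_le_def)
  qed
  show ?thesis unfolding proper_convex_functions_def using 1 2 3 4 by blast
qed

text \<open>The epigraph is cut out by affine minorants. For a limit point, the violation
  \<open>e\<close> of the inequality given by one minorant is bounded by the pairing with the
  displacement and the change of the scalar, and both can be made small. The topology enters only
  through \<open>cont\<close>, so both closures are covered.\<close>

lemma closed_epi_of_fcl:
  assumes mod: "module (L0 M) X"
    and pair: "rpair M (carrier X) (add X) \<zero>\<^bsub>X\<^esub> (\<lambda>a x. cls M a \<odot>\<^bsub>X\<^esub> x) Y plY zrY acY b"
    and f: "f \<in> fcl M (carrier X) Y b"
    and p: "\<And>p z. p \<in> \<P> \<Longrightarrow> z \<in> carrier (module_prod X (L0 M)) \<Longrightarrow> p z \<in> L0_pos M"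
    and cont: "\<And>y e. y \<in> Y \<Longrightarrow> 0 < e \<Longrightarrow> \<exists>Q d. finite Q \<and> Q \<subseteq> \<P> \<and> 0 < d \<and>
       (\<forall>z\<in>carrier X. \<forall>r\<in>carrier (L0 M). (\<forall>p\<in>Q. mu M (rep (p (z, r))) < d) \<longrightarrow> mu M (b z y) < e \<and> mu M (rep r) < e)"
  shows "closedin (prob_topology M (module_prod X (L0 M)) \<P>) (epi M X f)"
proof -
  interpret P: rpair M "carrier X" "add X" "\<zero>\<^bsub>X\<^esub>" "\<lambda>a x. cls M a \<odot>\<^bsub>X\<^esub> x" Y plY zrY acY b by (rule pair)
  interpret Xm: module "L0 M" X by (rule mod)
  have modp: "module (L0 M) (module_prod X (L0 M))" by (rule module_module_prod[OF mod module_L0])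
  have sub: "epi M X f \<subseteq> carrier (module_prod X (L0 M))" by (auto simp: epi_def carrier_module_prod)
  have cl: "closedin (prob_topology M (module_prod X (L0 M)) \<P>) (epi M X f) \<longleftrightarrow> (\<forall>x\<in>carrier (module_prod X (L0 M)). (\<forall>Q d. finite Q \<longrightarrow> Q \<subseteq> \<P> \<longrightarrow> 0 < d \<longrightarrow>
     (\<exists>y\<in>epi M X f. \<forall>p\<in>Q. mu M (rep (p (y \<ominus>\<^bsub>module_prod X (L0 M)\<^esub> x))) < d)) \<longrightarrow> x \<in> epi M X f)"
    by (rule closed_prob_topology[OF modp _ sub]) (rule p)
  show ?thesis unfolding cl
  proof (intro ballI impI)
    fix z0 assume z0: "z0 \<in> carrier (module_prod X (L0 M))"
      and near: "\<forall>Q d. finite Q \<longrightarrow> Q \<subseteq> \<P> \<longrightarrow> 0 < d \<longrightarrow>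
        (\<exists>y\<in>epi M X f. \<forall>p\<in>Q. mu M (rep (p (y \<ominus>\<^bsub>module_prod X (L0 M)\<^esub> z0))) < d)"
    obtain x0 r0 where z0e: "z0 = (x0, r0)" and x0: "x0 \<in> carrier X" and r0: "r0 \<in> carrier (L0 M)"
      using z0 by (auto simp: carrier_module_prod)
    note [measurable] = rep_L0(1)[OF r0]
    have "AE w in M. rep (f x0) w \<le> ereal (rep r0 w)"
    proof (rule P.fclD(5)[OF f x0])
      fix y a assume am: "aminor M (carrier X) Y b f y a"
      then have y: "y \<in> Y" and a[measurable]: "a \<in> \<L> M"
        and le: "\<And>x. x \<in> carrier X \<Longrightarrow> AE w in M. ereal (b x y w + a w) \<le> rep (f x) w" by (auto simp: aminor_def)
      note [measurable] = P.b_meas[OF x0 y]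
      define e where "e w = max 0 (b x0 y w + a w - rep r0 w)" for w
      have em: "e \<in> \<L> M" unfolding e_def by measurable
      have "mu M e = 0"
      proof (rule ccontr)
        assume "mu M e \<noteq> 0"
        then have pos: "0 < mu M e / 2" using mu_nonneg[of e] by linarith
        obtain Q d where Q: "finite Q" "Q \<subseteq> \<P>" "0 < d"
          and c: "\<And>z r. z \<in> carrier X \<Longrightarrow> r \<in> carrier (L0 M) \<Longrightarrow> (\<forall>p\<in>Q. mu M (rep (p (z, r))) < d) \<Longrightarrow>
            mu M (b z y) < mu M e / 2 \<and> mu M (rep r) < mu M e / 2"
          using cont[OF y pos] by blast
        obtain g where g: "g \<in> epi M X f" "\<forall>p\<in>Q. mu M (rep (p (g \<ominus>\<^bsub>module_prod X (L0 M)\<^esub> z0))) < d"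
          using near Q by blast
        obtain x r where ge: "g = (x, r)" and x: "x \<in> carrier X" and r: "r \<in> carrier (L0 M)" and fle: "ae_le M (f x) (to_ext M r)"
          using g(1) by (auto simp: epi_def)
        have gz: "g \<ominus>\<^bsub>module_prod X (L0 M)\<^esub> z0 = (x \<ominus>\<^bsub>X\<^esub> x0, r \<ominus>\<^bsub>L0 M\<^esub> r0)"
          unfolding ge z0e by (rule minus_module_prod[OF mod module_L0 x x0 r r0])
        have dx: "x \<ominus>\<^bsub>X\<^esub> x0 \<in> carrier X" "r \<ominus>\<^bsub>L0 M\<^esub> r0 \<in> carrier (L0 M)" using x x0 r r0 by auto
        have s: "mu M (b (x \<ominus>\<^bsub>X\<^esub> x0) y) < mu M e / 2" "mu M (rep (r \<ominus>\<^bsub>L0 M\<^esub> r0)) < mu M e / 2"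
          using c[OF dx] g(2) unfolding gz by auto
        have bd: "AE w in M. b (x \<ominus>\<^bsub>X\<^esub> x0) y w = b x y w - b x0 y w"
          using P.X.rlin_diff[OF P.linX[OF y] x x0] by (simp add: minus_neg(1)[OF mod x x0])
        have "AE w in M. \<bar>e w\<bar> \<le> \<bar>b (x \<ominus>\<^bsub>X\<^esub> x0) y w\<bar> + \<bar>rep (r \<ominus>\<^bsub>L0 M\<^esub> r0) w\<bar>"
          using bd rep_minus_L0[OF r r0] le[OF x] fle[unfolded ae_le_def] rep_to_ext(1)[OF r]
        proof eventually_elim
          case (elim w)
          have "ereal (b x y w + a w) \<le> ereal (rep r w)" using elim(3-5) by (metis order_trans)
          then show ?case using elim(1,2) by (simp add: e_def)
        qed
        then have "mu M e \<le> mu M (b (x \<ominus>\<^bsub>X\<^esub> x0) y) + mu M (rep (r \<ominus>\<^bsub>L0 M\<^esub> r0))"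
          by (intro mu_le_add em P.b_meas[OF dx(1) y] rep_L0(1)[OF dx(2)])
        then show False using s by linarith
      qed
      then have "AE w in M. e w = 0" using mu_eq_0[OF em] by simp
      then show "AE w in M. ereal (b x0 y w + a w) \<le> ereal (rep r0 w)"
        by eventually_elim (auto simp: e_def max_def split: if_splits)
    qed measurable
    then have "ae_le M (f x0) (to_ext M r0)" unfolding ae_le_def using rep_to_ext(1)[OF r0] by eventually_elim simp
    then show "z0 \<in> epi M X f" using x0 r0 by (simp add: epi_def z0e)
  qed
qed

end

section \<open>Distances from the epigraph\<close>

context prob_space
begin

text \<open>Transfers \<open>distance_pos\<close> to the epigraph of a function of classes.
  \<open>\<P>\<close> generates the topology on pairs with a class as second component,
  \<open>\<Q>\<close> consists of seminorms on pairs with a function there. Each finite part of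
  \<open>\<P>\<close> is dominated by a single member of \<open>\<Q>\<close>, so approximation with
  respect to \<open>\<Q>\<close> implies topological approximation.\<close>

lemma epigraph_distance:
  fixes X :: "(('a \<Rightarrow> real) set, 'x) module" and f :: "'x \<Rightarrow> ('a \<Rightarrow> ereal) set"
  defines "F \<equiv> convex_fun.ep M (carrier X) (\<lambda>x. rep (f x))"
  assumes mod: "module (L0 M) X"
    and cf: "convex_fun M (carrier X) (add X) \<zero>\<^bsub>X\<^esub> (\<lambda>a x. cls M a \<odot>\<^bsub>X\<^esub> x) (\<lambda>x. rep (f x)) x1"
    and cl: "closedin (prob_topology M (module_prod X (L0 M)) \<P>) (epi M X f)"
    and pos: "\<And>p z. p \<in> \<P> \<Longrightarrow> z \<in> carrier (module_prod X (L0 M)) \<Longrightarrow> p z \<in> L0_pos M"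
    and q: "\<And>q. q \<in> \<Q> \<Longrightarrow> rmodule.rseminorm M (carrier X \<times> \<L> M)
      (\<lambda>(x, r) (y, s). (x \<oplus>\<^bsub>X\<^esub> y, \<lambda>w. r w + s w)) (\<lambda>a (x, r). (cls M a \<odot>\<^bsub>X\<^esub> x, \<lambda>w. a w * r w)) q"
    and dom: "\<And>P. finite P \<Longrightarrow> P \<subseteq> \<P> \<Longrightarrow> \<exists>q\<in>\<Q>. \<forall>p\<in>P. \<forall>x\<in>carrier X. \<forall>r\<in>\<L> M.
      AE w in M. rep (p (x, cls M r)) w \<le> q (x, r) w"
    and x0: "x0 \<in> carrier X" and r0: "r0 \<in> \<L> M" and B: "B \<in> sets M"
    and l: "AE w in M. w \<in> B \<longrightarrow> ereal (r0 w) < rep (f x0) w"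
  obtains Qs ds where "\<And>n::nat. Qs n \<in> \<Q>" "\<And>n. ds n \<in> \<L> M" "\<And>n. AE w in M. (0::real) \<le> ds n w"
    "\<And>n x r. (x, r) \<in> F \<Longrightarrow> AE w in M. ds n w \<le> Qs n (x \<ominus>\<^bsub>X\<^esub> x0, \<lambda>w. r w - r0 w) w"
    "AE w in M. w \<in> B \<longrightarrow> (\<exists>n. 0 < ds n w)"
proof -
  interpret F: convex_fun M "carrier X" "add X" "\<zero>\<^bsub>X\<^esub>" "\<lambda>a x. cls M a \<odot>\<^bsub>X\<^esub> x" "\<lambda>x. rep (f x)" x1 by (rule cf)
  interpret X: module "L0 M" X by (rule mod)
  interpret L: cring "L0 M" by (rule cring_L0)
  have F: "F = F.ep" by (simp add: F_def)
  have epI: "(x, s) \<in> F.ep \<longleftrightarrow> (x, cls M s) \<in> epi M X f" if s: "s \<in> \<L> M" for x s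
  proof (cases "x \<in> carrier X")
    case True
    have "(AE w in M. rep (f x) w \<le> ereal (s w)) \<longleftrightarrow> ae_le M (f x) (to_ext M (cls M s))"
      unfolding ae_le_def using rep_to_ext(1)[OF cls_L0[OF s]] rep_cls[OF s]
      by (intro iffI; (drule AE_conjI, assumption, drule AE_conjI, assumption)?) (auto elim!: eventually_rev_mp)
    then show ?thesis using True s by (simp add: F.ep_def epi_def)
  qed (auto simp: F.ep_def epi_def)
  have diff: "F.minus_ep (y, r) (x, s) = (y \<ominus>\<^bsub>X\<^esub> x, \<lambda>w. r w - s w)" if "x \<in> carrier X" "y \<in> carrier X" for x y r s
    using that minus_neg(1)[OF mod that(2,1)] by simp
  have sub: "epi M X f \<subseteq> carrier (module_prod X (L0 M))" by (auto simp: epi_def carrier_module_prod)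
  have cl': "\<forall>x\<in>carrier (module_prod X (L0 M)). (\<forall>Q d. finite Q \<longrightarrow> Q \<subseteq> \<P> \<longrightarrow> 0 < d \<longrightarrow>
     (\<exists>y\<in>epi M X f. \<forall>p\<in>Q. mu M (rep (p (y \<ominus>\<^bsub>module_prod X (L0 M)\<^esub> x))) < d)) \<longrightarrow> x \<in> epi M X f"
    using cl by (subst (asm) closed_prob_topology[OF module_module_prod[OF mod module_L0] _ sub]) (use pos in auto)
  have z0: "(x0, r0) \<in> carrier X \<times> \<L> M" using x0 r0 by simp
  have ne: "\<Q> \<noteq> {}" using dom[of "{}"] by auto
  show ?thesis
  proof (rule F.prd.distance_pos[of \<Q> F.ep "(x0, r0)" B])
    show "F.ep \<noteq> {}" using F.ep_in by blast
    fix z :: "'x \<times> ('a \<Rightarrow> real)" assume z: "z \<in> carrier X \<times> \<L> M"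
      and near: "\<And>p d. p \<in> \<Q> \<Longrightarrow> 0 < d \<Longrightarrow> \<exists>g\<in>F.ep. mu M (p (F.minus_ep g z)) < d"
    obtain x s where zs: "z = (x, s)" "x \<in> carrier X" "s \<in> \<L> M" using z by auto
    have "(x, cls M s) \<in> epi M X f"
    proof (rule cl'[rule_format])
      show "(x, cls M s) \<in> carrier (module_prod X (L0 M))" using zs by (simp add: carrier_module_prod)
      fix P and d :: real assume P: "finite P" "P \<subseteq> \<P>" "0 < d"
      obtain p0 where p0: "p0 \<in> \<Q>" "\<forall>p\<in>P. \<forall>x\<in>carrier X. \<forall>r\<in>\<L> M. AE w in M. rep (p (x, cls M r)) w \<le> p0 (x, r) w"
        using dom[OF P(1,2)] by (rule bexE)
      obtain g where g: "g \<in> F.ep" "mu M (p0 (F.minus_ep g z)) < d" using near[OF p0(1) P(3)] by (rule bexE)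
      obtain y r where gy: "g = (y, r)" by (cases g)
      have yr: "y \<in> carrier X" "r \<in> \<L> M" using g(1) gy by (auto simp: F.ep_def)
      have dX: "y \<ominus>\<^bsub>X\<^esub> x \<in> carrier X" and dm: "(\<lambda>w. r w - s w) \<in> \<L> M" using zs yr by auto
      have "cls M r \<ominus>\<^bsub>L0 M\<^esub> cls M s = cls M (\<lambda>w. r w - s w)"
      proof (rule L0_eqI)
        show "AE w in M. rep (cls M r \<ominus>\<^bsub>L0 M\<^esub> cls M s) w = rep (cls M (\<lambda>w. r w - s w)) w"
          using rep_minus_L0[OF cls_L0[OF yr(2)] cls_L0[OF zs(3)]] rep_cls[OF yr(2)] rep_cls[OF zs(3)] rep_cls[OF dm]
          by eventually_elim simp
      qed (use yr zs dm in auto)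
      then have e: "(y, cls M r) \<ominus>\<^bsub>module_prod X (L0 M)\<^esub> (x, cls M s) = (y \<ominus>\<^bsub>X\<^esub> x, cls M (\<lambda>w. r w - s w))"
        using minus_module_prod[OF mod module_L0 yr(1) zs(2) cls_L0[OF yr(2)] cls_L0[OF zs(3)]] by simp
      have p0m: "p0 (y \<ominus>\<^bsub>X\<^esub> x, \<lambda>w. r w - s w) \<in> \<L> M"
        by (rule F.prd.rseminormD(1)[OF q[OF p0(1)]]) (use dX dm in simp)
      have "\<forall>p\<in>P. mu M (rep (p ((y, cls M r) \<ominus>\<^bsub>module_prod X (L0 M)\<^esub> (x, cls M s)))) < d"
      proof
        fix p assume p: "p \<in> P"
        have L: "p (y \<ominus>\<^bsub>X\<^esub> x, cls M (\<lambda>w. r w - s w)) \<in> L0_pos M"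
          using pos P(2) p dX dm by (auto simp: carrier_module_prod)
        have "AE w in M. rep (p (y \<ominus>\<^bsub>X\<^esub> x, cls M (\<lambda>w. r w - s w))) w \<le> p0 (y \<ominus>\<^bsub>X\<^esub> x, \<lambda>w. r w - s w) w"
          using p0(2) p dX dm by blast
        then have "AE w in M. \<bar>rep (p (y \<ominus>\<^bsub>X\<^esub> x, cls M (\<lambda>w. r w - s w))) w\<bar> \<le> \<bar>p0 (y \<ominus>\<^bsub>X\<^esub> x, \<lambda>w. r w - s w) w\<bar>"
          using L0_posD(2)[OF L] by eventually_elim simp
        then have "mu M (rep (p (y \<ominus>\<^bsub>X\<^esub> x, cls M (\<lambda>w. r w - s w)))) \<le> mu M (p0 (y \<ominus>\<^bsub>X\<^esub> x, \<lambda>w. r w - s w))"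
          by (rule mu_mono[OF L0_posD(3)[OF L] p0m])
        also have "\<dots> < d" using g(2) unfolding gy zs(1) diff[OF zs(2) yr(1)] .
        finally show "mu M (rep (p ((y, cls M r) \<ominus>\<^bsub>module_prod X (L0 M)\<^esub> (x, cls M s)))) < d" unfolding e .
      qed
      moreover have "(y, cls M r) \<in> epi M X f" using g(1) epI[OF yr(2)] gy by simp
      ultimately show "\<exists>y\<in>epi M X f. \<forall>p\<in>P. mu M (rep (p (y \<ominus>\<^bsub>module_prod X (L0 M)\<^esub> (x, cls M s)))) < d" by (rule bexI)
    qed
    then show "z \<in> F.ep" using epI[OF zs(3)] zs(1) by simp
  next
    fix A g assume "A \<in> sets M" "A \<subseteq> B" "g \<in> F.ep" "F.prd.glue A (x0, r0) g \<in> F.ep"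
    then show "AE w in M. w \<notin> A" by (rule F.ep_disjoint[OF x0 r0 l])
  next
    fix Qs ds assume 1: "\<And>n::nat. Qs n \<in> \<Q>" "\<And>n. ds n \<in> \<L> M" "\<And>n. AE w in M. (0::real) \<le> ds n w"
      and 2: "\<And>n g. g \<in> F.ep \<Longrightarrow> AE w in M. ds n w \<le> Qs n (F.minus_ep g (x0, r0)) w"
      and 3: "AE w in M. w \<in> B \<longrightarrow> (\<exists>n. 0 < ds n w)"
    have 4: "AE w in M. ds n w \<le> Qs n (x \<ominus>\<^bsub>X\<^esub> x0, \<lambda>w. r w - r0 w) w" if "(x, r) \<in> F" for n x r
    proof -
      have x: "x \<in> carrier X" using that F.ep_sub unfolding F by auto
      show ?thesis using 2[OF that[unfolded F], of n] unfolding diff[OF x0 x] .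
    qed
    show thesis by (rule that[OF 1 4 3])
  qed (use q F.ep_sub F.ep_convex z0 B ne in auto)
qed

end

section \<open>The two classes of functions for a random normed module\<close>

context random_normed_module
begin

abbreviation epi_nrm :: "'e \<times> ('w \<Rightarrow> real) set \<Rightarrow> ('w \<Rightarrow> real) set" where
  "epi_nrm \<equiv> \<lambda>(x, r). nrm x \<oplus>\<^bsub>L0 M\<^esub> L0_abs M r"

abbreviation wstar_nrms :: "(('e \<Rightarrow> ('w \<Rightarrow> real) set) \<times> ('w \<Rightarrow> real) set \<Rightarrow> ('w \<Rightarrow> real) set) set" where
  "wstar_nrms \<equiv> (\<lambda>x (u, r). L0_abs M (u x) \<oplus>\<^bsub>L0 M\<^esub> L0_abs M r) ` carrier E"

lemma rep_epi_nrm: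
  assumes "x \<in> carrier E" "r \<in> carrier (L0 M)"
  shows "AE w in M. rep (epi_nrm (x, r)) w = N x w + \<bar>rep r w\<bar>" "epi_nrm (x, r) \<in> L0_pos M"
proof -
  show 1: "AE w in M. rep (epi_nrm (x, r)) w = N x w + \<bar>rep r w\<bar>"
    using rep_add_L0[OF N_props(1)[OF assms(1)] rep_abs_L0(2)[OF assms(2)]] rep_abs_L0(1)[OF assms(2)]
    unfolding prod.case by eventually_elim simp
  show "epi_nrm (x, r) \<in> L0_pos M"
  proof (rule L0_posI)
    show "epi_nrm (x, r) \<in> carrier (L0 M)" using N_props(1)[OF assms(1)] rep_abs_L0(2)[OF assms(2)] by simp
    show "AE w in M. 0 \<le> rep (epi_nrm (x, r)) w" using 1 N_props(2)[OF assms(1)] by eventually_elim simp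
  qed
qed

lemma rep_wstar_nrm:
  assumes "x \<in> carrier E" "u \<in> carrier D" "r \<in> carrier (L0 M)"
  shows "AE w in M. rep (L0_abs M (u x) \<oplus>\<^bsub>L0 M\<^esub> L0_abs M r) w = \<bar>pr x u w\<bar> + \<bar>rep r w\<bar>"
    "L0_abs M (u x) \<oplus>\<^bsub>L0 M\<^esub> L0_abs M r \<in> L0_pos M"
proof -
  note ux = dualD(1)[OF assms(2,1)]
  show 1: "AE w in M. rep (L0_abs M (u x) \<oplus>\<^bsub>L0 M\<^esub> L0_abs M r) w = \<bar>pr x u w\<bar> + \<bar>rep r w\<bar>"
    using rep_add_L0[OF rep_abs_L0(2)[OF ux] rep_abs_L0(2)[OF assms(3)]] rep_abs_L0(1)[OF ux] rep_abs_L0(1)[OF assms(3)]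
    by eventually_elim simp
  show "L0_abs M (u x) \<oplus>\<^bsub>L0 M\<^esub> L0_abs M r \<in> L0_pos M"
  proof (rule L0_posI)
    show "L0_abs M (u x) \<oplus>\<^bsub>L0 M\<^esub> L0_abs M r \<in> carrier (L0 M)" using rep_abs_L0(2)[OF ux] rep_abs_L0(2)[OF assms(3)] by simp
    show "AE w in M. 0 \<le> rep (L0_abs M (u x) \<oplus>\<^bsub>L0 M\<^esub> L0_abs M r) w" using 1 by eventually_elim simp
  qed
qed

lemma lsc_of_fcl:
  assumes f: "f \<in> pair.C"
  shows "f \<in> lsc_convex_functions M E nrm"
proof -
  have "closedin (eps_lambda_topology M (module_prod E (L0 M)) epi_nrm) (epi M E f)"
  proof (rule closed_epi_of_fcl[OF module_E pair.rpair_axioms f])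
    show "p z \<in> L0_pos M" if "p \<in> {epi_nrm}" "z \<in> carrier (module_prod E (L0 M))" for p z
      using that rep_epi_nrm(2) by (auto simp: carrier_module_prod)
    fix u and e :: real assume u: "u \<in> carrier D" and e: "0 < e"
    obtain d where d: "0 < d" "\<forall>x\<in>carrier E. mu M (N x) < d \<longrightarrow> mu M (rep (u x)) < e" using dualD(6)[OF u e] by blast
    have "mu M (pr z u) < e \<and> mu M (rep r) < e"
      if z: "z \<in> carrier E" and r: "r \<in> carrier (L0 M)" and m: "mu M (rep (epi_nrm (z, r))) < min d e" for z r
    proof -
      note L = L0_posD[OF rep_epi_nrm(2)[OF z r]]
      have "AE w in M. \<bar>N z w\<bar> \<le> \<bar>rep (epi_nrm (z, r)) w\<bar>" "AE w in M. \<bar>rep r w\<bar> \<le> \<bar>rep (epi_nrm (z, r)) w\<bar>"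
        using rep_epi_nrm(1)[OF z r] N_props(2)[OF z] by (eventually_elim, simp)+
      then have "mu M (N z) \<le> mu M (rep (epi_nrm (z, r)))" "mu M (rep r) \<le> mu M (rep (epi_nrm (z, r)))"
        using N_props(3)[OF z] rep_L0(1)[OF r] L(3) by (blast intro: mu_mono)+
      then show ?thesis using d(2) z m by auto
    qed
    then show "\<exists>Q d. finite Q \<and> Q \<subseteq> {epi_nrm} \<and> 0 < d \<and>
       (\<forall>z\<in>carrier E. \<forall>r\<in>carrier (L0 M). (\<forall>p\<in>Q. mu M (rep (p (z, r))) < d) \<longrightarrow> mu M (pr z u) < e \<and> mu M (rep r) < e)"
      using d(1) e by (intro exI[of _ "{epi_nrm}"] exI[of _ "min d e"]) auto
  qed
  then show ?thesis using proper_convex_of_fcl[OF module_E pair.rpair_axioms f] by (simp add: lsc_convex_functions_def)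
qed

lemma wstar_of_fcl:
  assumes g: "g \<in> pair.C'"
  shows "g \<in> wstar_lsc_convex_functions M E nrm"
proof -
  have "closedin (prob_topology M (module_prod D (L0 M)) wstar_nrms) (epi M D g)"
  proof (rule closed_epi_of_fcl[OF module_dual pair.swap g])
    show "p z \<in> L0_pos M" if "p \<in> wstar_nrms" "z \<in> carrier (module_prod D (L0 M))" for p z
      using that rep_wstar_nrm(2) by (auto simp: carrier_module_prod)
    fix x and e :: real assume x: "x \<in> carrier E" and e: "0 < e"
    let ?p = "\<lambda>(u, r). L0_abs M (u x) \<oplus>\<^bsub>L0 M\<^esub> L0_abs M r"
    have "mu M (pr x u) < e \<and> mu M (rep r) < e"
      if u: "u \<in> carrier D" and r: "r \<in> carrier (L0 M)" and m: "mu M (rep (?p (u, r))) < e" for u r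
    proof -
      note L = L0_posD[OF rep_wstar_nrm(2)[OF x u r]]
      have "AE w in M. \<bar>pr x u w\<bar> \<le> \<bar>rep (L0_abs M (u x) \<oplus>\<^bsub>L0 M\<^esub> L0_abs M r) w\<bar>" "AE w in M. \<bar>rep r w\<bar> \<le> \<bar>rep (L0_abs M (u x) \<oplus>\<^bsub>L0 M\<^esub> L0_abs M r) w\<bar>"
        using rep_wstar_nrm(1)[OF x u r] by (eventually_elim, simp)+
      then have "mu M (pr x u) \<le> mu M (rep (L0_abs M (u x) \<oplus>\<^bsub>L0 M\<^esub> L0_abs M r))" "mu M (rep r) \<le> mu M (rep (L0_abs M (u x) \<oplus>\<^bsub>L0 M\<^esub> L0_abs M r))"
        using dualD(2)[OF u x] rep_L0(1)[OF r] L(3) by (blast intro: mu_mono)+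
      then show ?thesis using m by auto
    qed
    then show "\<exists>Q d. finite Q \<and> Q \<subseteq> wstar_nrms \<and> 0 < d \<and>
       (\<forall>u\<in>carrier D. \<forall>r\<in>carrier (L0 M). (\<forall>p\<in>Q. mu M (rep (p (u, r))) < d) \<longrightarrow> mu M (pr x u) < e \<and> mu M (rep r) < e)"
      using e x by (intro exI[of _ "{?p}"] exI[of _ e]) auto
  qed
  then show ?thesis using proper_convex_of_fcl[OF module_dual pair.swap g] by (simp add: wstar_lsc_convex_functions_def)
qed

text \<open>The separating functional of the epigraph of \<open>f\<close> on \<open>E \<times> L\<^sup>0\<close> is dominated by \<open>\<parallel>x\<parallel> + |r|\<close>, so its
  restriction to \<open>E\<close> is continuous.\<close>
lemma fcl_of_lsc:
  assumes f: "f \<in> lsc_convex_functions M E nrm"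
  shows "f \<in> pair.C"
proof -
  have fp: "f \<in> proper_convex_functions M E"
    and cl: "closedin (eps_lambda_topology M (module_prod E (L0 M)) epi_nrm) (epi M E f)"
    using f by (auto simp: lsc_convex_functions_def)
  obtain x1 where "convex_fun M (carrier E) (add E) \<zero>\<^sub>E (\<lambda>a x. cls M a \<odot>\<^sub>E x) (\<lambda>x. rep (f x)) x1"
    using proper_convexD(2)[OF module_E fp] by blast
  then interpret F: convex_fun M "carrier E" "add E" "\<zero>\<^sub>E" "\<lambda>a x. cls M a \<odot>\<^sub>E x" "\<lambda>x. rep (f x)" x1 .
  define q where "q = (\<lambda>(x, s) w. N x w + \<bar>s w\<bar>)"
  have q: "F.prd.rseminorm q" unfolding F.prd.rseminorm_def
  proof (intro conjI ballI)
    fix z :: "'e \<times> ('w \<Rightarrow> real)" assume z: "z \<in> carrier E \<times> \<L> M"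
    then obtain x s where zs: "z = (x, s)" "x \<in> carrier E" "s \<in> \<L> M" by auto
    note [measurable] = zs(3) N_props(3)[OF zs(2)]
    show "q z \<in> \<L> M" unfolding zs(1) q_def prod.case by measurable
    show "AE w in M. 0 \<le> q z w" using N_props(2)[OF zs(2)] by eventually_elim (simp add: q_def zs(1))
  next
    fix z z' :: "'e \<times> ('w \<Rightarrow> real)" assume "z \<in> carrier E \<times> \<L> M" "z' \<in> carrier E \<times> \<L> M"
    then obtain x s y r where zs: "z = (x, s)" "x \<in> carrier E" "z' = (y, r)" "y \<in> carrier E" by auto
    show "AE w in M. q ((case z of (x, r) \<Rightarrow> \<lambda>(y, s). (x \<oplus>\<^sub>E y, \<lambda>w. r w + s w)) z') w \<le> q z w + q z' w"
      using N_tri[OF zs(2,4)] by eventually_elim (simp add: zs q_def)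
  next
    fix a and z :: "'e \<times> ('w \<Rightarrow> real)" assume a: "a \<in> (\<L> M :: ('w \<Rightarrow> real) set)" and "z \<in> carrier E \<times> \<L> M"
    then obtain x s where zs: "z = (x, s)" "x \<in> carrier E" by auto
    show "AE w in M. q (case z of (x, r) \<Rightarrow> (ac a x, \<lambda>w. a w * r w)) w = \<bar>a w\<bar> * q z w"
      using N_ac[OF a zs(2)] by eventually_elim (simp add: zs q_def abs_mult distrib_left)
  qed
  have sep: "\<exists>v\<in>(\<lambda>u x. pr x u) ` carrier D. \<exists>c\<in>\<L> M. \<exists>d\<in>\<L> M. (AE w in M. 0 \<le> d w) \<and> (AE w in M. w \<in> B \<longrightarrow> 0 < d w) \<and>
        (\<forall>x r. (x, r) \<in> F.ep \<longrightarrow> (AE w in M. v x w + c w * r w \<le> v x0 w + c w * r0 w - d w))"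
    if x0: "x0 \<in> carrier E" and r0: "r0 \<in> \<L> M" and B: "B \<in> sets M"
      and l: "AE w in M. w \<in> B \<longrightarrow> ereal (r0 w) < rep (f x0) w" for x0 r0 B
  proof -
    have z0: "(x0, r0) \<in> carrier E \<times> \<L> M" using x0 r0 by simp
    obtain Qs ds where Qs: "\<And>n::nat. Qs n \<in> {q}" and dm: "\<And>n. ds n \<in> \<L> M"
      and d0: "\<And>n. AE w in M. (0::real) \<le> ds n w"
      and dle: "\<And>n x r. (x, r) \<in> F.ep \<Longrightarrow> AE w in M. ds n w \<le> Qs n (x \<ominus>\<^sub>E x0, \<lambda>w. r w - r0 w) w"
      and dB: "AE w in M. w \<in> B \<longrightarrow> (\<exists>n. 0 < ds n w)"
    proof (rule epigraph_distance[OF module_E F.convex_fun_axioms cl _ _ _ x0 r0 B l, where \<Q> = "{q}"])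
      show "p z \<in> L0_pos M" if "p \<in> {epi_nrm}" "z \<in> carrier (module_prod E (L0 M))" for p z
        using that rep_epi_nrm(2) by (auto simp: carrier_module_prod)
      show "F.prd.rseminorm p" if "p \<in> {q}" for p using that q by simp
      fix P assume "P \<subseteq> {epi_nrm}"
      moreover have "AE w in M. rep (epi_nrm (x, cls M r)) w \<le> q (x, r) w" if "x \<in> carrier E" "r \<in> \<L> M" for x r
        using rep_epi_nrm(1)[OF that(1) cls_L0[OF that(2)]] rep_cls[OF that(2)] by eventually_elim (simp add: q_def)
      ultimately show "\<exists>q\<in>{q}. \<forall>p\<in>P. \<forall>x\<in>carrier E. \<forall>r\<in>\<L> M. AE w in M. rep (p (x, cls M r)) w \<le> q (x, r) w" by blast
    qed (rule that)
    \<comment> \<open>There is a single seminorm, so the countably many distances can be merged: at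
      each w the first positive one is taken, which gives one lower bound positive on B.\<close>
    define \<nu> where "\<nu> w = (LEAST n. 0 < ds n w)" for w
    define d where "d w = (if \<exists>n. 0 < ds n w then ds (\<nu> w) w else 0)" for w
    note [measurable] = dm
    have \<nu>m[measurable]: "\<nu> \<in> measurable M (count_space UNIV)" unfolding \<nu>_def by measurable
    have [measurable]: "(\<lambda>w. ds (\<nu> w) w) \<in> \<L> M"
      by (rule measurable_compose_countable[OF _ \<nu>m]) measurable
    have dmm: "d \<in> \<L> M" unfolding d_def by measurable
    have dpos: "0 < d w" if "\<exists>n. 0 < ds n w" for w
      using that LeastI_ex[OF that] by (simp add: d_def \<nu>_def)
    have dnn: "0 \<le> d w" for w using dpos[of w] by (cases "\<exists>n. 0 < ds n w") (auto simp: d_def)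
    have dq: "AE w in M. d w \<le> q (F.minus_ep g (x0, r0)) w" if g: "g \<in> F.ep" for g
    proof -
      obtain x r where xr: "g = (x, r)" "x \<in> carrier E" "r \<in> \<L> M" using g F.ep_sub by auto
      have m: "F.minus_ep g (x0, r0) \<in> carrier E \<times> \<L> M" using xr x0 r0 by simp
      have e: "F.minus_ep g (x0, r0) = (x \<ominus>\<^sub>E x0, \<lambda>w. r w - r0 w)" using xr x0 by (simp add: minus_E)
      have "AE w in M. \<forall>n. ds n w \<le> q (F.minus_ep g (x0, r0)) w"
        unfolding AE_all_countable e
      proof
        fix n show "AE w in M. ds n w \<le> q (x \<ominus>\<^sub>E x0, \<lambda>w. r w - r0 w) w"
          using dle[OF g[unfolded xr(1)], of n] Qs[of n] by simp
      qed
      then show ?thesis using F.prd.rseminormD(2)[OF q m] by eventually_elim (auto simp: d_def)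
    qed
    have ne: "F.ep \<noteq> {}" using F.ep_in by blast
    obtain v where v: "F.prd.rlin v" "\<And>z. z \<in> carrier E \<times> \<L> M \<Longrightarrow> AE w in M. \<bar>v z w\<bar> \<le> q z w"
      "\<And>g. g \<in> F.ep \<Longrightarrow> AE w in M. v g w \<le> v (x0, r0) w - d w"
      by (rule F.prd.separation[OF q F.ep_sub ne F.ep_convex z0 dmm dq]) (assumption, rule that)
    \<comment> \<open>Linearity splits the separating functional into a functional on E and a random
      multiple c of the scalar coordinate.\<close>
    define v1 where "v1 x = v (x, \<lambda>_. 0)" for x
    define c where "c = v (\<zero>\<^sub>E, \<lambda>_. 1)"
    have cm: "c \<in> \<L> M" unfolding c_def using F.prd.rlinD(1)[OF v(1), of "(\<zero>\<^sub>E, \<lambda>_. 1)"] by simp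
    have dec: "AE w in M. v (x, r) w = v1 x w + c w * r w" if x: "x \<in> carrier E" and r: "r \<in> \<L> M" for x r
    proof -
      have z: "(x, \<lambda>_. 0 :: real) \<in> carrier E \<times> \<L> M" "(\<zero>\<^sub>E, \<lambda>_. 1 :: real) \<in> carrier E \<times> \<L> M"
        "(\<zero>\<^sub>E, r) \<in> carrier E \<times> \<L> M" using x r by auto
      have "AE w in M. v (x, r) w = v (x, \<lambda>_. 0) w + v (\<zero>\<^sub>E, r) w"
        using F.prd.rlinD(2)[OF v(1) z(1,3)] x by simp
      moreover have "AE w in M. v (\<zero>\<^sub>E, r) w = r w * v (\<zero>\<^sub>E, \<lambda>_. 1) w"
        using F.prd.rlinD(3)[OF v(1) r z(2)] r by simp
      ultimately show ?thesis by eventually_elim (simp add: v1_def c_def)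
    qed
    have v1: "rE.rlin v1" unfolding rE.rlin_def
    proof (intro conjI ballI)
      fix x assume x: "x \<in> carrier E"
      show "v1 x \<in> \<L> M" unfolding v1_def by (rule F.prd.rlinD(1)[OF v(1)]) (use x in simp)
      show "AE w in M. v1 (x \<oplus>\<^sub>E y) w = v1 x w + v1 y w" if y: "y \<in> carrier E" for y
        using F.prd.rlinD(2)[OF v(1), of "(x, \<lambda>_. 0)" "(y, \<lambda>_. 0)"] x y by (simp add: v1_def)
    next
      fix a x assume "a \<in> (\<L> M :: ('w \<Rightarrow> real) set)" "x \<in> carrier E"
      then show "AE w in M. v1 (ac a x) w = a w * v1 x w"
        using F.prd.rlinD(3)[OF v(1), of a "(x, \<lambda>_. 0)"] by (simp add: v1_def)
    qed
    have v1le: "AE w in M. \<bar>v1 x w\<bar> \<le> N x w" if "x \<in> carrier E" for x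
      using v(2)[of "(x, \<lambda>_. 0)"] that by (simp add: v1_def q_def)
    define u where "u = (\<lambda>x\<in>carrier E. cls M (v1 x))"
    have u: "u \<in> carrier D" "x \<in> carrier E \<Longrightarrow> AE w in M. pr x u w = v1 x w" for x
      unfolding u_def by (rule dual_of_rlin[OF v1 v1le]; assumption)+
    have "AE w in M. pr x u w + c w * r w \<le> pr x0 u w + c w * r0 w - d w" if ep: "(x, r) \<in> F.ep" for x r
    proof -
      have x: "x \<in> carrier E" "r \<in> \<L> M" using ep by (auto simp: F.ep_def)
      show ?thesis using v(3)[OF ep] dec[OF x] dec[OF x0 r0] u(2)[OF x(1)] u(2)[OF x0] by eventually_elim simp
    qed
    moreover have "AE w in M. w \<in> B \<longrightarrow> 0 < d w" using dB by eventually_elim (use dpos in blast)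
    ultimately show ?thesis using u(1) cm dmm dnn by (intro bexI[of _ "\<lambda>x. pr x u"] bexI[of _ c] bexI[of _ d]) auto
  qed
  have W: "rE.rlin v" if "v \<in> (\<lambda>u x. pr x u) ` carrier D" for v using that dual_rlin by auto
  have comb: "\<exists>v''\<in>(\<lambda>u x. pr x u) ` carrier D. \<forall>x\<in>carrier E. AE w in M. v'' x w = a w * v x w + b w * v' x w"
    if vv: "v \<in> (\<lambda>u x. pr x u) ` carrier D" "v' \<in> (\<lambda>u x. pr x u) ` carrier D"
      and ab: "a \<in> \<L> M" "b \<in> \<L> M" for v v' a b
  proof -
    obtain u u' where u: "u \<in> carrier D" "v = (\<lambda>x. pr x u)" "u' \<in> carrier D" "v' = (\<lambda>x. pr x u')" using vv by auto
    have au: "cls M a \<odot>\<^sub>D u \<in> carrier D" "cls M b \<odot>\<^sub>D u' \<in> carrier D" using ab u by auto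
    have "AE w in M. pr x (cls M a \<odot>\<^sub>D u \<oplus>\<^sub>D cls M b \<odot>\<^sub>D u') w = a w * v x w + b w * v' x w" if x: "x \<in> carrier E" for x
      using rD.rlinD(2)[OF eval_rlin[OF x] au] rD.rlinD(3)[OF eval_rlin[OF x] ab(1) u(1)] rD.rlinD(3)[OF eval_rlin[OF x] ab(2) u(3)]
      by eventually_elim (simp add: u)
    moreover have "(\<lambda>x. pr x (cls M a \<odot>\<^sub>D u \<oplus>\<^sub>D cls M b \<odot>\<^sub>D u')) \<in> (\<lambda>u x. pr x u) ` carrier D"
      using rD.pl_in[OF au] by blast
    ultimately show ?thesis by (intro bexI[of _ "\<lambda>x. pr x (cls M a \<odot>\<^sub>D u \<oplus>\<^sub>D cls M b \<odot>\<^sub>D u')"] ballI)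
  qed
  have s1: "\<exists>v\<in>(\<lambda>u x. pr x u) ` carrier D. \<exists>a\<in>\<L> M. aff_minor M (carrier E) (\<lambda>x. rep (f x)) v a"
    by (rule F.fenchel_moreau_step(1)[OF W comb sep])
  have s2: "\<exists>v\<in>(\<lambda>u x. pr x u) ` carrier D. \<exists>a\<in>\<L> M. aff_minor M (carrier E) (\<lambda>x. rep (f x)) v a \<and> (AE w in M. w \<in> B \<longrightarrow> r0 w \<le> v x0 w + a w)"
    if "x0 \<in> carrier E" "r0 \<in> \<L> M" "B \<in> sets M" "AE w in M. w \<in> B \<longrightarrow> ereal (r0 w) < rep (f x0) w" for x0 r0 B
    by (rule F.fenchel_moreau_step(2)[OF W comb sep that])
  show ?thesis
  proof (rule fclI_of_minorants[OF proper_convexD(1)[OF module_E fp] F.x1 pair.b_meas])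
    show "\<exists>y\<in>carrier D. \<exists>a\<in>\<L> M. aff_minor M (carrier E) (\<lambda>x. rep (f x)) (\<lambda>x. pr x y) a" using s1 by auto
    show "\<exists>y\<in>carrier D. \<exists>a\<in>\<L> M. aff_minor M (carrier E) (\<lambda>x. rep (f x)) (\<lambda>x. pr x y) a \<and> (AE w in M. w \<in> B \<longrightarrow> r0 w \<le> pr x0 y w + a w)"
      if "x0 \<in> carrier E" "r0 \<in> \<L> M" "B \<in> sets M" "AE w in M. w \<in> B \<longrightarrow> ereal (r0 w) < rep (f x0) w" for x0 r0 B
      using s2[OF that] by auto
  qed
qed

end

section \<open>Separation by finitely many evaluations on the dual\<close>

context prob_space
begin

text \<open>Families indexed by the whole type serve in place of a finite power of the scalars, so
  that no type has to depend on the finite set of evaluations.\<close>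

abbreviation fun_carrier :: "('i \<Rightarrow> 'a \<Rightarrow> real) set" where
  "fun_carrier \<equiv> {\<Phi>. \<forall>i. \<Phi> i \<in> \<L> M}"

lemma fun_rmodule:
  "rmodule M fun_carrier (\<lambda>\<Phi> \<Psi> i w. \<Phi> i w + \<Psi> i w) (\<lambda>_ _. 0) (\<lambda>a \<Phi> i w. a w * \<Phi> i w)"
  by unfold_locales (auto simp: algebra_simps intro!: borel_measurable_add borel_measurable_times)

text \<open>The domination makes v vanish on families that are zero on Q. Therefore v is determined
  by its values on the unit families of Q and on the scalar 1.\<close>

lemma finite_functional_repr:
  fixes v :: "('i \<Rightarrow> 'a \<Rightarrow> real) \<times> ('a \<Rightarrow> real) \<Rightarrow> 'a \<Rightarrow> real"
  assumes Q: "finite Q"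
    and v: "rmodule.rlin M (fun_carrier \<times> \<L> M) (\<lambda>(x, r) (y, s). (\<lambda>i w. x i w + y i w, \<lambda>w. r w + s w))
       (\<lambda>a (x, r). (\<lambda>i w. a w * x i w, \<lambda>w. a w * r w)) v"
    and le: "\<And>\<Phi> s. \<Phi> \<in> fun_carrier \<Longrightarrow> s \<in> \<L> M \<Longrightarrow> AE w in M. \<bar>v (\<Phi>, s) w\<bar> \<le> (\<Sum>i\<in>Q. \<bar>\<Phi> i w\<bar>) + \<bar>s w\<bar>"
  obtains c c0 where "\<And>i. c i \<in> \<L> M" "c0 \<in> \<L> M"
    "\<And>\<Phi> s. \<Phi> \<in> fun_carrier \<Longrightarrow> s \<in> \<L> M \<Longrightarrow> AE w in M. v (\<Phi>, s) w = (\<Sum>i\<in>Q. \<Phi> i w * c i w) + c0 w * s w"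
proof -
  interpret Z: rmodule M "fun_carrier \<times> \<L> M" "\<lambda>(x, r) (y, s). (\<lambda>i w. x i w + y i w, \<lambda>w. r w + s w)"
    "(\<lambda>_ _. 0, \<lambda>_. 0)" "\<lambda>a (x, r). (\<lambda>i w. a w * x i w, \<lambda>w. a w * r w)"
    by (rule rmodule.prod_rmodule[OF fun_rmodule])
  define e :: "'i \<Rightarrow> 'i \<Rightarrow> 'a \<Rightarrow> real" where "e i j w = (if j = i then 1 else 0)" for i j w
  have e: "e i \<in> fun_carrier" for i unfolding e_def by auto
  define c where "c i = v (e i, \<lambda>_. 0)" for i
  define c0 where "c0 = v (\<lambda>_ _. 0, \<lambda>_. 1)"
  have cm: "c i \<in> \<L> M" for i unfolding c_def by (rule Z.rlinD(1)[OF v]) (use e in auto)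
  have c0m: "c0 \<in> \<L> M" unfolding c0_def by (rule Z.rlinD(1)[OF v]) auto
  have fin: "AE w in M. v (\<Phi>, \<lambda>_. 0) w = (\<Sum>i\<in>R. \<Phi> i w * c i w)"
    if "finite R" "\<Phi> \<in> fun_carrier" "\<And>i. i \<notin> R \<Longrightarrow> \<Phi> i = (\<lambda>_. 0)" for R \<Phi>
    using that
  proof (induction R arbitrary: \<Phi> rule: finite_induct)
    case empty
    then have "\<Phi> = (\<lambda>_ _. 0)" by auto
    then show ?case using Z.rlin_zr[OF v] by simp
  next
    case (insert i R)
    define \<Psi> where "\<Psi> = \<Phi>(i := \<lambda>_. 0)"
    have \<Psi>: "\<Psi> \<in> fun_carrier" using insert.prems(1) by (auto simp: \<Psi>_def)
    have IH: "AE w in M. v (\<Psi>, \<lambda>_. 0) w = (\<Sum>j\<in>R. \<Psi> j w * c j w)"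
      by (rule insert.IH[OF \<Psi>]) (use insert.prems(2) in \<open>auto simp: \<Psi>_def\<close>)
    have \<Phi>i: "\<Phi> i \<in> \<L> M" using insert.prems(1) by auto
    have z: "(\<lambda>j w. \<Phi> i w * e i j w, \<lambda>w. 0) \<in> fun_carrier \<times> \<L> M" using \<Phi>i e[of i] by (auto intro!: borel_measurable_times)
    have "(\<lambda>j w. \<Phi> i w * e i j w + \<Psi> j w) = \<Phi>" by (intro ext) (simp add: e_def \<Psi>_def)
    then have "AE w in M. v (\<Phi>, \<lambda>_. 0) w = v (\<lambda>j w. \<Phi> i w * e i j w, \<lambda>w. 0) w + v (\<Psi>, \<lambda>_. 0) w"
      using Z.rlinD(2)[OF v z, of "(\<Psi>, \<lambda>_. 0)"] \<Psi> by simp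
    moreover have "AE w in M. v (\<lambda>j w. \<Phi> i w * e i j w, \<lambda>w. 0) w = \<Phi> i w * c i w"
      using Z.rlinD(3)[OF v \<Phi>i, of "(e i, \<lambda>_. 0)"] e by (simp add: c_def)
    ultimately show ?case using IH
    proof eventually_elim
      case (elim w)
      have "(\<Sum>j\<in>R. \<Psi> j w * c j w) = (\<Sum>j\<in>R. \<Phi> j w * c j w)"
        using insert.hyps(2) by (intro sum.cong) (auto simp: \<Psi>_def)
      then show ?case using elim insert.hyps by simp
    qed
  qed
  have main: "AE w in M. v (\<Phi>, s) w = (\<Sum>i\<in>Q. \<Phi> i w * c i w) + c0 w * s w"
    if \<Phi>: "\<Phi> \<in> fun_carrier" and s: "s \<in> \<L> M" for \<Phi> s
  proof -
    define A where "A i = (if i \<in> Q then \<Phi> i else (\<lambda>_. 0))" for i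
    define B where "B i = (if i \<in> Q then (\<lambda>_. 0) else \<Phi> i)" for i
    have AB: "A \<in> fun_carrier" "B \<in> fun_carrier" using \<Phi> by (auto simp: A_def B_def)
    have 1: "AE w in M. v (A, \<lambda>_. 0) w = (\<Sum>i\<in>Q. A i w * c i w)" by (rule fin[OF Q AB(1)]) (simp add: A_def)
    have 2: "AE w in M. \<bar>v (B, \<lambda>_. 0) w\<bar> \<le> (\<Sum>i\<in>Q. \<bar>B i w\<bar>) + \<bar>0\<bar>" by (rule le[OF AB(2)]) simp
    have "(\<lambda>i w. A i w + B i w) = \<Phi>" by (intro ext) (simp add: A_def B_def)
    then have 3: "AE w in M. v (\<Phi>, \<lambda>_. 0) w = v (A, \<lambda>_. 0) w + v (B, \<lambda>_. 0) w"
      using Z.rlinD(2)[OF v, of "(A, \<lambda>_. 0)" "(B, \<lambda>_. 0)"] AB by simp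
    have 4: "AE w in M. v (\<Phi>, s) w = v (\<Phi>, \<lambda>_. 0) w + v (\<lambda>_ _. 0, s) w"
      using Z.rlinD(2)[OF v, of "(\<Phi>, \<lambda>_. 0)" "(\<lambda>_ _. 0, s)"] \<Phi> s by simp
    have 5: "AE w in M. v (\<lambda>_ _. 0, s) w = s w * c0 w"
      using Z.rlinD(3)[OF v s, of "(\<lambda>_ _. 0, \<lambda>_. 1)"] by (simp add: c0_def)
    have 6: "(\<Sum>i\<in>Q. A i w * c i w) = (\<Sum>i\<in>Q. \<Phi> i w * c i w)" "(\<Sum>i\<in>Q. \<bar>B i w\<bar>) = 0" for w
      by (auto simp: A_def B_def intro: sum.cong)
    show ?thesis using 1 2 3 4 5 by eventually_elim (simp add: 6)
  qed
  show ?thesis by (rule that[of c c0, OF cm c0m main])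
qed

end

context random_normed_module
begin

lemma finite_combination:
  assumes "finite Q" "Q \<subseteq> carrier E" "\<And>x. c x \<in> \<L> M"
  obtains y where "y \<in> carrier E" "\<And>u. u \<in> carrier D \<Longrightarrow> AE w in M. pr y u w = (\<Sum>x\<in>Q. pr x u w * c x w)"
proof -
  have "\<exists>y\<in>carrier E. \<forall>u\<in>carrier D. AE w in M. pr y u w = (\<Sum>x\<in>Q. pr x u w * c x w)"
    using assms(1,2)
  proof (induction Q rule: finite_induct)
    case empty
    show ?case
    proof (intro bexI[of _ "\<zero>\<^sub>E"] ballI)
      show "AE w in M. pr \<zero>\<^sub>E u w = (\<Sum>x\<in>{}. pr x u w * c x w)" if "u \<in> carrier D" for u
        using rE.rlin_zr[OF dual_rlin[OF that]] by simp
    qed simp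
  next
    case (insert x Q)
    then obtain y where y: "y \<in> carrier E" "\<And>u. u \<in> carrier D \<Longrightarrow> AE w in M. pr y u w = (\<Sum>x\<in>Q. pr x u w * c x w)" by auto
    have x: "x \<in> carrier E" using insert.prems by simp
    have cx: "ac (c x) x \<in> carrier E" using x assms(3) by simp
    have "AE w in M. pr (ac (c x) x \<oplus>\<^sub>E y) u w = (\<Sum>x\<in>insert x Q. pr x u w * c x w)" if u: "u \<in> carrier D" for u
      using rE.rlinD(2)[OF dual_rlin[OF u] cx y(1)] rE.rlinD(3)[OF dual_rlin[OF u] assms(3) x, of x] y(2)[OF u]
      by eventually_elim (simp add: insert.hyps)
    then show ?case using rE.pl_in[OF cx y(1)] by (intro bexI[of _ "ac (c x) x \<oplus>\<^sub>E y"] ballI)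
  qed
  then obtain y where "y \<in> carrier E" "\<forall>u\<in>carrier D. AE w in M. pr y u w = (\<Sum>x\<in>Q. pr x u w * c x w)" by (rule bexE)
  then show ?thesis using that[of y] by simp
qed

text \<open>Separation in \<open>E\<^sup>* \<times> L\<^sup>0\<close> with respect to finitely many evaluations is separation in a finite power
  of \<open>L\<^sup>0\<close>, where every dominated functional is a linear combination of coordinates.\<close>
lemma separation_by_evaluation:
  assumes Q: "finite Q" "Q \<subseteq> carrier E"
    and G: "G \<subseteq> carrier D \<times> \<L> M" "G \<noteq> {}"
    and conv: "\<And>u r v s t. \<lbrakk>(u, r) \<in> G; (v, s) \<in> G; t \<in> \<L> M; \<And>w. 0 \<le> t w \<and> t w \<le> 1\<rbrakk> \<Longrightarrow>
      (cls M t \<odot>\<^sub>D u \<oplus>\<^sub>D cls M (\<lambda>w. 1 - t w) \<odot>\<^sub>D v, \<lambda>w. t w * r w + (1 - t w) * s w) \<in> G"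
    and z0: "u0 \<in> carrier D" "r0 \<in> \<L> M" and d: "d \<in> \<L> M"
    and le: "\<And>u r. (u, r) \<in> G \<Longrightarrow> AE w in M. d w \<le> (\<Sum>x\<in>Q. \<bar>pr x u w - pr x u0 w\<bar>) + \<bar>r w - r0 w\<bar>"
  obtains y c where "y \<in> carrier E" "c \<in> \<L> M"
    "\<And>u r. (u, r) \<in> G \<Longrightarrow> AE w in M. pr y u w + c w * r w \<le> pr y u0 w + c w * r0 w - d w"
proof -
  let ?F = "fun_carrier :: ('e \<Rightarrow> 'w \<Rightarrow> real) set"
  interpret Z: rmodule M "?F \<times> \<L> M" "\<lambda>(x, r) (y, s). (\<lambda>i w. x i w + y i w, \<lambda>w. r w + s w)"
    "(\<lambda>_ _. 0, \<lambda>_. 0)" "\<lambda>a (x, r). (\<lambda>i w. a w * x i w, \<lambda>w. a w * r w)"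
    by (rule rmodule.prod_rmodule[OF fun_rmodule])
  define \<Phi> where "\<Phi> u x = (if x \<in> carrier E then pr x u else (\<lambda>_. 0))" for u x
  have \<Phi>: "\<Phi> u \<in> ?F" if "u \<in> carrier D" for u using dualD(2)[OF that] by (auto simp: \<Phi>_def)
  \<comment> \<open>The evaluation of a convex combination agrees with the combination of the
    evaluations only almost surely. Admitting all representatives makes the image literally
    convex.\<close>
  define G' where "G' = {(\<Psi>, s). \<Psi> \<in> ?F \<and> s \<in> \<L> M \<and> (\<exists>u r. (u, r) \<in> G \<and>
     (\<forall>x\<in>carrier E. AE w in M. \<Psi> x w = pr x u w) \<and> (AE w in M. s w = r w))}"
  have G'I: "(\<Psi>, s) \<in> G'" if "\<Psi> \<in> ?F" "s \<in> \<L> M" "(u, r) \<in> G"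
    "\<And>x. x \<in> carrier E \<Longrightarrow> AE w in M. \<Psi> x w = pr x u w" "AE w in M. s w = r w" for \<Psi> s u r
    unfolding G'_def using that by blast
  have GG': "(\<Phi> u, r) \<in> G'" if "(u, r) \<in> G" for u r
    using that G(1) \<Phi>[of u] unfolding G'_def by (auto simp: \<Phi>_def intro!: exI[of _ u] exI[of _ r])
  define q :: "('e \<Rightarrow> 'w \<Rightarrow> real) \<times> ('w \<Rightarrow> real) \<Rightarrow> 'w \<Rightarrow> real" where "q = (\<lambda>(\<Psi>, s) w. (\<Sum>x\<in>Q. \<bar>\<Psi> x w\<bar>) + \<bar>s w\<bar> :: real)"
  have q: "Z.rseminorm q" unfolding Z.rseminorm_def
  proof (intro conjI ballI)
    fix z :: "('e \<Rightarrow> 'w \<Rightarrow> real) \<times> ('w \<Rightarrow> real)" assume z: "z \<in> ?F \<times> \<L> M"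
    then obtain \<Psi> s where zs: "z = (\<Psi>, s)" "\<And>x. \<Psi> x \<in> \<L> M" "s \<in> \<L> M" by auto
    note [measurable] = zs(2,3)
    show "q z \<in> \<L> M" unfolding zs(1) q_def prod.case by measurable
    show "AE w in M. 0 \<le> q z w" by (auto simp: q_def zs(1) intro!: sum_nonneg add_nonneg_nonneg)
  next
    fix z z' :: "('e \<Rightarrow> 'w \<Rightarrow> real) \<times> ('w \<Rightarrow> real)"
    obtain \<Psi> s \<Psi>' s' where zs: "z = (\<Psi>, s)" "z' = (\<Psi>', s')" by (cases z, cases z')
    have "(\<Sum>x\<in>Q. \<bar>\<Psi> x w + \<Psi>' x w\<bar>) \<le> (\<Sum>x\<in>Q. \<bar>\<Psi> x w\<bar>) + (\<Sum>x\<in>Q. \<bar>\<Psi>' x w\<bar>)" for w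
      unfolding sum.distrib[symmetric] by (intro sum_mono abs_triangle_ineq)
    note tri = this
    have "q (\<lambda>i w. \<Psi> i w + \<Psi>' i w, \<lambda>w. s w + s' w) w \<le> q z w + q z' w" for w
      using tri[of w] abs_triangle_ineq[of "s w" "s' w"] unfolding q_def zs prod.case by linarith
    then show "AE w in M. q ((case z of (x, r) \<Rightarrow> \<lambda>(y, s). (\<lambda>i w. x i w + y i w, \<lambda>w. r w + s w)) z') w \<le> q z w + q z' w"
      by (simp add: zs)
  next
    fix a :: "'w \<Rightarrow> real" and z :: "('e \<Rightarrow> 'w \<Rightarrow> real) \<times> ('w \<Rightarrow> real)"
    obtain \<Psi> s where zs: "z = (\<Psi>, s)" by (cases z)
    show "AE w in M. q (case z of (x, r) \<Rightarrow> (\<lambda>i w. a w * x i w, \<lambda>w. a w * r w)) w = \<bar>a w\<bar> * q z w"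
      by (simp add: zs q_def abs_mult distrib_left sum_distrib_left)
  qed
  have G'sub: "G' \<subseteq> ?F \<times> \<L> M" by (auto simp: G'_def)
  have G'ne: "G' \<noteq> {}"
  proof -
    obtain g where "g \<in> G" using G(2) by blast
    then obtain u r where "(u, r) \<in> G" by (cases g) simp
    then show ?thesis using GG' by (metis empty_iff)
  qed
  have G'conv: "Z.rconvex G'" unfolding Z.rconvex_def
  proof (intro ballI allI impI)
    fix g h and t :: "'w \<Rightarrow> real"
    assume g: "g \<in> G'" and h: "h \<in> G'" and t: "t \<in> \<L> M" "\<forall>w. 0 \<le> t w \<and> t w \<le> 1"
    obtain \<Psi> s u r where 1: "g = (\<Psi>, s)" "\<Psi> \<in> ?F" "s \<in> \<L> M" "(u, r) \<in> G"
      "\<And>x. x \<in> carrier E \<Longrightarrow> AE w in M. \<Psi> x w = pr x u w" "AE w in M. s w = r w" using g by (auto simp: G'_def)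
    obtain \<Psi>' s' u' r' where 2: "h = (\<Psi>', s')" "\<Psi>' \<in> ?F" "s' \<in> \<L> M" "(u', r') \<in> G"
      "\<And>x. x \<in> carrier E \<Longrightarrow> AE w in M. \<Psi>' x w = pr x u' w" "AE w in M. s' w = r' w" using h by (auto simp: G'_def)
    have t': "(\<lambda>w. 1 - t w) \<in> \<L> M" using t by simp
    have uD: "u \<in> carrier D" "u' \<in> carrier D" using 1(4) 2(4) G(1) by auto
    have tu: "cls M t \<odot>\<^sub>D u \<in> carrier D" "cls M (\<lambda>w. 1 - t w) \<odot>\<^sub>D u' \<in> carrier D" using t(1) t' uD by auto
    have Gc: "(cls M t \<odot>\<^sub>D u \<oplus>\<^sub>D cls M (\<lambda>w. 1 - t w) \<odot>\<^sub>D u', \<lambda>w. t w * r w + (1 - t w) * r' w) \<in> G"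
      using conv[OF 1(4) 2(4) t(1)] t(2) by blast
    have e1: "AE w in M. t w * \<Psi> x w + (1 - t w) * \<Psi>' x w = pr x (cls M t \<odot>\<^sub>D u \<oplus>\<^sub>D cls M (\<lambda>w. 1 - t w) \<odot>\<^sub>D u') w"
      if x: "x \<in> carrier E" for x
      using rD.rlinD(2)[OF eval_rlin[OF x] tu] rD.rlinD(3)[OF eval_rlin[OF x] t(1) uD(1)] rD.rlinD(3)[OF eval_rlin[OF x] t' uD(2)]
        1(5)[OF x] 2(5)[OF x] by eventually_elim simp
    have e2: "AE w in M. t w * s w + (1 - t w) * s' w = t w * r w + (1 - t w) * r' w"
      using 1(6) 2(6) by eventually_elim simp
    have m: "(\<lambda>i w. t w * \<Psi> i w + (1 - t w) * \<Psi>' i w) \<in> ?F" "(\<lambda>w. t w * s w + (1 - t w) * s' w) \<in> \<L> M"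
      using t(1) 1(2,3) 2(2,3) by (auto intro!: borel_measurable_add borel_measurable_times borel_measurable_diff)
    have "(\<lambda>i w. t w * \<Psi> i w + (1 - t w) * \<Psi>' i w, \<lambda>w. t w * s w + (1 - t w) * s' w) \<in> G'"
      by (rule G'I[OF m Gc _ e2]) (rule e1)
    then show "(case case g of (x, r) \<Rightarrow> (\<lambda>i w. t w * x i w, \<lambda>w. t w * r w) of (x, r) \<Rightarrow> \<lambda>(y, s). (\<lambda>i w. x i w + y i w, \<lambda>w. r w + s w))
        (case h of (x, r) \<Rightarrow> (\<lambda>i w. (1 - t w) * x i w, \<lambda>w. (1 - t w) * r w)) \<in> G'"
      by (simp add: 1(1) 2(1))
  qed
  have z0': "(\<Phi> u0, r0) \<in> ?F \<times> \<L> M" using \<Phi>[OF z0(1)] z0(2) by simp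
  have dq: "AE w in M. d w \<le> q ((case g of (x, r) \<Rightarrow> \<lambda>(y, s). (\<lambda>i w. x i w + y i w, \<lambda>w. r w + s w))
      (case (\<Phi> u0, r0) of (x, r) \<Rightarrow> (\<lambda>i w. - 1 * x i w, \<lambda>w. - 1 * r w))) w" if g: "g \<in> G'" for g
  proof -
    obtain \<Psi> s u r where 1: "g = (\<Psi>, s)" "(u, r) \<in> G"
      "\<And>x. x \<in> carrier E \<Longrightarrow> AE w in M. \<Psi> x w = pr x u w" "AE w in M. s w = r w" using g by (auto simp: G'_def)
    have "AE w in M. \<forall>x\<in>Q. \<Psi> x w = pr x u w" using Q 1(3) by (intro AE_finite_allI) auto
    then show ?thesis using 1(4) le[OF 1(2)]
    proof eventually_elim
      case (elim w)
      have "(\<Sum>x\<in>Q. \<bar>\<Psi> x w + - 1 * \<Phi> u0 x w\<bar>) = (\<Sum>x\<in>Q. \<bar>pr x u w - pr x u0 w\<bar>)"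
        using elim(1) Q(2) by (intro sum.cong) (auto simp: \<Phi>_def)
      then show ?case using elim(2,3) by (simp add: q_def 1(1))
    qed
  qed
  obtain v where v: "Z.rlin v" "\<And>z. z \<in> ?F \<times> \<L> M \<Longrightarrow> AE w in M. \<bar>v z w\<bar> \<le> q z w"
    "\<And>g. g \<in> G' \<Longrightarrow> AE w in M. v g w \<le> v (\<Phi> u0, r0) w - d w"
    by (rule Z.separation[OF q G'sub G'ne G'conv z0' d dq]) (assumption, rule that)
  have vq: "AE w in M. \<bar>v (\<Psi>, s) w\<bar> \<le> (\<Sum>x\<in>Q. \<bar>\<Psi> x w\<bar>) + \<bar>s w\<bar>" if "\<Psi> \<in> ?F" "s \<in> \<L> M" for \<Psi> s
    using v(2)[of "(\<Psi>, s)"] that by (simp add: q_def)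
  obtain c c0 where c: "\<And>x. c x \<in> \<L> M" "c0 \<in> \<L> M"
    "\<And>\<Psi> s. \<Psi> \<in> ?F \<Longrightarrow> s \<in> \<L> M \<Longrightarrow> AE w in M. v (\<Psi>, s) w = (\<Sum>x\<in>Q. \<Psi> x w * c x w) + c0 w * s w"
    by (rule finite_functional_repr[OF Q(1) v(1) vq]) (assumption, assumption, rule that)
  obtain y where y: "y \<in> carrier E" "\<And>u. u \<in> carrier D \<Longrightarrow> AE w in M. pr y u w = (\<Sum>x\<in>Q. pr x u w * c x w)"
    by (rule finite_combination[OF Q c(1)]) (rule that)
  have val: "AE w in M. v (\<Phi> u, r) w = pr y u w + c0 w * r w" if u: "u \<in> carrier D" and r: "r \<in> \<L> M" for u r
  proof -
    have "(\<Sum>x\<in>Q. \<Phi> u x w * c x w) = (\<Sum>x\<in>Q. pr x u w * c x w)" for w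
      using Q(2) by (intro sum.cong) (auto simp: \<Phi>_def)
    then show ?thesis using c(3)[OF \<Phi>[OF u] r] y(2)[OF u] by (auto elim: eventually_elim2)
  qed
  show ?thesis
  proof (rule that[OF y(1) c(2)])
    fix u r assume ur: "(u, r) \<in> G"
    then have "u \<in> carrier D" "r \<in> \<L> M" using G(1) by auto
    from val[OF this] val[OF z0] v(3)[OF GG'[OF ur]]
    show "AE w in M. pr y u w + c0 w * r w \<le> pr y u0 w + c0 w * r0 w - d w" by eventually_elim simp
  qed
qed

text \<open>A positive distance on all of B may require countably many finite sets of evaluations.
  Each gives its own separating evaluation at some \<open>y n\<close>, and completeness concatenates
  these points into a single one.\<close>

lemma fcl_of_wstar:
  assumes comp: "rn_complete M E nrm" and g: "g \<in> wstar_lsc_convex_functions M E nrm"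
  shows "g \<in> pair.C'"
proof -
  have gp: "g \<in> proper_convex_functions M D"
    and cl: "closedin (prob_topology M (module_prod D (L0 M)) wstar_nrms) (epi M D g)"
    using g by (auto simp: wstar_lsc_convex_functions_def)
  obtain u1 where "convex_fun M (carrier D) (add D) \<zero>\<^sub>D (\<lambda>a u. cls M a \<odot>\<^sub>D u) (\<lambda>u. rep (g u)) u1"
    using proper_convexD(2)[OF module_dual gp] by blast
  then interpret F: convex_fun M "carrier D" "add D" "\<zero>\<^sub>D" "\<lambda>a u. cls M a \<odot>\<^sub>D u" "\<lambda>u. rep (g u)" u1 .
  interpret Dm: module "L0 M" D by (rule module_dual)
  define q where "q Q = (\<lambda>(u, s) w. (\<Sum>x\<in>Q. \<bar>pr x u w\<bar>) + \<bar>s w\<bar> :: real)" for Q :: "'e set"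
  have q: "F.prd.rseminorm (q Q)" if Q: "finite Q" "Q \<subseteq> carrier E" for Q
    unfolding F.prd.rseminorm_def
  proof (intro conjI ballI)
    fix z :: "('e \<Rightarrow> ('w \<Rightarrow> real) set) \<times> ('w \<Rightarrow> real)" assume z: "z \<in> carrier D \<times> \<L> M"
    then obtain u s where zs: "z = (u, s)" "u \<in> carrier D" "s \<in> \<L> M" by auto
    have "(\<lambda>w. (\<Sum>x\<in>Q. \<bar>pr x u w\<bar>)) \<in> \<L> M"
      using Q(2) dualD(2)[OF zs(2)] by (intro borel_measurable_sum borel_measurable_abs) auto
    then show "q Q z \<in> \<L> M" unfolding zs(1) q_def prod.case using zs(3) by simp
    show "AE w in M. 0 \<le> q Q z w" by (auto simp: q_def zs(1) intro!: sum_nonneg add_nonneg_nonneg)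
  next
    fix z z' :: "('e \<Rightarrow> ('w \<Rightarrow> real) set) \<times> ('w \<Rightarrow> real)" assume "z \<in> carrier D \<times> \<L> M" "z' \<in> carrier D \<times> \<L> M"
    then obtain u s v r where zs: "z = (u, s)" "u \<in> carrier D" "z' = (v, r)" "v \<in> carrier D" by auto
    have "AE w in M. \<forall>x\<in>Q. pr x (u \<oplus>\<^sub>D v) w = pr x u w + pr x v w"
      using Q rD.rlinD(2)[OF eval_rlin zs(2,4)] by (intro AE_finite_allI) auto
    then show "AE w in M. q Q ((case z of (x, r) \<Rightarrow> \<lambda>(y, s). (x \<oplus>\<^sub>D y, \<lambda>w. r w + s w)) z') w \<le> q Q z w + q Q z' w"
    proof eventually_elim
      case (elim w)
      have "(\<Sum>x\<in>Q. \<bar>pr x (u \<oplus>\<^sub>D v) w\<bar>) \<le> (\<Sum>x\<in>Q. \<bar>pr x u w\<bar>) + (\<Sum>x\<in>Q. \<bar>pr x v w\<bar>)"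
        unfolding sum.distrib[symmetric] using elim by (intro sum_mono) (auto intro: abs_triangle_ineq)
      then show ?case using abs_triangle_ineq[of "s w" "r w"] by (simp add: q_def zs)
    qed
  next
    fix a :: "'w \<Rightarrow> real" and z :: "('e \<Rightarrow> ('w \<Rightarrow> real) set) \<times> ('w \<Rightarrow> real)"
    assume a: "a \<in> \<L> M" and "z \<in> carrier D \<times> \<L> M"
    then obtain u s where zs: "z = (u, s)" "u \<in> carrier D" by auto
    have "AE w in M. \<forall>x\<in>Q. pr x (cls M a \<odot>\<^sub>D u) w = a w * pr x u w"
      using Q rD.rlinD(3)[OF eval_rlin a zs(2)] by (intro AE_finite_allI) auto
    then show "AE w in M. q Q (case z of (x, r) \<Rightarrow> (cls M a \<odot>\<^sub>D x, \<lambda>w. a w * r w)) w = \<bar>a w\<bar> * q Q z w"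
      by eventually_elim (simp add: zs q_def abs_mult distrib_left sum_distrib_left)
  qed
  have sep: "\<exists>v\<in>pr ` carrier E. \<exists>c\<in>\<L> M. \<exists>d\<in>\<L> M. (AE w in M. 0 \<le> d w) \<and> (AE w in M. w \<in> B \<longrightarrow> 0 < d w) \<and>
        (\<forall>u r. (u, r) \<in> F.ep \<longrightarrow> (AE w in M. v u w + c w * r w \<le> v u0 w + c w * r0 w - d w))"
    if u0: "u0 \<in> carrier D" and r0: "r0 \<in> \<L> M" and B: "B \<in> sets M"
      and l: "AE w in M. w \<in> B \<longrightarrow> ereal (r0 w) < rep (g u0) w" for u0 r0 B
  proof -
    obtain Qs ds where Qs: "\<And>n::nat. Qs n \<in> q ` {Q. finite Q \<and> Q \<subseteq> carrier E}" and dm: "\<And>n. ds n \<in> \<L> M"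
      and d0: "\<And>n. AE w in M. (0::real) \<le> ds n w"
      and dle: "\<And>n u r. (u, r) \<in> F.ep \<Longrightarrow> AE w in M. ds n w \<le> Qs n (u \<ominus>\<^sub>D u0, \<lambda>w. r w - r0 w) w"
      and dB: "AE w in M. w \<in> B \<longrightarrow> (\<exists>n. 0 < ds n w)"
    proof (rule epigraph_distance[where f = g and ?x0.0 = u0 and \<Q> = "q ` {Q. finite Q \<and> Q \<subseteq> carrier E}",
        OF module_dual F.convex_fun_axioms cl _ _ _ u0 r0 B l])
      show "p z \<in> L0_pos M" if "p \<in> wstar_nrms" "z \<in> carrier (module_prod D (L0 M))" for p z
        using that rep_wstar_nrm(2) by (auto simp: carrier_module_prod)
      show "F.prd.rseminorm p" if "p \<in> q ` {Q. finite Q \<and> Q \<subseteq> carrier E}" for p using that q by auto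
      fix P assume P: "finite P" "P \<subseteq> wstar_nrms"
      obtain Q where Q: "finite Q" "Q \<subseteq> carrier E" "P = (\<lambda>x (u, r). L0_abs M (u x) \<oplus>\<^bsub>L0 M\<^esub> L0_abs M r) ` Q"
        using finite_subset_image[OF P] by blast
      have "AE w in M. rep (p (u, cls M r)) w \<le> q Q (u, r) w" if p: "p \<in> P" and u: "u \<in> carrier D" and r: "r \<in> \<L> M" for p u r
      proof -
        obtain x where x: "x \<in> Q" "p = (\<lambda>(u, r). L0_abs M (u x) \<oplus>\<^bsub>L0 M\<^esub> L0_abs M r)" using p Q(3) by blast
        have xc: "x \<in> carrier E" using x(1) Q(2) by auto
        have mem: "\<bar>pr x u w\<bar> \<le> (\<Sum>x\<in>Q. \<bar>pr x u w\<bar>)" for w by (rule member_le_sum[OF x(1)]) (use Q in auto)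
        show ?thesis using rep_wstar_nrm(1)[OF xc u cls_L0[OF r]] rep_cls[OF r] unfolding x(2) prod.case
          by eventually_elim (simp add: q_def mem)
      qed
      then show "\<exists>q\<in>q ` {Q. finite Q \<and> Q \<subseteq> carrier E}. \<forall>p\<in>P. \<forall>u\<in>carrier D. \<forall>r\<in>\<L> M.
          AE w in M. rep (p (u, cls M r)) w \<le> q (u, r) w"
        using Q(1,2) by (intro bexI[of _ "q Q"] ballI) auto
    qed (rule that)
    have "\<exists>y c. y \<in> carrier E \<and> c \<in> \<L> M \<and>
      (\<forall>u r. (u, r) \<in> F.ep \<longrightarrow> (AE w in M. pr y u w + c w * r w \<le> pr y u0 w + c w * r0 w - ds n w))" for n
    proof -
      obtain Q where Q: "finite Q" "Q \<subseteq> carrier E" "Qs n = q Q" using Qs[of n] by blast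
      have conv: "(cls M t \<odot>\<^sub>D u \<oplus>\<^sub>D cls M (\<lambda>w. 1 - t w) \<odot>\<^sub>D v, \<lambda>w. t w * r w + (1 - t w) * s w) \<in> F.ep"
        if "(u, r) \<in> F.ep" "(v, s) \<in> F.ep" "t \<in> \<L> M" "\<And>w. 0 \<le> t w \<and> t w \<le> 1" for u r v s t
        using F.ep_convex[unfolded F.prd.rconvex_def, rule_format, OF that(1,2,3) that(4)] by simp
      have le: "AE w in M. ds n w \<le> (\<Sum>x\<in>Q. \<bar>pr x u w - pr x u0 w\<bar>) + \<bar>r w - r0 w\<bar>" if ur: "(u, r) \<in> F.ep" for u r
      proof -
        have u: "u \<in> carrier D" using ur F.ep_sub by auto
        have "AE w in M. \<forall>x\<in>Q. pr x (u \<oplus>\<^sub>D rD.neg u0) w = pr x u w - pr x u0 w"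
          using Q rD.rlin_diff[OF eval_rlin u u0] by (intro AE_finite_allI) auto
        then show ?thesis using dle[OF ur, of n] unfolding Q(3) minus_neg(1)[OF module_dual u u0]
        proof eventually_elim
          case (elim w)
          have "(\<Sum>x\<in>Q. \<bar>pr x (u \<oplus>\<^sub>D rD.neg u0) w\<bar>) = (\<Sum>x\<in>Q. \<bar>pr x u w - pr x u0 w\<bar>)"
            using elim(1) by (intro sum.cong) auto
          then show ?case using elim(2) by (simp add: q_def)
        qed
      qed
      have ne: "F.ep \<noteq> {}" using F.ep_in by blast
      obtain y c where "y \<in> carrier E" "c \<in> \<L> M"
        "\<And>u r. (u, r) \<in> F.ep \<Longrightarrow> AE w in M. pr y u w + c w * r w \<le> pr y u0 w + c w * r0 w - ds n w"
        by (rule separation_by_evaluation[OF Q(1,2) F.ep_sub ne _ u0 r0 dm]) (rule conv, assumption+, rule le, assumption, rule that)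
      then show ?thesis by blast
    qed
    then have "\<forall>n. \<exists>y. \<exists>c. y \<in> carrier E \<and> c \<in> \<L> M \<and>
      (\<forall>u r. (u, r) \<in> F.ep \<longrightarrow> (AE w in M. pr y u w + c w * r w \<le> pr y u0 w + c w * r0 w - ds n w))" by blast
    from choice[OF this] obtain y where "\<forall>n. \<exists>c. y n \<in> carrier E \<and> c \<in> \<L> M \<and>
      (\<forall>u r. (u, r) \<in> F.ep \<longrightarrow> (AE w in M. pr (y n) u w + c w * r w \<le> pr (y n) u0 w + c w * r0 w - ds n w))" by (rule exE)
    from choice[OF this] obtain c where yc: "\<forall>n. y n \<in> carrier E \<and> c n \<in> \<L> M \<and>
      (\<forall>u r. (u, r) \<in> F.ep \<longrightarrow> (AE w in M. pr (y n) u w + c n w * r w \<le> pr (y n) u0 w + c n w * r0 w - ds n w))" by (rule exE)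
    have y: "y n \<in> carrier E" and cm: "c n \<in> \<L> M"
      and yc_le: "(u, r) \<in> F.ep \<Longrightarrow> AE w in M. pr (y n) u w + c n w * r w \<le> pr (y n) u0 w + c n w * r0 w - ds n w" for n u r
      using yc by auto
    note [measurable] = dm cm
    \<comment> \<open>The first index with positive distance splits U into disjoint sets
      \<open>A n\<close>, on each of which one of the countably many separating evaluations is
      used.\<close>
    define \<nu> where "\<nu> w = (LEAST n. 0 < ds n w)" for w
    define U where "U = {w \<in> space M. \<exists>n. 0 < ds n w}"
    define A where "A n = {w \<in> space M. 0 < ds n w \<and> \<nu> w = n}" for n
    have \<nu>m[measurable]: "\<nu> \<in> measurable M (count_space UNIV)" unfolding \<nu>_def by measurable
    have [measurable]: "(\<lambda>w. ds (\<nu> w) w) \<in> \<L> M" "(\<lambda>w. c (\<nu> w) w) \<in> \<L> M"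
      by (rule measurable_compose_countable[OF _ \<nu>m]; measurable)+
    have U[measurable]: "U \<in> sets M" unfolding U_def by measurable
    have A: "A n \<in> sets M" for n unfolding A_def by measurable
    have Adis: "disjoint_family A" by (auto simp: disjoint_family_on_def A_def)
    have inA: "w \<in> A (\<nu> w)" if "w \<in> U" for w
      using that LeastI_ex[of "\<lambda>n. 0 < ds n w"] by (auto simp: U_def A_def \<nu>_def)
    obtain z where z: "z \<in> carrier E" "\<And>n. AE w in M. w \<in> A n \<longrightarrow> N (z \<ominus>\<^sub>E y n) w = 0"
      by (rule countable_concatenation[OF comp A Adis y]) (rule that)
    have IU: "(indicator U :: 'w \<Rightarrow> real) \<in> \<L> M" by measurable
    \<comment> \<open>Off U there is nothing to separate; the point, its coefficient and the gap are
      set to zero there, and the inequality holds trivially.\<close>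
    define x where "x = ac (indicator U) z"
    have x: "x \<in> carrier E" unfolding x_def using IU z(1) by simp
    define c' where "c' w = (if w \<in> U then c (\<nu> w) w else 0)" for w
    define d where "d w = (if w \<in> U then ds (\<nu> w) w else 0)" for w
    have cd: "c' \<in> \<L> M" "d \<in> \<L> M" unfolding c'_def d_def by measurable
    have dpos: "0 < d w" if "w \<in> U" for w using inA[OF that] that by (simp add: d_def A_def)
    have dnn: "0 \<le> d w" for w using dpos[of w] by (cases "w \<in> U") (auto simp: d_def)
    have prx: "AE w in M. pr x u w = (if w \<in> U then pr (y (\<nu> w)) u w else 0)" if u: "u \<in> carrier D" for u
    proof -
      have "AE w in M. \<forall>n. w \<in> A n \<longrightarrow> pr z u w = pr (y n) u w"
        unfolding AE_all_countable using rlin_eq_on[OF dual_rlin[OF u] z(1) y A z(2)] by blast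
      then show ?thesis using rE.rlinD(3)[OF dual_rlin[OF u] IU z(1)] unfolding x_def
      proof eventually_elim
        case (elim w)
        then show ?case using inA[of w] by (cases "w \<in> U") auto
      qed
    qed
    have "AE w in M. pr x u w + c' w * r w \<le> pr x u0 w + c' w * r0 w - d w" if ep: "(u, r) \<in> F.ep" for u r
    proof -
      have u: "u \<in> carrier D" using ep F.ep_sub by auto
      have "AE w in M. \<forall>n. pr (y n) u w + c n w * r w \<le> pr (y n) u0 w + c n w * r0 w - ds n w"
        unfolding AE_all_countable using yc_le[OF ep] by blast
      then show ?thesis using prx[OF u] prx[OF u0] by eventually_elim (simp add: c'_def d_def)
    qed
    moreover have "AE w in M. w \<in> B \<longrightarrow> 0 < d w" using dB AE_space by eventually_elim (auto intro!: dpos simp: U_def)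
    ultimately show ?thesis using x cd dnn by (intro bexI[of _ "pr x"] bexI[of _ c'] bexI[of _ d]) auto
  qed
  have W: "rD.rlin v" if "v \<in> pr ` carrier E" for v using that eval_rlin by auto
  have comb: "\<exists>v''\<in>pr ` carrier E. \<forall>u\<in>carrier D. AE w in M. v'' u w = a w * v u w + b w * v' u w"
    if vv: "v \<in> pr ` carrier E" "v' \<in> pr ` carrier E"
      and ab: "a \<in> \<L> M" "b \<in> \<L> M" for v v' a b
  proof -
    obtain x x' where x: "x \<in> carrier E" "v = pr x" "x' \<in> carrier E" "v' = pr x'" using vv by auto
    have ax: "ac a x \<in> carrier E" "ac b x' \<in> carrier E" using ab x by auto
    have "AE w in M. pr (ac a x \<oplus>\<^sub>E ac b x') u w = a w * v u w + b w * v' u w" if u: "u \<in> carrier D" for u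
      using rE.rlinD(2)[OF dual_rlin[OF u] ax] rE.rlinD(3)[OF dual_rlin[OF u] ab(1) x(1)] rE.rlinD(3)[OF dual_rlin[OF u] ab(2) x(3)]
      by eventually_elim (simp add: x)
    moreover have "pr (ac a x \<oplus>\<^sub>E ac b x') \<in> pr ` carrier E" using rE.pl_in[OF ax] by blast
    ultimately show ?thesis by (intro bexI[of _ "pr (ac a x \<oplus>\<^sub>E ac b x')"] ballI)
  qed
  have s1: "\<exists>v\<in>pr ` carrier E. \<exists>a\<in>\<L> M. aff_minor M (carrier D) (\<lambda>u. rep (g u)) v a"
    by (rule F.fenchel_moreau_step(1)[OF W comb sep])
  have s2: "\<exists>v\<in>pr ` carrier E. \<exists>a\<in>\<L> M. aff_minor M (carrier D) (\<lambda>u. rep (g u)) v a \<and> (AE w in M. w \<in> B \<longrightarrow> r0 w \<le> v x0 w + a w)"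
    if "x0 \<in> carrier D" "r0 \<in> \<L> M" "B \<in> sets M" "AE w in M. w \<in> B \<longrightarrow> ereal (r0 w) < rep (g x0) w" for x0 r0 B
    by (rule F.fenchel_moreau_step(2)[OF W comb sep that])
  show ?thesis
  proof (rule fclI_of_minorants)
    show "g \<in> carrier D \<rightarrow>\<^sub>E ae_classes M" by (rule proper_convexD(1)[OF module_dual gp])
    show "u1 \<in> carrier D" "AE w in M. rep (g u1) w < \<infinity>" by (rule F.x1)+
    show "pr x u \<in> \<L> M" if "u \<in> carrier D" "x \<in> carrier E" for u x using dualD(2) that by blast
    show "\<exists>y\<in>carrier E. \<exists>a\<in>\<L> M. aff_minor M (carrier D) (\<lambda>x. rep (g x)) (\<lambda>x. pr y x) a" using s1 by auto
    show "\<exists>y\<in>carrier E. \<exists>a\<in>\<L> M. aff_minor M (carrier D) (\<lambda>x. rep (g x)) (\<lambda>x. pr y x) a \<and> (AE w in M. w \<in> B \<longrightarrow> r0 w \<le> pr y x0 w + a w)"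
      if "x0 \<in> carrier D" "r0 \<in> \<L> M" "B \<in> sets M" "AE w in M. w \<in> B \<longrightarrow> ereal (r0 w) < rep (g x0) w" for x0 r0 B
      using s2[OF that] by auto
  qed
qed

end

section \<open>The closed graph theorem\<close>

context random_normed_module
begin

lemma minus_add_E: "x \<in> carrier E \<Longrightarrow> y \<in> carrier E \<Longrightarrow> x \<ominus>\<^sub>E y \<oplus>\<^sub>E y = x"
  by (simp add: M.minus_eq M.a_assoc M.l_neg)

lemma minus_eq_iff_E:
  "x \<in> carrier E \<Longrightarrow> y \<in> carrier E \<Longrightarrow> z \<in> carrier E \<Longrightarrow> x \<ominus>\<^sub>E y = z \<longleftrightarrow> x = z \<oplus>\<^sub>E y"
  using minus_add_E[of x y] by (auto simp: M.minus_eq M.a_assoc M.r_neg)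

lemma minus_self_E: "x \<in> carrier E \<Longrightarrow> x \<ominus>\<^sub>E x = \<zero>\<^sub>E"
  by (simp add: M.minus_eq M.r_neg)

lemma minus_minus_E: "x \<in> carrier E \<Longrightarrow> y \<in> carrier E \<Longrightarrow> x \<ominus>\<^sub>E (x \<ominus>\<^sub>E y) = y"
  using minus_add_E[of x y] by (simp add: minus_eq_iff_E M.a_comm)

lemma minus_chain_E:
  "x \<in> carrier E \<Longrightarrow> y \<in> carrier E \<Longrightarrow> z \<in> carrier E \<Longrightarrow> x \<ominus>\<^sub>E z = (x \<ominus>\<^sub>E y) \<oplus>\<^sub>E (y \<ominus>\<^sub>E z)"
  by (simp add: minus_eq_iff_E M.a_assoc minus_add_E)

lemma mu_N_add: "x \<in> carrier E \<Longrightarrow> y \<in> carrier E \<Longrightarrow> mu M (N (x \<oplus>\<^sub>E y)) \<le> mu M (N x) + mu M (N y)"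
  by (rule l0normD(5)[OF l0norm_E])

lemma neg_E: "x \<in> carrier E \<Longrightarrow> rE.neg x = \<ominus>\<^sub>E x"
  using minus_E[of "\<zero>\<^sub>E" x] by (simp add: M.minus_eq)

lemma mu_N_minus_commute:
  assumes "x \<in> carrier E" "y \<in> carrier E"
  shows "mu M (N (x \<ominus>\<^sub>E y)) = mu M (N (y \<ominus>\<^sub>E x))"
proof (rule mu_cong)
  have "x \<ominus>\<^sub>E y = rE.neg (y \<ominus>\<^sub>E x)"
    using assms by (simp add: neg_E M.minus_eq M.minus_add M.minus_minus M.a_ac)
  then show "AE w in M. N (x \<ominus>\<^sub>E y) w = N (y \<ominus>\<^sub>E x) w"
    using N_ac[of "\<lambda>_. - 1" "y \<ominus>\<^sub>E x"] assms by simp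
qed (use assms N_props(3) in auto)

lemma mu_N_eq_0: "x \<in> carrier E \<Longrightarrow> mu M (N x) = 0 \<longleftrightarrow> x = \<zero>\<^sub>E"
  using mu_eq_0[OF N_props(3)] N_eq_0 N_zero by auto

text \<open>Set to 0 off the carrier because \<^locale>\<open>Metric_space\<close> demands symmetry everywhere.\<close>
definition dE :: "'e \<Rightarrow> 'e \<Rightarrow> real" where
  "dE x y = (if x \<in> carrier E \<and> y \<in> carrier E then mu M (N (x \<ominus>\<^sub>E y)) else 0)"

lemma Metric_space_dE: "Metric_space (carrier E) dE"
proof
  fix x y z assume x: "x \<in> carrier E" and y: "y \<in> carrier E" and z: "z \<in> carrier E"
  have "x \<ominus>\<^sub>E z = (x \<ominus>\<^sub>E y) \<oplus>\<^sub>E (y \<ominus>\<^sub>E z)"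
    using x y z by (rule minus_chain_E)
  then show "dE x z \<le> dE x y + dE y z"
    using mu_N_add[of "x \<ominus>\<^sub>E y" "y \<ominus>\<^sub>E z"] x y z by (simp add: dE_def)
next
  fix x y assume xy: "x \<in> carrier E" "y \<in> carrier E"
  have "x \<ominus>\<^sub>E y = \<zero>\<^sub>E \<longleftrightarrow> x = y" using xy by (simp add: minus_eq_iff_E)
  then show "dE x y = 0 \<longleftrightarrow> x = y"
    using mu_N_eq_0[of "x \<ominus>\<^sub>E y"] xy by (simp add: dE_def)
qed (auto simp: mu_nonneg dE_def intro: mu_N_minus_commute)

lemma mcomplete_dE:
  assumes "rn_complete M E nrm"
  shows "Metric_space.mcomplete (carrier E) dE"
proof -
  interpret ms: Metric_space "carrier E" dE by (rule Metric_space_dE)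
  show ?thesis unfolding ms.mcomplete_def
  proof (intro allI impI)
    fix s assume s: "ms.MCauchy s"
    have sc: "s n \<in> carrier E" for n using s by (auto simp: ms.MCauchy_def)
    have c: "\<exists>n0. \<forall>m\<ge>n0. \<forall>n\<ge>n0. mu M (N (s m \<ominus>\<^sub>E s n)) < e" if e: "0 < e" for e
    proof -
      obtain n0 where "\<forall>n n'. n0 \<le> n \<longrightarrow> n0 \<le> n' \<longrightarrow> dE (s n) (s n') < e"
        using s e unfolding ms.MCauchy_def by blast
      then show ?thesis using sc by (intro exI[of _ n0]) (simp add: dE_def)
    qed
    obtain x where x: "x \<in> carrier E" "(\<lambda>n. mu M (N (s n \<ominus>\<^sub>E x))) \<longlonglongrightarrow> 0"
      by (rule complete_mu[OF assms sc c]) (assumption, rule that)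
    have "\<forall>\<^sub>F n in sequentially. s n \<in> carrier E \<and> dE (s n) x < e" if "0 < e" for e
      using order_tendstoD(2)[OF x(2) that] by eventually_elim (simp add: sc x dE_def)
    then have "limitin ms.mtopology s x sequentially" using x(1) by (simp add: ms.limitin_metric)
    then show "\<exists>x. limitin ms.mtopology s x sequentially" ..
  qed
qed

text \<open>The truncation in \<open>mu\<close> destroys homogeneity. These three properties replace
  it where vectors are rescaled by real numbers.\<close>

lemma mu_N_scale:
  assumes "x \<in> carrier E"
  shows "1 \<le> k \<Longrightarrow> mu M (N (ac (\<lambda>_. k) x)) \<le> k * mu M (N x)"
    and "\<bar>k\<bar> \<le> 1 \<Longrightarrow> mu M (N (ac (\<lambda>_. k) x)) \<le> mu M (N x)"
    and "(\<lambda>n. mu M (N (ac (\<lambda>_. 1 / real (Suc n)) x))) \<longlonglongrightarrow> 0"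
proof -
  have m: "N (ac (\<lambda>_. k) x) \<in> \<L> M" for k by (rule N_props(3)) (use assms in simp)
  have e: "AE w in M. N (ac (\<lambda>_. k) x) w = \<bar>k\<bar> * N x w" for k using N_ac[of "\<lambda>_. k", OF _ assms] by simp
  have e': "mu M (N (ac (\<lambda>_. k) x)) = mu M (\<lambda>w. \<bar>k\<bar> * N x w)" for k
    by (rule mu_cong[OF m _ e]) (use N_props(3)[OF assms] in simp)
  show "mu M (N (ac (\<lambda>_. k) x)) \<le> k * mu M (N x)" if "1 \<le> k"
    unfolding e' using mu_scale[OF N_props(3)[OF assms] that] that by simp
  show "mu M (N (ac (\<lambda>_. k) x)) \<le> mu M (N x)" if "\<bar>k\<bar> \<le> 1"
    unfolding e' using N_props(3)[OF assms] that by (intro mu_mono AE_I2) (auto simp: abs_mult intro: mult_left_le_one_le)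
  show "(\<lambda>n. mu M (N (ac (\<lambda>_. 1 / real (Suc n)) x))) \<longlonglongrightarrow> 0" unfolding e'
  proof (rule mu_tendsto_0)
    show "(\<lambda>w. \<bar>1 / real (Suc n)\<bar> * N x w) \<in> \<L> M" for n using N_props(3)[OF assms] by simp
    have "(\<lambda>n. 1 / real (Suc n) * N x w) \<longlonglongrightarrow> 0" for w
      using tendsto_mult[OF LIMSEQ_inverse_real_of_nat tendsto_const[of "N x w"]] by (simp add: inverse_eq_divide)
    then show "AE w in M. (\<lambda>n. \<bar>1 / real (Suc n)\<bar> * N x w) \<longlonglongrightarrow> 0" by simp
  qed
qed

text \<open>By Baire's theorem the closure of one of the sets \<open>{x. T x / n is small}\<close> has interior points.\<close>
lemma closed_graph_approximation:
  assumes comp: "rn_complete M E nrm"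
    and T: "T \<in> carrier E \<rightarrow> carrier E"
    and add: "\<And>x y. x \<in> carrier E \<Longrightarrow> y \<in> carrier E \<Longrightarrow> T (x \<oplus>\<^sub>E y) = T x \<oplus>\<^sub>E T y"
    and hom: "\<And>k x. x \<in> carrier E \<Longrightarrow> T (ac (\<lambda>_. k) x) = ac (\<lambda>_. k) (T x)"
    and e: "0 < e"
  obtains r where "0 < r" "\<And>x \<eta>. x \<in> carrier E \<Longrightarrow> mu M (N x) < r \<Longrightarrow> 0 < \<eta> \<Longrightarrow>
    \<exists>y\<in>carrier E. mu M (N (T y)) < e \<and> mu M (N (x \<ominus>\<^sub>E y)) < \<eta>"
proof -
  interpret ms: Metric_space "carrier E" dE by (rule Metric_space_dE)
  have Tc: "T x \<in> carrier E" if "x \<in> carrier E" for x using T that by auto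
  \<comment> \<open>For fixed x the vectors T x / (n + 1) tend to 0, so these sets cover E. The
    bound e / 2 leaves room for the difference of two of their members.\<close>
  define \<A> where "\<A> n = {x \<in> carrier E. mu M (N (ac (\<lambda>_. 1 / real (Suc n)) (T x))) < e / 2}" for n
  define \<G> where "\<G> = range (\<lambda>n. ms.mtopology closure_of (\<A> n))"
  have "\<exists>n. ms.mtopology interior_of (ms.mtopology closure_of (\<A> n)) \<noteq> {}"
  proof (rule ccontr)
    assume "\<not> ?thesis"
    then have emp: "ms.mtopology interior_of \<Union>\<G> = {}"
      by (intro ms.metric_Baire_category_alt[OF mcomplete_dE[OF comp]]) (auto simp: \<G>_def)
    have "x \<in> \<Union>\<G>" if x: "x \<in> carrier E" for x
    proof -
      obtain n where "mu M (N (ac (\<lambda>_. 1 / real (Suc n)) (T x))) < e / 2"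
        using order_tendstoD(2)[OF mu_N_scale(3)[OF Tc[OF x]], of "e / 2"] e by (auto simp: eventually_sequentially)
      then have "x \<in> \<A> n" using x by (simp add: \<A>_def)
      moreover have "\<A> n \<subseteq> ms.mtopology closure_of (\<A> n)" by (rule closure_of_subset) (auto simp: \<A>_def)
      ultimately show ?thesis by (auto simp: \<G>_def)
    qed
    then have "ms.mball \<zero>\<^sub>E 1 \<subseteq> \<Union>\<G>" by (auto simp: ms.in_mball)
    then have "ms.mball \<zero>\<^sub>E 1 \<subseteq> ms.mtopology interior_of \<Union>\<G>" by (rule interior_of_maximal[OF _ ms.openin_mball])
    moreover have "\<zero>\<^sub>E \<in> ms.mball \<zero>\<^sub>E 1" by simp
    ultimately show False using emp by auto
  qed
  then obtain n x0 where "x0 \<in> ms.mtopology interior_of (ms.mtopology closure_of (\<A> n))" by blast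
  then obtain r where x0: "x0 \<in> carrier E" and r: "0 < r" "ms.mball x0 r \<subseteq> ms.mtopology closure_of (\<A> n)"
    unfolding ms.metric_interior_of by blast
  define k where "k = real (Suc n)"
  have k: "1 \<le> k" by (simp add: k_def)
  have near: "\<exists>a\<in>\<A> n. mu M (N (x \<ominus>\<^sub>E a)) < \<eta>" if "x \<in> carrier E" "mu M (N (x0 \<ominus>\<^sub>E x)) < r" "0 < \<eta>" for x \<eta>
  proof -
    have "x \<in> ms.mtopology closure_of (\<A> n)" using r(2) that(1,2) x0 by (auto simp: ms.in_mball dE_def)
    then show ?thesis unfolding ms.metric_closure_of using that(3) by (auto simp: ms.in_mball dE_def split: if_splits)
  qed
  show ?thesis
  \<comment> \<open>The vector x is blown up to k x before it is compared with the ball of radius r,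
    and this multiplies its size by at most k.\<close>
  proof (rule that[of "r / k"])
    show "0 < r / k" using r k by simp
    fix x and \<eta> :: real assume x: "x \<in> carrier E" and xr: "mu M (N x) < r / k" and \<eta>: "0 < \<eta>"
    define z where "z = ac (\<lambda>_. k) x"
    have z: "z \<in> carrier E" using x by (simp add: z_def)
    have "mu M (N z) \<le> k * mu M (N x)" unfolding z_def by (rule mu_N_scale(1)[OF x k])
    also have "\<dots> < r" using xr k by (simp add: field_simps)
    finally have zr: "mu M (N z) < r" .
    have e1: "x0 \<oplus>\<^sub>E z \<ominus>\<^sub>E x0 = z" using x0 z by (simp add: minus_eq_iff_E M.a_comm)
    have "mu M (N (x0 \<ominus>\<^sub>E (x0 \<oplus>\<^sub>E z))) < r"
      using mu_N_minus_commute[of x0 "x0 \<oplus>\<^sub>E z"] x0 z zr e1 by simp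
    then obtain a where a: "a \<in> \<A> n" "mu M (N ((x0 \<oplus>\<^sub>E z) \<ominus>\<^sub>E a)) < \<eta> / 2"
      using near[of "x0 \<oplus>\<^sub>E z" "\<eta> / 2"] x0 z \<eta> by auto
    have "mu M (N (x0 \<ominus>\<^sub>E x0)) < r" using mu_N_eq_0[of "\<zero>\<^sub>E"] minus_self_E[OF x0] r(1) by simp
    then obtain b where b: "b \<in> \<A> n" "mu M (N (x0 \<ominus>\<^sub>E b)) < \<eta> / 2"
      using near[of x0 "\<eta> / 2"] x0 \<eta> by auto
    have ab: "a \<in> carrier E" "b \<in> carrier E" using a b by (auto simp: \<A>_def)
    \<comment> \<open>As a approximates x0 + k x and b approximates x0, the difference a - b
      approximates k x; division by k brings it back to x and makes T y the difference of two
      vectors of size below e / 2.\<close>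
    define y where "y = ac (\<lambda>_. 1 / k) (a \<oplus>\<^sub>E ac (\<lambda>_. - 1) b)"
    have y: "y \<in> carrier E" using ab by (simp add: y_def)
    have k1: "\<bar>1 / k\<bar> \<le> 1" "\<bar>- 1 :: real\<bar> \<le> 1" using k by auto
    have small: "mu M (N (ac (\<lambda>_. 1 / k) (T c))) < e / 2" if "c \<in> \<A> n" for c using that by (simp add: \<A>_def k_def)
    have swap: "ac (\<lambda>_. c) (ac (\<lambda>_. d) x) = ac (\<lambda>_. d) (ac (\<lambda>_. c) x)" if "x \<in> carrier E" for c d x
      using that rE.ac_mult[of "\<lambda>_. c" "\<lambda>_. d" x] rE.ac_mult[of "\<lambda>_. d" "\<lambda>_. c" x] by (simp add: mult.commute)
    have "T y = ac (\<lambda>_. 1 / k) (T a) \<oplus>\<^sub>E ac (\<lambda>_. - 1) (ac (\<lambda>_. 1 / k) (T b))"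
      unfolding y_def using ab Tc by (simp add: add hom rE.ac_addr swap[of _ "1 / k"])
    then have "mu M (N (T y)) \<le> mu M (N (ac (\<lambda>_. 1 / k) (T a))) + mu M (N (ac (\<lambda>_. - 1) (ac (\<lambda>_. 1 / k) (T b))))"
      using mu_N_add[of "ac (\<lambda>_. 1 / k) (T a)" "ac (\<lambda>_. - 1) (ac (\<lambda>_. 1 / k) (T b))"] ab Tc by simp
    also have "\<dots> < e / 2 + e / 2"
      using small[OF a(1)] small[OF b(1)] mu_N_scale(2)[OF _ k1(2), of "ac (\<lambda>_. 1 / k) (T b)"] ab Tc by auto
    finally have Ty: "mu M (N (T y)) < e" by simp
    have d1: "x = ac (\<lambda>_. 1 / k) z" unfolding z_def using k x rE.ac_mult[of "\<lambda>_. 1 / k" "\<lambda>_. k" x] by simp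
    have d2: "z \<oplus>\<^sub>E rE.neg (a \<oplus>\<^sub>E rE.neg b) = (x0 \<oplus>\<^sub>E z \<ominus>\<^sub>E a) \<oplus>\<^sub>E rE.neg (x0 \<ominus>\<^sub>E b)"
    proof -
      let ?p = "x0 \<oplus>\<^sub>E z \<ominus>\<^sub>E a" and ?q = "x0 \<ominus>\<^sub>E b" and ?c = "a \<ominus>\<^sub>E b"
      have c: "?p \<in> carrier E" "?q \<in> carrier E" "?c \<in> carrier E" using ab x0 z by auto
      have "(?q \<oplus>\<^sub>E z) \<oplus>\<^sub>E b = (?q \<oplus>\<^sub>E b) \<oplus>\<^sub>E z" using c z ab by (simp add: M.a_ac)
      also have "\<dots> = ?p \<oplus>\<^sub>E a" using x0 z ab by (simp add: minus_add_E)
      also have "\<dots> = ?p \<oplus>\<^sub>E (?c \<oplus>\<^sub>E b)" using ab by (simp add: minus_add_E)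
      also have "\<dots> = (?p \<oplus>\<^sub>E ?c) \<oplus>\<^sub>E b" using c ab by (simp add: M.a_assoc)
      finally have "?q \<oplus>\<^sub>E z = ?p \<oplus>\<^sub>E ?c" using c z ab by simp
      then have "z \<oplus>\<^sub>E ?q = (?p \<ominus>\<^sub>E ?q) \<oplus>\<^sub>E ?c \<oplus>\<^sub>E ?q"
        using c z minus_add_E[OF c(1,2)] M.a_comm[OF c(2) z] M.a_comm[OF c(3,2)] by (simp add: M.a_assoc) (simp add: M.a_assoc[symmetric])
      then have "z \<ominus>\<^sub>E ?c = ?p \<ominus>\<^sub>E ?q" using c z by (simp add: minus_eq_iff_E)
      then show ?thesis using ab x0 z by (simp add: minus_E[symmetric])
    qed
    have "x \<ominus>\<^sub>E y = ac (\<lambda>_. 1 / k) z \<oplus>\<^sub>E rE.neg y" using minus_E[OF x y] d1 by simp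
    also have "\<dots> = ac (\<lambda>_. 1 / k) (z \<oplus>\<^sub>E rE.neg (a \<oplus>\<^sub>E rE.neg b))"
      unfolding y_def using z ab by (simp add: rE.ac_addr swap[of _ "1 / k"])
    finally have "mu M (N (x \<ominus>\<^sub>E y)) \<le> mu M (N ((x0 \<oplus>\<^sub>E z \<ominus>\<^sub>E a) \<oplus>\<^sub>E rE.neg (x0 \<ominus>\<^sub>E b)))"
      unfolding d2 using mu_N_scale(2)[OF _ k1(1), of "(x0 \<oplus>\<^sub>E z \<ominus>\<^sub>E a) \<oplus>\<^sub>E rE.neg (x0 \<ominus>\<^sub>E b)"] x0 z ab by simp
    also have "\<dots> \<le> mu M (N (x0 \<oplus>\<^sub>E z \<ominus>\<^sub>E a)) + mu M (N (rE.neg (x0 \<ominus>\<^sub>E b)))"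
      using x0 z ab by (intro mu_N_add) auto
    also have "\<dots> < \<eta> / 2 + \<eta> / 2" using a(2) b(2) mu_N_scale(2)[OF _ k1(2), of "x0 \<ominus>\<^sub>E b"] x0 ab by auto
    finally have xy: "mu M (N (x \<ominus>\<^sub>E y)) < \<eta>" by simp
    show "\<exists>y\<in>carrier E. mu M (N (T y)) < e \<and> mu M (N (x \<ominus>\<^sub>E y)) < \<eta>"
      using y Ty xy by (intro bexI[of _ y] conjI)
  qed
qed

text \<open>A small x is approximated by y_0 with small T y_0, the remainder by y_1 with a much
  smaller T y_1, and so on. The partial sums tend to x, their images form a Cauchy sequence, and the
  closed graph identifies the limit of the images as T x.\<close>

theorem closed_graph:
  assumes comp: "rn_complete M E nrm"
    and T: "T \<in> carrier E \<rightarrow> carrier E"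
    and add: "\<And>x y. x \<in> carrier E \<Longrightarrow> y \<in> carrier E \<Longrightarrow> T (x \<oplus>\<^sub>E y) = T x \<oplus>\<^sub>E T y"
    and hom: "\<And>k x. x \<in> carrier E \<Longrightarrow> T (ac (\<lambda>_. k) x) = ac (\<lambda>_. k) (T x)"
    and closed: "\<And>s x z. (\<And>n::nat. s n \<in> carrier E) \<Longrightarrow> x \<in> carrier E \<Longrightarrow> z \<in> carrier E \<Longrightarrow>
      (\<lambda>n. mu M (N (s n \<ominus>\<^sub>E x))) \<longlonglongrightarrow> 0 \<Longrightarrow> (\<lambda>n. mu M (N (T (s n) \<ominus>\<^sub>E z))) \<longlonglongrightarrow> 0 \<Longrightarrow> z = T x"
    and e: "0 < e"
  shows "\<exists>d>0. \<forall>x\<in>carrier E. mu M (N x) < d \<longrightarrow> mu M (N (T x)) < e"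
proof -
  have Tc: "T x \<in> carrier E" if "x \<in> carrier E" for x using T that by auto
  have Tneg: "T (rE.neg x) = rE.neg (T x)" if "x \<in> carrier E" for x using hom[OF that] .
  have Tdiff: "T (x \<ominus>\<^sub>E y) = T x \<ominus>\<^sub>E T y" if "x \<in> carrier E" "y \<in> carrier E" for x y
    using that Tc by (simp add: minus_E add Tneg)
  \<comment> \<open>These bounds add up to e / 2; the other half of e pays for passing from a
    partial sum to the limit.\<close>
  define \<epsilon> where "\<epsilon> j = e / 2 ^ (j + 2)" for j :: nat
  have \<epsilon>: "0 < \<epsilon> j" for j using e by (simp add: \<epsilon>_def)
  have "\<exists>r>0. \<forall>x\<in>carrier E. mu M (N x) < r \<longrightarrow> (\<forall>\<eta>>0. \<exists>y\<in>carrier E. mu M (N (T y)) < \<epsilon> j \<and> mu M (N (x \<ominus>\<^sub>E y)) < \<eta>)" for j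
  proof -
    obtain r where r: "0 < r" "\<And>x \<eta>. x \<in> carrier E \<Longrightarrow> mu M (N x) < r \<Longrightarrow> 0 < \<eta> \<Longrightarrow>
      \<exists>y\<in>carrier E. mu M (N (T y)) < \<epsilon> j \<and> mu M (N (x \<ominus>\<^sub>E y)) < \<eta>"
      by (rule closed_graph_approximation[OF comp T add hom \<epsilon>]) (assumption+, rule that)
    show ?thesis using r by (intro exI[of _ r] conjI ballI impI allI)
  qed
  then have "\<forall>j. \<exists>r. 0 < r \<and> (\<forall>x\<in>carrier E. mu M (N x) < r \<longrightarrow> (\<forall>\<eta>>0. \<exists>y\<in>carrier E. mu M (N (T y)) < \<epsilon> j \<and> mu M (N (x \<ominus>\<^sub>E y)) < \<eta>))" ..
  from choice[OF this] obtain r where r: "\<forall>j. 0 < r j \<and> (\<forall>x\<in>carrier E. mu M (N x) < r j \<longrightarrow> (\<forall>\<eta>>0. \<exists>y\<in>carrier E. mu M (N (T y)) < \<epsilon> j \<and> mu M (N (x \<ominus>\<^sub>E y)) < \<eta>))"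
    by (rule exE)
  have r0: "0 < r j" and rN: "x \<in> carrier E \<Longrightarrow> mu M (N x) < r j \<Longrightarrow> 0 < \<eta> \<Longrightarrow>
    \<exists>y\<in>carrier E. mu M (N (T y)) < \<epsilon> j \<and> mu M (N (x \<ominus>\<^sub>E y)) < \<eta>" for j x \<eta> using r by auto
  \<comment> \<open>The remainder is kept below the next radius, so that the approximation can be
    continued, and below \<open>\<epsilon> j\<close>, so that the remainders tend to zero.\<close>
  define P where "P j x y \<longleftrightarrow> y \<in> carrier E \<and> mu M (N (T y)) < \<epsilon> j \<and> mu M (N (x \<ominus>\<^sub>E y)) < min (r (Suc j)) (\<epsilon> j)" for j x y
  define Y where "Y j x = (SOME y. P j x y)" for j x
  have PY: "P j x (Y j x)" if "x \<in> carrier E" "mu M (N x) < r j" for j x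
  proof -
    have "0 < min (r (Suc j)) (\<epsilon> j)" using r0 \<epsilon> by simp
    from rN[OF that this] show ?thesis unfolding Y_def by (intro someI_ex[of "P j x"]) (auto simp: P_def)
  qed
  show ?thesis
  proof (intro exI[of _ "r 0"] conjI ballI impI)
    show "0 < r 0" by (rule r0)
    fix x assume x: "x \<in> carrier E" and xr: "mu M (N x) < r 0"
    define X where "X = rec_nat x (\<lambda>j z. z \<ominus>\<^sub>E Y j z)"
    have X0: "X 0 = x" and XS: "X (Suc j) = X j \<ominus>\<^sub>E Y j (X j)" for j by (simp_all add: X_def)
    have XP: "X j \<in> carrier E \<and> mu M (N (X j)) < r j" for j
    proof (induction j)
      case 0 then show ?case using x xr X0 by simp
    next
      case (Suc j)
      then show ?case using PY[of "X j" j] unfolding XS by (simp add: P_def)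
    qed
    define y where "y j = Y j (X j)" for j
    have y: "P j (X j) (y j)" for j unfolding y_def using PY XP by simp
    have Xc: "X j \<in> carrier E" and yc: "y j \<in> carrier E" for j using XP y by (auto simp: P_def)
    have Xd: "X j \<ominus>\<^sub>E X (Suc j) = y j" for j
      unfolding XS y_def[symmetric] by (rule minus_minus_E[OF Xc yc])
    have XN: "mu M (N (X (Suc j))) < \<epsilon> j" for j using y[of j] unfolding XS y_def[symmetric] by (simp add: P_def)
    define s where "s j = x \<ominus>\<^sub>E X j" for j
    have sc: "s j \<in> carrier E" for j using x Xc by (simp add: s_def)
    \<comment> \<open>The sum telescopes, because \<open>\<epsilon> j\<close> is the difference of e
      / 2^(j + 1) and e / 2^(j + 2).\<close>
    have tail: "mu M (N (T (X i) \<ominus>\<^sub>E T (X j))) \<le> e / 2 ^ (i + 1) - e / 2 ^ (j + 1)" if "i \<le> j" for i j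
      using that
    proof (induction j rule: dec_induct)
      case base
      then show ?case using minus_self_E[OF Tc[OF Xc[of i]]] mu_N_eq_0[of "\<zero>\<^sub>E"] by simp
    next
      case (step j)
      have "T (X i) \<ominus>\<^sub>E T (X (Suc j)) = (T (X i) \<ominus>\<^sub>E T (X j)) \<oplus>\<^sub>E (T (X j) \<ominus>\<^sub>E T (X (Suc j)))"
        by (rule minus_chain_E[OF Tc[OF Xc] Tc[OF Xc] Tc[OF Xc]])
      also have "T (X j) \<ominus>\<^sub>E T (X (Suc j)) = T (y j)" using Tdiff[OF Xc Xc, of j "Suc j"] Xd by simp
      finally have "mu M (N (T (X i) \<ominus>\<^sub>E T (X (Suc j)))) \<le> mu M (N (T (X i) \<ominus>\<^sub>E T (X j))) + mu M (N (T (y j)))"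
        using mu_N_add[of "T (X i) \<ominus>\<^sub>E T (X j)" "T (y j)"] Tc Xc yc by simp
      also have "\<dots> \<le> (e / 2 ^ (i + 1) - e / 2 ^ (j + 1)) + \<epsilon> j" using step(3) y[of j] by (auto simp: P_def)
      also have "\<dots> = e / 2 ^ (i + 1) - e / 2 ^ (Suc j + 1)" by (simp add: \<epsilon>_def field_simps)
      finally show ?case .
    qed
    have pow0: "(\<lambda>j. e / 2 ^ (j + 1)) \<longlonglongrightarrow> 0" using LIMSEQ_divide_realpow_zero[of 2 "e / 2"] by simp
    have Ts: "T (s i) \<ominus>\<^sub>E T (s j) = T (X j) \<ominus>\<^sub>E T (X i)" for i j
    proof -
      have "s i \<ominus>\<^sub>E s j = X j \<ominus>\<^sub>E X i" unfolding s_def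
        using x Xc[of i] Xc[of j] minus_chain_E[OF x Xc Xc, of i j] by (subst minus_eq_iff_E) (simp_all add: M.a_comm)
      then show ?thesis using Tdiff[OF sc sc, of i j] Tdiff[OF Xc Xc, of j i] by simp
    qed
    have c: "\<exists>n0. \<forall>m\<ge>n0. \<forall>n\<ge>n0. mu M (N (T (s m) \<ominus>\<^sub>E T (s n))) < d" if d: "0 < d" for d
    proof -
      obtain n0 where n0: "\<And>n. n \<ge> n0 \<Longrightarrow> e / 2 ^ (n + 1) < d"
        using order_tendstoD(2)[OF pow0 d] by (auto simp: eventually_sequentially)
      have main: "mu M (N (T (X i) \<ominus>\<^sub>E T (X j))) < d" if "i \<le> j" "n0 \<le> i" for i j
      proof -
        have "0 \<le> e / 2 ^ (j + 1)" using e by simp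
        then show ?thesis using tail[OF that(1)] n0[OF that(2)] by linarith
      qed
      then have "mu M (N (T (s m) \<ominus>\<^sub>E T (s n))) < d" if "n0 \<le> m" "n0 \<le> n" for m n
      proof (cases "m \<le> n")
        case True
        then show ?thesis unfolding Ts using mu_N_minus_commute[OF Tc[OF Xc[of m]] Tc[OF Xc[of n]]] main[OF True that(1)] by simp
      next
        case False
        then show ?thesis unfolding Ts using main[of n m] that(2) by simp
      qed
      then show ?thesis by (intro exI[of _ n0] allI impI)
    qed
    obtain z where z: "z \<in> carrier E" "(\<lambda>n. mu M (N (T (s n) \<ominus>\<^sub>E z))) \<longlonglongrightarrow> 0"
      by (rule complete_mu[OF comp Tc[OF sc] c]) (assumption, rule that)
    have "(\<lambda>n. mu M (N (s (Suc n) \<ominus>\<^sub>E x))) \<longlonglongrightarrow> 0"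
    proof (rule tendsto_sandwich[OF _ _ tendsto_const])
      show "\<forall>\<^sub>F n in sequentially. 0 \<le> mu M (N (s (Suc n) \<ominus>\<^sub>E x))" by (simp add: mu_nonneg)
      have "mu M (N (s (Suc n) \<ominus>\<^sub>E x)) \<le> \<epsilon> n" for n
        using mu_N_minus_commute[OF sc x, of "Suc n"] minus_minus_E[OF x Xc, of "Suc n"] XN[of n] by (simp add: s_def)
      then show "\<forall>\<^sub>F n in sequentially. mu M (N (s (Suc n) \<ominus>\<^sub>E x)) \<le> \<epsilon> n" by simp
      show "\<epsilon> \<longlonglongrightarrow> 0" unfolding \<epsilon>_def using LIMSEQ_divide_realpow_zero[of 2 "e / 4"] by simp
    qed
    then have sx: "(\<lambda>n. mu M (N (s n \<ominus>\<^sub>E x))) \<longlonglongrightarrow> 0" by (rule LIMSEQ_imp_Suc)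
    have "z = T x" by (rule closed[OF sc x z(1) sx z(2)])
    then obtain n where n: "mu M (N (T (s n) \<ominus>\<^sub>E T x)) < e / 2"
      using order_tendstoD(2)[OF z(2), of "e / 2"] e by (auto simp: eventually_sequentially)
    have "T (s n) = T (X 0) \<ominus>\<^sub>E T (X n)" unfolding s_def X0 using Tdiff x Xc by simp
    moreover have "0 \<le> e / 2 ^ (n + 1)" using e by simp
    ultimately have n2: "mu M (N (T (s n))) \<le> e / 2" using tail[of 0 n] by simp
    have "T x = T (s n) \<oplus>\<^sub>E (T x \<ominus>\<^sub>E T (s n))" using minus_add_E[OF Tc[OF x] Tc[OF sc], of n] Tc sc x by (simp add: M.a_comm)
    then have "mu M (N (T x)) \<le> mu M (N (T (s n))) + mu M (N (T x \<ominus>\<^sub>E T (s n)))"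
      using mu_N_add[of "T (s n)" "T x \<ominus>\<^sub>E T (s n)"] Tc sc x by simp
    also have "\<dots> < e" using n n2 mu_N_minus_commute[OF Tc[OF sc] Tc[OF x], of n] by simp
    finally show "mu M (N (T x)) < e" .
  qed
qed

end

section \<open>Operators given by conjugates\<close>

lemma ereal_mult_add_le_iff:
  fixes C k :: ereal
  assumes "0 < t"
  shows "ereal t * C + ereal d \<le> k \<longleftrightarrow> C \<le> (k - ereal d) / ereal t"
  using assms by (cases C; cases k) (auto simp: field_simps)

lemma ereal_scaled_difference:
  fixes F :: ereal
  assumes "0 < t" "- \<infinity> < F"
  shows "ereal (t * c + d) - ereal t * F = ereal t * (ereal c - F) + ereal d"
  using assms by (cases F) (auto simp: algebra_simps)

lemma ereal_scaled_difference_le_iff: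
  fixes F :: ereal
  assumes "0 < t"
  shows "ereal (t * c + d) - ereal t * F \<le> ereal (t * (- a) + d) \<longleftrightarrow> ereal (c + a) \<le> F"
proof (cases F)
  case (real r)
  have "t * c + d - t * r \<le> t * (- a) + d \<longleftrightarrow> t * (c + a) \<le> t * r" by (auto simp: algebra_simps)
  then show ?thesis using real assms by simp
qed (use assms in auto)

text \<open>Minorants of F and G are glued to a minorant of the pasted function. To bound F on A,
  its minorants are glued with one fixed minorant of G, and conversely off A.\<close>

lemma (in rpair) paste_in:
  assumes F: "F \<in> C" and G: "G \<in> C" and A: "A \<in> sets M"
  shows "paste M X A F G \<in> C"
proof -
  have rp: "AE w in M. rep (paste M X A F G x) w = (if w \<in> A then rep (F x) w else rep (G x) w)"
    and pc: "paste M X A F G x \<in> ae_classes M" if "x \<in> X" for x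
    using paste_rep[where F = F and G = G, OF that fclD(1)[OF F that] fclD(1)[OF G that] A] by auto
  have glue_minor: "aminor M X Y b (paste M X A F G) (Y.glue A y y') (\<lambda>w. if w \<in> A then a w else a' w)"
    and glue_b: "x \<in> X \<Longrightarrow> AE w in M. b x (Y.glue A y y') w = (if w \<in> A then b x y w else b x y' w)"
    if m: "aminor M X Y b F y a" "aminor M X Y b G y' a'" for y a y' a' x
  proof -
    have yy: "y \<in> Y" "y' \<in> Y" "a \<in> \<L> M" "a' \<in> \<L> M" using m by (auto simp: aminor_def)
    have g: "AE w in M. b x (Y.glue A y y') w = (if w \<in> A then b x y w else b x y' w)" if "x \<in> X" for x
      using Y.rlin_glue[OF linY[OF that] yy(1,2) A] .
    have "AE w in M. ereal (b x (Y.glue A y y') w + (if w \<in> A then a w else a' w)) \<le> rep (paste M X A F G x) w" if x: "x \<in> X" for x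
    proof -
      have "AE w in M. ereal (b x y w + a w) \<le> rep (F x) w" "AE w in M. ereal (b x y' w + a' w) \<le> rep (G x) w"
        using m x by (simp_all add: aminor_def)
      then show ?thesis using g[OF x] rp[OF x] by eventually_elim auto
    qed
    moreover have "(\<lambda>w. if w \<in> A then a w else a' w) \<in> \<L> M" using yy A by measurable
    ultimately show "aminor M X Y b (paste M X A F G) (Y.glue A y y') (\<lambda>w. if w \<in> A then a w else a' w)"
      using yy A by (simp add: aminor_def)
    show "x \<in> X \<Longrightarrow> AE w in M. b x (Y.glue A y y') w = (if w \<in> A then b x y w else b x y' w)" by (rule g)
  qed
  obtain y a where mF: "aminor M X Y b F y a" using fclD(4)[OF F] by (elim exE)
  obtain y' a' where mG: "aminor M X Y b G y' a'" using fclD(4)[OF G] by (elim exE)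
  obtain x where x: "x \<in> X" "AE w in M. rep (F x) w < \<infinity>" using fclD(3)[OF F] by (rule bexE)
  obtain x' where x': "x' \<in> X" "AE w in M. rep (G x') w < \<infinity>" using fclD(3)[OF G] by (rule bexE)
  have gx: "X.glue A x x' \<in> X" using A x(1) x'(1) by simp
  have fin: "AE w in M. rep (paste M X A F G (X.glue A x x')) w < \<infinity>"
    using rp[OF gx] fcl_local[OF F x(1) x'(1) A] fcl_local[OF G x(1) x'(1) A] x(2) x'(2)
  proof eventually_elim
    case (elim w)
    then show ?case by (cases "w \<in> A") (auto intro: le_less_trans)
  qed
  have lub: "AE w in M. rep (paste M X A F G z) w \<le> h w"
    if z: "z \<in> X" and h: "h \<in> \<L> M"
      and le: "\<And>y a. aminor M X Y b (paste M X A F G) y a \<Longrightarrow> AE w in M. ereal (b z y w + a w) \<le> h w" for z h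
  proof -
    \<comment> \<open>The value \<infinity> on the other side of A lets a global upper bound express
      a comparison on one side only.\<close>
    have hm: "(\<lambda>w. if w \<in> A then h w else \<infinity>) \<in> \<L> M" "(\<lambda>w. if w \<in> A then \<infinity> else h w) \<in> \<L> M"
      using h A by measurable
    have "AE w in M. rep (F z) w \<le> (if w \<in> A then h w else \<infinity>)"
    proof (rule fclD(5)[OF F z hm(1)])
      fix y1 a1 assume m: "aminor M X Y b F y1 a1"
      show "AE w in M. ereal (b z y1 w + a1 w) \<le> (if w \<in> A then h w else \<infinity>)"
        using le[OF glue_minor[OF m mG]] glue_b[OF m mG z] by eventually_elim auto
    qed
    moreover have "AE w in M. rep (G z) w \<le> (if w \<in> A then \<infinity> else h w)"
    proof (rule fclD(5)[OF G z hm(2)])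
      fix y1 a1 assume m: "aminor M X Y b G y1 a1"
      show "AE w in M. ereal (b z y1 w + a1 w) \<le> (if w \<in> A then \<infinity> else h w)"
        using le[OF glue_minor[OF mF m]] glue_b[OF mF m z] by eventually_elim auto
    qed
    ultimately show ?thesis using rp[OF z] by eventually_elim (auto split: if_splits)
  qed
  have PiE: "paste M X A F G \<in> X \<rightarrow>\<^sub>E ae_classes M"
    using pc by (auto simp: PiE_iff) (simp add: paste_def)
  show ?thesis
    unfolding fcl_def
  proof (intro CollectI conjI PiE ballI impI)
    show "\<exists>x\<in>X. AE w in M. rep (paste M X A F G x) w < \<infinity>" using gx fin by (rule bexI[rotated])
    show "\<exists>y a. aminor M X Y b (paste M X A F G) y a" using glue_minor[OF mF mG] by (intro exI)
    fix z h assume z: "z \<in> X" "h \<in> \<L> M"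
      and "\<forall>y a. aminor M X Y b (paste M X A F G) y a \<longrightarrow> (AE w in M. ereal (b z y w + a w) \<le> h w)"
    then show "AE w in M. rep (paste M X A F G z) w \<le> h w" by (intro lub) simp_all
  qed
qed

section \<open>Conjugates, adjoints and automorphisms\<close>

context random_normed_module
begin

lemma conjugate_sup:
  assumes f: "f \<in> pair.C" and u: "u \<in> carrier D"
  shows "conjugate M E nrm f u \<in> ae_classes M"
    and "x \<in> carrier E \<Longrightarrow> AE w in M. ereal (pr x u w) - rep (f x) w \<le> rep (conjugate M E nrm f u) w"
    and "\<lbrakk>h \<in> \<L> M; \<And>x. x \<in> carrier E \<Longrightarrow> AE w in M. ereal (pr x u w) - rep (f x) w \<le> h w\<rbrakk> \<Longrightarrow>
      AE w in M. rep (conjugate M E nrm f u) w \<le> h w"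
proof -
  let ?S = "(\<lambda>x. ext_diff M (to_ext M (u x)) (f x)) ` carrier E"
  have c: "conjugate M E nrm f u = \<Squnion>\<^bsub>L0bar M\<^esub> ?S" using u by (simp add: conjugate_def)
  have d: "ext_diff M (to_ext M (u x)) (f x) \<in> ae_classes M"
    "AE w in M. rep (ext_diff M (to_ext M (u x)) (f x)) w = ereal (pr x u w) - rep (f x) w" if x: "x \<in> carrier E" for x
  proof -
    note e = rep_to_ext[OF dualD(1)[OF u x]]
    show "ext_diff M (to_ext M (u x)) (f x) \<in> ae_classes M" by (rule rep_ext_ops(4)[OF e(2) pair.fclD(1)[OF f x]])
    show "AE w in M. rep (ext_diff M (to_ext M (u x)) (f x)) w = ereal (pr x u w) - rep (f x) w"
      using rep_ext_ops(3)[OF e(2) pair.fclD(1)[OF f x]] e(1) by eventually_elim simp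
  qed
  have sub: "?S \<subseteq> ae_classes M" using d(1) by auto
  show "conjugate M E nrm f u \<in> ae_classes M" unfolding c by (rule sup_L0bar(1)[OF sub])
  show "AE w in M. ereal (pr x u w) - rep (f x) w \<le> rep (conjugate M E nrm f u) w" if x: "x \<in> carrier E"
    unfolding c using sup_L0bar(2)[OF sub imageI[OF x]] d(2)[OF x] by eventually_elim simp
  assume h: "h \<in> \<L> M" and le: "\<And>x. x \<in> carrier E \<Longrightarrow> AE w in M. ereal (pr x u w) - rep (f x) w \<le> h w"
  show "AE w in M. rep (conjugate M E nrm f u) w \<le> h w" unfolding c
  proof (rule sup_L0bar(3)[OF sub h])
    fix Z assume "Z \<in> ?S"
    then obtain x where x: "x \<in> carrier E" "Z = ext_diff M (to_ext M (u x)) (f x)" by (rule imageE) (rule that)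
    show "AE w in M. rep Z w \<le> h w" using d(2)[OF x(1)] le[OF x(1)] unfolding x(2) by eventually_elim simp
  qed
qed

lemma dual_tendsto:
  assumes u: "u \<in> carrier D" and s: "\<And>n. s n \<in> carrier E" and x: "x \<in> carrier E"
    and l: "(\<lambda>n. mu M (N (s n \<ominus>\<^sub>E x))) \<longlonglongrightarrow> 0"
  shows "(\<lambda>n. mu M (\<lambda>w. pr (s n) u w - pr x u w)) \<longlonglongrightarrow> 0"
proof -
  have hu: "u \<in> module_homs (L0 M) E (L0 M)" using u by (simp add: dual_carrier)
  have e: "mu M (\<lambda>w. pr (s n) u w - pr x u w) = mu M (rep (u (s n \<ominus>\<^sub>E x)))" for n
    unfolding hom_minus[OF module_E module_L0 hu s x] using dualD(1)[OF u s] dualD(1)[OF u x] by (simp add: mu_minus_L0)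
  show ?thesis unfolding e
  proof (rule order_tendstoI)
    fix a :: real assume "0 < a"
    from dualD(6)[OF u this] obtain d where d: "0 < d" "\<forall>x\<in>carrier E. mu M (N x) < d \<longrightarrow> mu M (rep (u x)) < a" by (elim exE conjE)
    show "\<forall>\<^sub>F n in sequentially. mu M (rep (u (s n \<ominus>\<^sub>E x))) < a"
      using order_tendstoD(2)[OF l d(1)] by eventually_elim (use d(2) s x in auto)
  qed (auto intro!: always_eventually less_le_trans[OF _ mu_nonneg])
qed

lemma mu_limit_unique:
  assumes m: "\<And>n::nat. g n \<in> \<L> M" "a \<in> \<L> M" "b \<in> \<L> M"
    and l: "(\<lambda>n. mu M (\<lambda>w. g n w - a w)) \<longlonglongrightarrow> 0" "(\<lambda>n. mu M (\<lambda>w. g n w - b w)) \<longlonglongrightarrow> 0"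
  shows "AE w in M. a w = b w"
proof -
  have "mu M (\<lambda>w. a w - b w) \<le> mu M (\<lambda>w. g n w - a w) + mu M (\<lambda>w. g n w - b w)" for n
    using m by (intro mu_le_add) auto
  then have "mu M (\<lambda>w. a w - b w) \<le> 0"
    using LIMSEQ_le_const[OF tendsto_add[OF l]] by auto
  then have "mu M (\<lambda>w. a w - b w) = 0" using mu_nonneg[of "\<lambda>w. a w - b w"] by simp
  then show ?thesis using mu_eq_0[of "\<lambda>w. a w - b w"] m by auto
qed

lemma automorphism_iff:
  "H \<in> continuous_module_automorphisms M E nrm \<longleftrightarrow> H \<in> module_homs (L0 M) E E \<and> bij_betw H (carrier E) (carrier E) \<and>
     (\<forall>e>0. \<exists>d>0. \<forall>x\<in>carrier E. mu M (N x) < d \<longrightarrow> mu M (N (H x)) < e)"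
  using continuous_hom_iff[OF l0norm_E l0norm_E, of H] by (auto simp: continuous_module_automorphisms_def)

lemma module_hom_of_additive:
  assumes "H \<in> carrier E \<rightarrow> carrier E"
    and "\<And>x y. x \<in> carrier E \<Longrightarrow> y \<in> carrier E \<Longrightarrow> H (x \<oplus>\<^sub>E y) = H x \<oplus>\<^sub>E H y"
    and hom: "\<And>a x. a \<in> \<L> M \<Longrightarrow> x \<in> carrier E \<Longrightarrow> H (ac a x) = ac a (H x)"
  shows "H \<in> module_homs (L0 M) E E"
proof -
  have "H (\<xi> \<odot>\<^sub>E x) = \<xi> \<odot>\<^sub>E H x" if "\<xi> \<in> carrier (L0 M)" "x \<in> carrier E" for \<xi> x
    using hom[OF rep_L0(1)[OF that(1)] that(2)] by (simp add: rep_L0(2)[OF that(1)])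
  then show ?thesis using assms(1,2) by (simp add: module_homs_def)
qed

lemma adjoint_apply: "x \<in> carrier E \<Longrightarrow> rn_adjoint E H u x = u (H x)"
  by (simp add: rn_adjoint_def)

lemma adjoint_in_dual:
  assumes H: "H \<in> continuous_module_automorphisms M E nrm" and u: "u \<in> carrier D"
  shows "rn_adjoint E H u \<in> carrier D"
proof -
  have h: "H x \<in> carrier E" "x \<in> carrier E \<Longrightarrow> y \<in> carrier E \<Longrightarrow> H (x \<oplus>\<^sub>E y) = H x \<oplus>\<^sub>E H y"
    "\<xi> \<in> carrier (L0 M) \<Longrightarrow> x \<in> carrier E \<Longrightarrow> H (\<xi> \<odot>\<^sub>E x) = \<xi> \<odot>\<^sub>E H x" if "x \<in> carrier E" for x y \<xi>
    using H that by (auto simp: automorphism_iff module_homs_def)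
  have "rn_adjoint E H u \<in> module_homs (L0 M) E (L0 M)"
    using h dualD(1,3,4)[OF u] by (auto simp: module_homs_def adjoint_apply smult_L0)
  moreover have "\<exists>d>0. \<forall>x\<in>carrier E. mu M (N x) < d \<longrightarrow> mu M (rep (rn_adjoint E H u x)) < e" if e: "0 < e" for e
  proof -
    obtain d where d: "0 < d" "\<forall>x\<in>carrier E. mu M (N x) < d \<longrightarrow> mu M (rep (u x)) < e" using dualD(6)[OF u e] by (elim exE conjE)
    obtain d' where d': "0 < d'" "\<forall>x\<in>carrier E. mu M (N x) < d' \<longrightarrow> mu M (N (H x)) < d"
      using H d(1) by (auto simp: automorphism_iff)
    show ?thesis using d' d(2) h(1) by (intro exI[of _ d']) (auto simp: adjoint_apply)
  qed
  ultimately show ?thesis by (auto simp: dual_carrier rn_adjoint_def)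
qed

text \<open>An automorphism is continuous by definition, its inverse by the closed graph theorem. If
  s n tends to x and the preimages tend to z, testing s n against u and the preimages against the
  adjoint of u gives x = H z.\<close>

lemma inverse_automorphism:
  assumes comp: "rn_complete M E nrm" and H: "H \<in> continuous_module_automorphisms M E nrm"
  shows "inv_into (carrier E) H \<in> continuous_module_automorphisms M E nrm"
proof -
  let ?K = "inv_into (carrier E) H"
  have bij: "bij_betw H (carrier E) (carrier E)" and hom: "H \<in> module_homs (L0 M) E E"
    and cont: "\<And>e. 0 < e \<Longrightarrow> \<exists>d>0. \<forall>x\<in>carrier E. mu M (N x) < d \<longrightarrow> mu M (N (H x)) < e"
    using H by (auto simp: automorphism_iff)
  have h: "H x \<in> carrier E" "x \<in> carrier E \<Longrightarrow> y \<in> carrier E \<Longrightarrow> H (x \<oplus>\<^sub>E y) = H x \<oplus>\<^sub>E H y"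
    "\<xi> \<in> carrier (L0 M) \<Longrightarrow> x \<in> carrier E \<Longrightarrow> H (\<xi> \<odot>\<^sub>E x) = \<xi> \<odot>\<^sub>E H x" if "x \<in> carrier E" for x y \<xi>
    using hom that by (auto simp: module_homs_def)
  have k: "?K x \<in> carrier E" "H (?K x) = x" "?K (H x) = x" if "x \<in> carrier E" for x
    using that bij by (simp_all add: bij_betw_inv_into_right bij_betw_inv_into_left bij_betw_apply[OF bij_betw_inv_into])
  have kadd: "?K (x \<oplus>\<^sub>E y) = ?K x \<oplus>\<^sub>E ?K y" if "x \<in> carrier E" "y \<in> carrier E" for x y
    using k(3)[of "?K x \<oplus>\<^sub>E ?K y"] k(1,2) h(2) that by simp
  have ksm: "?K (ac a x) = ac a (?K x)" if "a \<in> \<L> M" "x \<in> carrier E" for a x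
    using k(3)[of "ac a (?K x)"] k(1,2) h(3) that by simp
  have kc: "?K \<in> carrier E \<rightarrow> carrier E" using k(1) by auto
  have "\<exists>d>0. \<forall>x\<in>carrier E. mu M (N x) < d \<longrightarrow> mu M (N (?K x)) < e" if e: "0 < e" for e
  proof (rule closed_graph[OF comp kc kadd _ _ e])
    fix s x z assume s: "\<And>n::nat. s n \<in> carrier E" and x: "x \<in> carrier E" and z: "z \<in> carrier E"
      and l: "(\<lambda>n. mu M (N (s n \<ominus>\<^sub>E x))) \<longlonglongrightarrow> 0" "(\<lambda>n. mu M (N (?K (s n) \<ominus>\<^sub>E z))) \<longlonglongrightarrow> 0"
    have "x = H z"
    proof (rule pair.eq_X[OF x h(1)[OF z]])
      fix u assume u: "u \<in> carrier D"
      have u': "rn_adjoint E H u \<in> carrier D" by (rule adjoint_in_dual[OF H u])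
      have "pr (?K (s n)) (rn_adjoint E H u) = pr (s n) u" for n using k[OF s] by (simp add: adjoint_apply)
      then have "(\<lambda>n. mu M (\<lambda>w. pr (s n) u w - pr (H z) u w)) \<longlonglongrightarrow> 0"
        using dual_tendsto[OF u' k(1)[OF s] z l(2)] z by (simp add: adjoint_apply)
      then show "AE w in M. pr x u w = pr (H z) u w"
        by (rule mu_limit_unique[OF dualD(2)[OF u s] dualD(2)[OF u x] dualD(2)[OF u h(1)[OF z]] dual_tendsto[OF u s x l(1)]])
    qed
    then show "z = ?K x" using k(3)[OF z] by simp
  qed (use kadd ksm in auto)
  moreover have "bij_betw ?K (carrier E) (carrier E)" by (rule bij_betw_inv_into[OF bij])
  ultimately show ?thesis
    using module_hom_of_additive[OF kc kadd ksm] by (simp add: automorphism_iff)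
qed

text \<open>If s n tends to x and H (s n) to z, then pairing H (s n) with \<open>P u\<close> is
  pairing s n with u, so z and H x pair equally with every \<open>P u\<close>. As P is onto, z = H x
  and the graph is closed.\<close>

lemma automorphism_of_adjoint:
  assumes comp: "rn_complete M E nrm"
    and bij: "bij_betw H (carrier E) (carrier E)"
    and add: "\<And>x y. x \<in> carrier E \<Longrightarrow> y \<in> carrier E \<Longrightarrow> H (x \<oplus>\<^sub>E y) = H x \<oplus>\<^sub>E H y"
    and hom: "\<And>a x. a \<in> \<L> M \<Longrightarrow> x \<in> carrier E \<Longrightarrow> H (ac a x) = ac a (H x)"
    and P: "P ` carrier D = carrier D"
    and adj: "\<And>x u. x \<in> carrier E \<Longrightarrow> u \<in> carrier D \<Longrightarrow> AE w in M. pr (H x) (P u) w = pr x u w"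
  shows "H \<in> continuous_module_automorphisms M E nrm"
proof -
  have Hc: "H x \<in> carrier E" if "x \<in> carrier E" for x using bij that by (rule bij_betw_apply)
  have HE: "H \<in> carrier E \<rightarrow> carrier E" using Hc by auto
  have "\<exists>d>0. \<forall>x\<in>carrier E. mu M (N x) < d \<longrightarrow> mu M (N (H x)) < e" if e: "0 < e" for e
  proof (rule closed_graph[OF comp HE add _ _ e])
    fix s x z assume s: "\<And>n::nat. s n \<in> carrier E" and x: "x \<in> carrier E" and z: "z \<in> carrier E"
      and l: "(\<lambda>n. mu M (N (s n \<ominus>\<^sub>E x))) \<longlonglongrightarrow> 0" "(\<lambda>n. mu M (N (H (s n) \<ominus>\<^sub>E z))) \<longlonglongrightarrow> 0"
    show "z = H x"
    proof (rule pair.eq_X[OF z Hc[OF x]])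
      fix p assume p: "p \<in> carrier D"
      then have "p \<in> P ` carrier D" by (simp add: P)
      then obtain u where u: "u \<in> carrier D" "p = P u" by (rule imageE) (rule that)
      have "mu M (\<lambda>w. pr (H (s n)) p w - pr (H x) p w) = mu M (\<lambda>w. pr (s n) u w - pr x u w)" for n
      proof (rule mu_cong)
        show "AE w in M. pr (H (s n)) p w - pr (H x) p w = pr (s n) u w - pr x u w"
          using adj[OF s[of n] u(1)] adj[OF x u(1)] unfolding u(2) by eventually_elim simp
      qed (use dualD(2)[OF p Hc[OF s]] dualD(2)[OF p Hc[OF x]] dualD(2)[OF u(1) s] dualD(2)[OF u(1) x] in auto)
      then have l1: "(\<lambda>n. mu M (\<lambda>w. pr (H (s n)) p w - pr (H x) p w)) \<longlonglongrightarrow> 0"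
        using dual_tendsto[OF u(1) s x l(1)] by simp
      show "AE w in M. pr z p w = pr (H x) p w"
        by (rule mu_limit_unique[OF dualD(2)[OF p Hc[OF s]] dualD(2)[OF p z] dualD(2)[OF p Hc[OF x]] dual_tendsto[OF p Hc[OF s] z l(2)] l1])
    qed
  qed (use add hom in auto)
  then show ?thesis using module_hom_of_additive[OF HE add hom] bij by (simp add: automorphism_iff)
qed

end

section \<open>The operator given by the conjugation formula\<close>

abbreviation (in random_normed_module) conj_formula where
  "conj_formula v y \<rho> \<tau> H f u \<equiv>
    ext_add M (ext_add M (ext_mult M (to_ext M \<tau>) (conjugate M E nrm f (rn_adjoint E H u \<oplus>\<^sub>D v))) (to_ext M (u y))) (to_ext M \<rho>)"

locale conjugate_formula = random_normed_module M E nrm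
  for M :: "'w measure" and E :: "(('w \<Rightarrow> real) set, 'e) module" and nrm :: "'e \<Rightarrow> ('w \<Rightarrow> real) set" +
  fixes v y \<rho> \<tau> H
  assumes comp: "rn_complete M E nrm"
    and v: "v \<in> carrier D" and y: "y \<in> carrier E" and \<rho>: "\<rho> \<in> carrier (L0 M)" and \<tau>: "\<tau> \<in> L0_strict_pos M"
    and H: "H \<in> continuous_module_automorphisms M E nrm"
begin

abbreviation B :: "('e \<Rightarrow> ('w \<Rightarrow> real) set) \<Rightarrow> 'e \<Rightarrow> ('w \<Rightarrow> real) set" where
  "B u \<equiv> rn_adjoint E H u \<oplus>\<^sub>D v"

abbreviation \<Psi> :: "('e \<Rightarrow> ('w \<Rightarrow> ereal) set) \<Rightarrow> ('e \<Rightarrow> ('w \<Rightarrow> real) set) \<Rightarrow> ('w \<Rightarrow> ereal) set" where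
  "\<Psi> \<equiv> conj_formula v y \<rho> \<tau> H"

lemma tau: "\<tau> \<in> carrier (L0 M)" "AE w in M. 0 < rep \<tau> w" "rep \<tau> \<in> \<L> M"
proof -
  show 1: "\<tau> \<in> carrier (L0 M)" using \<tau> by (simp add: L0_strict_pos_def)
  have "AE w in M. w \<in> space M \<longrightarrow> rep \<zero>\<^bsub>L0 M\<^esub> w < rep \<tau> w" using \<tau> by (simp add: L0_strict_pos_def less_on_def)
  then show "AE w in M. 0 < rep \<tau> w" using rep_zero_L0 AE_space by eventually_elim simp
  show "rep \<tau> \<in> \<L> M" by (rule rep_L0(1)[OF 1])
qed

lemma rho: "rep \<rho> \<in> \<L> M"
  by (rule rep_L0(1)[OF \<rho>])

lemma H_in: "x \<in> carrier E \<Longrightarrow> H x \<in> carrier E"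
  using H by (auto simp: automorphism_iff module_homs_def)

lemma B_in: "u \<in> carrier D \<Longrightarrow> B u \<in> carrier D"
  using adjoint_in_dual[OF H] v by simp

lemma pr_B: "x \<in> carrier E \<Longrightarrow> u \<in> carrier D \<Longrightarrow> AE w in M. pr x (B u) w = pr (H x) u w + pr x v w"
  using rD.rlinD(2)[OF eval_rlin adjoint_in_dual[OF H] v] by (simp add: adjoint_apply)

text \<open>After subtracting v, the adjoint of H is inverted by the adjoint of the inverse of H,
  which maps into the dual because that inverse is continuous.\<close>

lemma B_onto:
  assumes u: "u \<in> carrier D"
  obtains u' where "u' \<in> carrier D" "B u' = u"
proof -
  let ?K = "inv_into (carrier E) H"
  have K: "?K \<in> continuous_module_automorphisms M E nrm" by (rule inverse_automorphism[OF comp H])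
  have KH: "?K (H x) = x" if "x \<in> carrier E" for x
    using H that by (auto simp: automorphism_iff bij_betw_inv_into_left)
  have uv: "u \<oplus>\<^sub>D rD.neg v \<in> carrier D" using u v by simp
  have u': "rn_adjoint E ?K (u \<oplus>\<^sub>D rD.neg v) \<in> carrier D" by (rule adjoint_in_dual[OF K uv])
  have "B (rn_adjoint E ?K (u \<oplus>\<^sub>D rD.neg v)) = u"
  proof (rule rpair.eq_X[OF pair.swap B_in[OF u'] u])
    fix x assume x: "x \<in> carrier E"
    show "AE w in M. pr x (B (rn_adjoint E ?K (u \<oplus>\<^sub>D rD.neg v))) w = pr x u w"
      using pr_B[OF x u'] rD.rlin_diff[OF eval_rlin[OF x] u v]
      by eventually_elim (simp add: adjoint_apply H_in x KH)
  qed
  then show ?thesis using that u' by blast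
qed

lemma Psi_rep:
  assumes f: "f \<in> pair.C" and u: "u \<in> carrier D"
  shows "\<Psi> f u \<in> ae_classes M"
    and "AE w in M. rep (\<Psi> f u) w = ereal (rep \<tau> w) * rep (conjugate M E nrm f (B u)) w + ereal (pr y u w + rep \<rho> w)"
proof -
  note c = conjugate_sup(1)[OF f B_in[OF u]]
  note t = rep_to_ext[OF tau(1)] and uy = rep_to_ext[OF dualD(1)[OF u y]] and r = rep_to_ext[OF \<rho>]
  note m = rep_ext_ops(5,6)[OF t(2) c]
  note a = rep_ext_ops(1,2)[OF m(2) uy(2)]
  note a' = rep_ext_ops(1,2)[OF a(2) r(2)]
  show "\<Psi> f u \<in> ae_classes M" by (rule a'(2))
  show "AE w in M. rep (\<Psi> f u) w = ereal (rep \<tau> w) * rep (conjugate M E nrm f (B u)) w + ereal (pr y u w + rep \<rho> w)"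
    using t(1) uy(1) r(1) m(1) a(1) a'(1)
  proof eventually_elim
    case (elim w)
    then show ?case by (simp add: add.assoc)
  qed
qed

text \<open>Upper bounds pass through the positive factor \<tau> and the translation without
  computing the supremum. \<open>operator_form\<close> describes S in the same shape, so that the
  two can be compared term by term.\<close>

lemma Psi_le_iff:
  assumes f: "f \<in> pair.C" and u: "u \<in> carrier D" and k: "k \<in> \<L> M"
  shows "(AE w in M. rep (\<Psi> f u) w \<le> k w) \<longleftrightarrow>
    (\<forall>x\<in>carrier E. AE w in M. ereal (rep \<tau> w * pr x (B u) w + (pr y u w + rep \<rho> w)) - ereal (rep \<tau> w) * rep (f x) w \<le> k w)"
proof
  assume le: "AE w in M. rep (\<Psi> f u) w \<le> k w"
  show "\<forall>x\<in>carrier E. AE w in M. ereal (rep \<tau> w * pr x (B u) w + (pr y u w + rep \<rho> w)) - ereal (rep \<tau> w) * rep (f x) w \<le> k w"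
  proof
    fix x assume x: "x \<in> carrier E"
    show "AE w in M. ereal (rep \<tau> w * pr x (B u) w + (pr y u w + rep \<rho> w)) - ereal (rep \<tau> w) * rep (f x) w \<le> k w"
      using le Psi_rep(2)[OF f u] conjugate_sup(2)[OF f B_in[OF u] x] tau(2) pair.fclD(7)[OF f x]
    proof eventually_elim
      case (elim w)
      have le': "ereal (rep \<tau> w) * (ereal (pr x (B u) w) - rep (f x) w) \<le> ereal (rep \<tau> w) * rep (conjugate M E nrm f (B u)) w"
        using elim(3,4) by (intro ereal_mult_left_mono) auto
      show ?case unfolding ereal_scaled_difference[OF elim(4,5)]
        by (rule order_trans[OF add_right_mono[OF le'] elim(1)[unfolded elim(2)]])
    qed
  qed
next
  assume le: "\<forall>x\<in>carrier E. AE w in M. ereal (rep \<tau> w * pr x (B u) w + (pr y u w + rep \<rho> w)) - ereal (rep \<tau> w) * rep (f x) w \<le> k w"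
  let ?h = "\<lambda>w. (k w - ereal (pr y u w + rep \<rho> w)) / ereal (rep \<tau> w)"
  note [measurable] = dualD(2)[OF u y] rho tau(3) k
  have "AE w in M. rep (conjugate M E nrm f (B u)) w \<le> ?h w"
  proof (rule conjugate_sup(3)[OF f B_in[OF u]])
    show "?h \<in> \<L> M" by measurable
    fix x assume x: "x \<in> carrier E"
    show "AE w in M. ereal (pr x (B u) w) - rep (f x) w \<le> ?h w"
      using bspec[OF le x] tau(2) pair.fclD(7)[OF f x]
      by eventually_elim (simp only: ereal_scaled_difference ereal_mult_add_le_iff)
  qed
  then show "AE w in M. rep (\<Psi> f u) w \<le> k w"
    using Psi_rep(2)[OF f u] tau(2) by eventually_elim (simp only: ereal_mult_add_le_iff)
qed

text \<open>The Fenchel correspondence: \<open>B u\<close> plus the constant a is a minorant of f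
  exactly if the conjugate of f at \<open>B u\<close> is at most -a; the formula then rescales and
  shifts this bound.\<close>

lemma minorant_iff_Psi_le:
  assumes f: "f \<in> pair.C" and u: "u \<in> carrier D" and a: "a \<in> \<L> M"
  shows "aminor M (carrier E) (carrier D) pr f (B u) a \<longleftrightarrow>
    (AE w in M. rep (\<Psi> f u) w \<le> ereal (rep \<tau> w * (- a w) + (pr y u w + rep \<rho> w)))"
proof -
  note [measurable] = dualD(2)[OF u y] rho tau(3) a
  have k: "(\<lambda>w. ereal (rep \<tau> w * (- a w) + (pr y u w + rep \<rho> w))) \<in> \<L> M" by measurable
  have e: "(AE w in M. ereal (pr x (B u) w + a w) \<le> rep (f x) w) \<longleftrightarrow>
     (AE w in M. ereal (rep \<tau> w * pr x (B u) w + (pr y u w + rep \<rho> w)) - ereal (rep \<tau> w) * rep (f x) w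
        \<le> ereal (rep \<tau> w * (- a w) + (pr y u w + rep \<rho> w)))" (is "(AE w in M. ?P w) \<longleftrightarrow> (AE w in M. ?Q w)") for x
  proof -
    have "AE w in M. ?P w \<longleftrightarrow> ?Q w" using tau(2) by eventually_elim (simp only: ereal_scaled_difference_le_iff)
    then show ?thesis by (rule eventually_subst)
  qed
  show ?thesis unfolding Psi_le_iff[OF f u k] aminor_def e using B_in[OF u] a by blast
qed

lemma Psi_antimono:
  assumes f: "f \<in> pair.C" and g: "g \<in> pair.C" and le: "fun_le M (carrier E) f g"
  shows "fun_le M (carrier D) (\<Psi> g) (\<Psi> f)"
  unfolding fun_le_def ae_le_def
proof
  fix u assume u: "u \<in> carrier D"
  have m: "rep (\<Psi> f u) \<in> \<L> M" by (rule rep_props(1)[OF Psi_rep(1)[OF f u]])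
  show "AE w in M. rep (\<Psi> g u) w \<le> rep (\<Psi> f u) w"
  proof (rule Psi_le_iff[OF g u m, THEN iffD2], rule)
    fix x assume x: "x \<in> carrier E"
    have fg: "AE w in M. rep (f x) w \<le> rep (g x) w" using le x by (simp add: fun_le_def ae_le_def)
    have "AE w in M. ereal (rep \<tau> w * pr x (B u) w + (pr y u w + rep \<rho> w)) - ereal (rep \<tau> w) * rep (f x) w \<le> rep (\<Psi> f u) w"
      by (rule Psi_le_iff[OF f u m, THEN iffD1, rule_format, OF _ x]) simp
    then show "AE w in M. ereal (rep \<tau> w * pr x (B u) w + (pr y u w + rep \<rho> w)) - ereal (rep \<tau> w) * rep (g x) w \<le> rep (\<Psi> f u) w"
      using fg tau(2)
    proof eventually_elim
      case (elim w)
      have "ereal (rep \<tau> w) * rep (f x) w \<le> ereal (rep \<tau> w) * rep (g x) w" using elim by (intro ereal_mult_left_mono) auto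
      from ereal_minus_mono[OF order_refl this] elim(1) show ?case by (rule order_trans)
    qed
  qed
qed

text \<open>f is the supremum of its affine minorants, and since \<open>B\<close> is onto, each of
  them can be read off from an upper bound of \<Psi> f and is then also a minorant of g.\<close>

lemma Psi_antimono_rev:
  assumes f: "f \<in> pair.C" and g: "g \<in> pair.C" and le: "fun_le M (carrier D) (\<Psi> g) (\<Psi> f)"
  shows "fun_le M (carrier E) f g"
  unfolding fun_le_def ae_le_def
proof
  fix x assume x: "x \<in> carrier E"
  show "AE w in M. rep (f x) w \<le> rep (g x) w"
  proof (rule pair.fclD(5)[OF f x pair.fclD(6)[OF g x]])
    fix u' a assume am: "aminor M (carrier E) (carrier D) pr f u' a"
    have a: "a \<in> \<L> M" and u': "u' \<in> carrier D" using am by (auto simp: aminor_def)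
    obtain u where u: "u \<in> carrier D" "B u = u'" by (rule B_onto[OF u'])
    have "AE w in M. rep (\<Psi> f u) w \<le> ereal (rep \<tau> w * (- a w) + (pr y u w + rep \<rho> w))"
      using am minorant_iff_Psi_le[OF f u(1) a] u(2) by simp
    moreover have "AE w in M. rep (\<Psi> g u) w \<le> rep (\<Psi> f u) w" using le u(1) by (simp add: fun_le_def ae_le_def)
    ultimately have "AE w in M. rep (\<Psi> g u) w \<le> ereal (rep \<tau> w * (- a w) + (pr y u w + rep \<rho> w))"
      by eventually_elim (rule order_trans)
    then have "aminor M (carrier E) (carrier D) pr g u' a" using minorant_iff_Psi_le[OF g u(1) a] u(2) by simp
    then show "AE w in M. ereal (pr x u' w + a w) \<le> rep (g x) w" using x by (simp add: aminor_def)
  qed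
qed

lemma Psi_paste:
  assumes f: "f \<in> pair.C" and g: "g \<in> pair.C" and A: "A \<in> sets M" and u: "u \<in> carrier D"
  shows "\<Psi> (paste M (carrier E) A f g) u = paste M (carrier D) A (\<Psi> f) (\<Psi> g) u"
proof -
  let ?p = "paste M (carrier E) A f g"
  let ?cf = "conjugate M E nrm f (B u)" and ?cg = "conjugate M E nrm g (B u)" and ?cp = "conjugate M E nrm ?p (B u)"
  have p: "?p \<in> pair.C" by (rule pair.paste_in[OF f g A])
  have Bu: "B u \<in> carrier D" by (rule B_in[OF u])
  have rp: "AE w in M. rep (?p x) w = (if w \<in> A then rep (f x) w else rep (g x) w)" if x: "x \<in> carrier E" for x
    using pair.paste_rep(1)[where F = f and G = g, OF x pair.fclD(1)[OF f x] pair.fclD(1)[OF g x] A] .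
  have cm: "rep ?cf \<in> \<L> M" "rep ?cg \<in> \<L> M"
    "rep ?cp \<in> \<L> M"
    using conjugate_sup(1)[OF f Bu] conjugate_sup(1)[OF g Bu] conjugate_sup(1)[OF p Bu] by (auto intro: rep_props)
  note [measurable] = cm A
  have "AE w in M. rep ?cp w \<le>
      (if w \<in> A then rep ?cf w else rep ?cg w)"
  proof (rule conjugate_sup(3)[OF p Bu])
    show "(\<lambda>w. if w \<in> A then rep ?cf w else rep ?cg w) \<in> \<L> M"
      by measurable
    fix x assume x: "x \<in> carrier E"
    show "AE w in M. ereal (pr x (B u) w) - rep (?p x) w \<le>
      (if w \<in> A then rep ?cf w else rep ?cg w)"
      using rp[OF x] conjugate_sup(2)[OF f Bu x] conjugate_sup(2)[OF g Bu x] by eventually_elim auto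
  qed
  \<comment> \<open>The value \<infinity> off A restricts the comparison to A, where f and the
    pasted function have the same values.\<close>
  moreover have "AE w in M. rep ?cf w \<le> (if w \<in> A then rep ?cp w else \<infinity>)"
  proof (rule conjugate_sup(3)[OF f Bu])
    show "(\<lambda>w. if w \<in> A then rep ?cp w else \<infinity>) \<in> \<L> M" by measurable
    fix x assume x: "x \<in> carrier E"
    show "AE w in M. ereal (pr x (B u) w) - rep (f x) w \<le> (if w \<in> A then rep ?cp w else \<infinity>)"
      using rp[OF x] conjugate_sup(2)[OF p Bu x] by eventually_elim auto
  qed
  moreover have "AE w in M. rep ?cg w \<le> (if w \<in> A then \<infinity> else rep ?cp w)"
  proof (rule conjugate_sup(3)[OF g Bu])
    show "(\<lambda>w. if w \<in> A then \<infinity> else rep ?cp w) \<in> \<L> M" by measurable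
    fix x assume x: "x \<in> carrier E"
    show "AE w in M. ereal (pr x (B u) w) - rep (g x) w \<le> (if w \<in> A then \<infinity> else rep ?cp w)"
      using rp[OF x] conjugate_sup(2)[OF p Bu x] by eventually_elim auto
  qed
  ultimately have c: "AE w in M. rep ?cp w =
      (if w \<in> A then rep ?cf w else rep ?cg w)"
  proof eventually_elim
    case (elim w)
    then show ?case by (cases "w \<in> A") (auto intro: antisym)
  qed
  interpret sw: rpair M "carrier D" "add D" "\<zero>\<^sub>D" "\<lambda>a u. cls M a \<odot>\<^sub>D u" "carrier E" "add E" "\<zero>\<^sub>E"
    "\<lambda>a x. cls M a \<odot>\<^sub>E x" "\<lambda>u x. pr x u" by (rule pair.swap)
  note q = sw.paste_rep[where F = "\<Psi> f" and G = "\<Psi> g", OF u Psi_rep(1)[OF f u] Psi_rep(1)[OF g u] A]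
  show ?thesis
  proof (rule ae_classes_eqI[OF Psi_rep(1)[OF p u] q(2)])
    show "AE w in M. rep (\<Psi> ?p u) w = rep (paste M (carrier D) A (\<Psi> f) (\<Psi> g) u) w"
      using q(1) c Psi_rep(2)[OF p u] Psi_rep(2)[OF f u] Psi_rep(2)[OF g u]
    proof eventually_elim
      case (elim w)
      then show ?case by (cases "w \<in> A") auto
    qed
  qed
qed

text \<open>The preimage of G is, up to the change of variables, its conjugate: the supremum of the
  affine functions allowed by \<open>minorant_iff_Psi_le\<close>. This gives \<Psi> f <= G directly.
  Conversely, each affine minorant of G comes from a point x and a value not below f x, so it lies
  below \<Psi> f. The assumption \<open>in_C'\<close> provides locality of \<Psi> f.\<close>

lemma Psi_onto:
  assumes G: "G \<in> pair.C'" and in_C': "\<And>f. f \<in> pair.C \<Longrightarrow> (\<lambda>u\<in>carrier D. \<Psi> f u) \<in> pair.C'"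
  obtains f where "f \<in> pair.C" "\<And>u. u \<in> carrier D \<Longrightarrow> \<Psi> f u = G u"
proof -
  interpret sw: rpair M "carrier D" "add D" "\<zero>\<^sub>D" "\<lambda>a u. cls M a \<odot>\<^sub>D u" "carrier E" "add E" "\<zero>\<^sub>E"
    "\<lambda>a x. cls M a \<odot>\<^sub>E x" "\<lambda>u x. pr x u" by (rule pair.swap)
  let ?d = "\<lambda>u w. pr y u w + rep \<rho> w"
  have d: "?d u \<in> \<L> M" if "u \<in> carrier D" for u using dualD(2)[OF that y] rho by simp
  define \<A> where "\<A> = {(u', a). a \<in> \<L> M \<and>
    (\<exists>u\<in>carrier D. u' = B u \<and> (AE w in M. rep (G u) w \<le> ereal (rep \<tau> w * (- a w) + ?d u w)))}"
  have sub: "\<A> \<subseteq> carrier D \<times> \<L> M" using B_in by (auto simp: \<A>_def)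
  have finG: "\<exists>a. a \<in> \<L> M \<and> (B u, a) \<in> \<A> \<and> (AE w in M. rep (G u) w = ereal (rep \<tau> w * (- a w) + ?d u w))"
    if u: "u \<in> carrier D" and fin: "AE w in M. rep (G u) w < \<infinity>" for u
  proof -
    define a where "a w = (?d u w - real_of_ereal (rep (G u) w)) / rep \<tau> w" for w
    note [measurable] = d[OF u] tau(3) sw.fclD(6)[OF G u] dualD(2)[OF u y] rho
    have a: "a \<in> \<L> M" unfolding a_def by measurable
    have e: "AE w in M. rep (G u) w = ereal (rep \<tau> w * (- a w) + ?d u w)"
      using fin sw.fclD(7)[OF G u] tau(2)
    proof eventually_elim
      case (elim w)
      have "rep \<tau> w * (- a w) + ?d u w = real_of_ereal (rep (G u) w)" using elim(3) by (simp add: a_def)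
      then show ?case using elim(1,2) by (cases "rep (G u) w") auto
    qed
    then have "AE w in M. rep (G u) w \<le> ereal (rep \<tau> w * (- a w) + ?d u w)" by eventually_elim simp
    then have "(B u, a) \<in> \<A>" unfolding \<A>_def using a u by blast
    then show ?thesis using a e by (intro exI[of _ a] conjI)
  qed
  obtain u1 where u1: "u1 \<in> carrier D" "AE w in M. rep (G u1) w < \<infinity>" using sw.fclD(3)[OF G] by (rule bexE)
  have ne: "\<A> \<noteq> {}" using finG[OF u1] by blast
  \<comment> \<open>The point x solves H x = (z - y) / \<tau>, which gives the linear part z in the
    formula; k is the value at x for which the constant becomes c. The minorant inequality for G
    then says that all members of the family lie below k at x.\<close>
  have bound: "\<exists>x\<in>carrier E. \<exists>k\<in>\<L> M.
      (\<forall>u'. \<forall>a. (u', a) \<in> \<A> \<longrightarrow> (AE w in M. ereal (pr x u' w + a w) \<le> ereal (k w))) \<and>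
      (\<forall>u\<in>carrier D. AE w in M. rep \<tau> w * pr x (B u) w + ?d u w - rep \<tau> w * k w = pr z u w + c w)"
    if m: "aminor M (carrier D) (carrier E) (\<lambda>u x. pr x u) G z c" for z c
  proof -
    have z: "z \<in> carrier E" and c: "c \<in> \<L> M" using m by (auto simp: aminor_def)
    let ?K = "inv_into (carrier E) H" and ?i = "\<lambda>w. 1 / rep \<tau> w"
    have im: "?i \<in> \<L> M" using tau(3) by simp
    have zy: "z \<oplus>\<^sub>E rE.neg y \<in> carrier E" using z y by simp
    have bij: "bij_betw H (carrier E) (carrier E)" and hom: "H \<in> module_homs (L0 M) E E" using H by (auto simp: automorphism_iff)
    have K: "?K (z \<oplus>\<^sub>E rE.neg y) \<in> carrier E" "H (?K (z \<oplus>\<^sub>E rE.neg y)) = z \<oplus>\<^sub>E rE.neg y"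
      using zy bij by (simp_all add: bij_betw_inv_into_right bij_betw_apply[OF bij_betw_inv_into])
    define x where "x = ac ?i (?K (z \<oplus>\<^sub>E rE.neg y))"
    have x: "x \<in> carrier E" unfolding x_def using im K(1) by simp
    have Hx: "H x = ac ?i (z \<oplus>\<^sub>E rE.neg y)" unfolding x_def using hom K im by (simp add: module_homs_def)
    define k where "k w = ?i w * (rep \<rho> w - c w) + pr x v w" for w
    have km: "k \<in> \<L> M" unfolding k_def
      by (intro borel_measurable_add borel_measurable_times borel_measurable_diff im rho c dualD(2)[OF v x])
    have prx: "AE w in M. pr x (B u) w = ?i w * (pr z u w - pr y u w) + pr x v w" if u: "u \<in> carrier D" for u
      using pr_B[OF x u] rE.rlinD(3)[OF dual_rlin[OF u] im zy] rE.rlin_diff[OF dual_rlin[OF u] z y]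
      unfolding Hx by eventually_elim simp
    have 1: "AE w in M. ereal (pr x u' w + a w) \<le> ereal (k w)" if ua: "(u', a) \<in> \<A>" for u' a
    proof -
      obtain u where u: "u \<in> carrier D" "u' = B u" "AE w in M. rep (G u) w \<le> ereal (rep \<tau> w * (- a w) + ?d u w)"
        using ua by (auto simp: \<A>_def)
      have "AE w in M. ereal (pr z u w + c w) \<le> rep (G u) w" using m u(1) by (simp add: aminor_def)
      then show ?thesis using u(3) prx[OF u(1)] tau(2) unfolding u(2)
      proof eventually_elim
        case (elim w)
        have "ereal (pr z u w + c w) \<le> ereal (rep \<tau> w * (- a w) + ?d u w)" using elim(1,2) by (rule order_trans)
        then have "pr z u w + c w \<le> rep \<tau> w * (- a w) + ?d u w" by simp
        moreover have "rep \<tau> w * pr x (B u) w = pr z u w - pr y u w + rep \<tau> w * pr x v w"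
          using elim(3,4) by (simp add: distrib_left)
        moreover have "rep \<tau> w * k w = rep \<rho> w - c w + rep \<tau> w * pr x v w"
          using elim(4) by (simp add: k_def distrib_left)
        ultimately have "rep \<tau> w * (pr x (B u) w + a w) \<le> rep \<tau> w * k w"
          by (simp add: distrib_left)
        then show ?case using elim(4) by simp
      qed
    qed
    have 2: "AE w in M. rep \<tau> w * pr x (B u) w + ?d u w - rep \<tau> w * k w = pr z u w + c w" if u: "u \<in> carrier D" for u
      using prx[OF u] tau(2) by eventually_elim (simp add: k_def field_simps)
    show ?thesis using x km 1 2 by (intro bexI[of _ x] bexI[of _ k] conjI allI impI ballI)
  qed
  define f where "f = supf M (carrier E) pr \<A>"
  obtain z0 c0 where zc0: "aminor M (carrier D) (carrier E) (\<lambda>u x. pr x u) G z0 c0" using sw.fclD(4)[OF G] by (elim exE)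
  obtain x0 where "x0 \<in> carrier E" "\<exists>k\<in>\<L> M.
      (\<forall>u'. \<forall>a. (u', a) \<in> \<A> \<longrightarrow> (AE w in M. ereal (pr x0 u' w + a w) \<le> ereal (k w))) \<and>
      (\<forall>u\<in>carrier D. AE w in M. rep \<tau> w * pr x0 (B u) w + ?d u w - rep \<tau> w * k w = pr z0 u w + c0 w)"
    using bound[OF zc0] by (rule bexE)
  then obtain k0 where x0: "x0 \<in> carrier E" and k0: "k0 \<in> \<L> M"
    "\<forall>u' a. (u', a) \<in> \<A> \<longrightarrow> (AE w in M. ereal (pr x0 u' w + a w) \<le> ereal (k0 w))" by (elim bexE conjE)
  have f: "f \<in> pair.C" unfolding f_def by (rule pair.supf_in[OF sub ne x0 k0(1)]) (use k0(2) in simp)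
  have fmin: "aminor M (carrier E) (carrier D) pr f u' a" if "(u', a) \<in> \<A>" for u' a
    using pair.supf_ge[OF sub _ that] sub that unfolding f_def aminor_def by auto
  have Psif: "(\<lambda>u\<in>carrier D. \<Psi> f u) \<in> pair.C'" by (rule in_C'[OF f])
  have le1: "AE w in M. rep (\<Psi> f u) w \<le> rep (G u) w" if u: "u \<in> carrier D" and fin: "AE w in M. rep (G u) w < \<infinity>" for u
  proof -
    obtain a where a: "a \<in> \<L> M" "(B u, a) \<in> \<A>" "AE w in M. rep (G u) w = ereal (rep \<tau> w * (- a w) + ?d u w)"
      using finG[OF u fin] by (elim exE conjE)
    have "AE w in M. rep (\<Psi> f u) w \<le> ereal (rep \<tau> w * (- a w) + ?d u w)"
      using minorant_iff_Psi_le[OF f u a(1)] fmin[OF a(2)] by simp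
    then show ?thesis using a(3) by eventually_elim simp
  qed
  have le: "AE w in M. rep (\<Psi> f u) w \<le> rep (G u) w" if u: "u \<in> carrier D" for u
  proof -
    \<comment> \<open>Where G u is infinite there is nothing to show; there u is replaced by the
      domain point \<open>u1\<close> so that \<open>le1\<close> applies, and locality of \<Psi> f
      brings the result back to u on A.\<close>
    define A where "A = {w \<in> space M. rep (G u) w < \<infinity>}"
    note [measurable] = sw.fclD(6)[OF G u]
    have A: "A \<in> sets M" unfolding A_def by measurable
    have IA: "(indicator A :: 'w \<Rightarrow> real) \<in> \<L> M" using A by simp
    let ?u = "rD.glue A u u1"
    have u2: "?u \<in> carrier D" using A u u1(1) by simp
    have gg: "rD.glue A ?u u = u" unfolding rD.glue_def
      by (rule rD.glue_glue[OF IA _ u u1(1)]) (simp add: indicator_def)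
    have "AE w in M. rep (G ?u) w < \<infinity>" using sw.fcl_local[OF G u u1(1) A] u1(2)
    proof eventually_elim
      case (elim w)
      then show ?case by (cases "w \<in> A") (auto simp: A_def intro: le_less_trans)
    qed
    then have 1: "AE w in M. rep (\<Psi> f ?u) w \<le> rep (G ?u) w" by (rule le1[OF u2])
    have 2: "AE w in M. rep (\<Psi> f u) w \<le> (if w \<in> A then rep (\<Psi> f ?u) w else rep (\<Psi> f u) w)"
      using sw.fcl_local[OF Psif u2 u A] unfolding gg restrict_apply'[OF u] restrict_apply'[OF u2] .
    show ?thesis using 1 2 sw.fcl_local[OF G u u1(1) A] AE_space
    proof eventually_elim
      case (elim w)
      then show ?case by (cases "w \<in> A") (auto simp: A_def intro: order_trans)
    qed
  qed
  have ge: "AE w in M. rep (G u) w \<le> rep (\<Psi> f u) w" if u: "u \<in> carrier D" for u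
  proof -
    have m: "rep (\<Psi> f u) \<in> \<L> M" by (rule rep_props(1)[OF Psi_rep(1)[OF f u]])
    show ?thesis
    proof (rule sw.fclD(5)[OF G u m])
      fix z c assume zc: "aminor M (carrier D) (carrier E) (\<lambda>u x. pr x u) G z c"
      obtain x where "x \<in> carrier E" "\<exists>k\<in>\<L> M.
          (\<forall>u'. \<forall>a. (u', a) \<in> \<A> \<longrightarrow> (AE w in M. ereal (pr x u' w + a w) \<le> ereal (k w))) \<and>
          (\<forall>u\<in>carrier D. AE w in M. rep \<tau> w * pr x (B u) w + ?d u w - rep \<tau> w * k w = pr z u w + c w)"
        using bound[OF zc] by (rule bexE)
      then obtain k where x: "x \<in> carrier E" and k: "k \<in> \<L> M"
        "\<forall>u' a. (u', a) \<in> \<A> \<longrightarrow> (AE w in M. ereal (pr x u' w + a w) \<le> ereal (k w))"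
        "\<forall>u\<in>carrier D. AE w in M. rep \<tau> w * pr x (B u) w + ?d u w - rep \<tau> w * k w = pr z u w + c w" by (elim bexE conjE)
      have fx: "AE w in M. rep (f x) w \<le> ereal (k w)" unfolding f_def
        by (rule pair.supf_le[OF sub x]) (use k(1,2) in auto)
      have "AE w in M. ereal (rep \<tau> w * pr x (B u) w + ?d u w) - ereal (rep \<tau> w) * rep (f x) w \<le> rep (\<Psi> f u) w"
        by (rule Psi_le_iff[OF f u m, THEN iffD1, rule_format, OF _ x]) simp
      then show "AE w in M. ereal (pr z u w + c w) \<le> rep (\<Psi> f u) w"
        using fx bspec[OF k(3) u] tau(2)
      proof eventually_elim
        case (elim w)
        have "ereal (rep \<tau> w) * rep (f x) w \<le> ereal (rep \<tau> w) * ereal (k w)" using elim(2,4) by (intro ereal_mult_left_mono) auto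
        then have "ereal (rep \<tau> w * pr x (B u) w + ?d u w) - ereal (rep \<tau> w) * ereal (k w)
            \<le> ereal (rep \<tau> w * pr x (B u) w + ?d u w) - ereal (rep \<tau> w) * rep (f x) w" by (intro ereal_minus_mono order_refl)
        then have "ereal (rep \<tau> w * pr x (B u) w + ?d u w - rep \<tau> w * k w) \<le> rep (\<Psi> f u) w" using elim(1) by simp
        then show ?case using elim(3) by simp
      qed
    qed
  qed
  have "\<Psi> f u = G u" if u: "u \<in> carrier D" for u
  proof (rule ae_classes_eqI[OF Psi_rep(1)[OF f u] sw.fclD(1)[OF G u]])
    show "AE w in M. rep (\<Psi> f u) w = rep (G u) w" using le[OF u] ge[OF u] by eventually_elim (rule antisym)
  qed
  then show ?thesis by (rule that[OF f])
qed

lemma stable_and_reversing: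
  assumes S: "S \<in> pair.C \<rightarrow> pair.C'" and eq: "\<And>f u. f \<in> pair.C \<Longrightarrow> u \<in> carrier D \<Longrightarrow> S f u = \<Psi> f u"
  shows "pair.rev_bij S" "\<lbrakk>A \<in> sets M; f \<in> pair.C; g \<in> pair.C\<rbrakk> \<Longrightarrow> S (paste M (carrier E) A f g) = paste M (carrier D) A (S f) (S g)"
proof -
  interpret sw: rpair M "carrier D" "add D" "\<zero>\<^sub>D" "\<lambda>a u. cls M a \<odot>\<^sub>D u" "carrier E" "add E" "\<zero>\<^sub>E"
    "\<lambda>a x. cls M a \<odot>\<^sub>E x" "\<lambda>u x. pr x u" by (rule pair.swap)
  have SC: "S f \<in> pair.C'" if "f \<in> pair.C" for f using S that by auto
  have SPsi: "S f = (\<lambda>u\<in>carrier D. \<Psi> f u)" if "f \<in> pair.C" for f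
    using sw.fclD(2)[OF SC[OF that]] eq[OF that] by (intro extensionalityI[of _ "carrier D"]) auto
  have le: "fun_le M (carrier D) (S g) (S f) \<longleftrightarrow> fun_le M (carrier D) (\<Psi> g) (\<Psi> f)" if "f \<in> pair.C" "g \<in> pair.C" for f g
    using eq that by (simp add: fun_le_def)
  show "pair.rev_bij S" unfolding pair.rev_bij_def
  proof (intro conjI ballI)
    show "S ` pair.C = pair.C'"
    proof (intro equalityI subsetI)
      fix G assume G: "G \<in> pair.C'"
      have Psi_C': "(\<lambda>u\<in>carrier D. \<Psi> f u) \<in> pair.C'" if "f \<in> pair.C" for f using SC[OF that] SPsi[OF that] by simp
      obtain f where f: "f \<in> pair.C" "\<And>u. u \<in> carrier D \<Longrightarrow> \<Psi> f u = G u" by (rule Psi_onto[OF G Psi_C']) (assumption, rule that)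
      have "S f = G" using eq[OF f(1)] f(2)
        by (intro extensionalityI[OF sw.fclD(2)[OF SC[OF f(1)]] sw.fclD(2)[OF G]]) simp
      then show "G \<in> S ` pair.C" using f(1) by blast
    qed (use SC in auto)
    fix f g assume "f \<in> pair.C" "g \<in> pair.C"
    then show "fun_le M (carrier E) f g \<longleftrightarrow> fun_le M (carrier D) (S g) (S f)"
      unfolding le[OF \<open>f \<in> pair.C\<close> \<open>g \<in> pair.C\<close>] using Psi_antimono[of f g] Psi_antimono_rev[of f g] by blast
  qed
  assume A: "A \<in> sets M" and f: "f \<in> pair.C" and g: "g \<in> pair.C"
  have p: "paste M (carrier E) A f g \<in> pair.C" by (rule pair.paste_in[OF f g A])
  show "S (paste M (carrier E) A f g) = paste M (carrier D) A (S f) (S g)"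
  proof (rule extensionalityI[OF sw.fclD(2)[OF SC[OF p]]])
    show "paste M (carrier D) A (S f) (S g) \<in> extensional (carrier D)" by (simp add: paste_def)
    fix u assume u: "u \<in> carrier D"
    show "S (paste M (carrier E) A f g) u = paste M (carrier D) A (S f) (S g) u"
      using Psi_paste[OF f g A u] eq[OF p u] eq[OF f u] eq[OF g u] u by (simp add: paste_def)
  qed
qed

end

section \<open>The characterization of stable fully order reversing operators\<close>

lemma (in random_normed_module) formula_of_reversing:
  assumes comp: "rn_complete M E nrm" and full: "full_support M E nrm"
    and S: "pair.rev_bij S"
    and st: "\<And>A f g. \<lbrakk>A \<in> sets M; f \<in> pair.C; g \<in> pair.C\<rbrakk> \<Longrightarrow> S (paste M (carrier E) A f g) = paste M (carrier D) A (S f) (S g)"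
  obtains v y \<rho> \<tau> H where "v \<in> carrier D" "y \<in> carrier E" "\<rho> \<in> carrier (L0 M)" "\<tau> \<in> L0_strict_pos M"
    "H \<in> continuous_module_automorphisms M E nrm"
    "\<And>f u. f \<in> pair.C \<Longrightarrow> u \<in> carrier D \<Longrightarrow> S f u = conj_formula v y \<rho> \<tau> H f u"
proof -
  obtain x1 u1 where unit: "x1 \<in> carrier E" "u1 \<in> carrier D" "AE w in M. pr x1 u1 w = 1"
    by (rule full_support_unit[OF comp full])
  obtain H y p0 P t r where y: "y \<in> carrier E" and p0: "p0 \<in> carrier D"
    and t: "t \<in> \<L> M" and r: "r \<in> \<L> M" and tp: "\<And>w. (0::real) < t w"
    and bij: "bij_betw H (carrier E) (carrier E)"
    and add: "\<And>x z. x \<in> carrier E \<Longrightarrow> z \<in> carrier E \<Longrightarrow> H (x \<oplus>\<^sub>E z) = H x \<oplus>\<^sub>E H z"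
    and hom: "\<And>a x. a \<in> \<L> M \<Longrightarrow> x \<in> carrier E \<Longrightarrow> H (ac a x) = ac a (H x)"
    and P: "P ` carrier D = carrier D"
    and adj: "\<And>x u. x \<in> carrier E \<Longrightarrow> u \<in> carrier D \<Longrightarrow> AE w in M. pr (H x) (P u) w = pr x u w"
    and form: "\<And>F u k. \<lbrakk>F \<in> pair.C; u \<in> carrier D; k \<in> \<L> M\<rbrakk> \<Longrightarrow> (AE w in M. rep (S F u) w \<le> k w) \<longleftrightarrow>
      (\<forall>x\<in>carrier E. AE w in M. ereal (t w * (pr (H x) u w - pr (H x) p0 w) + pr y u w + r w) - ereal (t w) * rep (F x) w \<le> k w)"
    by (rule pair.operator_form[OF S st unit]) (assumption+, rule that)
  have H: "H \<in> continuous_module_automorphisms M E nrm"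
    by (rule automorphism_of_adjoint[OF comp bij add hom P adj])
  \<comment> \<open>The shift by -p0 occurs after H, as the term - p0(H x). Moving it through the
    adjoint turns it into the functional v added to the adjoint of u.\<close>
  define v where "v = rn_adjoint E H (rD.neg p0)"
  have np: "rD.neg p0 \<in> carrier D" using p0 by simp
  have v: "v \<in> carrier D" unfolding v_def by (rule adjoint_in_dual[OF H np])
  have \<rho>: "cls M r \<in> carrier (L0 M)" using r by simp
  have "AE w in M. w \<in> space M \<longrightarrow> rep \<zero>\<^bsub>L0 M\<^esub> w < rep (cls M t) w"
    using rep_zero_L0[of M] rep_cls[OF t] by eventually_elim (simp add: tp)
  then have \<tau>: "cls M t \<in> L0_strict_pos M" using t by (simp add: L0_strict_pos_def less_on_def)
  interpret cf: conjugate_formula M E nrm v y "cls M r" "cls M t" H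
    by unfold_locales (fact comp v y \<rho> \<tau> H)+
  interpret sw: rpair M "carrier D" "add D" "\<zero>\<^sub>D" "\<lambda>a u. cls M a \<odot>\<^sub>D u" "carrier E" "add E" "\<zero>\<^sub>E"
    "\<lambda>a x. cls M a \<odot>\<^sub>E x" "\<lambda>u x. pr x u" by (rule pair.swap)
  have "S f u = cf.\<Psi> f u" if f: "f \<in> pair.C" and u: "u \<in> carrier D" for f u
  proof -
    have Sc: "S f u \<in> ae_classes M" by (rule sw.fclD(1)[OF pair.rev_bijD(1)[OF S f] u])
    note Pc = cf.Psi_rep(1)[OF f u]
    have e: "(AE w in M. ereal (t w * (pr (H x) u w - pr (H x) p0 w) + pr y u w + r w) - ereal (t w) * rep (f x) w \<le> k w) \<longleftrightarrow>
        (AE w in M. ereal (rep (cls M t) w * pr x (cf.B u) w + (pr y u w + rep (cls M r) w)) - ereal (rep (cls M t) w) * rep (f x) w \<le> k w)"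
        (is "(AE w in M. ?P w) \<longleftrightarrow> (AE w in M. ?Q w)") if x: "x \<in> carrier E" for x and k :: "'w \<Rightarrow> ereal"
    proof -
      have hx: "H x \<in> carrier E" by (rule cf.H_in[OF x])
      have "AE w in M. pr x v w = - pr (H x) p0 w"
        unfolding v_def using rD.rlinD(3)[OF eval_rlin[OF hx], of "\<lambda>_. - 1" p0] p0 by (simp add: adjoint_apply[OF x])
      then have "AE w in M. ?P w \<longleftrightarrow> ?Q w" using cf.pr_B[OF x u] rep_cls[OF t] rep_cls[OF r]
        by eventually_elim (simp add: add.assoc)
      then show ?thesis by (rule eventually_subst)
    qed
    have iff: "(AE w in M. rep (S f u) w \<le> k w) \<longleftrightarrow> (AE w in M. rep (cf.\<Psi> f u) w \<le> k w)" if k: "k \<in> \<L> M" for k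
      unfolding form[OF f u k] cf.Psi_le_iff[OF f u k] using e[of _ k] by (intro ball_cong refl)
    have "AE w in M. rep (S f u) w \<le> rep (cf.\<Psi> f u) w" using iff[OF rep_props(1)[OF Pc]] by simp
    moreover have "AE w in M. rep (cf.\<Psi> f u) w \<le> rep (S f u) w" using iff[OF rep_props(1)[OF Sc]] by simp
    ultimately have "AE w in M. rep (S f u) w = rep (cf.\<Psi> f u) w" by eventually_elim (rule antisym)
    then show ?thesis by (rule ae_classes_eqI[OF Sc Pc])
  qed
  then show ?thesis by (rule that[OF v y \<rho> \<tau> H])
qed

theorem theorem2:
  fixes M :: "'w measure" and E :: "(('w \<Rightarrow> real) set, 'e) module"
    and nrm :: "'e \<Rightarrow> ('w \<Rightarrow> real) set"
    and S :: "('e \<Rightarrow> ('w \<Rightarrow> ereal) set) \<Rightarrow> (('e \<Rightarrow> ('w \<Rightarrow> real) set) \<Rightarrow> ('w \<Rightarrow> ereal) set)"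
  assumes "random_normed_module M E nrm"
    and "rn_complete M E nrm"
    and "full_support M E nrm"
    and "S \<in> lsc_convex_functions M E nrm \<rightarrow> wstar_lsc_convex_functions M E nrm"
  shows "stable_operator M E nrm S \<and> fully_order_reversing M E nrm S \<longleftrightarrow>
    (\<exists>v\<in>carrier (dual M E nrm). \<exists>y\<in>carrier E. \<exists>\<rho>\<in>carrier (L0 M). \<exists>\<tau>\<in>L0_strict_pos M.
      \<exists>H\<in>continuous_module_automorphisms M E nrm.
      \<forall>f\<in>lsc_convex_functions M E nrm. \<forall>u\<in>carrier (dual M E nrm).
        S f u =
          ext_add M
            (ext_add M
              (ext_mult M (to_ext M \<tau>) (conjugate M E nrm f (rn_adjoint E H u \<oplus>\<^bsub>dual M E nrm\<^esub> v)))
              (to_ext M (u y)))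
            (to_ext M \<rho>))"
proof -
  interpret random_normed_module M E nrm by fact
  have lsc: "lsc_convex_functions M E nrm = pair.C" using fcl_of_lsc lsc_of_fcl by blast
  have wst: "wstar_lsc_convex_functions M E nrm = pair.C'" using fcl_of_wstar[OF assms(2)] wstar_of_fcl by blast
  have rev: "fully_order_reversing M E nrm S \<longleftrightarrow> pair.rev_bij S"
    unfolding fully_order_reversing_def lsc wst pair.rev_bij_def ..
  show ?thesis
  proof
    assume "stable_operator M E nrm S \<and> fully_order_reversing M E nrm S"
    then have S: "pair.rev_bij S" and st: "\<And>A f g. \<lbrakk>A \<in> sets M; f \<in> pair.C; g \<in> pair.C\<rbrakk> \<Longrightarrow>
      S (paste M (carrier E) A f g) = paste M (carrier D) A (S f) (S g)"
      by (simp_all add: rev stable_operator_def lsc)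
    obtain v y \<rho> \<tau> H where p: "v \<in> carrier D" "y \<in> carrier E" "\<rho> \<in> carrier (L0 M)" "\<tau> \<in> L0_strict_pos M"
      "H \<in> continuous_module_automorphisms M E nrm"
      and e: "\<And>f u. f \<in> pair.C \<Longrightarrow> u \<in> carrier D \<Longrightarrow> S f u = conj_formula v y \<rho> \<tau> H f u"
      by (rule formula_of_reversing[OF assms(2,3) S st]) (assumption+, rule that)
    show "\<exists>v\<in>carrier D. \<exists>y\<in>carrier E. \<exists>\<rho>\<in>carrier (L0 M). \<exists>\<tau>\<in>L0_strict_pos M. \<exists>H\<in>continuous_module_automorphisms M E nrm.
      \<forall>f\<in>lsc_convex_functions M E nrm. \<forall>u\<in>carrier D. S f u = conj_formula v y \<rho> \<tau> H f u"
      unfolding lsc using p e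
      by (intro bexI[of _ v] bexI[of _ y] bexI[of _ \<rho>] bexI[of _ \<tau>] bexI[of _ H] ballI)
  next
    assume "\<exists>v\<in>carrier D. \<exists>y\<in>carrier E. \<exists>\<rho>\<in>carrier (L0 M). \<exists>\<tau>\<in>L0_strict_pos M. \<exists>H\<in>continuous_module_automorphisms M E nrm.
      \<forall>f\<in>lsc_convex_functions M E nrm. \<forall>u\<in>carrier D. S f u = conj_formula v y \<rho> \<tau> H f u"
    then obtain v y \<rho> \<tau> H where p: "v \<in> carrier D" "y \<in> carrier E" "\<rho> \<in> carrier (L0 M)" "\<tau> \<in> L0_strict_pos M"
      "H \<in> continuous_module_automorphisms M E nrm"
      and e: "\<forall>f\<in>lsc_convex_functions M E nrm. \<forall>u\<in>carrier D. S f u = conj_formula v y \<rho> \<tau> H f u"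
      by (elim bexE)
    interpret cf: conjugate_formula M E nrm v y \<rho> \<tau> H
      by unfold_locales (fact assms(2) p)+
    have SC: "S \<in> pair.C \<rightarrow> pair.C'" using assms(4) unfolding lsc wst .
    have e': "S f u = cf.\<Psi> f u" if "f \<in> pair.C" "u \<in> carrier D" for f u
      using e that unfolding lsc by simp
    show "stable_operator M E nrm S \<and> fully_order_reversing M E nrm S"
      using cf.stable_and_reversing[OF SC e'] by (simp add: rev stable_operator_def lsc)
  qed
qed

end
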